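(* Let $n$ be a positive integer and let $\mathcal{M}$ be a small projectively generated $n$-abelian category. Let $\mathcal{P}$ be the full subcategory of projective objects in $\mathcal{M}$ and let $F\colon\mathcal{M}\to\operatorname{mod}\mathcal{P}$ be the functor defined by $FX:=\mathcal{M}(-,X)|_{\mathcal{P}}$. Let $$F\mathcal{M}:=\{M\in\operatorname{mod}\mathcal{P}\mid \exists X\in\mathcal{M}\text{ such that }M\cong FX\}$$ be the essential image of $F$. If there exists an exact duality $D\colon\operatorname{mod}\mathcal{P}\to\operatorname{mod}\mathcal{P}^{\mathrm{op}}$, then $F$ is a fully faithful functor such that $F\mathcal{M}$ is an $n$-cluster-tilting subcategory of $\operatorname{mod}\mathcal{P}$.
   Context: Subcategories are full. Composition is written left to right. **Coherent modules.** For a small additive category $\mathcal{C}$, a $\mathcal{C}$-module is a contravariant (additive) functor from $\mathcal{C}$ to abelian groups; these form the abelian category $\operatorname{Mod}\mathcal{C}$. The category $\operatorname{mod}\mathcal{C}$ of coherent $\mathcal{C}$-modules is the full subcategory of those $G$ admitting an exact sequence $\mathcal{C}(-,X)\to\mathcal{C}(-,Y)\to G\to0$ induced by some morphism $X\to Y$ in $\mathcal{C}$. If $\mathcal{C}$ has weak kernels, $\operatorname{mod}\mathcal{C}$ is abelian (this is the case for $\mathcal{C}=\mathcal{P}$). $\operatorname{mod}\mathcal{P}^{\mathrm{op}}$ denotes coherent modules over $\mathcal{P}^{\mathrm{op}}$; a duality is a contravariant equivalence. **Projective objects.** $P\in\mathcal{M}$ is projective if for every epimorphism $f\colon A\to B$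 in $\mathcal{M}$ the map $\mathcal{M}(P,A)\to\mathcal{M}(P,B)$ is surjective. $\mathcal{M}$ is projectively generated if for every $M\in\mathcal{M}$ there are a projective $P\in\mathcal{M}$ and an epimorphism $P\to M$. **$n$-cokernels, $n$-kernels, $n$-exact sequences.** In an additive category $\mathcal{C}$, an $n$-cokernel of $d^0\colon X^0\to X^1$ is a sequence $(d^1,\dots,d^n)$, $X^1\xrightarrow{d^1}X^2\to\cdots\xrightarrow{d^n}X^{n+1}$, such that for all $Y\in\mathcal{C}$ the induced sequence $0\to\mathcal{C}(X^{n+1},Y)\to\mathcal{C}(X^n,Y)\to\cdots\to\mathcal{C}(X^1,Y)\to\mathcal{C}(X^0,Y)$ is exact. Dually, an $n$-kernel of $d^n\colon X^n\to X^{n+1}$ is a sequence $(d^0,\dots,d^{n-1})$, $X^0\to\cdots\to X^n$, such that $0\to\mathcal{C}(Y,X^0)\to\cdots\to\mathcal{C}(Y,X^n)\to\mathcal{C}(Y,X^{n+1})$ is exact for all $Y$. An $n$-exact sequence is a complex $X^0\xrightarrow{d^0}X^1\to\cdots\to X^n\xrightarrow{d^n}X^{n+1}$ such that $(d^0,\dots,d^{n-1})$ is an $n$-kernel of $d^n$ and $(d^1,\dots,d^n)$ is an $n$-cokernel of $d^0$. **$n$-abelian category.** An additive category $\mathcal{M}$ such that: (A0) $\mathcal{M}$ is idempotent complete; (A1) every morphism in $\mathcal{M}$ has an $n$-kernel and an $n$-cokernel; (A2) for every monomorphism $f^0\colon X^0\to X^1$ in $\mathcal{M}$ and every $n$-cokernel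 $(f^1,\dots,f^n)$ of $f^0$, the sequence $(f^0,f^1,\dots,f^n)$ is $n$-exact; (A2$^{\mathrm{op}}$) for every epimorphism $g^n\colon X^n\to X^{n+1}$ in $\mathcal{M}$ and every $n$-kernel $(g^0,\dots,g^{n-1})$ of $g^n$, the sequence $(g^0,\dots,g^n)$ is $n$-exact. **$n$-cluster-tilting subcategory.** A subcategory $\mathcal{N}$ of an abelian category $\mathcal{A}$ is cogenerating if every $X\in\mathcal{A}$ admits a monomorphism $X\to Y$ with $Y\in\mathcal{N}$; generating is dual. It is covariantly finite if for every $A\in\mathcal{A}$ there is a morphism $A\to N$ with $N\in\mathcal{N}$ through which every morphism from $A$ to an object of $\mathcal{N}$ factors; contravariantly finite is dual; functorially finite means both. A generating-cogenerating subcategory $\mathcal{N}$ is $n$-cluster-tilting if it is functorially finite and $$\mathcal{N}=\{X\in\mathcal{A}\mid \operatorname{Ext}^i_{\mathcal{A}}(X,\mathcal{N})=0\ \forall\, 1\le i\le n-1\}=\{X\in\mathcal{A}\mid \operatorname{Ext}^i_{\mathcal{A}}(\mathcal{N},X)=0\ \forall\, 1\le i\le n-1\}.$$ *)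

theory Defs
  imports "HOL-Algebra.Coset" "HOL-Library.Equipollence" "HOL-Library.FuncSet"
begin

section \<open>Preadditive categories\<close>

text \<open>
  A category enriched in abelian groups is given by a set of objects and, for each ordered pair of
  objects, an abelian group of morphisms (a \<^term>\<open>comm_group\<close>, hence written multiplicatively: the
  unit of \<open>Hom C X Y\<close> is the zero morphism). The sets \<open>Hom C X Y\<close> are not required to be disjoint,
  so composition takes the three objects as arguments. As in diagrammatic order,
  \<open>Comp C X Y Z f g\<close> is "first \<open>f : X \<rightarrow> Y\<close>, then \<open>g : Y \<rightarrow> Z\<close>". Since objects and morphisms are
  elements of types, every such category is small.
\<close>

record ('o, 'a) pcat =
  Ob :: "'o set"
  Hom :: "'o \<Rightarrow> 'o \<Rightarrow> 'a monoid"
  Comp :: "'o \<Rightarrow> 'o \<Rightarrow> 'o \<Rightarrow> 'a \<Rightarrow> 'a \<Rightarrow> 'a"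
  Ident :: "'o \<Rightarrow> 'a"

abbreviation mor :: "('o, 'a) pcat \<Rightarrow> 'o \<Rightarrow> 'o \<Rightarrow> 'a set"
  where "mor C X Y \<equiv> carrier (Hom C X Y)"

abbreviation zero_mor :: "('o, 'a) pcat \<Rightarrow> 'o \<Rightarrow> 'o \<Rightarrow> 'a"
  where "zero_mor C X Y \<equiv> \<one>\<^bsub>Hom C X Y\<^esub>"

locale preadditive_category =
  fixes C :: "('o, 'a) pcat"
  assumes hom_group: "\<lbrakk>X \<in> Ob C; Y \<in> Ob C\<rbrakk> \<Longrightarrow> comm_group (Hom C X Y)"
    and comp_closed: "\<lbrakk>X \<in> Ob C; Y \<in> Ob C; Z \<in> Ob C; f \<in> mor C X Y; g \<in> mor C Y Z\<rbrakk>
      \<Longrightarrow> Comp C X Y Z f g \<in> mor C X Z"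
    and ident_closed: "X \<in> Ob C \<Longrightarrow> Ident C X \<in> mor C X X"
    and ident_left: "\<lbrakk>X \<in> Ob C; Y \<in> Ob C; f \<in> mor C X Y\<rbrakk> \<Longrightarrow> Comp C X X Y (Ident C X) f = f"
    and ident_right: "\<lbrakk>X \<in> Ob C; Y \<in> Ob C; f \<in> mor C X Y\<rbrakk> \<Longrightarrow> Comp C X Y Y f (Ident C Y) = f"
    and comp_assoc: "\<lbrakk>W \<in> Ob C; X \<in> Ob C; Y \<in> Ob C; Z \<in> Ob C;
        f \<in> mor C W X; g \<in> mor C X Y; h \<in> mor C Y Z\<rbrakk>
      \<Longrightarrow> Comp C W Y Z (Comp C W X Y f g) h = Comp C W X Z f (Comp C X Y Z g h)"
    and comp_add_left: "\<lbrakk>X \<in> Ob C; Y \<in> Ob C; Z \<in> Ob C;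
        f \<in> mor C X Y; f' \<in> mor C X Y; g \<in> mor C Y Z\<rbrakk>
      \<Longrightarrow> Comp C X Y Z (f \<otimes>\<^bsub>Hom C X Y\<^esub> f') g
          = Comp C X Y Z f g \<otimes>\<^bsub>Hom C X Z\<^esub> Comp C X Y Z f' g"
    and comp_add_right: "\<lbrakk>X \<in> Ob C; Y \<in> Ob C; Z \<in> Ob C;
        f \<in> mor C X Y; g \<in> mor C Y Z; g' \<in> mor C Y Z\<rbrakk>
      \<Longrightarrow> Comp C X Y Z f (g \<otimes>\<^bsub>Hom C Y Z\<^esub> g')
          = Comp C X Y Z f g \<otimes>\<^bsub>Hom C X Z\<^esub> Comp C X Y Z f g'"

definition op_cat :: "('o, 'a) pcat \<Rightarrow> ('o, 'a) pcat"
  where "op_cat C = \<lparr>Ob = Ob C, Hom = (\<lambda>X Y. Hom C Y X),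
    Comp = (\<lambda>X Y Z f g. Comp C Z Y X g f), Ident = Ident C\<rparr>"

definition full_subcat :: "('o, 'a) pcat \<Rightarrow> 'o set \<Rightarrow> ('o, 'a) pcat"
  where "full_subcat C S = C\<lparr>Ob := S\<rparr>"

definition is_mono :: "('o, 'a) pcat \<Rightarrow> 'o \<Rightarrow> 'o \<Rightarrow> 'a \<Rightarrow> bool"
  where "is_mono C X Y f \<longleftrightarrow> f \<in> mor C X Y \<and>
    (\<forall>W\<in>Ob C. \<forall>g\<in>mor C W X. \<forall>h\<in>mor C W X. Comp C W X Y g f = Comp C W X Y h f \<longrightarrow> g = h)"

definition is_epi :: "('o, 'a) pcat \<Rightarrow> 'o \<Rightarrow> 'o \<Rightarrow> 'a \<Rightarrow> bool"
  where "is_epi C X Y f \<longleftrightarrow> f \<in> mor C X Y \<and>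
    (\<forall>Z\<in>Ob C. \<forall>g\<in>mor C Y Z. \<forall>h\<in>mor C Y Z. Comp C X Y Z f g = Comp C X Y Z f h \<longrightarrow> g = h)"

definition is_iso :: "('o, 'a) pcat \<Rightarrow> 'o \<Rightarrow> 'o \<Rightarrow> 'a \<Rightarrow> bool"
  where "is_iso C X Y f \<longleftrightarrow> f \<in> mor C X Y \<and>
    (\<exists>g\<in>mor C Y X. Comp C X Y X f g = Ident C X \<and> Comp C Y X Y g f = Ident C Y)"

definition isomorphic :: "('o, 'a) pcat \<Rightarrow> 'o \<Rightarrow> 'o \<Rightarrow> bool"
  where "isomorphic C X Y \<longleftrightarrow> (\<exists>f. is_iso C X Y f)"

definition is_ker :: "('o, 'a) pcat \<Rightarrow> 'o \<Rightarrow> 'o \<Rightarrow> 'a \<Rightarrow> 'o \<Rightarrow> 'a \<Rightarrow> bool"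
  where "is_ker C X Y f K k \<longleftrightarrow> K \<in> Ob C \<and> k \<in> mor C K X \<and> Comp C K X Y k f = zero_mor C K Y \<and>
    (\<forall>W\<in>Ob C. \<forall>g\<in>mor C W X. Comp C W X Y g f = zero_mor C W Y \<longrightarrow>
      (\<exists>!h. h \<in> mor C W K \<and> Comp C W K X h k = g))"

definition is_coker :: "('o, 'a) pcat \<Rightarrow> 'o \<Rightarrow> 'o \<Rightarrow> 'a \<Rightarrow> 'o \<Rightarrow> 'a \<Rightarrow> bool"
  where "is_coker C X Y f Q q \<longleftrightarrow> Q \<in> Ob C \<and> q \<in> mor C Y Q \<and> Comp C X Y Q f q = zero_mor C X Q \<and>
    (\<forall>Z\<in>Ob C. \<forall>g\<in>mor C Y Z. Comp C X Y Z f g = zero_mor C X Z \<longrightarrow>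
      (\<exists>!h. h \<in> mor C Q Z \<and> Comp C Y Q Z q h = g))"

section \<open>Additive and abelian categories\<close>

definition zero_object :: "('o, 'a) pcat \<Rightarrow> 'o \<Rightarrow> bool"
  where "zero_object C Z \<longleftrightarrow> Z \<in> Ob C \<and>
    (\<forall>X\<in>Ob C. mor C X Z = {zero_mor C X Z} \<and> mor C Z X = {zero_mor C Z X})"

definition biproduct :: "('o, 'a) pcat \<Rightarrow> 'o \<Rightarrow> 'o \<Rightarrow> 'o \<Rightarrow> 'a \<Rightarrow> 'a \<Rightarrow> 'a \<Rightarrow> 'a \<Rightarrow> bool"
  where "biproduct C X Y S i j p q \<longleftrightarrow> S \<in> Ob C \<and>
    i \<in> mor C X S \<and> j \<in> mor C Y S \<and> p \<in> mor C S X \<and> q \<in> mor C S Y \<and>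
    Comp C X S X i p = Ident C X \<and> Comp C Y S Y j q = Ident C Y \<and>
    Comp C X S Y i q = zero_mor C X Y \<and> Comp C Y S X j p = zero_mor C Y X \<and>
    Comp C S X S p i \<otimes>\<^bsub>Hom C S S\<^esub> Comp C S Y S q j = Ident C S"

locale additive_category = preadditive_category +
  assumes ex_zero_object: "\<exists>Z. zero_object C Z"
    and ex_biproduct: "\<lbrakk>X \<in> Ob C; Y \<in> Ob C\<rbrakk> \<Longrightarrow> \<exists>S i j p q. biproduct C X Y S i j p q"

locale abelian_category = additive_category +
  assumes ex_ker: "\<lbrakk>X \<in> Ob C; Y \<in> Ob C; f \<in> mor C X Y\<rbrakk> \<Longrightarrow> \<exists>K k. is_ker C X Y f K k"
    and ex_coker: "\<lbrakk>X \<in> Ob C; Y \<in> Ob C; f \<in> mor C X Y\<rbrakk> \<Longrightarrow> \<exists>Q q. is_coker C X Y f Q q"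
    and mono_is_ker: "\<lbrakk>X \<in> Ob C; Y \<in> Ob C; is_mono C X Y f\<rbrakk>
      \<Longrightarrow> \<exists>Z\<in>Ob C. \<exists>g\<in>mor C Y Z. is_ker C Y Z g X f"
    and epi_is_coker: "\<lbrakk>X \<in> Ob C; Y \<in> Ob C; is_epi C X Y f\<rbrakk>
      \<Longrightarrow> \<exists>W\<in>Ob C. \<exists>g\<in>mor C W X. is_coker C W X g Y f"

definition idempotent_complete :: "('o, 'a) pcat \<Rightarrow> bool"
  where "idempotent_complete C \<longleftrightarrow>
    (\<forall>X\<in>Ob C. \<forall>e\<in>mor C X X. Comp C X X X e e = e \<longrightarrow>
      (\<exists>Y\<in>Ob C. \<exists>r\<in>mor C X Y. \<exists>s\<in>mor C Y X.
        Comp C X Y X r s = e \<and> Comp C Y X Y s r = Ident C Y))"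

definition projective :: "('o, 'a) pcat \<Rightarrow> 'o \<Rightarrow> bool"
  where "projective C P \<longleftrightarrow> P \<in> Ob C \<and>
    (\<forall>A\<in>Ob C. \<forall>B\<in>Ob C. \<forall>f. is_epi C A B f \<longrightarrow> (\<lambda>g. Comp C P A B g f) ` mor C P A = mor C P B)"

definition projectively_generated :: "('o, 'a) pcat \<Rightarrow> bool"
  where "projectively_generated C \<longleftrightarrow>
    (\<forall>X\<in>Ob C. \<exists>P f. projective C P \<and> is_epi C P X f)"

definition proj_subcat :: "('o, 'a) pcat \<Rightarrow> ('o, 'a) pcat"
  where "proj_subcat C = full_subcat C {P. projective C P}"

section \<open>\<open>n\<close>-abelian categories\<close>

text \<open>
  A sequence \<open>X 0 \<rightarrow> X 1 \<rightarrow> \<dots> \<rightarrow> X (m + 1)\<close> with differentials \<open>d k : X k \<rightarrow> X (k + 1)\<close> for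
  \<open>k \<le> m\<close> is encoded by functions on the natural numbers; values at larger indices are irrelevant.
\<close>

definition chain :: "nat \<Rightarrow> ('o, 'a) pcat \<Rightarrow> (nat \<Rightarrow> 'o) \<Rightarrow> (nat \<Rightarrow> 'a) \<Rightarrow> bool"
  where "chain m C X d \<longleftrightarrow> (\<forall>k\<le>m + 1. X k \<in> Ob C) \<and> (\<forall>k\<le>m. d k \<in> mor C (X k) (X (k + 1)))"

text \<open>
  \<open>n_cokernel n C X d\<close> says that \<open>(d 1, \<dots>, d n)\<close> is an \<open>n\<close>-cokernel of \<open>d 0\<close>, i.e. that
  \<open>0 \<rightarrow> C(X (n+1), Y) \<rightarrow> \<dots> \<rightarrow> C(X 1, Y) \<rightarrow> C(X 0, Y)\<close> is exact for all \<open>Y\<close>;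
  \<open>n_kernel n C X d\<close> says that \<open>(d 0, \<dots>, d (n-1))\<close> is an \<open>n\<close>-kernel of \<open>d n\<close>.
  In both, the condition at the leftmost term expresses injectivity of the first map.
\<close>

definition n_cokernel :: "nat \<Rightarrow> ('o, 'a) pcat \<Rightarrow> (nat \<Rightarrow> 'o) \<Rightarrow> (nat \<Rightarrow> 'a) \<Rightarrow> bool"
  where "n_cokernel n C X d \<longleftrightarrow> chain n C X d \<and>
    (\<forall>Y\<in>Ob C.
      kernel (Hom C (X (n + 1)) Y) (Hom C (X n) Y) (\<lambda>g. Comp C (X n) (X (n + 1)) Y (d n) g)
        = {zero_mor C (X (n + 1)) Y} \<and>
      (\<forall>k<n.
        kernel (Hom C (X (k + 1)) Y) (Hom C (X k) Y) (\<lambda>g. Comp C (X k) (X (k + 1)) Y (d k) g)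
          = (\<lambda>g. Comp C (X (k + 1)) (X (k + 2)) Y (d (k + 1)) g) ` mor C (X (k + 2)) Y))"

definition n_kernel :: "nat \<Rightarrow> ('o, 'a) pcat \<Rightarrow> (nat \<Rightarrow> 'o) \<Rightarrow> (nat \<Rightarrow> 'a) \<Rightarrow> bool"
  where "n_kernel n C X d \<longleftrightarrow> chain n C X d \<and>
    (\<forall>Y\<in>Ob C.
      kernel (Hom C Y (X 0)) (Hom C Y (X 1)) (\<lambda>g. Comp C Y (X 0) (X 1) g (d 0))
        = {zero_mor C Y (X 0)} \<and>
      (\<forall>k<n.
        kernel (Hom C Y (X (k + 1))) (Hom C Y (X (k + 2)))
            (\<lambda>g. Comp C Y (X (k + 1)) (X (k + 2)) g (d (k + 1)))
          = (\<lambda>g. Comp C Y (X k) (X (k + 1)) g (d k)) ` mor C Y (X k)))"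

definition n_exact :: "nat \<Rightarrow> ('o, 'a) pcat \<Rightarrow> (nat \<Rightarrow> 'o) \<Rightarrow> (nat \<Rightarrow> 'a) \<Rightarrow> bool"
  where "n_exact n C X d \<longleftrightarrow> chain n C X d \<and>
    (\<forall>k<n. Comp C (X k) (X (k + 1)) (X (k + 2)) (d k) (d (k + 1)) = zero_mor C (X k) (X (k + 2))) \<and>
    n_kernel n C X d \<and> n_cokernel n C X d"

locale n_abelian_category = additive_category C for n :: nat and C :: "('o, 'a) pcat" +
  assumes A0: "idempotent_complete C"
    and A1_kernel: "\<lbrakk>A \<in> Ob C; B \<in> Ob C; f \<in> mor C A B\<rbrakk>
      \<Longrightarrow> \<exists>X d. X n = A \<and> X (n + 1) = B \<and> d n = f \<and> n_kernel n C X d"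
    and A1_cokernel: "\<lbrakk>A \<in> Ob C; B \<in> Ob C; f \<in> mor C A B\<rbrakk>
      \<Longrightarrow> \<exists>X d. X 0 = A \<and> X 1 = B \<and> d 0 = f \<and> n_cokernel n C X d"
    and A2: "\<lbrakk>is_mono C (X 0) (X 1) (d 0); n_cokernel n C X d\<rbrakk> \<Longrightarrow> n_exact n C X d"
    and A2_op: "\<lbrakk>is_epi C (X n) (X (n + 1)) (d n); n_kernel n C X d\<rbrakk> \<Longrightarrow> n_exact n C X d"

section \<open>Functors\<close>

record ('o1, 'a1, 'o2, 'a2) fctr =
  fob :: "'o1 \<Rightarrow> 'o2"
  far :: "'o1 \<Rightarrow> 'o1 \<Rightarrow> 'a1 \<Rightarrow> 'a2"

definition is_functor ::
  "('o1, 'a1) pcat \<Rightarrow> ('o2, 'a2) pcat \<Rightarrow> ('o1, 'a1, 'o2, 'a2) fctr \<Rightarrow> bool"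
  where "is_functor C D F \<longleftrightarrow>
    (\<forall>X\<in>Ob C. fob F X \<in> Ob D) \<and>
    (\<forall>X\<in>Ob C. \<forall>Y\<in>Ob C. \<forall>f\<in>mor C X Y. far F X Y f \<in> mor D (fob F X) (fob F Y)) \<and>
    (\<forall>X\<in>Ob C. far F X X (Ident C X) = Ident D (fob F X)) \<and>
    (\<forall>X\<in>Ob C. \<forall>Y\<in>Ob C. \<forall>Z\<in>Ob C. \<forall>f\<in>mor C X Y. \<forall>g\<in>mor C Y Z.
      far F X Z (Comp C X Y Z f g)
        = Comp D (fob F X) (fob F Y) (fob F Z) (far F X Y f) (far F Y Z g))"

definition additive_functor ::
  "('o1, 'a1) pcat \<Rightarrow> ('o2, 'a2) pcat \<Rightarrow> ('o1, 'a1, 'o2, 'a2) fctr \<Rightarrow> bool"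
  where "additive_functor C D F \<longleftrightarrow> is_functor C D F \<and>
    (\<forall>X\<in>Ob C. \<forall>Y\<in>Ob C. far F X Y \<in> hom (Hom C X Y) (Hom D (fob F X) (fob F Y)))"

definition fully_faithful ::
  "('o1, 'a1) pcat \<Rightarrow> ('o2, 'a2) pcat \<Rightarrow> ('o1, 'a1, 'o2, 'a2) fctr \<Rightarrow> bool"
  where "fully_faithful C D F \<longleftrightarrow>
    (\<forall>X\<in>Ob C. \<forall>Y\<in>Ob C. bij_betw (far F X Y) (mor C X Y) (mor D (fob F X) (fob F Y)))"

definition essential_image ::
  "('o1, 'a1) pcat \<Rightarrow> ('o2, 'a2) pcat \<Rightarrow> ('o1, 'a1, 'o2, 'a2) fctr \<Rightarrow> 'o2 set"
  where "essential_image C D F = {M \<in> Ob D. \<exists>X\<in>Ob C. isomorphic D M (fob F X)}"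

definition id_fctr :: "('o, 'a, 'o, 'a) fctr"
  where "id_fctr = \<lparr>fob = (\<lambda>X. X), far = (\<lambda>X Y f. f)\<rparr>"

definition comp_fctr ::
  "('o1, 'a1, 'o2, 'a2) fctr \<Rightarrow> ('o2, 'a2, 'o3, 'a3) fctr \<Rightarrow> ('o1, 'a1, 'o3, 'a3) fctr"
  where "comp_fctr F G = \<lparr>fob = (\<lambda>X. fob G (fob F X)),
    far = (\<lambda>X Y f. far G (fob F X) (fob F Y) (far F X Y f))\<rparr>"

definition naturally_isomorphic ::
  "('o1, 'a1) pcat \<Rightarrow> ('o2, 'a2) pcat \<Rightarrow>
    ('o1, 'a1, 'o2, 'a2) fctr \<Rightarrow> ('o1, 'a1, 'o2, 'a2) fctr \<Rightarrow> bool"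
  where "naturally_isomorphic C D F G \<longleftrightarrow>
    (\<exists>\<eta>. (\<forall>X\<in>Ob C. is_iso D (fob F X) (fob G X) (\<eta> X)) \<and>
      (\<forall>X\<in>Ob C. \<forall>Y\<in>Ob C. \<forall>f\<in>mor C X Y.
        Comp D (fob F X) (fob F Y) (fob G Y) (far F X Y f) (\<eta> Y)
          = Comp D (fob F X) (fob G X) (fob G Y) (\<eta> X) (far G X Y f)))"

definition is_equivalence ::
  "('o1, 'a1) pcat \<Rightarrow> ('o2, 'a2) pcat \<Rightarrow> ('o1, 'a1, 'o2, 'a2) fctr \<Rightarrow> bool"
  where "is_equivalence C D F \<longleftrightarrow> is_functor C D F \<and>
    (\<exists>G. is_functor D C G \<and>
      naturally_isomorphic C C id_fctr (comp_fctr F G) \<and>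
      naturally_isomorphic D D (comp_fctr G F) id_fctr)"

definition short_exact :: "('o, 'a) pcat \<Rightarrow> 'o \<Rightarrow> 'o \<Rightarrow> 'o \<Rightarrow> 'a \<Rightarrow> 'a \<Rightarrow> bool"
  where "short_exact C X Y Z f g \<longleftrightarrow> is_ker C Y Z g X f \<and> is_coker C X Y f Z g"

definition exact_functor ::
  "('o1, 'a1) pcat \<Rightarrow> ('o2, 'a2) pcat \<Rightarrow> ('o1, 'a1, 'o2, 'a2) fctr \<Rightarrow> bool"
  where "exact_functor C D F \<longleftrightarrow> additive_functor C D F \<and>
    (\<forall>X\<in>Ob C. \<forall>Y\<in>Ob C. \<forall>Z\<in>Ob C. \<forall>f\<in>mor C X Y. \<forall>g\<in>mor C Y Z. short_exact C X Y Z f g \<longrightarrow>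
      short_exact D (fob F X) (fob F Y) (fob F Z) (far F X Y f) (far F Y Z g))"

text \<open>A contravariant functor on \<open>C\<close> is a functor on \<^term>\<open>op_cat C\<close>.\<close>

definition exact_duality ::
  "('o1, 'a1) pcat \<Rightarrow> ('o2, 'a2) pcat \<Rightarrow> ('o1, 'a1, 'o2, 'a2) fctr \<Rightarrow> bool"
  where "exact_duality C D F \<longleftrightarrow> is_equivalence (op_cat C) D F \<and> exact_functor (op_cat C) D F"

section \<open>Modules over a preadditive category\<close>

text \<open>
  A \<open>C\<close>-module \<open>G\<close> consists of abelian groups \<open>mob G X\<close> and, for \<open>f : X \<rightarrow> Y\<close>, homomorphisms
  \<open>mar G X Y f : mob G Y \<rightarrow> mob G X\<close>. The type \<open>'v\<close> carries the underlying sets of the groups.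
\<close>

record ('o, 'a, 'v) cmodule =
  mob :: "'o \<Rightarrow> 'v monoid"
  mar :: "'o \<Rightarrow> 'o \<Rightarrow> 'a \<Rightarrow> 'v \<Rightarrow> 'v"

definition is_module :: "('o, 'a) pcat \<Rightarrow> ('o, 'a, 'v) cmodule \<Rightarrow> bool"
  where "is_module C G \<longleftrightarrow>
    (\<forall>X\<in>Ob C. comm_group (mob G X)) \<and>
    (\<forall>X\<in>Ob C. \<forall>Y\<in>Ob C. \<forall>f\<in>mor C X Y. mar G X Y f \<in> hom (mob G Y) (mob G X)) \<and>
    (\<forall>X\<in>Ob C. \<forall>x\<in>carrier (mob G X). mar G X X (Ident C X) x = x) \<and>
    (\<forall>X\<in>Ob C. \<forall>Y\<in>Ob C. \<forall>Z\<in>Ob C. \<forall>f\<in>mor C X Y. \<forall>g\<in>mor C Y Z. \<forall>x\<in>carrier (mob G Z).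
      mar G X Z (Comp C X Y Z f g) x = mar G X Y f (mar G Y Z g x)) \<and>
    (\<forall>X\<in>Ob C. \<forall>Y\<in>Ob C. \<forall>f\<in>mor C X Y. \<forall>g\<in>mor C X Y. \<forall>x\<in>carrier (mob G Y).
      mar G X Y (f \<otimes>\<^bsub>Hom C X Y\<^esub> g) x = mar G X Y f x \<otimes>\<^bsub>mob G X\<^esub> mar G X Y g x)"

text \<open>
  Natural transformations, made extensional so that they are equal iff they agree on all elements.
  The two modules may have different value types.
\<close>

definition mod_hom ::
  "('o, 'a) pcat \<Rightarrow> ('o, 'a, 'v) cmodule \<Rightarrow> ('o, 'a, 'w) cmodule \<Rightarrow> ('o \<Rightarrow> 'v \<Rightarrow> 'w) set"
  where "mod_hom C G H = {\<tau> \<in> extensional (Ob C).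
    (\<forall>X\<in>Ob C. \<tau> X \<in> hom (mob G X) (mob H X) \<inter> extensional (carrier (mob G X))) \<and>
    (\<forall>X\<in>Ob C. \<forall>Y\<in>Ob C. \<forall>f\<in>mor C X Y. \<forall>x\<in>carrier (mob G Y).
      \<tau> X (mar G X Y f x) = mar H X Y f (\<tau> Y x))}"

definition module_cat ::
  "('o, 'a) pcat \<Rightarrow> (('o, 'a, 'v) cmodule, 'o \<Rightarrow> 'v \<Rightarrow> 'v) pcat"
  where "module_cat C = \<lparr>
    Ob = {G. is_module C G},
    Hom = (\<lambda>G H. \<lparr>carrier = mod_hom C G H,
      monoid.mult = (\<lambda>\<sigma> \<tau>. \<lambda>X\<in>Ob C. \<lambda>x\<in>carrier (mob G X). \<sigma> X x \<otimes>\<^bsub>mob H X\<^esub> \<tau> X x),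
      one = (\<lambda>X\<in>Ob C. \<lambda>x\<in>carrier (mob G X). \<one>\<^bsub>mob H X\<^esub>)\<rparr>),
    Comp = (\<lambda>G H K \<sigma> \<tau>. \<lambda>X\<in>Ob C. \<lambda>x\<in>carrier (mob G X). \<tau> X (\<sigma> X x)),
    Ident = (\<lambda>G. \<lambda>X\<in>Ob C. \<lambda>x\<in>carrier (mob G X). x)\<rparr>"

definition representable :: "('o, 'a) pcat \<Rightarrow> 'o \<Rightarrow> ('o, 'a, 'a) cmodule"
  where "representable C X = \<lparr>mob = (\<lambda>W. Hom C W X), mar = (\<lambda>V W f g. Comp C V W X f g)\<rparr>"

definition coherent :: "('o, 'a) pcat \<Rightarrow> ('o, 'a, 'v) cmodule \<Rightarrow> bool"
  where "coherent C G \<longleftrightarrow> is_module C G \<and>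
    (\<exists>X\<in>Ob C. \<exists>Y\<in>Ob C. \<exists>f\<in>mor C X Y. \<exists>p\<in>mod_hom C (representable C Y) G.
      \<forall>W\<in>Ob C. p W ` mor C W Y = carrier (mob G W) \<and>
        kernel (Hom C W Y) (mob G W) (p W) = (\<lambda>g. Comp C W X Y g f) ` mor C W X)"

definition coh_cat ::
  "('o, 'a) pcat \<Rightarrow> (('o, 'a, 'v) cmodule, 'o \<Rightarrow> 'v \<Rightarrow> 'v) pcat"
  where "coh_cat C = full_subcat (module_cat C) {G. coherent C G}"

text \<open>
  Morphisms have type \<open>'a\<close> but the objects of \<^term>\<open>coh_cat\<close> have values in \<open>'v\<close>. An injection
  \<open>\<iota> :: 'a \<Rightarrow> 'v\<close> is used to replace each group \<open>C(W, X)\<close> by its isomorphic copy in \<open>'v\<close>.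
  A coherent module is pointwise a quotient of a group of morphisms, i.e. a group of cosets of type
  \<open>'a set\<close>; so as soon as \<open>'a set\<close> embeds into \<open>'v\<close>, every coherent module is isomorphic to one with
  values in \<open>'v\<close>.
\<close>

definition transport_group :: "('a \<Rightarrow> 'v) \<Rightarrow> 'a monoid \<Rightarrow> 'v monoid"
  where "transport_group \<iota> G = \<lparr>carrier = \<iota> ` carrier G,
    monoid.mult = (\<lambda>x y. \<iota> (inv_into UNIV \<iota> x \<otimes>\<^bsub>G\<^esub> inv_into UNIV \<iota> y)), one = \<iota> \<one>\<^bsub>G\<^esub>\<rparr>"

definition transport_module :: "('w \<Rightarrow> 'v) \<Rightarrow> ('o, 'a, 'w) cmodule \<Rightarrow> ('o, 'a, 'v) cmodule"
  where "transport_module \<iota> G = \<lparr>mob = (\<lambda>X. transport_group \<iota> (mob G X)),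
    mar = (\<lambda>X Y f x. \<iota> (mar G X Y f (inv_into UNIV \<iota> x)))\<rparr>"

text \<open>
  The functor \<open>X \<mapsto> M(-, X)\<close> restricted to the full subcategory of projectives, on morphisms given
  by composition. Restricting a module to a full subcategory does not change the underlying record.
\<close>

definition restricted_yoneda ::
  "('a \<Rightarrow> 'v) \<Rightarrow> ('o, 'a) pcat \<Rightarrow> ('o, 'a, ('o, 'a, 'v) cmodule, 'o \<Rightarrow> 'v \<Rightarrow> 'v) fctr"
  where "restricted_yoneda \<iota> M = \<lparr>
    fob = (\<lambda>X. transport_module \<iota> (representable M X)),
    far = (\<lambda>X Y f. \<lambda>W\<in>Ob (proj_subcat M). \<lambda>x\<in>\<iota> ` mor M W X.
      \<iota> (Comp M W X Y (inv_into UNIV \<iota> x) f))\<rparr>"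

section \<open>Yoneda extensions and cluster tilting\<close>

text \<open>Exactness at \<open>Y\<close>: a kernel of a cokernel of \<open>f\<close> (an image of \<open>f\<close>) is a kernel of \<open>g\<close>.\<close>

definition exact_at :: "('o, 'a) pcat \<Rightarrow> 'o \<Rightarrow> 'o \<Rightarrow> 'o \<Rightarrow> 'a \<Rightarrow> 'a \<Rightarrow> bool"
  where "exact_at C X Y Z f g \<longleftrightarrow>
    (\<exists>Q q I i. is_coker C X Y f Q q \<and> is_ker C Y Q q I i \<and> is_ker C Y Z g I i)"

text \<open>
  For \<open>i \<ge> 1\<close>, an \<open>i\<close>-extension of \<open>X\<close> by \<open>Y\<close> is an exact sequence
  \<open>0 \<rightarrow> Y = E 0 \<rightarrow> E 1 \<rightarrow> \<dots> \<rightarrow> E i \<rightarrow> E (i + 1) = X \<rightarrow> 0\<close>, and \<open>Ext\<^sup>i(X, Y)\<close> consists of the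
  \<open>i\<close>-extensions modulo the equivalence relation generated by morphisms of extensions that are
  the identity on \<open>X\<close> and on \<open>Y\<close>.
\<close>

definition extensions ::
  "('o, 'a) pcat \<Rightarrow> nat \<Rightarrow> 'o \<Rightarrow> 'o \<Rightarrow> ((nat \<Rightarrow> 'o) \<times> (nat \<Rightarrow> 'a)) set"
  where "extensions C i X Y = {(E, d). chain i C E d \<and> E 0 = Y \<and> E (i + 1) = X \<and>
    is_mono C (E 0) (E 1) (d 0) \<and> is_epi C (E i) (E (i + 1)) (d i) \<and>
    (\<forall>k<i. exact_at C (E k) (E (k + 1)) (E (k + 2)) (d k) (d (k + 1)))}"

definition extension_morphism ::
  "('o, 'a) pcat \<Rightarrow> nat \<Rightarrow> 'o \<Rightarrow> 'o \<Rightarrow>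
    (((nat \<Rightarrow> 'o) \<times> (nat \<Rightarrow> 'a)) \<times> ((nat \<Rightarrow> 'o) \<times> (nat \<Rightarrow> 'a))) set"
  where "extension_morphism C i X Y = {((E, d), (E', d')).
    (E, d) \<in> extensions C i X Y \<and> (E', d') \<in> extensions C i X Y \<and>
    (\<exists>\<phi>. (\<forall>k\<le>i + 1. \<phi> k \<in> mor C (E k) (E' k)) \<and> \<phi> 0 = Ident C Y \<and> \<phi> (i + 1) = Ident C X \<and>
      (\<forall>k\<le>i. Comp C (E k) (E (k + 1)) (E' (k + 1)) (d k) (\<phi> (k + 1))
        = Comp C (E k) (E' k) (E' (k + 1)) (\<phi> k) (d' k)))}"

definition Ext :: "('o, 'a) pcat \<Rightarrow> nat \<Rightarrow> 'o \<Rightarrow> 'o \<Rightarrow> ((nat \<Rightarrow> 'o) \<times> (nat \<Rightarrow> 'a)) set set"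
  where "Ext C i X Y = extensions C i X Y //
    (extension_morphism C i X Y \<union> (extension_morphism C i X Y)\<inverse>)\<^sup>+"

text \<open>The group \<open>Ext\<^sup>i(X, Y)\<close> is zero iff its underlying set has exactly one element.\<close>

definition Ext_zero :: "('o, 'a) pcat \<Rightarrow> nat \<Rightarrow> 'o \<Rightarrow> 'o \<Rightarrow> bool"
  where "Ext_zero C i X Y \<longleftrightarrow> is_singleton (Ext C i X Y)"

text \<open>Subcategories are full, so they are given by sets of objects.\<close>

definition generating :: "('o, 'a) pcat \<Rightarrow> 'o set \<Rightarrow> bool"
  where "generating A N \<longleftrightarrow> (\<forall>X\<in>Ob A. \<exists>Y\<in>N. \<exists>f. is_epi A Y X f)"

definition cogenerating :: "('o, 'a) pcat \<Rightarrow> 'o set \<Rightarrow> bool"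
  where "cogenerating A N \<longleftrightarrow> (\<forall>X\<in>Ob A. \<exists>Y\<in>N. \<exists>f. is_mono A X Y f)"

definition covariantly_finite :: "('o, 'a) pcat \<Rightarrow> 'o set \<Rightarrow> bool"
  where "covariantly_finite A N \<longleftrightarrow> (\<forall>X\<in>Ob A. \<exists>Y\<in>N. \<exists>f\<in>mor A X Y.
    \<forall>Z\<in>N. \<forall>g\<in>mor A X Z. \<exists>h\<in>mor A Y Z. Comp A X Y Z f h = g)"

definition contravariantly_finite :: "('o, 'a) pcat \<Rightarrow> 'o set \<Rightarrow> bool"
  where "contravariantly_finite A N \<longleftrightarrow> (\<forall>X\<in>Ob A. \<exists>Y\<in>N. \<exists>f\<in>mor A Y X.
    \<forall>Z\<in>N. \<forall>g\<in>mor A Z X. \<exists>h\<in>mor A Z Y. Comp A Z Y X h f = g)"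

definition functorially_finite :: "('o, 'a) pcat \<Rightarrow> 'o set \<Rightarrow> bool"
  where "functorially_finite A N \<longleftrightarrow> covariantly_finite A N \<and> contravariantly_finite A N"

definition n_cluster_tilting :: "nat \<Rightarrow> ('o, 'a) pcat \<Rightarrow> 'o set \<Rightarrow> bool"
  where "n_cluster_tilting n A N \<longleftrightarrow> abelian_category A \<and> N \<subseteq> Ob A \<and>
    generating A N \<and> cogenerating A N \<and> functorially_finite A N \<and>
    N = {X \<in> Ob A. \<forall>i. 1 \<le> i \<and> i \<le> n - 1 \<longrightarrow> (\<forall>Y\<in>N. Ext_zero A i X Y)} \<and>
    N = {X \<in> Ob A. \<forall>i. 1 \<le> i \<and> i \<le> n - 1 \<longrightarrow> (\<forall>Y\<in>N. Ext_zero A i Y X)}"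

end

theory Submission
  imports Defs
begin

text \<open>
  By the dual of (A2), an epimorphism \<open>P \<rightarrow> X\<close> from a projective is a weak cokernel of a morphism of projectives.
  Hence every \<open>F X\<close> is coherent, \<open>F\<close> is fully faithful, preserves epimorphisms and
  turns weak kernels into exact sequences. Write \<open>N\<close> for its essential image.

  An \<open>n\<close>-kernel of an epimorphism becomes an exact sequence in \<open>N\<close> on which \<open>Hom (-, N)\<close> is exact as far
  as needed, which gives \<open>Ext\<^sup>i (N, N) = 0\<close> for \<open>0 < i < n\<close> by dimension shifting. A coherent module \<open>G\<close>
  is a cokernel of some \<open>F f\<close>, and the \<open>n\<close>-cokernel of \<open>f\<close> becomes a sequence \<open>G \<rightarrow> N\<^sub>1 \<rightarrow> N\<^sub>2 \<rightarrow> \<dots>\<close> of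
  iterated left \<open>N\<close>-approximations. That \<open>N\<close> is cogenerating follows from (A2): the cokernel of a
  monomorphism of \<open>N\<close> embeds into \<open>N\<close>, and this passes to cokernels of monomorphisms \<open>C \<rightarrow> X\<close> with
  \<open>C\<close> cogenerated by \<open>N\<close> and \<open>X\<close> in \<open>N\<close>, hence along finite \<open>N\<close>-resolutions. So the approximations are
  monomorphisms, every \<open>G\<close> has \<open>N\<close>-resolutions and \<open>N\<close>-coresolutions of length \<open>n\<close>, and these
  split off \<open>G\<close> as a direct summand of an object of \<open>N\<close> as soon as the relevant \<open>Ext\<close> groups vanish.

  Diagram chases use arrows out of projective objects in place of elements.
\<close>

section \<open>Arrow calculus\<close>

text \<open>Hom groups need not be disjoint and composition carries three objects, so calculations
  use arrows that know their source and target. Vanishing of Ext is measured by syzygies in the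
  first variable (\<open>evan\<close>); it is matched with Yoneda extensions by recording an
  extension through the arrow that it induces on a syzygy. The obstacle is that the approximations
  coming from an n-cokernel are not known to be monomorphisms. Below the top of the chain this
  follows from vanishing of Ext^1 and Ext^2 into N, but at the top the vanishing range is one degree
  too short, and cogeneration has to come from elsewhere. Its source is that the n-cokernel of a
  monomorphism h is n-exact: h is a weak kernel of the next arrow, so the cokernel of h embeds into
  the next object. For a monomorphism from C to X with C outside N, a monic approximation of C is
  paired with an embedding of its cokernel, which gives a monomorphism between objects of N whose
  cokernel contains the cokernel wanted. Modules take values in a fixed type, so quotients and sums
  are re-encoded there by chosen representatives.\<close>

datatype ('o, 'a) arrow = Arrow (src: 'o) (val: 'a) (tgt: 'o)

lemma Arrow_eqI: "src f = src g \<Longrightarrow> tgt f = tgt g \<Longrightarrow> val f = val g \<Longrightarrow> f = g"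
  by (cases f, cases g) simp

lemma all_arrow: "(\<forall>x. Q x) \<longleftrightarrow> (\<forall>X f Y. Q (Arrow X f Y))"
  by (metis arrow.exhaust)

lemma Arrow_collapse [simp]: "src f = X \<Longrightarrow> tgt f = Y \<Longrightarrow> Arrow X (val f) Y = f"
  by (cases f) simp

context preadditive_category
begin

definition arr :: "('o, 'a) arrow \<Rightarrow> bool"
  where "arr f \<longleftrightarrow> src f \<in> Ob C \<and> tgt f \<in> Ob C \<and> val f \<in> mor C (src f) (tgt f)"

definition cmp :: "('o, 'a) arrow \<Rightarrow> ('o, 'a) arrow \<Rightarrow> ('o, 'a) arrow" (infixr ";;" 75)
  where "f ;; g = Arrow (src f) (Comp C (src f) (tgt f) (tgt g) (val f) (val g)) (tgt g)"

definition add :: "('o, 'a) arrow \<Rightarrow> ('o, 'a) arrow \<Rightarrow> ('o, 'a) arrow" (infixl "\<boxplus>" 65)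
  where "f \<boxplus> g = Arrow (src f) (val f \<otimes>\<^bsub>Hom C (src f) (tgt f)\<^esub> val g) (tgt f)"

definition neg :: "('o, 'a) arrow \<Rightarrow> ('o, 'a) arrow"
  where "neg f = Arrow (src f) (inv\<^bsub>Hom C (src f) (tgt f)\<^esub> val f) (tgt f)"

definition zer :: "'o \<Rightarrow> 'o \<Rightarrow> ('o, 'a) arrow"
  where "zer X Y = Arrow X (zero_mor C X Y) Y"

definition idt :: "'o \<Rightarrow> ('o, 'a) arrow"
  where "idt X = Arrow X (Ident C X) X"

abbreviation par :: "('o, 'a) arrow \<Rightarrow> ('o, 'a) arrow \<Rightarrow> bool"
  where "par f g \<equiv> arr f \<and> arr g \<and> src f = src g \<and> tgt f = tgt g"

lemma arr_ob [simp]: "arr f \<Longrightarrow> src f \<in> Ob C" "arr f \<Longrightarrow> tgt f \<in> Ob C"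
  by (simp_all add: arr_def)

lemma arrI: "X \<in> Ob C \<Longrightarrow> Y \<in> Ob C \<Longrightarrow> f \<in> mor C X Y \<Longrightarrow> arr (Arrow X f Y)"
  by (simp del: arr_ob add: arr_def)

lemma src_tgt_ops [simp]:
  "src (f ;; g) = src f" "tgt (f ;; g) = tgt g" "src (f \<boxplus> g) = src f" "tgt (f \<boxplus> g) = tgt f"
  "src (neg f) = src f" "tgt (neg f) = tgt f" "src (zer X Y) = X" "tgt (zer X Y) = Y"
  "src (idt X) = X" "tgt (idt X) = X"
  by (simp_all add: cmp_def add_def neg_def zer_def idt_def)

lemma arr_cmp [simp]: "arr f \<Longrightarrow> arr g \<Longrightarrow> tgt f = src g \<Longrightarrow> arr (f ;; g)"
  by (auto simp del: arr_ob simp: arr_def cmp_def intro: comp_closed)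

lemma arr_idt [simp]: "X \<in> Ob C \<Longrightarrow> arr (idt X)"
  by (simp del: arr_ob add: arr_def idt_def ident_closed)

lemma cmp_assoc [simp]:
  "arr f \<Longrightarrow> arr g \<Longrightarrow> arr h \<Longrightarrow> tgt f = src g \<Longrightarrow> tgt g = src h \<Longrightarrow> (f ;; g) ;; h = f ;; g ;; h"
  by (auto simp del: arr_ob simp: arr_def cmp_def intro: comp_assoc)

lemma idt_cmp [simp]: "arr f \<Longrightarrow> src f = X \<Longrightarrow> idt X ;; f = f"
  by (rule Arrow_eqI) (auto simp del: arr_ob simp: arr_def cmp_def idt_def ident_left)

lemma cmp_idt [simp]: "arr f \<Longrightarrow> tgt f = X \<Longrightarrow> f ;; idt X = f"
  by (rule Arrow_eqI) (auto simp del: arr_ob simp: arr_def cmp_def idt_def ident_right)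

lemma hom_grp: "X \<in> Ob C \<Longrightarrow> Y \<in> Ob C \<Longrightarrow> group (Hom C X Y)"
  by (simp add: hom_group comm_group.axioms(2))

lemma hom_mon: "X \<in> Ob C \<Longrightarrow> Y \<in> Ob C \<Longrightarrow> comm_monoid (Hom C X Y)"
  by (simp add: hom_group comm_group.axioms(1))

lemma hom_mon': "X \<in> Ob C \<Longrightarrow> Y \<in> Ob C \<Longrightarrow> Group.monoid (Hom C X Y)"
  by (simp add: hom_grp group.is_monoid)

lemma arr_add [simp]: "par f g \<Longrightarrow> arr (f \<boxplus> g)"
  by (auto simp del: arr_ob simp: arr_def add_def intro: monoid.m_closed[OF hom_mon'])

lemma arr_neg [simp]: "arr f \<Longrightarrow> arr (neg f)"
  by (auto simp del: arr_ob simp: arr_def neg_def intro: group.inv_closed[OF hom_grp])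

lemma arr_zer [simp]: "X \<in> Ob C \<Longrightarrow> Y \<in> Ob C \<Longrightarrow> arr (zer X Y)"
  by (auto simp del: arr_ob simp: arr_def zer_def intro: monoid.one_closed[OF hom_mon'])

lemma add_commute: "par f g \<Longrightarrow> f \<boxplus> g = g \<boxplus> f"
  by (auto simp del: arr_ob simp: arr_def add_def intro: comm_monoid.m_comm[OF hom_mon])

lemma add_assoc: "par f g \<Longrightarrow> par g h \<Longrightarrow> (f \<boxplus> g) \<boxplus> h = f \<boxplus> (g \<boxplus> h)"
  by (auto simp del: arr_ob simp: arr_def add_def intro: monoid.m_assoc[OF hom_mon'])

lemma zer_add [simp]: "arr f \<Longrightarrow> src f = X \<Longrightarrow> tgt f = Y \<Longrightarrow> zer X Y \<boxplus> f = f"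
  by (rule Arrow_eqI) (auto simp del: arr_ob simp: arr_def add_def zer_def intro: monoid.l_one[OF hom_mon'])

lemma add_zer [simp]: "arr f \<Longrightarrow> src f = X \<Longrightarrow> tgt f = Y \<Longrightarrow> f \<boxplus> zer X Y = f"
  by (rule Arrow_eqI) (auto simp del: arr_ob simp: arr_def add_def zer_def intro: monoid.r_one[OF hom_mon'])

lemma add_neg [simp]: "arr f \<Longrightarrow> f \<boxplus> neg f = zer (src f) (tgt f)"
  by (auto simp del: arr_ob simp: arr_def add_def zer_def neg_def intro: group.r_inv[OF hom_grp])

lemma neg_add [simp]: "arr f \<Longrightarrow> neg f \<boxplus> f = zer (src f) (tgt f)"
  by (auto simp del: arr_ob simp: arr_def add_def zer_def neg_def intro: group.l_inv[OF hom_grp])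

lemma cmp_add [simp]: "arr f \<Longrightarrow> par g h \<Longrightarrow> tgt f = src g \<Longrightarrow> f ;; (g \<boxplus> h) = f ;; g \<boxplus> f ;; h"
  by (auto simp del: arr_ob simp: arr_def add_def cmp_def intro: comp_add_right)

lemma add_cmp [simp]: "arr h \<Longrightarrow> par f g \<Longrightarrow> tgt f = src h \<Longrightarrow> (f \<boxplus> g) ;; h = f ;; h \<boxplus> g ;; h"
  by (auto simp del: arr_ob simp: arr_def add_def cmp_def intro: comp_add_left)

lemma add_eq_zer: "par f g \<Longrightarrow> f \<boxplus> g = zer (src f) (tgt f) \<Longrightarrow> g = neg f"
proof -
  assume a: "par f g" "f \<boxplus> g = zer (src f) (tgt f)"
  have "g = (neg f \<boxplus> f) \<boxplus> g" using a by simp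
  also have "\<dots> = neg f \<boxplus> (f \<boxplus> g)" using a by (intro add_assoc) simp_all
  also have "\<dots> = neg f" using a by simp
  finally show "g = neg f" .
qed

lemma add_self_zer: "arr f \<Longrightarrow> f \<boxplus> f = f \<Longrightarrow> f = zer (src f) (tgt f)"
proof -
  assume a: "arr f" "f \<boxplus> f = f"
  have "f = (neg f \<boxplus> f) \<boxplus> f" using a by simp
  also have "\<dots> = neg f \<boxplus> (f \<boxplus> f)" using a by (intro add_assoc) simp_all
  finally show ?thesis using a by simp
qed

lemma zer_cmp [simp]: "arr f \<Longrightarrow> src f = Y \<Longrightarrow> X \<in> Ob C \<Longrightarrow> zer X Y ;; f = zer X (tgt f)"
proof -
  assume a: "arr f" "src f = Y" "X \<in> Ob C"
  have "zer X Y ;; f \<boxplus> zer X Y ;; f = (zer X Y \<boxplus> zer X Y) ;; f"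
    using a by (intro add_cmp[symmetric]) auto
  also have "zer X Y \<boxplus> zer X Y = zer X Y" using a by (intro zer_add) auto
  finally show ?thesis using add_self_zer[of "zer X Y ;; f"] a by auto
qed

lemma cmp_zer [simp]: "arr f \<Longrightarrow> tgt f = Y \<Longrightarrow> Z \<in> Ob C \<Longrightarrow> f ;; zer Y Z = zer (src f) Z"
proof -
  assume a: "arr f" "tgt f = Y" "Z \<in> Ob C"
  have "f ;; zer Y Z \<boxplus> f ;; zer Y Z = f ;; (zer Y Z \<boxplus> zer Y Z)"
    using a by (intro cmp_add[symmetric]) auto
  also have "zer Y Z \<boxplus> zer Y Z = zer Y Z" using a by (intro zer_add) auto
  finally show ?thesis using add_self_zer[of "f ;; zer Y Z"] a by auto
qed

lemma cmp_neg [simp]: "arr f \<Longrightarrow> arr g \<Longrightarrow> tgt f = src g \<Longrightarrow> f ;; neg g = neg (f ;; g)"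
proof -
  assume a: "arr f" "arr g" "tgt f = src g"
  have "f ;; g \<boxplus> f ;; neg g = f ;; (g \<boxplus> neg g)"
    using a by (intro cmp_add[symmetric]) auto
  then show ?thesis using a add_eq_zer[of "f ;; g" "f ;; neg g"] by auto
qed

lemma neg_cmp [simp]: "arr f \<Longrightarrow> arr g \<Longrightarrow> tgt f = src g \<Longrightarrow> neg f ;; g = neg (f ;; g)"
proof -
  assume a: "arr f" "arr g" "tgt f = src g"
  have "f ;; g \<boxplus> neg f ;; g = (f \<boxplus> neg f) ;; g"
    using a by (intro add_cmp[symmetric]) auto
  then show ?thesis using a add_eq_zer[of "f ;; g" "neg f ;; g"] by auto
qed

lemma neg_neg [simp]: "arr f \<Longrightarrow> neg (neg f) = f"
  using add_eq_zer[of "neg f" f] by auto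

lemma neg_zer [simp]: "X \<in> Ob C \<Longrightarrow> Y \<in> Ob C \<Longrightarrow> neg (zer X Y) = zer X Y"
  using add_eq_zer[of "zer X Y" "zer X Y"] by auto

lemma add_neg_eq_zer: "par f g \<Longrightarrow> f \<boxplus> neg g = zer (src f) (tgt f) \<longleftrightarrow> f = g"
proof -
  assume a: "par f g"
  show ?thesis
  proof
    assume "f \<boxplus> neg g = zer (src f) (tgt f)"
    then have "neg g = neg f" using a by (intro add_eq_zer) simp_all
    then have "neg (neg g) = neg (neg f)" by (rule arg_cong)
    then show "f = g" using a by simp
  qed (use a in simp)
qed

lemma neg_add_distrib [simp]: "par f g \<Longrightarrow> neg (f \<boxplus> g) = neg f \<boxplus> neg g"
proof -
  assume a: "par f g"
  have "(f \<boxplus> g) \<boxplus> (neg f \<boxplus> neg g) = (f \<boxplus> g) \<boxplus> (neg g \<boxplus> neg f)"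
    using a by (simp add: add_commute[of "neg f"])
  also have "\<dots> = f \<boxplus> ((g \<boxplus> neg g) \<boxplus> neg f)"
    using a by (simp add: add_assoc del: add_neg)
  also have "\<dots> = zer (src f) (tgt f)" using a by simp
  finally show ?thesis using a add_eq_zer[of "f \<boxplus> g" "neg f \<boxplus> neg g"] by simp
qed

lemma add_neg_cancel [simp]: "par f g \<Longrightarrow> f \<boxplus> (g \<boxplus> neg f) = g" "par f g \<Longrightarrow> f \<boxplus> (neg f \<boxplus> g) = g"
  "par f g \<Longrightarrow> neg f \<boxplus> (f \<boxplus> g) = g" "par f g \<Longrightarrow> (g \<boxplus> neg f) \<boxplus> f = g" "par f g \<Longrightarrow> (g \<boxplus> f) \<boxplus> neg f = g"
proof -
  assume a: "par f g"
  show 1: "f \<boxplus> (neg f \<boxplus> g) = g" using a by (simp add: add_assoc[symmetric])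
  show "f \<boxplus> (g \<boxplus> neg f) = g" using a 1 by (simp add: add_commute[of g])
  show "neg f \<boxplus> (f \<boxplus> g) = g" using a by (simp add: add_assoc[symmetric])
qed (simp_all add: add_assoc)

text \<open>Composites are kept associated to the right, where an equation for \<open>f ;; g\<close>
  no longer matches once something follows; this is its form with a tail \<open>h\<close>.\<close>

lemma cmp_reduce: "f ;; g = k \<Longrightarrow> arr f \<Longrightarrow> arr g \<Longrightarrow> tgt f = src g \<Longrightarrow> arr h \<Longrightarrow> tgt g = src h
    \<Longrightarrow> f ;; g ;; h = k ;; h"
  by (metis cmp_assoc)

section \<open>Universal properties of arrows\<close>

text \<open>A trivial kernel stands in for cancellation; subtraction makes the two agree, see
  \<open>mono_cancel\<close> and \<open>is_mono_iff\<close>.\<close>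

definition mono :: "('o, 'a) arrow \<Rightarrow> bool"
  where "mono f \<longleftrightarrow> arr f \<and> (\<forall>x. arr x \<and> tgt x = src f \<and> x ;; f = zer (src x) (tgt f) \<longrightarrow> x = zer (src x) (src f))"

definition epi :: "('o, 'a) arrow \<Rightarrow> bool"
  where "epi f \<longleftrightarrow> arr f \<and> (\<forall>x. arr x \<and> src x = tgt f \<and> f ;; x = zer (src f) (tgt x) \<longrightarrow> x = zer (tgt f) (tgt x))"

definition isomap :: "('o, 'a) arrow \<Rightarrow> bool"
  where "isomap f \<longleftrightarrow> arr f \<and> (\<exists>g. arr g \<and> src g = tgt f \<and> tgt g = src f \<and> f ;; g = idt (src f) \<and> g ;; f = idt (tgt f))"

definition kerp :: "('o, 'a) arrow \<Rightarrow> ('o, 'a) arrow \<Rightarrow> bool"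
  where "kerp f k \<longleftrightarrow> arr f \<and> arr k \<and> tgt k = src f \<and> k ;; f = zer (src k) (tgt f) \<and>
    (\<forall>x. arr x \<and> tgt x = src f \<and> x ;; f = zer (src x) (tgt f) \<longrightarrow>
      (\<exists>!y. arr y \<and> src y = src x \<and> tgt y = src k \<and> y ;; k = x))"

definition cokerp :: "('o, 'a) arrow \<Rightarrow> ('o, 'a) arrow \<Rightarrow> bool"
  where "cokerp f q \<longleftrightarrow> arr f \<and> arr q \<and> src q = tgt f \<and> f ;; q = zer (src f) (tgt q) \<and>
    (\<forall>x. arr x \<and> src x = tgt f \<and> f ;; x = zer (src f) (tgt x) \<longrightarrow>
      (\<exists>!y. arr y \<and> src y = tgt q \<and> tgt y = tgt x \<and> q ;; y = x))"

definition ses :: "('o, 'a) arrow \<Rightarrow> ('o, 'a) arrow \<Rightarrow> bool"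
  where "ses f g \<longleftrightarrow> kerp g f \<and> cokerp f g"

definition bip :: "('o, 'a) arrow \<Rightarrow> ('o, 'a) arrow \<Rightarrow> ('o, 'a) arrow \<Rightarrow> ('o, 'a) arrow \<Rightarrow> bool"
  where "bip i j p q \<longleftrightarrow> arr i \<and> arr j \<and> arr p \<and> arr q \<and> tgt j = tgt i \<and> src p = tgt i \<and> src q = tgt i \<and>
    tgt p = src i \<and> tgt q = src j \<and> i ;; p = idt (src i) \<and> j ;; q = idt (src j) \<and>
    i ;; q = zer (src i) (src j) \<and> j ;; p = zer (src j) (src i) \<and> p ;; i \<boxplus> q ;; j = idt (tgt i)"

definition proj :: "'o \<Rightarrow> bool"
  where "proj P \<longleftrightarrow> P \<in> Ob C \<and> (\<forall>f x. epi f \<and> arr x \<and> src x = P \<and> tgt x = tgt f \<longrightarrow>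
    (\<exists>y. arr y \<and> src y = P \<and> tgt y = src f \<and> y ;; f = x))"

text \<open>A dictionary between quantification over arrows and over elements of hom groups. With
  \<open>ex1_triple\<close> it reduces the universal properties of arrows to those in
  \<open>is_ker\<close> and \<open>is_coker\<close>.\<close>

lemma all_triple: "(\<forall>x. arr x \<and> tgt x = Y \<and> Q x \<longrightarrow> R x) \<longleftrightarrow> (\<forall>W\<in>Ob C. Y \<in> Ob C \<longrightarrow> (\<forall>g\<in>mor C W Y. Q (Arrow W g Y) \<longrightarrow> R (Arrow W g Y)))"
  "(\<forall>x. arr x \<and> src x = Y \<and> Q x \<longrightarrow> R x) \<longleftrightarrow> (\<forall>W\<in>Ob C. Y \<in> Ob C \<longrightarrow> (\<forall>g\<in>mor C Y W. Q (Arrow Y g W) \<longrightarrow> R (Arrow Y g W)))"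
  by (auto simp del: arr_ob simp: arr_def all_arrow)

lemma ex1_triple: "(\<exists>!y. arr y \<and> src y = X \<and> tgt y = Y \<and> Q y) \<longleftrightarrow> X \<in> Ob C \<and> Y \<in> Ob C \<and> (\<exists>!h. h \<in> mor C X Y \<and> Q (Arrow X h Y))"
proof
  assume "\<exists>!y. arr y \<and> src y = X \<and> tgt y = Y \<and> Q y"
  then obtain y where y: "arr y" "src y = X" "tgt y = Y" "Q y"
    and u: "\<And>z. arr z \<Longrightarrow> src z = X \<Longrightarrow> tgt z = Y \<Longrightarrow> Q z \<Longrightarrow> z = y" by blast
  have "\<exists>!h. h \<in> mor C X Y \<and> Q (Arrow X h Y)"
  proof (rule ex1I[of _ "val y"])
    show "val y \<in> mor C X Y \<and> Q (Arrow X (val y) Y)" using y by (auto simp del: arr_ob simp: arr_def)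
    fix h assume "h \<in> mor C X Y \<and> Q (Arrow X h Y)"
    then have "(Arrow X h Y) = y" using y by (intro u) (auto simp del: arr_ob simp: arr_def)
    then show "h = val y" by auto
  qed
  then show "X \<in> Ob C \<and> Y \<in> Ob C \<and> (\<exists>!h. h \<in> mor C X Y \<and> Q (Arrow X h Y))" using y by auto
next
  assume "X \<in> Ob C \<and> Y \<in> Ob C \<and> (\<exists>!h. h \<in> mor C X Y \<and> Q (Arrow X h Y))"
  then obtain h where h: "X \<in> Ob C" "Y \<in> Ob C" "h \<in> mor C X Y" "Q (Arrow X h Y)"
    and u: "\<And>k. k \<in> mor C X Y \<Longrightarrow> Q (Arrow X k Y) \<Longrightarrow> k = h" by blast
  show "\<exists>!y. arr y \<and> src y = X \<and> tgt y = Y \<and> Q y"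
  proof (rule ex1I[of _ "Arrow X h Y"])
    show "arr (Arrow X h Y) \<and> src (Arrow X h Y) = X \<and> tgt (Arrow X h Y) = Y \<and> Q (Arrow X h Y)"
      using h by (simp del: arr_ob add: arr_def)
    fix y assume a: "arr y \<and> src y = X \<and> tgt y = Y \<and> Q y"
    then have "val y = h" by (intro u) (auto simp del: arr_ob simp: arr_def)
    then show "y = (Arrow X h Y)" using a by (metis Arrow_collapse)
  qed
qed

lemma monoD: "mono f \<Longrightarrow> arr x \<Longrightarrow> tgt x = src f \<Longrightarrow> x ;; f = zer (src x) (tgt f) \<Longrightarrow> x = zer (src x) (src f)"
  unfolding mono_def by blast

lemma epiD: "epi f \<Longrightarrow> arr x \<Longrightarrow> src x = tgt f \<Longrightarrow> f ;; x = zer (src f) (tgt x) \<Longrightarrow> x = zer (tgt f) (tgt x)"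
  unfolding epi_def by blast

lemma mono_cancel: "mono f \<Longrightarrow> par x y \<Longrightarrow> tgt x = src f \<Longrightarrow> x ;; f = y ;; f \<Longrightarrow> x = y"
proof -
  assume a: "mono f" "par x y" "tgt x = src f" "x ;; f = y ;; f"
  then have f: "arr f" by (simp add: mono_def)
  have "(x \<boxplus> neg y) ;; f = zer (src x) (tgt f)" using a f by simp
  then have "x \<boxplus> neg y = zer (src x) (tgt x)" using monoD[OF a(1), of "x \<boxplus> neg y"] a f by simp
  then show "x = y" using a add_neg_eq_zer by blast
qed

lemma epi_cancel: "epi f \<Longrightarrow> par x y \<Longrightarrow> src x = tgt f \<Longrightarrow> f ;; x = f ;; y \<Longrightarrow> x = y"
proof -
  assume a: "epi f" "par x y" "src x = tgt f" "f ;; x = f ;; y"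
  then have f: "arr f" by (simp add: epi_def)
  have "f ;; (x \<boxplus> neg y) = zer (src f) (tgt x)" using a f by simp
  then have "x \<boxplus> neg y = zer (src x) (tgt x)" using epiD[OF a(1), of "x \<boxplus> neg y"] a f by simp
  then show "x = y" using a add_neg_eq_zer by blast
qed

lemma is_mono_iff:
  assumes "X \<in> Ob C" "Y \<in> Ob C"
  shows "is_mono C X Y f \<longleftrightarrow> mono (Arrow X f Y)"
proof
  assume m: "is_mono C X Y f"
  then have f: "arr (Arrow X f Y)" using assms by (auto simp del: arr_ob simp: arr_def is_mono_def)
  show "mono (Arrow X f Y)" unfolding mono_def
  proof (intro conjI allI impI f)
    fix x assume a: "arr x \<and> tgt x = src (Arrow X f Y) \<and> x ;; (Arrow X f Y) = zer (src x) (tgt (Arrow X f Y))"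
    have "zer (src x) X ;; (Arrow X f Y) = zer (src x) Y" using a f by simp
    then have "Comp C (src x) X Y (val x) f = Comp C (src x) X Y (zero_mor C (src x) X) f"
      using a by (auto simp: cmp_def zer_def)
    moreover have "arr (zer (src x) X)" using a assms by simp
    ultimately have "val x = zero_mor C (src x) X"
      using m a unfolding is_mono_def by (auto simp del: arr_ob simp: arr_def zer_def)
    then show "x = zer (src x) (src (Arrow X f Y))"
      using a by (intro Arrow_eqI) (auto simp: zer_def)
  qed
next
  assume m: "mono (Arrow X f Y)"
  show "is_mono C X Y f" unfolding is_mono_def
  proof (intro conjI ballI impI)
    show "f \<in> mor C X Y" using m by (auto simp del: arr_ob simp: mono_def arr_def)
    fix W g h assume a: "W \<in> Ob C" "g \<in> mor C W X" "h \<in> mor C W X" "Comp C W X Y g f = Comp C W X Y h f"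
    have "(Arrow W g X) = (Arrow W h X)"
      using m by (rule mono_cancel) (use a assms in \<open>auto simp del: arr_ob simp: arr_def cmp_def\<close>)
    then show "g = h" by simp
  qed
qed

lemma is_epi_iff:
  assumes "X \<in> Ob C" "Y \<in> Ob C"
  shows "is_epi C X Y f \<longleftrightarrow> epi (Arrow X f Y)"
proof
  assume m: "is_epi C X Y f"
  then have f: "arr (Arrow X f Y)" using assms by (auto simp del: arr_ob simp: arr_def is_epi_def)
  show "epi (Arrow X f Y)" unfolding epi_def
  proof (intro conjI allI impI f)
    fix x assume a: "arr x \<and> src x = tgt (Arrow X f Y) \<and> (Arrow X f Y) ;; x = zer (src (Arrow X f Y)) (tgt x)"
    have "(Arrow X f Y) ;; zer Y (tgt x) = zer X (tgt x)" using a f by simp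
    then have "Comp C X Y (tgt x) f (val x) = Comp C X Y (tgt x) f (zero_mor C Y (tgt x))"
      using a by (auto simp: cmp_def zer_def)
    moreover have "arr (zer Y (tgt x))" using a assms by simp
    ultimately have "val x = zero_mor C Y (tgt x)"
      using m a unfolding is_epi_def by (auto simp del: arr_ob simp: arr_def zer_def)
    then show "x = zer (tgt (Arrow X f Y)) (tgt x)"
      using a by (intro Arrow_eqI) (auto simp: zer_def)
  qed
next
  assume m: "epi (Arrow X f Y)"
  show "is_epi C X Y f" unfolding is_epi_def
  proof (intro conjI ballI impI)
    show "f \<in> mor C X Y" using m by (auto simp del: arr_ob simp: epi_def arr_def)
    fix Z g h assume a: "Z \<in> Ob C" "g \<in> mor C Y Z" "h \<in> mor C Y Z" "Comp C X Y Z f g = Comp C X Y Z f h"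
    have "(Arrow Y g Z) = (Arrow Y h Z)"
      using m by (rule epi_cancel) (use a assms in \<open>auto simp del: arr_ob simp: arr_def cmp_def\<close>)
    then show "g = h" by simp
  qed
qed

lemma is_iso_iff: "X \<in> Ob C \<Longrightarrow> Y \<in> Ob C \<Longrightarrow> is_iso C X Y f \<longleftrightarrow> isomap (Arrow X f Y)"
proof -
  assume ob: "X \<in> Ob C" "Y \<in> Ob C"
  show ?thesis
  proof
    assume "is_iso C X Y f"
    then obtain g where g: "f \<in> mor C X Y" "g \<in> mor C Y X"
      "Comp C X Y X f g = Ident C X" "Comp C Y X Y g f = Ident C Y" unfolding is_iso_def by blast
    then show "isomap (Arrow X f Y)" unfolding isomap_def
      using ob by (intro conjI exI[of _ "Arrow Y g X"]) (auto simp: arrI cmp_def idt_def)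
  next
    assume "isomap (Arrow X f Y)"
    then obtain g where g: "arr (Arrow X f Y)" "arr g" "src g = Y" "tgt g = X"
      "(Arrow X f Y) ;; g = idt X" "g ;; (Arrow X f Y) = idt Y" unfolding isomap_def by auto
    then have "val g \<in> mor C Y X" "f \<in> mor C X Y" by (auto simp del: arr_ob simp: arr_def)
    then show "is_iso C X Y f" unfolding is_iso_def
      using g by (intro conjI bexI[of _ "val g"]) (auto simp: cmp_def idt_def)
  qed
qed

lemma is_ker_iff:
  assumes "X \<in> Ob C" "Y \<in> Ob C" "f \<in> mor C X Y"
  shows "is_ker C X Y f K k \<longleftrightarrow> kerp (Arrow X f Y) (Arrow K k X)"
proof (cases "K \<in> Ob C \<and> k \<in> mor C K X")
  case False
  then show ?thesis by (auto simp del: arr_ob simp: is_ker_def kerp_def arr_def)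
next
  case True
  then show ?thesis using assms
    unfolding is_ker_def kerp_def all_triple ex1_triple
    by (simp del: arr_ob add: arr_def cmp_def zer_def)
qed

lemma is_coker_iff:
  assumes "X \<in> Ob C" "Y \<in> Ob C" "f \<in> mor C X Y"
  shows "is_coker C X Y f Q q \<longleftrightarrow> cokerp (Arrow X f Y) (Arrow Y q Q)"
proof (cases "Q \<in> Ob C \<and> q \<in> mor C Y Q")
  case False
  then show ?thesis by (auto simp del: arr_ob simp: is_coker_def cokerp_def arr_def)
next
  case True
  then show ?thesis using assms
    unfolding is_coker_def cokerp_def all_triple ex1_triple
    by (simp del: arr_ob add: arr_def cmp_def zer_def)
qed

lemma biproduct_iff:
  assumes "X \<in> Ob C" "Y \<in> Ob C"
  shows "biproduct C X Y S i j p q \<longleftrightarrow> bip (Arrow X i S) (Arrow Y j S) (Arrow S p X) (Arrow S q Y)"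
  using assms by (auto simp del: arr_ob simp: biproduct_def bip_def arr_def cmp_def zer_def idt_def add_def)

lemma projE: "proj P \<Longrightarrow> epi f \<Longrightarrow> arr x \<Longrightarrow> src x = P \<Longrightarrow> tgt x = tgt f \<Longrightarrow>
   (\<And>y. arr y \<Longrightarrow> src y = P \<Longrightarrow> tgt y = src f \<Longrightarrow> y ;; f = x \<Longrightarrow> thesis) \<Longrightarrow> thesis"
  unfolding proj_def by blast

lemma projective_iff: "projective C P \<longleftrightarrow> proj P"
proof
  assume p: "projective C P"
  then have P: "P \<in> Ob C" by (simp add: projective_def)
  show "proj P" unfolding proj_def
  proof (intro conjI allI impI P)
    fix f x assume a: "epi f \<and> arr x \<and> src x = P \<and> tgt x = tgt f"
    then have f: "arr f" by (simp add: epi_def)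
    then have "is_epi C (src f) (tgt f) (val f)" using a by (simp add: is_epi_iff)
    then have "val x \<in> (\<lambda>g. Comp C P (src f) (tgt f) g (val f)) ` mor C P (src f)"
      using p a f by (auto simp del: arr_ob simp: projective_def arr_def)
    then obtain g where g: "g \<in> mor C P (src f)" "val x = Comp C P (src f) (tgt f) g (val f)" by auto
    show "\<exists>y. arr y \<and> src y = P \<and> tgt y = src f \<and> y ;; f = x"
      using g P f a by (intro exI[of _ "Arrow P g (src f)"] conjI Arrow_eqI) (auto simp: arrI cmp_def)
  qed
next
  assume p: "proj P"
  then have P: "P \<in> Ob C" by (simp add: proj_def)
  show "projective C P" unfolding projective_def
  proof (intro conjI ballI allI impI P)
    fix A B f assume a: "A \<in> Ob C" "B \<in> Ob C" "is_epi C A B f"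
    then have e: "epi (Arrow A f B)" by (simp add: is_epi_iff)
    then have f: "f \<in> mor C A B" by (simp del: arr_ob add: epi_def arr_def)
    show "(\<lambda>g. Comp C P A B g f) ` mor C P A = mor C P B"
    proof (intro equalityI subsetI)
      fix x assume "x \<in> (\<lambda>g. Comp C P A B g f) ` mor C P A"
      then show "x \<in> mor C P B" using a P f by (auto intro: comp_closed)
    next
      fix x assume "x \<in> mor C P B"
      then obtain y where y: "arr y" "src y = P" "tgt y = A" "y ;; (Arrow A f B) = (Arrow P x B)"
        using p e a P by (elim projE[of P "Arrow A f B" "Arrow P x B"]) (auto simp: arrI)
      then have "val y \<in> mor C P A" "Comp C P A B (val y) f = x" by (auto simp del: arr_ob simp: arr_def cmp_def)
      then show "x \<in> (\<lambda>g. Comp C P A B g f) ` mor C P A" by auto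
    qed
  qed
qed

lemma monoI: "arr f \<Longrightarrow> (\<And>x. arr x \<Longrightarrow> tgt x = src f \<Longrightarrow> x ;; f = zer (src x) (tgt f) \<Longrightarrow> x = zer (src x) (src f)) \<Longrightarrow> mono f"
  unfolding mono_def by blast

lemma epiI: "arr f \<Longrightarrow> (\<And>x. arr x \<Longrightarrow> src x = tgt f \<Longrightarrow> f ;; x = zer (src f) (tgt x) \<Longrightarrow> x = zer (tgt f) (tgt x)) \<Longrightarrow> epi f"
  unfolding epi_def by blast

text \<open>An arrow killed by \<open>k\<close> and the zero arrow both factor zero through
  \<open>k\<close>, so uniqueness of factorisations identifies them.\<close>

lemma kerp_mono: assumes "kerp f k" shows "mono k"
proof (rule monoI)
  show k: "arr k" using assms by (simp add: kerp_def)
  have f: "arr f" "tgt k = src f" "k ;; f = zer (src k) (tgt f)" using assms by (auto simp: kerp_def)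
  fix x assume x: "arr x" "tgt x = src k" "x ;; k = zer (src x) (tgt k)"
  have "zer (src x) (tgt k) ;; f = zer (src x) (tgt f)" using f x k by simp
  then have "\<exists>!y. arr y \<and> src y = src x \<and> tgt y = src k \<and> y ;; k = zer (src x) (tgt k)"
    using assms[unfolded kerp_def, THEN conjunct2, THEN conjunct2, THEN conjunct2, THEN conjunct2,
      rule_format, of "zer (src x) (tgt k)"] x k f by simp
  then obtain y where u: "\<And>z. arr z \<Longrightarrow> src z = src x \<Longrightarrow> tgt z = src k \<Longrightarrow>
      z ;; k = zer (src x) (tgt k) \<Longrightarrow> z = y" unfolding Ex1_def by blast
  show "x = zer (src x) (src k)" using u[of x] u[of "zer (src x) (src k)"] x k by simp
qed

lemma cokerp_epi: assumes "cokerp f k" shows "epi k"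
proof (rule epiI)
  show k: "arr k" using assms by (simp add: cokerp_def)
  have f: "arr f" "src k = tgt f" "f ;; k = zer (src f) (tgt k)" using assms by (auto simp: cokerp_def)
  fix x assume x: "arr x" "src x = tgt k" "k ;; x = zer (src k) (tgt x)"
  have "f ;; zer (src k) (tgt x) = zer (src f) (tgt x)" using f x k by simp
  then have "\<exists>!y. arr y \<and> src y = tgt k \<and> tgt y = tgt x \<and> k ;; y = zer (src k) (tgt x)"
    using assms[unfolded cokerp_def, THEN conjunct2, THEN conjunct2, THEN conjunct2, THEN conjunct2,
      rule_format, of "zer (src k) (tgt x)"] x k f by simp
  then obtain y where u: "\<And>z. arr z \<Longrightarrow> src z = tgt k \<Longrightarrow> tgt z = tgt x \<Longrightarrow>
      k ;; z = zer (src k) (tgt x) \<Longrightarrow> z = y" unfolding Ex1_def by blast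
  show "x = zer (tgt k) (tgt x)" using u[of x] u[of "zer (tgt k) (tgt x)"] x k by simp
qed

lemma kerp_factor: assumes "kerp f k" "arr x" "tgt x = src f" "x ;; f = zer (src x) (tgt f)"
  obtains y where "arr y" "src y = src x" "tgt y = src k" "y ;; k = x"
  using assms unfolding kerp_def by blast

lemma cokerp_factor: assumes "cokerp f k" "arr x" "src x = tgt f" "f ;; x = zer (src f) (tgt x)"
  obtains y where "arr y" "src y = tgt k" "tgt y = tgt x" "k ;; y = x"
  using assms unfolding cokerp_def by blast

lemma kerpI:
  assumes "mono k" "arr f" "tgt k = src f" "k ;; f = zer (src k) (tgt f)"
    and ex: "\<And>x. arr x \<Longrightarrow> tgt x = src f \<Longrightarrow> x ;; f = zer (src x) (tgt f) \<Longrightarrow> \<exists>y. arr y \<and> src y = src x \<and> tgt y = src k \<and> y ;; k = x"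
  shows "kerp f k"
proof -
  have k: "arr k" using assms by (simp add: mono_def)
  show ?thesis unfolding kerp_def
  proof (intro conjI allI impI)
    fix x assume x: "arr x \<and> tgt x = src f \<and> x ;; f = zer (src x) (tgt f)"
    then obtain y where y: "arr y \<and> src y = src x \<and> tgt y = src k \<and> y ;; k = x" using ex by blast
    then show "\<exists>!y. arr y \<and> src y = src x \<and> tgt y = src k \<and> y ;; k = x"
    proof (rule ex1I[of _ y])
      fix z assume "arr z \<and> src z = src x \<and> tgt z = src k \<and> z ;; k = x"
      then show "z = y" using y mono_cancel[OF assms(1), of z y] by simp
    qed
  qed (use assms k in auto)
qed

lemma cokerpI:
  assumes "epi k" "arr f" "src k = tgt f" "f ;; k = zer (src f) (tgt k)"
    and ex: "\<And>x. arr x \<Longrightarrow> src x = tgt f \<Longrightarrow> f ;; x = zer (src f) (tgt x) \<Longrightarrow> \<exists>y. arr y \<and> src y = tgt k \<and> tgt y = tgt x \<and> k ;; y = x"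
  shows "cokerp f k"
proof -
  have k: "arr k" using assms by (simp add: epi_def)
  show ?thesis unfolding cokerp_def
  proof (intro conjI allI impI)
    fix x assume x: "arr x \<and> src x = tgt f \<and> f ;; x = zer (src f) (tgt x)"
    then obtain y where y: "arr y \<and> src y = tgt k \<and> tgt y = tgt x \<and> k ;; y = x" using ex by blast
    then show "\<exists>!y. arr y \<and> src y = tgt k \<and> tgt y = tgt x \<and> k ;; y = x"
    proof (rule ex1I[of _ y])
      fix z assume "arr z \<and> src z = tgt k \<and> tgt z = tgt x \<and> k ;; z = x"
      then show "z = y" using y epi_cancel[OF assms(1), of z y] by simp
    qed
  qed (use assms k in auto)
qed

end

locale abelian_enough_projectives = abelian_category C for C :: "('o, 'a) pcat" +
  assumes pgen: "projectively_generated C"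

section \<open>Direct sums and projective objects\<close>

context preadditive_category
begin

lemma bipD: assumes "bip i j p q"
  shows "arr i" "arr j" "arr p" "arr q" "tgt j = tgt i" "src p = tgt i" "src q = tgt i"
    "tgt p = src i" "tgt q = src j" "i ;; p = idt (src i)" "j ;; q = idt (src j)"
    "i ;; q = zer (src i) (src j)" "j ;; p = zer (src j) (src i)" "p ;; i \<boxplus> q ;; j = idt (tgt i)"
  using assms by (simp_all add: bip_def)

lemma bip_red: assumes b: "bip i j p q" and x: "arr x"
  shows "src x = src i \<Longrightarrow> i ;; p ;; x = x" "src x = src j \<Longrightarrow> j ;; q ;; x = x"
    "src x = src j \<Longrightarrow> i ;; q ;; x = zer (src i) (tgt x)" "src x = src i \<Longrightarrow> j ;; p ;; x = zer (src j) (tgt x)"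
proof -
  note B = bipD[OF b]
  show "i ;; p ;; x = x" if "src x = src i" using B x that by (simp add: cmp_reduce[OF B(10)])
  show "j ;; q ;; x = x" if "src x = src j" using B x that by (simp add: cmp_reduce[OF B(11)])
  show "i ;; q ;; x = zer (src i) (tgt x)" if "src x = src j" using B x that by (simp add: cmp_reduce[OF B(12)])
  show "j ;; p ;; x = zer (src j) (tgt x)" if "src x = src i" using B x that by (simp add: cmp_reduce[OF B(13)])
qed

lemma bip_decomp: assumes "bip i j p q" "arr x" "tgt x = tgt i"
  shows "x ;; p ;; i \<boxplus> x ;; q ;; j = x"
proof -
  note b = bipD[OF assms(1)]
  have "x ;; p ;; i \<boxplus> x ;; q ;; j = x ;; (p ;; i \<boxplus> q ;; j)" using b(1-9) assms by simp
  also have "\<dots> = x" using b assms(2,3) by simp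
  finally show ?thesis .
qed

lemma projectively_generated_cover:
  assumes g: "projectively_generated C" and X: "X \<in> Ob C"
  obtains q where "proj (src q)" "epi q" "arr q" "tgt q = X"
proof -
  obtain P f where P: "projective C P" "is_epi C P X f"
    using g X unfolding projectively_generated_def by blast
  have "proj P" using P by (simp add: projective_iff)
  moreover have "epi (Arrow P f X)" using P X by (simp add: projective_def is_epi_iff)
  ultimately show ?thesis using that[of "Arrow P f X"] by (simp add: epi_def)
qed

lemma proj_retract:
  assumes "proj Q" "arr i" "arr r" "tgt i = Q" "src r = Q" "tgt r = src i" "i ;; r = idt (src i)"
  shows "proj (src i)"
  unfolding proj_def
proof (intro conjI allI impI)
  show "src i \<in> Ob C" using assms by simp
  fix f x assume a: "epi f \<and> arr x \<and> src x = src i \<and> tgt x = tgt f"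
  then have f: "arr f" by (simp add: epi_def)
  obtain y where y: "arr y" "src y = Q" "tgt y = src f" "y ;; f = r ;; x"
    using projE[OF assms(1), of f "r ;; x"] a assms by auto
  have "(i ;; y) ;; f = i ;; r ;; x" using y f assms(2-6) by simp
  also have "\<dots> = x" using a assms(2-6) by (simp add: cmp_reduce[OF assms(7)])
  finally show "\<exists>y. arr y \<and> src y = src i \<and> tgt y = src f \<and> y ;; f = x"
    using y f assms by (intro exI[of _ "i ;; y"]) simp
qed

lemma proj_bip:
  assumes b: "bip i j p q" and "proj (src i)" "proj (src j)"
  shows "proj (tgt i)"
  unfolding proj_def
proof (intro conjI allI impI)
  note B = bipD[OF b]
  show "tgt i \<in> Ob C" using B by simp
  fix f x assume a: "epi f \<and> arr x \<and> src x = tgt i \<and> tgt x = tgt f"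
  then have f: "arr f" by (simp add: epi_def)
  obtain y where y: "arr y" "src y = src i" "tgt y = src f" "y ;; f = i ;; x"
    using projE[OF assms(2), of f "i ;; x"] a B by auto
  obtain z where z: "arr z" "src z = src j" "tgt z = src f" "z ;; f = j ;; x"
    using projE[OF assms(3), of f "j ;; x"] a B by auto
  have "(p ;; y \<boxplus> q ;; z) ;; f = p ;; i ;; x \<boxplus> q ;; j ;; x" using y z B(1-9) f by simp
  also have "\<dots> = (p ;; i \<boxplus> q ;; j) ;; x" using B(1-9) a by simp
  also have "\<dots> = x" unfolding B(14) using a by simp
  finally show "\<exists>y. arr y \<and> src y = tgt i \<and> tgt y = src f \<and> y ;; f = x"
    using y z f B by (intro exI[of _ "p ;; y \<boxplus> q ;; z"]) simp
qed

end

context additive_category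
begin

lemma ex_bip: assumes "X \<in> Ob C" "Y \<in> Ob C"
  obtains i j p q where "bip i j p q" "src i = X" "src j = Y"
proof -
  obtain S i j p q where "biproduct C X Y S i j p q" using ex_biproduct assms by blast
  then show ?thesis using assms biproduct_iff[of X Y S i j p q] by (intro that) auto
qed

end

section \<open>Short exact sequences in an abelian category\<close>

context abelian_category
begin

lemma ex_kerp: assumes "arr f" obtains k where "kerp f k"
proof -
  obtain K k where "is_ker C (src f) (tgt f) (val f) K k"
    using assms ex_ker unfolding arr_def by blast
  then show ?thesis using assms that is_ker_iff[of "src f" "tgt f" "val f" K k]
    by (simp del: arr_ob add: arr_def)
qed

lemma ex_cokerp: assumes "arr f" obtains k where "cokerp f k"
proof -
  obtain K k where "is_coker C (src f) (tgt f) (val f) K k"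
    using assms ex_coker unfolding arr_def by blast
  then show ?thesis using assms that is_coker_iff[of "src f" "tgt f" "val f" K k]
    by (simp del: arr_ob add: arr_def)
qed

lemma mono_kerp: assumes "mono f" obtains g where "kerp g f"
proof -
  have f: "arr f" using assms by (simp add: mono_def)
  then have "is_mono C (src f) (tgt f) (val f)" using assms by (simp add: is_mono_iff)
  then obtain Z g where "Z \<in> Ob C" "g \<in> mor C (tgt f) Z" "is_ker C (tgt f) Z g (src f) (val f)"
    using mono_is_ker f by (meson arr_ob)
  then show ?thesis using that f is_ker_iff[of "tgt f" Z g "src f" "val f"] by simp
qed

lemma epi_cokerp: assumes "epi f" obtains g where "cokerp g f"
proof -
  have f: "arr f" using assms by (simp add: epi_def)
  then have "is_epi C (src f) (tgt f) (val f)" using assms by (simp add: is_epi_iff)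
  then obtain Z g where "Z \<in> Ob C" "g \<in> mor C Z (src f)" "is_coker C Z (src f) g (tgt f) (val f)"
    using epi_is_coker f by (meson arr_ob)
  then show ?thesis using that f is_coker_iff[of Z "src f" g "tgt f" "val f"] by simp
qed

text \<open>The monomorphism \<open>f\<close> is the kernel of some \<open>h\<close>, and
  \<open>h\<close> factors through the cokernel \<open>g\<close> of \<open>f\<close>. Hence what
  \<open>g\<close> kills is killed by \<open>h\<close>, and \<open>f\<close> is also the kernel of
  its own cokernel.\<close>

lemma mono_ses: assumes "mono f" obtains g where "ses f g"
proof -
  obtain h where h: "kerp h f" using mono_kerp assms by blast
  have f: "arr f" using assms by (simp add: mono_def)
  obtain g where g: "cokerp f g" using ex_cokerp f by blast
  have gh: "arr g" "arr h" "src g = tgt f" "tgt f = src h" "f ;; g = zer (src f) (tgt g)" "f ;; h = zer (src f) (tgt h)"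
    using g h by (simp_all add: kerp_def cokerp_def)
  obtain u where u: "arr u" "src u = tgt g" "tgt u = tgt h" "g ;; u = h"
    using cokerp_factor[OF g, of h] gh by auto
  have "kerp g f"
  proof (rule kerpI[OF assms])
    fix x assume x: "arr x" "tgt x = src g" "x ;; g = zer (src x) (tgt g)"
    have "x ;; h = (x ;; g) ;; u" using x(1,2) gh u by simp
    also have "\<dots> = zer (src x) (tgt h)" using x gh u by simp
    finally have xh: "x ;; h = zer (src x) (tgt h)" .
    have "tgt x = src h" using x gh by simp
    from kerp_factor[OF h x(1) this xh]
    show "\<exists>y. arr y \<and> src y = src x \<and> tgt y = src f \<and> y ;; f = x" by blast
  qed (use gh in auto)
  then show ?thesis using that g by (auto simp: ses_def)
qed

lemma epi_ses: assumes "epi g" obtains f where "ses f g"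
proof -
  obtain h where h: "cokerp h g" using epi_cokerp assms by blast
  have g: "arr g" using assms by (simp add: epi_def)
  obtain f where f: "kerp g f" using ex_kerp g by blast
  have gh: "arr f" "arr h" "src g = tgt f" "tgt h = src g" "f ;; g = zer (src f) (tgt g)" "h ;; g = zer (src h) (tgt g)"
    using f h by (simp_all add: kerp_def cokerp_def)
  obtain u where u: "arr u" "src u = src h" "tgt u = src f" "u ;; f = h"
    using kerp_factor[OF f, of h] gh by auto
  have "cokerp f g"
  proof (rule cokerpI[OF assms])
    fix x assume x: "arr x" "src x = tgt f" "f ;; x = zer (src f) (tgt x)"
    have "h ;; x = u ;; f ;; x" using x(1,2) gh u by (simp add: cmp_reduce[OF u(4)])
    also have "\<dots> = zer (src h) (tgt x)" using x gh u by simp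
    finally have hx: "h ;; x = zer (src h) (tgt x)" .
    have "src x = tgt h" using x gh by simp
    from cokerp_factor[OF h x(1) this hx]
    show "\<exists>y. arr y \<and> src y = tgt g \<and> tgt y = tgt x \<and> g ;; y = x" by blast
  qed (use gh in auto)
  then show ?thesis using that f by (auto simp: ses_def)
qed

lemma sesD: assumes "ses f g"
  shows "arr f" "arr g" "tgt f = src g" "f ;; g = zer (src f) (tgt g)" "mono f" "epi g"
proof -
  have k: "kerp g f" "cokerp f g" using assms by (simp_all add: ses_def)
  show "arr f" "arr g" "tgt f = src g" "f ;; g = zer (src f) (tgt g)"
    using k(1) unfolding kerp_def by blast+
  show "mono f" "epi g" using k kerp_mono cokerp_epi by blast+
qed

lemma ses_lift: assumes "ses f g" "arr x" "tgt x = src g" "x ;; g = zer (src x) (tgt g)"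
  obtains y where "arr y" "src y = src x" "tgt y = src f" "y ;; f = x"
  using kerp_factor[of g f x thesis] assms unfolding ses_def by blast

lemma ses_extend: assumes "ses f g" "arr x" "src x = tgt f" "f ;; x = zer (src f) (tgt x)"
  obtains y where "arr y" "src y = tgt g" "tgt y = tgt x" "g ;; y = x"
  using cokerp_factor[of f g x thesis] assms unfolding ses_def by blast

end

section \<open>Diagram chases with arrows out of projective objects\<close>

context abelian_enough_projectives
begin

lemma proj_ob [simp]: "proj P \<Longrightarrow> P \<in> Ob C" by (simp add: proj_def)

lemmas cover = projectively_generated_cover[OF pgen]

lemma cover_ses: assumes "X \<in> Ob C" obtains f g where "ses f g" "tgt g = X" "proj (src g)"
proof -
  obtain q where q: "proj (src q)" "epi q" "tgt q = X" using cover[OF assms] by blast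
  obtain f where "ses f q" using epi_ses[OF q(2)] .
  then show ?thesis using that q by blast
qed

text \<open>It is enough to lift a projective cover \<open>q\<close> of the target: whatever is
  killed by \<open>g\<close> is then killed by the epimorphism \<open>q\<close>.\<close>

lemma epi_elI:
  assumes "arr g" "\<And>x. arr x \<Longrightarrow> proj (src x) \<Longrightarrow> tgt x = tgt g \<Longrightarrow> \<exists>y. arr y \<and> src y = src x \<and> tgt y = src g \<and> y ;; g = x"
  shows "epi g"
proof (rule epiI)
  fix x assume x: "arr x" "src x = tgt g" "g ;; x = zer (src g) (tgt x)"
  obtain q where q: "proj (src q)" "epi q" "arr q" "tgt q = tgt g" using cover assms(1) arr_ob(2) by metis
  obtain y where y: "arr y" "src y = src q" "tgt y = src g" "y ;; g = q" using assms(2)[of q] q by auto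
  have "q ;; x = y ;; g ;; x" using y q assms(1) x(1,2) by (simp add: cmp_reduce[OF y(4)])
  also have "\<dots> = zer (src q) (tgt x)" using x y(1-3) assms(1) by simp
  finally show "x = zer (tgt g) (tgt x)" using epiD[OF q(2) x(1)] q x by simp
qed fact

lemma mono_elI:
  assumes "arr f" "\<And>x. arr x \<Longrightarrow> proj (src x) \<Longrightarrow> tgt x = src f \<Longrightarrow> x ;; f = zer (src x) (tgt f) \<Longrightarrow> x = zer (src x) (src f)"
  shows "mono f"
proof (rule monoI)
  fix x assume x: "arr x" "tgt x = src f" "x ;; f = zer (src x) (tgt f)"
  obtain q where q: "proj (src q)" "epi q" "arr q" "tgt q = src x" using cover x(1) arr_ob(1) by metis
  have "q ;; x ;; f = zer (src q) (tgt f)" using x q assms(1) by simp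
  then have "q ;; x = zer (src q) (src f)" using assms(2)[of "q ;; x"] x q assms(1) by simp
  then show "x = zer (src x) (src f)" using epiD[OF q(2) x(1)] q x by simp
qed fact

text \<open>Exactness in the middle is tested on projective sources only. For a general
  \<open>x\<close>, a lift \<open>y\<close> of \<open>q ;; x\<close>, with \<open>q\<close> a cover
  of the source, kills the kernel of \<open>q\<close> because \<open>f\<close> is mono, so it
  descends along \<open>q\<close> to a lift of \<open>x\<close>.\<close>

lemma ses_elI:
  assumes f: "mono f" and g: "epi g" and fg: "tgt f = src g" "f ;; g = zer (src f) (tgt g)"
    and ex: "\<And>x. arr x \<Longrightarrow> proj (src x) \<Longrightarrow> tgt x = src g \<Longrightarrow> x ;; g = zer (src x) (tgt g) \<Longrightarrow> \<exists>y. arr y \<and> src y = src x \<and> tgt y = src f \<and> y ;; f = x"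
  shows "ses f g"
proof -
  have af: "arr f" "arr g" using f g by (auto simp: mono_def epi_def)
  have k: "kerp g f"
  proof (rule kerpI[OF f af(2) fg])
    fix x assume x: "arr x" "tgt x = src g" "x ;; g = zer (src x) (tgt g)"
    obtain q where q: "proj (src q)" "epi q" "arr q" "tgt q = src x" using cover x(1) arr_ob(1) by metis
    obtain w where w: "ses w q" using epi_ses q by blast
    note w' = sesD[OF w]
    have "(q ;; x) ;; g = zer (src q) (tgt g)" using x q af by simp
    then obtain y where y: "arr y" "src y = src q" "tgt y = src f" "y ;; f = q ;; x"
      using ex[of "q ;; x"] x q af by auto
    have "(w ;; y) ;; f = (w ;; q) ;; x" using y w'(1-3) x af q by simp
    also have "\<dots> = zer (src w) (tgt f)" using x q w' fg by simp
    finally have "w ;; y = zer (src w) (src f)" using monoD[OF f, of "w ;; y"] y w' by simp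
    then obtain z where z: "arr z" "src z = tgt q" "tgt z = src f" "q ;; z = y"
      using ses_extend[OF w, of y] y w' by auto
    have "q ;; (z ;; f) = q ;; x" using z y q af cmp_assoc[of q z f] by simp
    then have "z ;; f = x" using epi_cancel[OF q(2), of "z ;; f" x] z x q af fg by simp
    then show "\<exists>y. arr y \<and> src y = src x \<and> tgt y = src f \<and> y ;; f = x" using z q by auto
  qed
  \<comment> \<open>The kernel \<open>w\<close> of \<open>g\<close> factors through
    \<open>f\<close>; so an arrow killed by \<open>f\<close> is killed by \<open>w\<close> and
    descends along \<open>g\<close>.\<close>
  obtain w where w: "ses w g" using epi_ses g by blast
  note w' = sesD[OF w]
  obtain u where u: "arr u" "src u = src w" "tgt u = src f" "u ;; f = w"
    using kerp_factor[OF k, of w] w' by auto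
  have "cokerp f g"
  proof (rule cokerpI[OF g af(1) fg(1)[symmetric] fg(2)])
    fix x assume x: "arr x" "src x = tgt f" "f ;; x = zer (src f) (tgt x)"
    have "w ;; x = u ;; f ;; x" using x(1,2) u af by (simp add: cmp_reduce[OF u(4)])
    then have wx: "w ;; x = zer (src w) (tgt x)" using x u by simp
    have "src x = tgt w" using x w' fg by simp
    from ses_extend[OF w x(1) this wx]
    show "\<exists>y. arr y \<and> src y = tgt g \<and> tgt y = tgt x \<and> g ;; y = x" by blast
  qed
  then show ?thesis using k by (simp add: ses_def)
qed

lemma ses_el:
  assumes "ses f g" "arr x" "tgt x = tgt g" "proj (src x)"
  obtains y where "arr y" "src y = src x" "tgt y = src g" "y ;; g = x"
  using projE[of "src x" g x] assms sesD[OF assms(1)] by auto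

end

section \<open>Pushouts of short exact sequences\<close>

context abelian_enough_projectives
begin

lemma neg_zerD: assumes "arr f" "neg f = zer (src f) (tgt f)" shows "f = zer (src f) (tgt f)"
proof -
  have "f = neg (neg f)" using assms(1) by simp
  also have "\<dots> = zer (src f) (tgt f)" using assms(1) by (simp add: assms(2))
  finally show ?thesis .
qed

lemma mono_neg: "mono f \<Longrightarrow> mono (neg f)"
proof (rule monoI)
  assume f: "mono f"
  then show af: "arr (neg f)" by (simp add: mono_def)
  fix x assume x: "arr x" "tgt x = src (neg f)" "x ;; neg f = zer (src x) (tgt (neg f))"
  have a: "arr f" using f by (simp add: mono_def)
  have "x ;; f = zer (src x) (tgt f)" using neg_zerD[of "x ;; f"] x a by simp
  then show "x = zer (src x) (src (neg f))" using monoD[OF f x(1)] x by simp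
qed

lemma mono_cmpD: assumes "mono (f ;; g)" "arr f" "arr g" "tgt f = src g" shows "mono f"
proof (rule monoI[OF assms(2)])
  fix x assume x: "arr x" "tgt x = src f" "x ;; f = zer (src x) (tgt f)"
  have "x ;; f ;; g = zer (src x) (tgt g)" using x(1,2) assms(2-4) by (simp add: cmp_reduce[OF x(3)])
  then show "x = zer (src x) (src f)" using monoD[OF assms(1) x(1)] x by simp
qed

lemma epi_cmpD: assumes "epi (f ;; g)" "arr f" "arr g" "tgt f = src g" shows "epi g"
proof (rule epiI[OF assms(3)])
  fix x assume x: "arr x" "src x = tgt g" "g ;; x = zer (src g) (tgt x)"
  have "(f ;; g) ;; x = zer (src f) (tgt x)" using x assms(2-4) by simp
  then show "x = zer (tgt g) (tgt x)" using epiD[OF assms(1) x(1)] x by simp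
qed

text \<open>A morphism of short exact sequences that is the identity on the right exhibits a pushout
  square, and hence a short exact sequence from the source to a direct sum.\<close>

lemma pushout_ses:
  assumes S: "ses f g" "ses f' g'" and t: "arr t" "src t = src g" "tgt t = src g'" "t ;; g' = g"
    and s: "arr s" "src s = src f" "tgt s = src f'" "f ;; t = s ;; f'"
    and b: "bip i j p q" "src i = src f'" "src j = src g"
  shows "ses (s ;; i \<boxplus> neg (f ;; j)) (p ;; f' \<boxplus> q ;; t)"
proof -
  note d = sesD[OF S(1)] and d' = sesD[OF S(2)] and B = bipD[OF b(1)] and R = bip_red[OF b(1)]
  have tg: "tgt g' = tgt g" using t d d' by (metis src_tgt_ops(2))
  define k where "k = s ;; i \<boxplus> neg (f ;; j)"
  define e where "e = p ;; f' \<boxplus> q ;; t"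
  have k: "arr k" "src k = src f" "tgt k = tgt i" and e: "arr e" "src e = tgt i" "tgt e = tgt f'"
    unfolding k_def e_def using d d' B b t s by simp_all
  have kp: "k ;; p = s" "k ;; q = neg f" unfolding k_def using d d' B(1-13) b t s by simp_all
  have ie: "i ;; e = f'" "j ;; e = t" unfolding e_def using d d' B(1-13) b t s R by simp_all
  have xe: "x ;; e = x ;; p ;; f' \<boxplus> x ;; q ;; t" if "arr x" "tgt x = tgt i" for x
    unfolding e_def using d d' B(1-9) b t s that by simp
  have "ses k e"
  proof (rule ses_elI)
    \<comment> \<open>One component of \<open>k\<close> is \<open>neg f\<close>, which is already a
      monomorphism.\<close>
    show "mono k"
      using mono_cmpD[of k q] mono_neg[OF d(5)] kp(2) k B(4,7) by simp
    show "epi e"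
    proof (rule epi_elI[OF e(1)])
      fix x assume x: "arr x" "proj (src x)" "tgt x = tgt e"
      then have xg: "arr (x ;; g')" using d' e by simp
      obtain y where y: "arr y" "src y = src x" "tgt y = src g" "y ;; g = x ;; g'"
        using ses_el[OF S(1) xg] x tg by auto
      have "(x \<boxplus> neg (y ;; t)) ;; g' = x ;; g' \<boxplus> neg (y ;; t ;; g')" using x y t e d' by simp
      also have "\<dots> = zer (src x) (tgt g')" using x y t d' e xg tg by simp
      finally obtain z where z: "arr z" "src z = src x" "tgt z = src f'" "z ;; f' = x \<boxplus> neg (y ;; t)"
        using ses_lift[OF S(2), of "x \<boxplus> neg (y ;; t)"] x y t e d' by auto
      have "(z ;; i \<boxplus> y ;; j) ;; e = z ;; f' \<boxplus> y ;; t" using z y b B e ie x by simp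
      also have "\<dots> = x" using x y t e d' by (simp add: z(4))
      finally show "\<exists>y. arr y \<and> src y = src x \<and> tgt y = src e \<and> y ;; e = x"
        using z y b B e by (intro exI[of _ "z ;; i \<boxplus> y ;; j"]) simp
    qed
    show "tgt k = src e" using k e by simp
    have "k ;; e = s ;; f' \<boxplus> neg (f ;; t)" 
      using xe[of k] k B(1-9) b d t(1-3) d' s(1-3) by (simp add: cmp_reduce[OF kp(1)] cmp_reduce[OF kp(2)])
    then show "k ;; e = zer (src k) (tgt e)" using s k e d' by simp
    fix x assume x: "arr x" "tgt x = src e" "x ;; e = zer (src x) (tgt e)"
    \<comment> \<open>In components, the second one lifts over \<open>f\<close> to some
      \<open>u\<close>, since \<open>g\<close> kills it. As \<open>f'\<close> is mono, the first
      component is then \<open>neg (u ;; s)\<close>, so \<open>neg u\<close> is the factorisation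
      through \<open>k\<close>.\<close>
    define a c where "a = x ;; p" and "c = x ;; q"
    have a: "arr a" "src a = src x" "tgt a = src f'" and c: "arr c" "src c = src x" "tgt c = src g"
      using x B b e by (auto simp: a_def c_def)
    have z: "a ;; f' \<boxplus> c ;; t = zer (src x) (tgt f')" using xe[of x] x e B d' t b by (simp add: a_def c_def)
    have "(a ;; f' \<boxplus> c ;; t) ;; g' = c ;; g" using a c d' t tg d(2) by simp
    then have "c ;; g = zer (src x) (tgt g)" using z x d' tg by simp
    then obtain u where u: "arr u" "src u = src x" "tgt u = src f" "u ;; f = c"
      using ses_lift[OF S(1), of c] c by auto
    have "c ;; t = u ;; f ;; t" using u(1-3) t(1-3) d(1-3) by (simp add: cmp_reduce[OF u(4)])
    then have "c ;; t = u ;; s ;; f'" by (simp add: s(4))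
    then have "a ;; f' \<boxplus> (u ;; s) ;; f' = zer (src x) (tgt f')" using z u s d' by simp
    then have "(a \<boxplus> u ;; s) ;; f' = zer (src x) (tgt f')" using a u s d' by simp
    then have "a \<boxplus> u ;; s = zer (src x) (src f')" using monoD[OF d'(5), of "a \<boxplus> u ;; s"] a u s by simp
    then have us: "u ;; s = neg a" using add_eq_zer[of a "u ;; s"] a u s by simp
    have "neg u ;; k = neg (u ;; s) ;; i \<boxplus> u ;; f ;; j" unfolding k_def using u s d B(1-9) b by simp
    also have "\<dots> = a ;; i \<boxplus> c ;; j" using us a u B b d cmp_assoc[of u f j] by simp
    also have "\<dots> = x" using bip_decomp[OF b(1), of x] x e B b by (simp add: a_def c_def)
    finally show "\<exists>y. arr y \<and> src y = src x \<and> tgt y = src k \<and> y ;; k = x"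
      using u k by (intro exI[of _ "neg u"]) simp
  qed
  then show ?thesis by (simp add: k_def e_def)
qed

text \<open>The universal property of the pushout square: the arrow with components \<open>a\<close>
  and \<open>c\<close> is killed by the first map of \<open>pushout_ses\<close>, so it descends
  along the second.\<close>

lemma pushout_glue:
  assumes S: "ses f g" "ses f' g'" and t: "arr t" "src t = src g" "tgt t = src g'" "t ;; g' = g"
    and s: "arr s" "src s = src f" "tgt s = src f'" "f ;; t = s ;; f'"
    and a: "arr a" "src a = src f'" and c: "arr c" "src c = src g" "tgt c = tgt a" "f ;; c = s ;; a"
  obtains u where "arr u" "src u = src g'" "tgt u = tgt a" "f' ;; u = a" "t ;; u = c"
proof -
  note d = sesD[OF S(1)] and d' = sesD[OF S(2)]
  have ob: "src f' \<in> Ob C" "src g \<in> Ob C" using d d' by simp_all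
  obtain i j p q where b: "bip i j p q" "src i = src f'" "src j = src g" using ex_bip[OF ob] .
  note B = bipD[OF b(1)] and R = bip_red[OF b(1)]
  have E: "ses (s ;; i \<boxplus> neg (f ;; j)) (p ;; f' \<boxplus> q ;; t)" by (rule pushout_ses[OF S t s b])
  have "(s ;; i \<boxplus> neg (f ;; j)) ;; (p ;; a \<boxplus> q ;; c) = s ;; a \<boxplus> neg (f ;; c)"
    using d d' B(1-13) R b s a c t by (simp add: add_assoc)
  then obtain u where u: "arr u" "src u = src g'" "tgt u = tgt a" "(p ;; f' \<boxplus> q ;; t) ;; u = p ;; a \<boxplus> q ;; c"
    using ses_extend[OF E, of "p ;; a \<boxplus> q ;; c"] d d' B b s a c t by auto
  have "i ;; (p ;; f' \<boxplus> q ;; t) ;; u = i ;; (p ;; a \<boxplus> q ;; c)" "j ;; (p ;; f' \<boxplus> q ;; t) ;; u = j ;; (p ;; a \<boxplus> q ;; c)"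
    by (simp_all only: u(4))
  then have "f' ;; u = a" "t ;; u = c"
    using d(1-3) d'(1-3) B(1-13) R b s(1-3) a c(1-3) t(1-3) u(1-3) by simp_all
  then show ?thesis using that[OF u(1-3)] by simp
qed

text \<open>The pushout is the cokernel of the arrow \<open>k\<close> with components
  \<open>h\<close> and \<open>neg f\<close> into a direct sum; \<open>k\<close> is mono because
  \<open>f\<close> is. The new epimorphism \<open>g'\<close> is induced by \<open>q ;; g\<close>,
  which \<open>k\<close> kills.\<close>

lemma ex_pushout:
  assumes S: "ses f g" and h: "arr h" "src h = src f"
  obtains f' g' t where "ses f' g'" "src f' = tgt h" "tgt g' = tgt g"
    "arr t" "src t = src g" "tgt t = src g'" "t ;; g' = g" "f ;; t = h ;; f'"
proof -
  note d = sesD[OF S]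
  have ob: "tgt h \<in> Ob C" "src g \<in> Ob C" using d h by simp_all
  obtain i j p q where b: "bip i j p q" "src i = tgt h" "src j = src g" using ex_bip[OF ob] .
  note B = bipD[OF b(1)] and R = bip_red[OF b(1)]
  define k where "k = h ;; i \<boxplus> neg (f ;; j)"
  have k: "arr k" "src k = src f" "tgt k = tgt i" unfolding k_def using d h b B by simp_all
  have kp: "k ;; p = h" "k ;; q = neg f" unfolding k_def using d B(1-13) b h by simp_all
  have mk: "mono k"
    using mono_cmpD[of k q] mono_neg[OF d(5)] kp(2) k B(4,7) by simp
  obtain c where c: "ses k c" using mono_ses[OF mk] .
  note d' = sesD[OF c]
  have "k ;; c = h ;; i ;; c \<boxplus> neg (f ;; j ;; c)" unfolding k_def using d' k B b h d by simp
  then have "h ;; i ;; c \<boxplus> neg (f ;; j ;; c) = zer (src f) (tgt c)" using d' k by simp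
  then have com: "f ;; j ;; c = h ;; i ;; c"
    using add_neg_eq_zer[of "h ;; i ;; c" "f ;; j ;; c"] d' k B b h d by simp
  have "k ;; q ;; g = zer (src f) (tgt g)" using kp k B b d cmp_assoc[of k q g] by simp
  then obtain g' where g': "arr g'" "src g' = tgt c" "tgt g' = tgt g" "c ;; g' = q ;; g"
    using ses_extend[OF c, of "q ;; g"] d B b k by auto
  have tg: "(j ;; c) ;; g' = g" using g' d' k B b R[of g] d by simp
  have "ses (i ;; c) g'"
  proof (rule ses_elI)
    show "mono (i ;; c)"
    proof (rule mono_elI)
      show "arr (i ;; c)" using d' k B b by simp
      fix x assume x: "arr x" "tgt x = src (i ;; c)" "x ;; i ;; c = zer (src x) (tgt (i ;; c))"
      then obtain y where y: "arr y" "src y = src x" "tgt y = src k" "y ;; k = x ;; i"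
        using ses_lift[OF c, of "x ;; i"] B b d' k by auto
      have "neg (y ;; f) = y ;; k ;; q" using kp(2) y(1-3) k d(1) by simp
      also have "\<dots> = x ;; i ;; q" using x(1,2) y(1-3) k B(1-9) by (simp add: cmp_reduce[OF y(4)])
      also have "\<dots> = zer (src x) (src j)" using x(1,2) B b d(2) by simp
      finally have "y ;; f = zer (src x) (tgt f)" using neg_zerD[of "y ;; f"] y(1-3) d(1,3) k(2) b by simp
      then have y0: "y = zer (src x) (src f)" using monoD[OF d(5), of y] y(1-3) d(1,3) k(2) by simp
      have "x ;; i = zer (src x) (src f) ;; k" using y(4) y0 by simp
      also have "\<dots> = zer (src x) (tgt i)" using x(1) k by simp
      finally have xi: "x ;; i = zer (src x) (tgt i)" .
      have "x = x ;; i ;; p" using x(1,2) B by simp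
      also have "\<dots> = zer (src x) (src i)" using x(1,2) B(1-9) by (simp add: cmp_reduce[OF xi])
      finally show "x = zer (src x) (src (i ;; c))" by simp
    qed
    show "epi g'"
      using epi_cmpD[of "j ;; c" g'] tg d(6) g'(1,2) d'(1,2) d'(3)[symmetric] k(3) B(2,5) by simp
    show "tgt (i ;; c) = src g'" using g' by simp
    show "(i ;; c) ;; g' = zer (src (i ;; c)) (tgt g')"
      using g' d'(1,2) d'(3)[symmetric] k(3) B(1-9) b R(3)[OF d(2)] d(1,2) by simp
    fix x assume x: "arr x" "proj (src x)" "tgt x = src g'" "x ;; g' = zer (src x) (tgt g')"
    obtain z where z: "arr z" "src z = src x" "tgt z = src c" "z ;; c = x"
      using ses_el[OF c x(1)] x g' by auto
    have "(z ;; q) ;; g = z ;; c ;; g'" using z(1-3) g' d' B b d k by simp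
    also have "\<dots> = zer (src x) (tgt g)" using x z g'(1-3) d' by (simp add: cmp_reduce[OF z(4)])
    finally have "(z ;; q) ;; g = zer (src x) (tgt g)" .
    then obtain u where u: "arr u" "src u = src x" "tgt u = src f" "u ;; f = z ;; q"
      using ses_lift[OF S, of "z ;; q"] z B b k d d' by auto
    have "x = (z ;; p ;; i \<boxplus> z ;; q ;; j) ;; c" using bip_decomp[OF b(1), of z] z d' k by simp
    also have "\<dots> = z ;; p ;; i ;; c \<boxplus> (z ;; q) ;; j ;; c" using z B(1-9) b d' k by simp
    also have "\<dots> = z ;; p ;; i ;; c \<boxplus> u ;; f ;; j ;; c" using z B(1-9) b d' k u d by (simp add: cmp_reduce[OF u(4)])
    also have "\<dots> = (z ;; p \<boxplus> u ;; h) ;; i ;; c" using com z B(1-9) b d' k u d h by simp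
    finally show "\<exists>y. arr y \<and> src y = src x \<and> tgt y = src (i ;; c) \<and> y ;; i ;; c = x"
      using z B b d' k u h by (intro exI[of _ "z ;; p \<boxplus> u ;; h"]) simp
  qed
  then show ?thesis
    using that[of "i ;; c" g' "j ;; c"] g' tg com B b d' k by simp
qed

end

section \<open>Comparison, splitting and direct sums of short exact sequences\<close>

context abelian_enough_projectives
begin

lemma ses_cmp:
  assumes S: "ses f g" "ses f' g'" and Q: "proj (src g)" and c: "arr c" "src c = tgt g" "tgt c = tgt g'"
  obtains t s where "arr t" "src t = src g" "tgt t = src g'" "t ;; g' = g ;; c"
    "arr s" "src s = src f" "tgt s = src f'" "f ;; t = s ;; f'"
proof -
  note d = sesD[OF S(1)] and d' = sesD[OF S(2)]
  have gc: "arr (g ;; c)" using d c by simp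
  obtain t where t: "arr t" "src t = src g" "tgt t = src g'" "t ;; g' = g ;; c"
    using ses_el[OF S(2) gc] c Q by auto
  have "(f ;; t) ;; g' = f ;; g ;; c" using t d d' by simp
  also have "\<dots> = zer (src f) (tgt g')" using d(1-3) c by (simp add: cmp_reduce[OF d(4)])
  finally have z: "(f ;; t) ;; g' = zer (src f) (tgt g')" .
  obtain s where "arr s" "src s = src f" "tgt s = src f'" "s ;; f' = f ;; t"
    using ses_lift[OF S(2), of "f ;; t"] t d d' z by auto
  then show ?thesis using that t by simp
qed

lemma ses_split:
  assumes S: "ses f g" and r: "arr r" "src r = tgt g" "tgt r = src g" "r ;; g = idt (tgt g)"
  obtains w where "arr w" "src w = tgt f" "tgt w = src f" "f ;; w = idt (src f)"
proof -
  note d = sesD[OF S]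
  \<comment> \<open>The projection complementary to \<open>g ;; r\<close>. It lands in the kernel of
    \<open>g\<close>, and its factor through \<open>f\<close> is the retraction.\<close>
  define u where "u = idt (src g) \<boxplus> neg (g ;; r)"
  have u: "arr u" "src u = src g" "tgt u = src g" unfolding u_def using d r by simp_all
  have "u ;; g = g \<boxplus> neg (g ;; r ;; g)" unfolding u_def using d r(1-3) by simp
  also have "\<dots> = zer (src g) (tgt g)" using d r by simp
  finally obtain w where w: "arr w" "src w = src g" "tgt w = src f" "w ;; f = u"
    using ses_lift[OF S, of u] u by auto
  have "f ;; u = f \<boxplus> neg (f ;; g ;; r)" unfolding u_def using d r(1-3) by simp
  also have "\<dots> = f" using d(1-3) r(1-3) by (simp add: cmp_reduce[OF d(4)])
  finally have "(f ;; w) ;; f = idt (src f) ;; f" using w d by simp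
  then have "f ;; w = idt (src f)" using mono_cancel[OF d(5), of "f ;; w" "idt (src f)"] w d by simp
  then show ?thesis using that w d by simp
qed

lemma bip_ses:
  assumes b: "bip i j p q" shows "ses i q"
proof -
  note B = bipD[OF b]
  show ?thesis
  proof (rule ses_elI)
    show "mono i"
    proof (rule monoI[OF B(1)])
      fix x assume x: "arr x" "tgt x = src i" "x ;; i = zer (src x) (tgt i)"
      have "x = x ;; i ;; p" using x(1,2) B by simp
      also have "\<dots> = zer (src x) (src i)" using x(1,2) B(1-9) by (simp add: cmp_reduce[OF x(3)])
      finally show "x = zer (src x) (src i)" .
    qed
    show "epi q"
    proof (rule epi_elI[OF B(4)])
      fix x assume x: "arr x" "tgt x = tgt q"
      then show "\<exists>y. arr y \<and> src y = src x \<and> tgt y = src q \<and> y ;; q = x"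
        using B by (intro exI[of _ "x ;; j"]) simp
    qed
    show "tgt i = src q" "i ;; q = zer (src i) (tgt q)" using B by simp_all
    fix x assume x: "arr x" "tgt x = src q" "x ;; q = zer (src x) (tgt q)"
    have "x = x ;; p ;; i \<boxplus> x ;; q ;; j" using bip_decomp[OF b, of x] x(1,2) B by simp
    also have "x ;; q ;; j = zer (src x) (tgt i)" using x(1,2) B(1-9) by (simp add: cmp_reduce[OF x(3)])
    also have "x ;; p ;; i \<boxplus> zer (src x) (tgt i) = (x ;; p) ;; i" using x(1,2) B(1-9) by simp
    finally show "\<exists>y. arr y \<and> src y = src x \<and> tgt y = src i \<and> y ;; i = x"
      using x(1,2) B by (intro exI[of _ "x ;; p"]) simp
  qed
qed

text \<open>Adding the identity of \<open>src j\<close> to the epimorphism \<open>h\<close> does not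
  change its kernel. This turns a cover of a direct summand into a cover of the whole object with
  the same syzygy.\<close>

lemma bip_ses_sum:
  assumes S: "ses l h" "tgt h = src i" and b: "bip i j p q" and b': "bip i' j' p' q'" "src i' = src h" "src j' = src j"
  shows "ses (l ;; i') (p' ;; h ;; i \<boxplus> q' ;; j)"
proof -
  note B = bipD[OF b] and R = bip_red[OF b] and B' = bipD[OF b'(1)] and R' = bip_red[OF b'(1)] and d = sesD[OF S(1)]
  have i: "mono i" "mono i'" using sesD[OF bip_ses] b b'(1) by auto
  define e where "e = p' ;; h ;; i \<boxplus> q' ;; j"
  have e: "arr e" "src e = tgt i'" "tgt e = tgt i" unfolding e_def using B B' d b' S(2) by simp_all
  have ie: "i' ;; e = h ;; i" "j' ;; e = j" and ep: "e ;; p = p' ;; h" "e ;; q = q'"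
    unfolding e_def using B(1-13) B'(1-13) d b' S(2) R' by simp_all
  have "ses (l ;; i') e"
  proof (rule ses_elI)
    show "mono (l ;; i')"
    proof (rule monoI)
      show li: "arr (l ;; i')" using d B' b' by simp
      fix x assume x: "arr x" "tgt x = src (l ;; i')" "x ;; l ;; i' = zer (src x) (tgt (l ;; i'))"
      then have "x ;; l = zer (src x) (tgt l)" using monoD[OF i(2), of "x ;; l"] d b' B'(1) by simp
      then show "x = zer (src x) (src (l ;; i'))" using monoD[OF d(5), of x] x(1,2) by simp
    qed
    show "epi e"
    proof (rule epi_elI[OF e(1)])
      fix x assume x: "arr x" "proj (src x)" "tgt x = tgt e"
      obtain y where y: "arr y" "src y = src x" "tgt y = src h" "y ;; h = x ;; p"
        using ses_el[OF S(1), of "x ;; p"] x B e S(2) by auto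
      have "(y ;; i' \<boxplus> x ;; q ;; j') ;; e = y ;; h ;; i \<boxplus> x ;; q ;; j" using y(1-3) x B(1-9) B'(1-9) b' e ie d S(2) by simp
      also have "y ;; h ;; i = (x ;; p) ;; i"
        by (rule cmp_reduce[OF y(4)]) (use y(1-3) d S(2) B in simp_all)
      also have "(x ;; p) ;; i \<boxplus> x ;; q ;; j = x" using bip_decomp[OF b, of x] x B e by simp
      finally show "\<exists>y. arr y \<and> src y = src x \<and> tgt y = src e \<and> y ;; e = x"
        using y(1-3) x B B' b' e by (intro exI[of _ "y ;; i' \<boxplus> x ;; q ;; j'"]) simp
    qed
    show "tgt (l ;; i') = src e" using e by simp
    have "(l ;; i') ;; e = l ;; h ;; i" using ie d B' b' e by simp
    also have "\<dots> = zer (src l) (tgt e)" using d(1-3) B S(2) e by (simp add: cmp_reduce[OF d(4)])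
    finally show "(l ;; i') ;; e = zer (src (l ;; i')) (tgt e)" by simp
    fix x assume x: "arr x" "tgt x = src e" "x ;; e = zer (src x) (tgt e)"
    have "(x ;; p') ;; h = x ;; e ;; p" using ep(1) x(1,2) e B' d b' B S(2) by simp
    also have "\<dots> = zer (src x) (tgt h)" using x(1,2) e B(1-9) S(2) by (simp add: cmp_reduce[OF x(3)])
    finally obtain y where y: "arr y" "src y = src x" "tgt y = src l" "y ;; l = x ;; p'"
      using ses_lift[OF S(1), of "x ;; p'"] x(1,2) e B' b' by auto
    have xq: "x ;; q' = zer (src x) (src j)"
      using ep(2) x e B cmp_assoc[of x e q] by simp
    have "y ;; l ;; i' = (x ;; p') ;; i'"
      by (rule cmp_reduce[OF y(4)]) (use y(1-3) d B' b' in simp_all)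
    also have "\<dots> = x ;; p' ;; i' \<boxplus> x ;; q' ;; j'"
      using x(1,2) e B'(1-9) b' by (simp add: cmp_reduce[OF xq])
    also have "\<dots> = x" using bip_decomp[OF b'(1), of x] x(1,2) e by simp
    finally show "\<exists>y. arr y \<and> src y = src x \<and> tgt y = src (l ;; i') \<and> y ;; l ;; i' = x"
      using y by auto
  qed
  then show ?thesis by (simp add: e_def)
qed

text \<open>The kernel of \<open>h ;; g\<close> is the preimage of the subobject \<open>f\<close>
  under \<open>h\<close>; it is an extension of \<open>src f\<close> by the kernel of
  \<open>h\<close>.\<close>

lemma ses_kernel:
  assumes S: "ses f g" "ses l h" "tgt h = tgt f"
  obtains m l' h' where "ses m (h ;; g)" "ses l' h'" "src l' = src l" "tgt h' = src f" "tgt l' = src m" "l' ;; m = l"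
proof -
  note d = sesD[OF S(1)] and d' = sesD[OF S(2)]
  have hg: "arr (h ;; g)" using d d' S(3) by simp
  have "epi (h ;; g)"
  proof (rule epiI[OF hg])
    fix x assume x: "arr x" "src x = tgt (h ;; g)" "(h ;; g) ;; x = zer (src (h ;; g)) (tgt x)"
    then have "g ;; x = zer (src g) (tgt x)" using epiD[OF d'(6), of "g ;; x"] d d' S(3) by simp
    then show "x = zer (tgt (h ;; g)) (tgt x)" using epiD[OF d(6), of x] x d by simp
  qed
  then obtain m where m: "ses m (h ;; g)" using epi_ses by blast
  note dm = sesD[OF m]
  have tm: "tgt m = src h" using dm by simp
  have "l ;; h ;; g = zer (src l) (tgt g)" using d d'(1-3) S(3) by (simp add: cmp_reduce[OF d'(4)])
  then obtain l' where l': "arr l'" "src l' = src l" "tgt l' = src m" "l' ;; m = l"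
    using ses_lift[OF m, of l] d' by auto
  have "(m ;; h) ;; g = zer (src m) (tgt g)" using dm d' d tm S(3) by simp
  then obtain h' where h': "arr h'" "src h' = src m" "tgt h' = src f" "h' ;; f = m ;; h"
    using ses_lift[OF S(1), of "m ;; h"] dm d' d tm S(3) by auto
  have "ses l' h'"
  proof (rule ses_elI)
    show "mono l'" using mono_cmpD[of l' m] l' d' dm by simp
    show "epi h'"
    proof (rule epi_elI[OF h'(1)])
      fix x assume x: "arr x" "proj (src x)" "tgt x = tgt h'"
      obtain y where y: "arr y" "src y = src x" "tgt y = src h" "y ;; h = x ;; f"
        using ses_el[OF S(2), of "x ;; f"] x h' d S(3) by auto
      have "y ;; h ;; g = (x ;; f) ;; g" by (rule cmp_reduce[OF y(4)]) (use y(1-3) d d' S(3) in simp_all)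
      also have "\<dots> = zer (src x) (tgt g)" using x h'(1-3) d by simp
      finally obtain z where z: "arr z" "src z = src y" "tgt z = src m" "z ;; m = y"
        using ses_lift[OF m, of y] y by auto
      have "(z ;; h') ;; f = z ;; m ;; h" using z(1-3) h' d by simp
      also have "\<dots> = y ;; h" by (rule cmp_reduce[OF z(4)]) (use z(1-3) d' dm tm in simp_all)
      also have "\<dots> = x ;; f" by (rule y(4))
      finally have "z ;; h' = x" using mono_cancel[OF d(5), of "z ;; h'" x] z y x h' by simp
      then show "\<exists>y. arr y \<and> src y = src x \<and> tgt y = src h' \<and> y ;; h' = x" using z y h' by auto
    qed
    show "tgt l' = src h'" using l' h' by simp
    have "(l' ;; h') ;; f = l' ;; m ;; h" using l'(1-3) h' d by simp
    also have "\<dots> = l ;; h" by (rule cmp_reduce[OF l'(4)]) (use l'(1-3) d' dm tm in simp_all)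
    also have "\<dots> = zer (src l) (tgt f)" using d' S(3) by simp
    finally show "l' ;; h' = zer (src l') (tgt h')"
      using monoD[OF d(5), of "l' ;; h'"] l' h' by simp
    fix x assume x: "arr x" "tgt x = src h'" "x ;; h' = zer (src x) (tgt h')"
    have "(x ;; m) ;; h = x ;; h' ;; f" using h' x(1,2) dm d' tm by simp
    also have "\<dots> = zer (src x) (tgt h)" using x(1,2) h'(1-3) d S(3) by (simp add: cmp_reduce[OF x(3)])
    finally obtain y where y: "arr y" "src y = src x" "tgt y = src l" "y ;; l = x ;; m"
      using ses_lift[OF S(2), of "x ;; m"] x(1,2) h' dm tm by auto
    have "(y ;; l') ;; m = x ;; m" using y l' dm by simp
    then have "y ;; l' = x" using mono_cancel[OF dm(5), of "y ;; l'" x] y x(1,2) l' h' by simp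
    then show "\<exists>y. arr y \<and> src y = src x \<and> tgt y = src l' \<and> y ;; l' = x" using y l' by auto
  qed
  then show ?thesis using that m l' h' by blast
qed

section \<open>Vanishing of extension groups\<close>

text \<open>By dimension shifting, \<open>evan k X Y\<close> expresses that the extension group of degree \<open>k + 1\<close> of
  \<open>X\<close> by \<open>Y\<close> vanishes.\<close>

primrec evan :: "nat \<Rightarrow> 'o \<Rightarrow> 'o \<Rightarrow> bool" where
  "evan 0 X Y \<longleftrightarrow> (\<forall>f g a. ses f g \<and> tgt g = X \<and> arr a \<and> src a = src f \<and> tgt a = Y \<longrightarrow>
    (\<exists>b. arr b \<and> src b = tgt f \<and> tgt b = Y \<and> f ;; b = a))"
| "evan (Suc k) X Y \<longleftrightarrow> (\<forall>f g. ses f g \<and> tgt g = X \<and> proj (src g) \<longrightarrow> evan k (src f) Y)"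

lemma evan_0D:
  assumes "evan 0 (tgt g) Y" "ses f g" "arr a" "src a = src f" "tgt a = Y"
  obtains b where "arr b" "src b = tgt f" "tgt b = Y" "f ;; b = a"
  using assms(1)[unfolded evan.simps(1), rule_format, of f g a] assms(2-5) that by auto

lemma evan_SucD: "evan (Suc k) (tgt g) Y \<Longrightarrow> ses f g \<Longrightarrow> proj (src g) \<Longrightarrow> evan k (src f) Y"
  by auto

declare evan.simps [simp del]

text \<open>By projectivity the given sequence maps to any other one ending in the same object, and
  that square is a pushout. An extension found over \<open>f\<close> is therefore carried over to
  \<open>f'\<close> by \<open>pushout_glue\<close>.\<close>

lemma evan_0I:
  assumes S: "ses f g" "proj (src g)"
    and ex: "\<And>a. arr a \<Longrightarrow> src a = src f \<Longrightarrow> tgt a = Y \<Longrightarrow> \<exists>b. arr b \<and> src b = tgt f \<and> tgt b = Y \<and> f ;; b = a"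
  shows "evan 0 (tgt g) Y"
  unfolding evan.simps(1)
proof (intro allI impI, elim conjE)
  fix f' g' a assume S': "ses f' g'" "tgt g' = tgt g" and a: "arr a" "src a = src f'" "tgt a = Y"
  note d = sesD[OF S(1)] and d' = sesD[OF S'(1)]
  obtain t s where t: "arr t" "src t = src g" "tgt t = src g'" "t ;; g' = g ;; idt (tgt g)"
    and s: "arr s" "src s = src f" "tgt s = src f'" "f ;; t = s ;; f'"
    using ses_cmp[OF S(1) S'(1) S(2), of "idt (tgt g)"] S' d by auto
  have t': "t ;; g' = g" using t(4) d by simp
  obtain c where c: "arr c" "src c = tgt f" "tgt c = Y" "f ;; c = s ;; a"
    using ex[of "s ;; a"] s a by auto
  have c': "src c = src g" "tgt c = tgt a" using c d a by simp_all
  obtain u where "arr u" "src u = src g'" "tgt u = tgt a" "f' ;; u = a"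
    by (rule pushout_glue[OF S(1) S'(1) t(1-3) t' s a(1,2) c(1) c' c(4)])
  then show "\<exists>b. arr b \<and> src b = tgt f' \<and> tgt b = Y \<and> f' ;; b = a" using a d' by auto
qed

text \<open>A sequence ending in a projective object splits. If its middle term is projective too,
  the kernel is a retract of it and hence projective, so the induction continues with the
  syzygy.\<close>

lemma evan_proj: "proj Q \<Longrightarrow> Y \<in> Ob C \<Longrightarrow> evan k Q Y"
proof (induction k arbitrary: Q)
  case 0
  show ?case unfolding evan.simps(1)
  proof (intro allI impI, elim conjE)
    fix f g a assume S: "ses f g" "tgt g = Q" and a: "arr a" "src a = src f" "tgt a = Y"
    note d = sesD[OF S(1)]
    obtain r where r: "arr r" "src r = tgt g" "tgt r = src g" "r ;; g = idt (tgt g)"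
      using ses_el[OF S(1), of "idt Q"] S 0 by auto
    obtain w where w: "arr w" "src w = tgt f" "tgt w = src f" "f ;; w = idt (src f)"
      using ses_split[OF S(1) r] .
    have "f ;; w ;; a = a" using w(1-3) a d by (simp add: cmp_reduce[OF w(4)])
    then show "\<exists>b. arr b \<and> src b = tgt f \<and> tgt b = Y \<and> f ;; b = a"
      using w a by (intro exI[of _ "w ;; a"]) simp
  qed
next
  case (Suc k)
  show ?case unfolding evan.simps(2)
  proof (intro allI impI, elim conjE)
    fix f g assume S: "ses f g" "tgt g = Q" "proj (src g)"
    note d = sesD[OF S(1)]
    obtain r where r: "arr r" "src r = tgt g" "tgt r = src g" "r ;; g = idt (tgt g)"
      using ses_el[OF S(1), of "idt Q"] S Suc.prems by auto
    obtain w where w: "arr w" "src w = tgt f" "tgt w = src f" "f ;; w = idt (src f)"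
      using ses_split[OF S(1) r] .
    have "proj (src f)" using proj_retract[OF S(3) d(1) w(1) d(3)] w d by simp
    then show "evan k (src f) Y" using Suc by simp
  qed
qed

text \<open>A cover of \<open>src i\<close> together with the identity of the projective
  \<open>src j\<close> covers the whole sum and has the same syzygy, so both objects have the same
  Ext groups in positive degrees.\<close>

lemma evan_summand:
  assumes b: "bip i j p q" "proj (src j)" and v: "evan k (tgt i) Y"
  shows "evan k (src i) Y"
proof -
  note B = bipD[OF b(1)]
  have step: "\<exists>i' H. ses (l ;; i') H \<and> tgt H = tgt i \<and> proj (src H) \<and> arr i' \<and> src i' = src h \<and> tgt i' = src H"
    if S: "ses l h" "tgt h = src i" "proj (src h)" for l h
  proof -
    note d = sesD[OF S(1)]
    have ob: "src h \<in> Ob C" "src j \<in> Ob C" using d B by simp_all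
    obtain i' j' p' q' where b': "bip i' j' p' q'" "src i' = src h" "src j' = src j" using ex_bip[OF ob] .
    note B' = bipD[OF b'(1)]
    have "proj (tgt i')" using proj_bip[OF b'(1)] b' S b by simp
    moreover have "ses (l ;; i') (p' ;; h ;; i \<boxplus> q' ;; j)" by (rule bip_ses_sum[OF S(1,2) b(1) b'])
    ultimately show ?thesis using B B' b'
      by (intro exI[of _ i'] exI[of _ "p' ;; h ;; i \<boxplus> q' ;; j"]) simp
  qed
  show ?thesis
  proof (cases k)
    case 0
    have ob: "src i \<in> Ob C" using B by simp
    obtain l h where S: "ses l h" "tgt h = src i" "proj (src h)" using cover_ses[OF ob] .
    note d = sesD[OF S(1)]
    obtain i' H where H: "ses (l ;; i') H" "tgt H = tgt i" "arr i'" "src i' = src h" "tgt i' = src H"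
      using step[OF S] by blast
    have "evan 0 (tgt h) Y"
    proof (rule evan_0I[OF S(1,3)])
      fix a assume a: "arr a" "src a = src l" "tgt a = Y"
      obtain c where c: "arr c" "src c = tgt (l ;; i')" "tgt c = Y" "(l ;; i') ;; c = a"
        using evan_0D[OF _ H(1) a(1), of Y] v 0 H(2) a by auto
      then show "\<exists>b. arr b \<and> src b = tgt l \<and> tgt b = Y \<and> l ;; b = a"
        using H(3-5) d by (intro exI[of _ "i' ;; c"]) simp
    qed
    then show ?thesis using S 0 by simp
  next
    case (Suc m)
    show ?thesis unfolding Suc evan.simps(2)
    proof (intro allI impI, elim conjE)
      fix l h assume S: "ses l h" "tgt h = src i" "proj (src h)"
      obtain i' H where H: "ses (l ;; i') H" "tgt H = tgt i" "proj (src H)" using step[OF S] by blast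
      show "evan m (src l) Y" using evan_SucD[OF _ H(1,3), of m Y] v Suc H(2) by simp
    qed
  qed
qed

text \<open>Two exactness statements of the long exact sequence in the first variable. They are
  proved together: the second in degree \<open>k\<close> follows from the first in degree
  \<open>k\<close> through the pushout of a cover (\<open>shift\<close>), and the first in degree
  \<open>Suc k\<close> follows from the second in degree \<open>k\<close> through
  \<open>ses_kernel\<close>.\<close>

lemma evan_ses:
  assumes "Y \<in> Ob C"
  shows "(\<forall>f g. ses f g \<and> evan k (src f) Y \<and> evan k (tgt g) Y \<longrightarrow> evan k (tgt f) Y) \<and>
    (\<forall>f g. ses f g \<and> evan k (tgt f) Y \<and> evan (Suc k) (tgt g) Y \<longrightarrow> evan k (src f) Y)"
proof (induction k)
  have shift: "\<forall>f g. ses f g \<and> evan k (tgt f) Y \<and> evan (Suc k) (tgt g) Y \<longrightarrow> evan k (src f) Y"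
    if E: "\<forall>f g. ses f g \<and> evan k (src f) Y \<and> evan k (tgt g) Y \<longrightarrow> evan k (tgt f) Y" for k
  proof (intro allI impI, elim conjE)
    fix f' g' assume S': "ses f' g'" "evan k (tgt f') Y" "evan (Suc k) (tgt g') Y"
    note d' = sesD[OF S'(1)]
    have ob: "tgt g' \<in> Ob C" using d' by simp
    obtain f g where S: "ses f g" "tgt g = tgt g'" "proj (src g)" using cover_ses[OF ob] .
    note d = sesD[OF S(1)]
    obtain t s where t: "arr t" "src t = src g" "tgt t = src g'" "t ;; g' = g ;; idt (tgt g)"
      and s: "arr s" "src s = src f" "tgt s = src f'" "f ;; t = s ;; f'"
      using ses_cmp[OF S(1) S'(1) S(3), of "idt (tgt g)" thesis] S(2) arr_idt[OF arr_ob(2)[OF d(2)]] by simp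
    have t': "t ;; g' = g" using t(4) d by simp
    have ob: "src f' \<in> Ob C" "src g \<in> Ob C" using d d' by simp_all
    obtain i j p q where b: "bip i j p q" "src i = src f'" "src j = src g" using ex_bip[OF ob] .
    \<comment> \<open>The outer terms are the syzygy of \<open>tgt g'\<close> and the object
      \<open>tgt f'\<close>; the middle one is \<open>src f'\<close> plus a projective summand,
      which \<open>evan_summand\<close> removes.\<close>
    have P: "ses (s ;; i \<boxplus> neg (f ;; j)) (p ;; f' \<boxplus> q ;; t)" by (rule pushout_ses[OF S(1) S'(1) t(1-3) t' s b])
    have "evan k (src f) Y" using evan_SucD[OF _ S(1,3)] S(2) S'(3) by simp
    then have "evan k (tgt (s ;; i \<boxplus> neg (f ;; j))) Y"
      using E[rule_format, OF conjI[OF P]] s S' bipD[OF b(1)] by simp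
    then show "evan k (src f') Y" using evan_summand[OF b(1), of k Y] b S s bipD[OF b(1)] by simp
  qed
  {
    case 0
    have "\<forall>f g. ses f g \<and> evan 0 (src f) Y \<and> evan 0 (tgt g) Y \<longrightarrow> evan 0 (tgt f) Y"
    proof (intro allI impI, elim conjE)
      fix f g assume S: "ses f g" "evan 0 (src f) Y" "evan 0 (tgt g) Y"
      show "evan 0 (tgt f) Y" unfolding evan.simps(1)
      proof (intro allI impI, elim conjE)
        fix l h a assume L: "ses l h" "tgt h = tgt f" and a: "arr a" "src a = src l" "tgt a = Y"
        obtain m l' h' where m: "ses m (h ;; g)" "ses l' h'" "src l' = src l" "tgt h' = src f" "tgt l' = src m" "l' ;; m = l"
          using ses_kernel[OF S(1) L] .
        note dm = sesD[OF m(1)] and dl = sesD[OF m(2)]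
        \<comment> \<open>The extension over \<open>l\<close> is made in two stages, over
          \<open>l'\<close> with cokernel \<open>src f\<close> and over \<open>m\<close> with
          cokernel \<open>tgt g\<close>.\<close>
        obtain b where b: "arr b" "src b = tgt l'" "tgt b = Y" "l' ;; b = a"
          using evan_0D[OF _ m(2) a(1), of Y] S m a by auto
        obtain c where c: "arr c" "src c = tgt m" "tgt c = Y" "m ;; c = b"
          using evan_0D[OF _ m(1) b(1), of Y] S m b by auto
        have "l ;; c = l' ;; m ;; c" by (rule cmp_reduce[OF m(6), symmetric]) (use dm dl c m in simp_all)
        then have "l ;; c = a" using c b by simp
        moreover have "tgt m = tgt l" using m(6) by auto
        ultimately show "\<exists>b. arr b \<and> src b = tgt l \<and> tgt b = Y \<and> l ;; b = a" using c by auto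
      qed
    qed
    then show ?case using shift by blast
  next
    case (Suc k)
    have "\<forall>f g. ses f g \<and> evan (Suc k) (src f) Y \<and> evan (Suc k) (tgt g) Y \<longrightarrow> evan (Suc k) (tgt f) Y"
    proof (intro allI impI, elim conjE)
      fix f g assume S: "ses f g" "evan (Suc k) (src f) Y" "evan (Suc k) (tgt g) Y"
      note d = sesD[OF S(1)]
      show "evan (Suc k) (tgt f) Y" unfolding evan.simps(2)
      proof (intro allI impI, elim conjE)
        fix l h assume L: "ses l h" "tgt h = tgt f" "proj (src h)"
        obtain m l' h' where m: "ses m (h ;; g)" "ses l' h'" "src l' = src l" "tgt h' = src f" "tgt l' = src m" "l' ;; m = l"
          using ses_kernel[OF S(1) L(1,2)] .
        have "evan k (src m) Y" using evan_SucD[OF _ m(1), of k Y] S L by simp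
        then have "evan k (src l') Y" using Suc.IH m S by metis
        then show "evan k (src l) Y" using m by simp
      qed
    qed
    then show ?case using shift by blast
  }
qed

lemma evan_middle: "ses f g \<Longrightarrow> evan k (src f) Y \<Longrightarrow> evan k (tgt g) Y \<Longrightarrow> Y \<in> Ob C \<Longrightarrow> evan k (tgt f) Y"
  using evan_ses by blast

lemma evan_left: "ses f g \<Longrightarrow> evan k (tgt f) Y \<Longrightarrow> evan (Suc k) (tgt g) Y \<Longrightarrow> Y \<in> Ob C \<Longrightarrow> evan k (src f) Y"
  using evan_ses by blast

end

section \<open>The remaining positions of the long exact sequences, isomorphisms and zero
  objects\<close>

context abelian_enough_projectives
begin

text \<open>The sequence of \<open>pushout_ses\<close> for a projective cover of the last term of
  the second sequence. It links the syzygy to \<open>tgt f'\<close>, and the last two equations are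
  what is needed to compute with it.\<close>

lemma cover_pushout:
  assumes S: "ses f g" "proj (src g)" and S': "ses f' g'" "tgt g = tgt g'"
  obtains k e i j p q where "ses k e" "src k = src f" "tgt e = tgt f'" "bip i j p q" "src i = src f'" "src j = src g"
    "tgt k = tgt i" "i ;; e = f'" "k ;; q = neg f"
proof -
  note d = sesD[OF S(1)] and d' = sesD[OF S'(1)]
  obtain t s where t: "arr t" "src t = src g" "tgt t = src g'" "t ;; g' = g ;; idt (tgt g)"
    and s: "arr s" "src s = src f" "tgt s = src f'" "f ;; t = s ;; f'"
    using ses_cmp[OF S(1) S'(1) S(2), of "idt (tgt g)" thesis] S'(2) arr_idt[OF arr_ob(2)[OF d(2)]] by simp
  have t': "t ;; g' = g" using t(4) d by simp
  have ob: "src f' \<in> Ob C" "src g \<in> Ob C" using d d' by simp_all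
  obtain i j p q where b: "bip i j p q" "src i = src f'" "src j = src g" using ex_bip[OF ob] .
  note B = bipD[OF b(1)] and R = bip_red[OF b(1)]
  have P: "ses (s ;; i \<boxplus> neg (f ;; j)) (p ;; f' \<boxplus> q ;; t)" by (rule pushout_ses[OF S(1) S'(1) t(1-3) t' s b])
  have 1: "i ;; (p ;; f' \<boxplus> q ;; t) = f'" using d d' B(1-13) b t(1-3) s(1-3) R by simp
  have 2: "(s ;; i \<boxplus> neg (f ;; j)) ;; q = neg f" using d d' B(1-13) b t(1-3) s(1-3) by simp
  show ?thesis by (rule that[OF P _ _ b _ 1 2]) (use s B d d' in simp_all)
qed

text \<open>The syzygy of \<open>tgt g\<close> is the kernel of an epimorphism from
  \<open>src f\<close> plus a projective onto \<open>tgt f\<close>, so the claim reduces to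
  \<open>evan_middle\<close> and \<open>evan_left\<close> one degree lower.\<close>

lemma evan_right:
  assumes S: "ses f g" "evan k (src f) Y" "evan (Suc k) (tgt f) Y" "Y \<in> Ob C"
  shows "evan (Suc k) (tgt g) Y"
  unfolding evan.simps(2)
proof (intro allI impI, elim conjE)
  fix l h assume L: "ses l h" "tgt h = tgt g" "proj (src h)"
  obtain m e i j p q where m: "ses m e" "src m = src l" "tgt e = tgt f" "bip i j p q" "src i = src f" "src j = src h"
    "tgt m = tgt i" "i ;; e = f" "m ;; q = neg l" using cover_pushout[OF L(1,3) S(1) L(2)] .
  note B = bipD[OF m(4)]
  have "evan k (tgt q) Y" using evan_proj[OF L(3) S(4), of k] B m by simp
  then have "evan k (tgt i) Y" using evan_middle[OF bip_ses[OF m(4)], of k Y] S m by simp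
  then show "evan k (src l) Y" using evan_left[OF m(1), of k Y] S m by simp
qed

text \<open>The lowest degree of the long exact sequence: the kernel of Ext^1(\<open>tgt g\<close>,
  Y) to Ext^1(\<open>tgt f\<close>, Y) is the cokernel of restriction along \<open>f\<close> on
  arrows into Y, and \<open>ex\<close> says that restriction is onto.\<close>

lemma evan_0_right:
  assumes S: "ses f g" "evan 0 (tgt f) Y"
    and ex: "\<And>a. arr a \<Longrightarrow> src a = src f \<Longrightarrow> tgt a = Y \<Longrightarrow> \<exists>b. arr b \<and> src b = tgt f \<and> tgt b = Y \<and> f ;; b = a"
  shows "evan 0 (tgt g) Y"
proof -
  note d = sesD[OF S(1)]
  obtain l h where L: "ses l h" "tgt h = tgt g" "proj (src h)" using cover_ses[OF arr_ob(2)[OF d(2)]] .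
  note d' = sesD[OF L(1)]
  obtain m e i j p q where m: "ses m e" "src m = src l" "tgt e = tgt f" "bip i j p q" "src i = src f" "src j = src h"
    "tgt m = tgt i" "i ;; e = f" "m ;; q = neg l" using cover_pushout[OF L(1,3) S(1) L(2)] .
  note B = bipD[OF m(4)] and dm = sesD[OF m(1)]
  have "evan 0 (tgt h) Y"
  proof (rule evan_0I[OF L(1,3)])
    fix a assume a: "arr a" "src a = src l" "tgt a = Y"
    obtain c where c: "arr c" "src c = tgt m" "tgt c = Y" "m ;; c = a"
      using evan_0D[OF _ m(1) a(1), of Y thesis] S(2) m(2,3) a by simp
    obtain b where b: "arr b" "src b = tgt f" "tgt b = Y" "f ;; b = i ;; c"
      using ex[of "i ;; c"] c m(5,7) B(1) by auto
    \<comment> \<open>The correction by \<open>e ;; b\<close> makes \<open>c\<close> vanish on the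
      first summand without changing its restriction along \<open>m\<close>. So it factors through
      the projection \<open>q\<close>, and \<open>m ;; q = neg l\<close> accounts for the sign in
      the witness.\<close>
    define u where "u = c \<boxplus> neg (e ;; b)"
    have u: "arr u" "src u = tgt i" "tgt u = Y" unfolding u_def using c b dm m(3,7) by simp_all
    have "i ;; u = i ;; c \<boxplus> neg (i ;; e ;; b)" unfolding u_def using c b(1-3) dm m(3,7) B(1) by simp
    also have "i ;; e ;; b = f ;; b" by (rule cmp_reduce[OF m(8)]) (use B(1) dm m(3,7) b in simp_all)
    finally have "i ;; u = zer (src i) Y" using b c B(1) m(7) by simp
    then obtain w where w: "arr w" "src w = tgt q" "tgt w = Y" "q ;; w = u"
      using ses_extend[OF bip_ses[OF m(4)], of u] u by auto
    have "m ;; u = m ;; c \<boxplus> neg (m ;; e ;; b)" unfolding u_def using c(1-3) b(1-3) dm m(3,7) by simp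
    also have "m ;; e ;; b = zer (src m) Y" using dm(1-3) b(1-3) m(3) by (simp add: cmp_reduce[OF dm(4)])
    finally have mu: "m ;; u = a" using c a(1,2) m(2) b(1,3) d'(1) arr_ob(2)[OF a(1), unfolded a(3)] a(3) by simp
    have "m ;; u = m ;; q ;; w" using w by simp
    also have "\<dots> = neg l ;; w" by (rule cmp_reduce[OF m(9)]) (use B w(1-3) dm(1) m(7) in simp_all)
    finally have "l ;; neg w = a" using mu w(1-3) d' B m(6) by simp
    then show "\<exists>b. arr b \<and> src b = tgt l \<and> tgt b = Y \<and> l ;; b = a"
      using w d' B m(6) by (intro exI[of _ "neg w"]) simp
  qed
  then show ?thesis using L by simp
qed

text \<open>The predicate \<open>evan\<close> speaks about extending arrows. To lift along
  \<open>g\<close> instead, a lift \<open>t\<close> is taken on a projective cover of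
  \<open>src a\<close>; its restriction to the syzygy lands in \<open>src f\<close>, extends by
  vanishing of Ext^1, and is subtracted.\<close>

lemma evan_0_lift:
  assumes S: "ses f g" and v: "evan 0 (src a) (src f)" and a: "arr a" "tgt a = tgt g"
  obtains b where "arr b" "src b = src a" "tgt b = src g" "b ;; g = a"
proof -
  note d = sesD[OF S]
  obtain l h where L: "ses l h" "tgt h = src a" "proj (src h)" using cover_ses[OF arr_ob(1)[OF a(1)]] .
  note d' = sesD[OF L(1)]
  have v': "evan 0 (tgt h) (src f)" using v L(2) by simp
  have "arr a" "src a = tgt h" "tgt a = tgt g" using a L by simp_all
  then obtain t s where t: "arr t" "src t = src h" "tgt t = src g" "t ;; g = h ;; a"
    and s: "arr s" "src s = src l" "tgt s = src f" "l ;; t = s ;; f"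
    using ses_cmp[OF L(1) S L(3)] by blast
  obtain w where w: "arr w" "src w = tgt l" "tgt w = src f" "l ;; w = s"
    using evan_0D[OF v' L(1) s(1-3)] .
  define u where "u = t \<boxplus> neg (w ;; f)"
  have u: "arr u" "src u = src h" "tgt u = src g" unfolding u_def using t w d d' by simp_all
  have "l ;; u = s ;; f \<boxplus> neg (l ;; w ;; f)" unfolding u_def using t s(4) w(1-3) d d' by simp
  also have "l ;; w ;; f = s ;; f" by (rule cmp_reduce[OF w(4)]) (use w(1-3) d d' in simp_all)
  finally have "l ;; u = zer (src l) (tgt u)" using s(1-3) d u by simp
  then obtain b where b: "arr b" "src b = tgt h" "tgt b = src g" "h ;; b = u"
    using ses_extend[OF L(1), of u thesis] u d' by simp
  have "(h ;; b) ;; g = t ;; g \<boxplus> neg (w ;; f ;; g)" unfolding b(4) u_def using t(1-3) w(1-3) d(1-3) d' by simp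
  also have "\<dots> = h ;; a" using t w(1-3) d d' a L(2) by simp
  finally have "h ;; b ;; g = h ;; a" using b(1-3) d d' by simp
  then have "b ;; g = a" using epi_cancel[OF d'(6), of "b ;; g" a] b(1-3) a d L(2) by simp
  then show ?thesis using that b L by simp
qed

text \<open>The long exact sequence in the second variable. As \<open>evan\<close> shifts the first
  variable, all degrees reduce to the lowest one, which is \<open>evan_0_lift\<close> applied to a
  syzygy.\<close>

lemma evan_target:
  assumes S: "ses f g" and "evan k X (tgt f)" "evan (Suc k) X (src f)" "X \<in> Ob C"
  shows "evan k X (tgt g)"
  using assms(2-4)
proof (induction k arbitrary: X)
  case 0
  note d = sesD[OF S]
  obtain l h where L: "ses l h" "tgt h = X" "proj (src h)" using cover_ses[OF 0(3)] .
  note d' = sesD[OF L(1)]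
  have "evan 0 (tgt h) (tgt g)"
  proof (rule evan_0I[OF L(1,3)])
    fix a assume a: "arr a" "src a = src l" "tgt a = tgt g"
    have v: "evan 0 (src a) (src f)" using evan_SucD[OF 0(2)[folded L(2)] L(1,3)] a(2) by simp
    obtain b where b: "arr b" "src b = src a" "tgt b = src g" "b ;; g = a" using evan_0_lift[OF S v a(1,3)] .
    obtain c where c: "arr c" "src c = tgt l" "tgt c = src g" "l ;; c = b"
      using evan_0D[OF _ L(1) b(1), of "src g" thesis] 0 L(2) a(2) b(2,3) d by simp
    have "l ;; c ;; g = a" using cmp_reduce[OF c(4), of g] b c(1-3) d d' by simp
    then show "\<exists>b. arr b \<and> src b = tgt l \<and> tgt b = tgt g \<and> l ;; b = a"
      using c(1-3) d by (intro exI[of _ "c ;; g"]) simp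
  qed
  then show ?case using L by simp
next
  case (Suc k)
  show ?case unfolding evan.simps(2)
  proof (intro allI impI, elim conjE)
    fix l h assume L: "ses l h" "tgt h = X" "proj (src h)"
    show "evan k (src l) (tgt g)"
      by (rule Suc.IH[OF evan_SucD[OF Suc.prems(1)[folded L(2)] L(1,3)]
        evan_SucD[OF Suc.prems(2)[folded L(2)] L(1,3)]]) (use sesD[OF L(1)] in simp)
  qed
qed

definition iso :: "'o \<Rightarrow> 'o \<Rightarrow> bool"
  where "iso X Y \<longleftrightarrow> (\<exists>f. isomap f \<and> src f = X \<and> tgt f = Y)"

lemma isoE: assumes "iso X Y"
  obtains u v where "arr u" "src u = X" "tgt u = Y" "arr v" "src v = Y" "tgt v = X" "u ;; v = idt X" "v ;; u = idt Y"
proof -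
  obtain f where f: "isomap f" "src f = X" "tgt f = Y" using assms unfolding iso_def by blast
  then obtain g where g: "arr f" "arr g" "src g = tgt f" "tgt g = src f" "f ;; g = idt (src f)" "g ;; f = idt (tgt f)"
    unfolding isomap_def by blast
  show ?thesis by (rule that[of f g]) (use f g in simp_all)
qed

lemma isoI: assumes "arr u" "src u = X" "tgt u = Y" "arr v" "src v = Y" "tgt v = X" "u ;; v = idt X" "v ;; u = idt Y"
  shows "iso X Y"
  unfolding iso_def isomap_def by (intro exI[of _ u] conjI exI[of _ v]) (use assms in simp_all)

lemma iso_refl: "X \<in> Ob C \<Longrightarrow> iso X X"
  by (rule isoI[of "idt X" X X "idt X"]) simp_all

definition zob :: "'o \<Rightarrow> bool" where "zob Z \<longleftrightarrow> Z \<in> Ob C \<and> idt Z = zer Z Z"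

lemma zob_to: assumes "zob Z" "arr f" "tgt f = Z" shows "f = zer (src f) Z"
proof -
  have "f = f ;; idt Z" using assms by simp
  also have "\<dots> = zer (src f) Z" using assms by (simp add: zob_def del: cmp_idt)
  finally show ?thesis .
qed

lemma zob_from: assumes "zob Z" "arr f" "src f = Z" shows "f = zer Z (tgt f)"
proof -
  have "f = idt Z ;; f" using assms by simp
  also have "\<dots> = zer Z (tgt f)" using assms by (simp add: zob_def del: idt_cmp)
  finally show ?thesis .
qed

lemma zob_evan_0: assumes "zob Y" shows "evan 0 X Y"
  unfolding evan.simps(1)
proof (intro allI impI, elim conjE)
  fix f g a assume S: "ses f g" "tgt g = X" and a: "arr a" "src a = src f" "tgt a = Y"
  note d = sesD[OF S(1)]
  have "Y \<in> Ob C" using assms by (simp add: zob_def)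
  then show "\<exists>b. arr b \<and> src b = tgt f \<and> tgt b = Y \<and> f ;; b = a"
    using d zob_to[OF assms a(1,3)] a by (intro exI[of _ "zer (tgt f) Y"]) simp
qed

lemma zob_evan: assumes "zob Z" "Y \<in> Ob C" shows "evan k Z Y"
proof (rule evan_proj[OF _ assms(2)])
  show "proj Z" unfolding proj_def
  proof (intro conjI allI impI)
    fix f x assume x: "local.epi f \<and> arr x \<and> src x = Z \<and> tgt x = tgt f"
    then have "arr f" by (simp add: epi_def)
    then show "\<exists>y. arr y \<and> src y = Z \<and> tgt y = src f \<and> y ;; f = x"
      using zob_from[OF assms(1), of x] x assms(1) by (intro exI[of _ "zer Z (src f)"]) (simp add: zob_def)
  qed (use assms in \<open>simp add: zob_def\<close>)
qed

end

section \<open>Yoneda extensions\<close>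

context abelian_enough_projectives
begin

text \<open>A ladder cuts an exact sequence into short exact sequences
  \<open>0 \<rightarrow> src (a k) \<rightarrow> tgt (a k) \<rightarrow> src (a (k + 1)) \<rightarrow> 0\<close> for \<open>1 \<le> k \<le> n\<close>.\<close>

definition ladder :: "nat \<Rightarrow> (nat \<Rightarrow> ('o, 'a) arrow) \<Rightarrow> (nat \<Rightarrow> ('o, 'a) arrow) \<Rightarrow> bool"
  where "ladder n a b \<longleftrightarrow> (\<forall>k. 1 \<le> k \<and> k \<le> n \<longrightarrow> ses (a k) (b k) \<and> (k < n \<longrightarrow> tgt (b k) = src (a (Suc k))))"

text \<open>The differentials of the long sequence, indexed from 0 to \<open>n\<close> as in
  \<open>extensions\<close>, while the ladder is indexed from 1.\<close>

definition splice :: "nat \<Rightarrow> (nat \<Rightarrow> ('o, 'a) arrow) \<Rightarrow> (nat \<Rightarrow> ('o, 'a) arrow) \<Rightarrow> nat \<Rightarrow> ('o, 'a) arrow"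
  where "splice n a b k = (if k = 0 then a 1 else if k < n then b k ;; a (Suc k) else b n)"

lemma ladderD: assumes "ladder n a b" "1 \<le> k" "k \<le> n"
  shows "ses (a k) (b k)" "arr (a k)" "arr (b k)" "tgt (a k) = src (b k)" "a k ;; b k = zer (src (a k)) (tgt (b k))"
    "mono (a k)" "epi (b k)" "k < n \<Longrightarrow> tgt (b k) = src (a (Suc k))"
proof -
  show s: "ses (a k) (b k)" "k < n \<Longrightarrow> tgt (b k) = src (a (Suc k))" using assms by (auto simp: ladder_def)
  show "arr (a k)" "arr (b k)" "tgt (a k) = src (b k)" "a k ;; b k = zer (src (a k)) (tgt (b k))"
    "mono (a k)" "epi (b k)" using sesD[OF s(1)] by blast+
qed

text \<open>The arrow \<open>f k\<close> acts on the middle term and \<open>u k\<close> on the left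
  end of step \<open>k\<close>. Thus \<open>u 1\<close> and \<open>u (Suc n)\<close> are the arrows
  on the two ends of the long sequence.\<close>

definition lad_map :: "nat \<Rightarrow> (nat \<Rightarrow> ('o, 'a) arrow) \<Rightarrow> (nat \<Rightarrow> ('o, 'a) arrow) \<Rightarrow> (nat \<Rightarrow> ('o, 'a) arrow) \<Rightarrow>
    (nat \<Rightarrow> ('o, 'a) arrow) \<Rightarrow> (nat \<Rightarrow> ('o, 'a) arrow) \<Rightarrow> (nat \<Rightarrow> ('o, 'a) arrow) \<Rightarrow> bool"
  where "lad_map n p q a b u f \<longleftrightarrow> (\<forall>k. 1 \<le> k \<and> k \<le> n \<longrightarrow>
    arr (f k) \<and> src (f k) = tgt (p k) \<and> tgt (f k) = tgt (a k) \<and>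
    arr (u k) \<and> src (u k) = src (p k) \<and> tgt (u k) = src (a k) \<and>
    arr (u (Suc k)) \<and> src (u (Suc k)) = tgt (q k) \<and> tgt (u (Suc k)) = tgt (b k) \<and>
    p k ;; f k = u k ;; a k \<and> q k ;; u (Suc k) = f k ;; b k)"

lemma lad_mapD: assumes "lad_map n p q a b u f" "1 \<le> k" "k \<le> n"
  shows "arr (f k)" "src (f k) = tgt (p k)" "tgt (f k) = tgt (a k)"
    "arr (u k)" "src (u k) = src (p k)" "tgt (u k) = src (a k)"
    "arr (u (Suc k))" "src (u (Suc k)) = tgt (q k)" "tgt (u (Suc k)) = tgt (b k)"
    "p k ;; f k = u k ;; a k" "q k ;; u (Suc k) = f k ;; b k"
  using assms unfolding lad_map_def by blast+

lemma lad_map_cmp: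
  assumes "ladder n p q" "ladder n a b" "ladder n a' b'" "lad_map n p q a b u f" "lad_map n a b a' b' v g"
  shows "lad_map n p q a' b' (\<lambda>k. u k ;; v k) (\<lambda>k. f k ;; g k)"
  unfolding lad_map_def
proof (intro allI impI, elim conjE)
  fix k :: nat assume k: "1 \<le> k" "k \<le> n"
  note P = ladderD[OF assms(1) k] and A = ladderD[OF assms(2) k] and A' = ladderD[OF assms(3) k]
    and U = lad_mapD[OF assms(4) k] and V = lad_mapD[OF assms(5) k]
  have "p k ;; f k ;; g k = (u k ;; a k) ;; g k" by (rule cmp_reduce[OF U(10)]) (use P(2) U V(1,2) in simp_all)
  also have "\<dots> = u k ;; v k ;; a' k" using U(4-6) A(2) V(1,2,10) by simp
  also have "\<dots> = (u k ;; v k) ;; a' k" using U(4-6) V(4-6) A'(2) by simp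
  finally have 1: "p k ;; f k ;; g k = (u k ;; v k) ;; a' k" .
  have "q k ;; u (Suc k) ;; v (Suc k) = (f k ;; b k) ;; v (Suc k)"
    by (rule cmp_reduce[OF U(11)]) (use P(3) U V(7-9) in simp_all)
  also have "\<dots> = f k ;; g k ;; b' k" using U(1-3) A(3,4) V(7-9,11) by simp
  also have "\<dots> = (f k ;; g k) ;; b' k" using U(1-3) V(1-3) A'(3,4) by simp
  finally have 2: "q k ;; u (Suc k) ;; v (Suc k) = (f k ;; g k) ;; b' k" .
  show "arr (f k ;; g k) \<and> src (f k ;; g k) = tgt (p k) \<and> tgt (f k ;; g k) = tgt (a' k) \<and>
    arr (u k ;; v k) \<and> src (u k ;; v k) = src (p k) \<and> tgt (u k ;; v k) = src (a' k) \<and>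
    arr (u (Suc k) ;; v (Suc k)) \<and> src (u (Suc k) ;; v (Suc k)) = tgt (q k) \<and> tgt (u (Suc k) ;; v (Suc k)) = tgt (b' k) \<and>
    p k ;; f k ;; g k = (u k ;; v k) ;; a' k \<and> q k ;; u (Suc k) ;; v (Suc k) = (f k ;; g k) ;; b' k"
    using 1 2 U(1-9) V(1-9) by simp
qed

lemma cokerp_epi_cmp: assumes q: "cokerp f q" and e: "epi e" "arr e" "tgt e = src f" shows "cokerp (e ;; f) q"
proof -
  have f: "arr f" "arr q" "src q = tgt f" "f ;; q = zer (src f) (tgt q)" using q unfolding cokerp_def by blast+
  show ?thesis
  proof (rule cokerpI[OF cokerp_epi[OF q]])
    fix x assume x: "arr x" "src x = tgt (e ;; f)" "(e ;; f) ;; x = zer (src (e ;; f)) (tgt x)"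
    then have fx: "f ;; x = zer (src f) (tgt x)" using epiD[OF e(1), of "f ;; x"] f e by simp
    have "src x = tgt f" using x(2) by simp
    from cokerp_factor[OF q x(1) this fx]
    show "\<exists>y. arr y \<and> src y = tgt q \<and> tgt y = tgt x \<and> q ;; y = x" by blast
  qed (use f e in simp_all)
qed

lemma kerp_cmp_mono: assumes k: "kerp f k" and m: "mono m" "arr m" "tgt f = src m" shows "kerp (f ;; m) k"
proof -
  have f: "arr f" "arr k" "tgt k = src f" "k ;; f = zer (src k) (tgt f)" using k unfolding kerp_def by blast+
  show ?thesis
  proof (rule kerpI[OF kerp_mono[OF k]])
    show "k ;; f ;; m = zer (src k) (tgt (f ;; m))" using f(1-3) m by (simp add: cmp_reduce[OF f(4)])
    fix x assume x: "arr x" "tgt x = src (f ;; m)" "x ;; f ;; m = zer (src x) (tgt (f ;; m))"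
    then have xf: "x ;; f = zer (src x) (tgt f)" using monoD[OF m(1), of "x ;; f"] f m by simp
    have "tgt x = src f" using x(2) by simp
    from kerp_factor[OF k x(1) this xf]
    show "\<exists>y. arr y \<and> src y = src x \<and> tgt y = src k \<and> y ;; k = x" by blast
  qed (use f m in simp_all)
qed

lemma image_factor:
  assumes "arr f" obtains e m where "epi e" "mono m" "arr e" "arr m" "tgt e = src m" "e ;; m = f"
proof -
  obtain k where k: "kerp f k" using ex_kerp[OF assms] .
  obtain e where e: "ses k e" using mono_ses[OF kerp_mono[OF k]] .
  have K: "tgt k = src f" "k ;; f = zer (src k) (tgt f)" using k unfolding kerp_def by blast+
  note d = sesD[OF e]
  obtain m where m: "arr m" "src m = tgt e" "tgt m = tgt f" "e ;; m = f"
    using ses_extend[OF e assms] K by auto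
  have "mono m"
  proof (rule mono_elI[OF m(1)])
    fix x assume x: "arr x" "proj (src x)" "tgt x = src m" "x ;; m = zer (src x) (tgt m)"
    obtain y where y: "arr y" "src y = src x" "tgt y = src e" "y ;; e = x"
      using ses_el[OF e x(1)] x(2,3) m by auto
    have "y ;; f = y ;; e ;; m" by (simp add: m(4))
    also have "\<dots> = x ;; m" by (rule cmp_reduce[OF y(4)]) (use y(1-3) d m(1,2) in simp_all)
    finally have yf: "y ;; f = zer (src y) (tgt f)" using x(4) m(3) y(2) by simp
    have "tgt y = src f" using y d K by simp
    then obtain z where z: "arr z" "src z = src y" "tgt z = src k" "z ;; k = y"
      using kerp_factor[OF k y(1) _ yf] by blast
    have "x = z ;; k ;; e" using y z d cmp_assoc[of z k e] by simp
    then show "x = zer (src x) (src m)" using z(1-3) y(2) d(1-4) m by simp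
  qed
  then show ?thesis using that[of e m] d m by simp
qed

text \<open>An arrow killed by \<open>g\<close> is killed by the cokernel \<open>q\<close> of
  \<open>f\<close>. The cokernel of the image \<open>m\<close> of \<open>f\<close> factors through
  \<open>q\<close>, and \<open>m\<close> is its kernel, so the arrow factors through
  \<open>m\<close>; a projective source lifts it further along the epimorphism
  \<open>e\<close>.\<close>

lemma exact_el:
  assumes "cokerp f q" "kerp q i" "kerp g i" "tgt f = src g"
  shows "f ;; g = zer (src f) (tgt g)"
    "\<And>x. arr x \<Longrightarrow> proj (src x) \<Longrightarrow> tgt x = src g \<Longrightarrow> x ;; g = zer (src x) (tgt g) \<Longrightarrow> \<exists>y. arr y \<and> src y = src x \<and> tgt y = src f \<and> y ;; f = x"
proof -
  have f: "arr f" "arr q" "src q = tgt f" "f ;; q = zer (src f) (tgt q)" using assms(1) unfolding cokerp_def by blast+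
  have g: "arr g" "arr i" "tgt i = src g" "i ;; g = zer (src i) (tgt g)" using assms(3) unfolding kerp_def by blast+
  have i: "i ;; q = zer (src i) (tgt q)" using assms(2) unfolding kerp_def by blast
  obtain u where u: "arr u" "src u = src f" "tgt u = src i" "u ;; i = f"
    using kerp_factor[OF assms(2) f(1) f(3)[symmetric] f(4)] .
  have "f ;; g = u ;; i ;; g" by (rule cmp_reduce[OF u(4), symmetric]) (use u(1-3) g in simp_all)
  then show "f ;; g = zer (src f) (tgt g)" using u(1-3) g by simp
  fix x assume x: "arr x" "proj (src x)" "tgt x = src g" "x ;; g = zer (src x) (tgt g)"
  obtain z where z: "arr z" "src z = src x" "tgt z = src i" "z ;; i = x"
    using kerp_factor[OF assms(3) x(1,3,4)] .
  have "x ;; q = z ;; i ;; q" by (rule cmp_reduce[OF z(4), symmetric]) (use z(1-3) f g assms(4) in simp_all)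
  then have xq: "x ;; q = zer (src x) (tgt q)" using z(1-3) g i f by simp
  obtain e m where m: "epi e" "mono m" "arr e" "arr m" "tgt e = src m" "e ;; m = f"
    using image_factor[OF f(1)] .
  have tm: "tgt m = tgt f" "src e = src f" using m(6) by auto
  have "(e ;; m) ;; q = zer (src e) (tgt q)" unfolding m(6) using f tm by simp
  then have mq: "m ;; q = zer (src m) (tgt q)" using epiD[OF m(1), of "m ;; q"] m(3-5) tm f by simp
  obtain q' where q': "ses m q'" using mono_ses[OF m(2)] .
  note d = sesD[OF q']
  have "f ;; q' = e ;; m ;; q'" by (rule cmp_reduce[OF m(6), symmetric]) (use m(3-5) d in simp_all)
  then have fq': "f ;; q' = zer (src f) (tgt q')" using m(3-5) d tm by simp
  have "src q' = tgt f" using d tm by simp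
  then obtain w where w: "arr w" "src w = tgt q" "tgt w = tgt q'" "q ;; w = q'"
    using cokerp_factor[OF assms(1) d(2) _ fq'] by blast
  have "x ;; q' = x ;; q ;; w" using w by simp
  also have "\<dots> = zer (src x) (tgt q')" using x(1) w(1-3) f(2,3) x(3) assms(4) by (simp add: cmp_reduce[OF xq])
  finally obtain v where v: "arr v" "src v = src x" "tgt v = src m" "v ;; m = x"
    using ses_lift[OF q' x(1)] x(3) d tm assms(4) by auto
  obtain y where y: "arr y" "src y = src v" "tgt y = src e" "y ;; e = v"
    using projE[of "src v" e v] m(1) v x(2) m(5) by auto
  have "y ;; f = y ;; e ;; m" by (simp add: m(6))
  also have "\<dots> = v ;; m" by (rule cmp_reduce[OF y(4)]) (use y(1-3) m in simp_all)
  finally show "\<exists>y. arr y \<and> src y = src x \<and> tgt y = src f \<and> y ;; f = x" using v y tm by auto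
qed

lemma exact_at_iff:
  assumes "arr f" "arr g" "tgt f = src g"
  shows "exact_at C (src f) (src g) (tgt g) (val f) (val g) \<longleftrightarrow> (\<exists>q i. cokerp f q \<and> kerp q i \<and> kerp g i)"
proof
  have m: "val f \<in> mor C (src f) (src g)" "val g \<in> mor C (src g) (tgt g)"
    using assms unfolding arr_def by auto
  have A: "Arrow (src f) (val f) (src g) = f" "Arrow (src g) (val g) (tgt g) = g" using assms by simp_all
  {
    assume "exact_at C (src f) (src g) (tgt g) (val f) (val g)"
    then obtain Q q I i where e: "is_coker C (src f) (src g) (val f) Q q" "is_ker C (src g) Q q I i" "is_ker C (src g) (tgt g) (val g) I i"
      unfolding exact_at_def by blast
    have "Q \<in> Ob C" "q \<in> mor C (src g) Q" using e(1) unfolding is_coker_def by blast+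
    then have "cokerp f (Arrow (src g) q Q)" "kerp (Arrow (src g) q Q) (Arrow I i (src g))" "kerp g (Arrow I i (src g))"
      using e is_coker_iff[OF _ _ m(1), of Q q] is_ker_iff[of "src g" Q q I i] is_ker_iff[OF _ _ m(2), of I i] assms A
      by simp_all
    then show "\<exists>q i. cokerp f q \<and> kerp q i \<and> kerp g i" by blast
  }
  assume "\<exists>q i. cokerp f q \<and> kerp q i \<and> kerp g i"
  then obtain q i where q: "cokerp f q" "kerp q i" "kerp g i" by blast
  have t: "arr q" "src q = src g" "tgt i = src g" using q assms unfolding cokerp_def kerp_def by auto
  have "val q \<in> mor C (src g) (tgt q)" using t unfolding arr_def by auto
  then show "exact_at C (src f) (src g) (tgt g) (val f) (val g)" unfolding exact_at_def
    using q t is_coker_iff[OF _ _ m(1), of "tgt q" "val q"] is_ker_iff[of "src g" "tgt q" "val q" "src i" "val i"]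
      is_ker_iff[OF _ _ m(2), of "src i" "val i"] assms A
    by (intro exI[of _ "tgt q"] exI[of _ "val q"] exI[of _ "src i"] exI[of _ "val i"]) simp
qed

definition ext_lad :: "nat \<Rightarrow> 'o \<Rightarrow> 'o \<Rightarrow> (nat \<Rightarrow> 'o) \<times> (nat \<Rightarrow> 'a) \<Rightarrow> (nat \<Rightarrow> ('o, 'a) arrow) \<Rightarrow> (nat \<Rightarrow> ('o, 'a) arrow) \<Rightarrow> bool"
  where "ext_lad n X Y x a b \<longleftrightarrow> x \<in> extensions C n X Y \<and> ladder n a b \<and> src (a 1) = Y \<and> tgt (b n) = X \<and>
    (\<forall>k\<le>n. Arrow (fst x k) (snd x k) (fst x (Suc k)) = splice n a b k)"

lemma splice_arr:
  assumes L: "ladder n a b" "1 \<le> n" "k \<le> n"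
  shows "arr (splice n a b k)" "k = 0 \<Longrightarrow> src (splice n a b k) = src (a 1)" "k > 0 \<Longrightarrow> src (splice n a b k) = tgt (a k)"
    "k < n \<Longrightarrow> tgt (splice n a b k) = tgt (a (Suc k))" "k = n \<Longrightarrow> tgt (splice n a b k) = tgt (b n)"
proof -
  have 1: "arr (a 1)" using ladderD(2)[OF L(1), of 1] L(2) by simp
  have k: "arr (a k)" "arr (b k)" "tgt (a k) = src (b k)" if "0 < k" using ladderD(2-4)[OF L(1), of k] L(3) that by simp_all
  have Sk: "arr (a (Suc k))" if "k < n" using ladderD(2)[OF L(1), of "Suc k"] that by simp
  have c: "tgt (b k) = src (a (Suc k))" if "0 < k" "k < n" using ladderD(8)[OF L(1), of k] that by simp
  consider "k = 0" | "0 < k" "k < n" | "0 < k" "k = n" using L by linarith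
  then show "arr (splice n a b k)"
  proof cases
    case 1 then show ?thesis using \<open>arr (a 1)\<close> by (simp add: splice_def)
  next
    case 2 then show ?thesis using k Sk c by (simp add: splice_def)
  next
    case 3 then show ?thesis using k by (simp add: splice_def)
  qed
  show "src (splice n a b k) = src (a 1)" if "k = 0" using that by (simp add: splice_def)
  show "src (splice n a b k) = tgt (a k)" if "k > 0" using that k L(3) by (auto simp: splice_def)
  show "tgt (splice n a b k) = tgt (a (Suc k))" if "k < n" using that by (simp add: splice_def)
  show "tgt (splice n a b k) = tgt (b n)" if "k = n" using that L(2) by (simp add: splice_def)
qed

lemma ladder_extension:
  assumes L: "ladder n a b" "1 \<le> n"
  obtains x where "ext_lad n (tgt (b n)) (src (a 1)) x a b"
proof -
  define E where "E k = (if k = 0 then src (a 1) else if k \<le> n then tgt (a k) else tgt (b n))" for k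
  define d where "d k = val (splice n a b k)" for k
  have D: "Arrow (E k) (d k) (E (Suc k)) = splice n a b k" if "k \<le> n" for k
    using splice_arr[OF L that] that unfolding E_def d_def
    by (cases "k = 0"; cases "k < n") (auto intro!: Arrow_collapse)
  have aD: "arr (Arrow (E k) (d k) (E (Suc k)))" if "k \<le> n" for k
    using D[OF that] splice_arr[OF L that] by simp
  have "(E, d) \<in> extensions C n (tgt (b n)) (src (a 1))"
    unfolding extensions_def
  proof (intro CollectI, unfold prod.case, intro conjI allI impI)
    show "chain n C E d" unfolding chain_def
    proof (intro conjI allI impI)
      fix k assume "k \<le> n + 1"
      then show "E k \<in> Ob C" using arr_ob[OF aD[of k]] arr_ob[OF aD[of n]] by (cases "k = n + 1") auto
    next
      fix k assume "k \<le> n"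
      then show "d k \<in> mor C (E k) (E (k + 1))" using aD[of k] unfolding arr_def by simp
    qed
    show "E 0 = src (a 1)" "E (n + 1) = tgt (b n)" by (simp_all add: E_def)
    have "mono (Arrow (E 0) (d 0) (E 1))" using D[of 0] ladderD(6)[OF L(1), of 1] L(2) by (simp add: splice_def)
    then show "is_mono C (E 0) (E 1) (d 0)" using arr_ob[OF aD[of 0]] by (simp add: is_mono_iff)
    have "epi (Arrow (E n) (d n) (E (n + 1)))" using D[of n] ladderD(7)[OF L(1), of n] L(2) by (simp add: splice_def)
    then show "is_epi C (E n) (E (n + 1)) (d n)" using arr_ob[OF aD[of n]] by (simp add: is_epi_iff)
    fix k assume k: "k < n"
    note A = ladderD[OF L(1), of "Suc k"]
    have s: "ses (a (Suc k)) (b (Suc k))" using A k by simp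
    \<comment> \<open>Composing with an epimorphism in front does not change the cokernel; composing
      with a monomorphism behind does not change the kernel.\<close>
    have c: "cokerp (splice n a b k) (b (Suc k))"
    proof (cases "k = 0")
      case True then show ?thesis using s by (simp add: splice_def ses_def)
    next
      case False
      then show ?thesis using s ladderD[OF L(1), of k] k
        by (simp add: splice_def ses_def cokerp_epi_cmp)
    qed
    have g: "kerp (splice n a b (Suc k)) (a (Suc k))"
    proof (cases "Suc k = n")
      case True then show ?thesis using s by (simp add: splice_def ses_def)
    next
      case False
      then show ?thesis using s ladderD[OF L(1), of "Suc k"] ladderD[OF L(1), of "Suc (Suc k)"] k
        by (simp add: splice_def ses_def kerp_cmp_mono)
    qed
    have kb: "kerp (b (Suc k)) (a (Suc k))" using s by (simp add: ses_def)
    have "exact_at C (src (splice n a b k)) (src (splice n a b (Suc k))) (tgt (splice n a b (Suc k)))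
       (val (splice n a b k)) (val (splice n a b (Suc k)))"
      using exact_at_iff[of "splice n a b k" "splice n a b (Suc k)"] c g kb k splice_arr[OF L, of k] splice_arr[OF L, of "Suc k"]
      by auto
    then show "exact_at C (E k) (E (k + 1)) (E (k + 2)) (d k) (d (k + 1))"
      using D[of k] D[of "Suc k"] k by (metis Suc_eq_plus1 Suc_leI add_2_eq_Suc' arrow.sel less_imp_le)
  qed
  then show ?thesis using that[of "(E, d)"] L D by (simp add: ext_lad_def)
qed

end

section \<open>Extensions as ladders, and their morphisms\<close>

context abelian_enough_projectives
begin

text \<open>The short exact pieces are the kernels of the differentials; each differential factors
  through the kernel of the next one, and exactness makes that factor an epimorphism.\<close>

lemma extension_ladder:
  assumes x: "x \<in> extensions C n X Y" and n: "1 \<le> n"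
  obtains a b where "ext_lad n X Y x a b"
proof -
  define E d where "E = fst x" and "d = snd x"
  have e: "chain n C E d" "E 0 = Y" "E (n + 1) = X" "is_mono C (E 0) (E 1) (d 0)" "is_epi C (E n) (E (n + 1)) (d n)"
    "\<And>k. k < n \<Longrightarrow> exact_at C (E k) (E (k + 1)) (E (k + 2)) (d k) (d (k + 1))"
    using x unfolding extensions_def E_def d_def by auto
  define D where "D k = Arrow (E k) (d k) (E (Suc k))" for k
  have D: "arr (D k)" "src (D k) = E k" "tgt (D k) = E (Suc k)" if "k \<le> n" for k
    using e(1) that unfolding chain_def D_def by (auto intro: arrI)
  have ob: "E k \<in> Ob C" if "k \<le> Suc n" for k using e(1) that unfolding chain_def by simp
  have m: "mono (D 0)" using e(4) ob[of 0] ob[of 1] n by (simp add: D_def is_mono_iff)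
  have ep: "epi (D n)" using e(5) ob[of n] ob[of "Suc n"] by (simp add: D_def is_epi_iff)
  have ex: "D k ;; D (Suc k) = zer (E k) (E (Suc (Suc k))) \<and>
     (\<forall>x. arr x \<and> proj (src x) \<and> tgt x = E (Suc k) \<and> x ;; D (Suc k) = zer (src x) (E (Suc (Suc k))) \<longrightarrow>
       (\<exists>y. arr y \<and> src y = src x \<and> tgt y = E k \<and> y ;; D k = x))" if "k < n" for k
  proof -
    have kn: "k \<le> n" "Suc k \<le> n" using that by simp_all
    have t: "tgt (D k) = src (D (Suc k))" using D[of k] D[of "Suc k"] that by simp
    have "exact_at C (src (D k)) (src (D (Suc k))) (tgt (D (Suc k))) (val (D k)) (val (D (Suc k)))"
      using e(6)[OF that] by (simp add: D_def)
    then obtain q i where q: "cokerp (D k) q" "kerp q i" "kerp (D (Suc k)) i"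
      using exact_at_iff[OF D(1)[OF kn(1)] D(1)[OF kn(2)] t] by blast
    note X = exact_el[OF q t]
    show ?thesis using X D[of k] D[of "Suc k"] that by simp
  qed
  \<comment> \<open>For \<open>k = 1\<close> the inclusion is \<open>D 0\<close> itself and not a
    chosen kernel, so the ladder starts at Y on the nose; in the same way \<open>b n\<close> will be
    \<open>D n\<close>.\<close>
  define a where "a k = (if k = 1 then D 0 else (SOME i. kerp (D k) i))" for k
  have a: "arr (a k)" "mono (a k)" "tgt (a k) = E k" "a k ;; D k = zer (src (a k)) (E (Suc k))"
    if k: "1 \<le> k" "k \<le> n" for k
  proof -
    have *: "arr (a k) \<and> mono (a k) \<and> tgt (a k) = E k \<and> a k ;; D k = zer (src (a k)) (E (Suc k))"
    proof (cases "k = 1")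
      case True
      then show ?thesis using m ex[of 0] D[of 0] k by (simp add: a_def)
    next
      case False
      obtain i where "kerp (D k) i" using ex_kerp[OF D(1)[OF k(2)]] .
      then have K: "kerp (D k) (a k)" using False unfolding a_def by (simp add: someI[of "kerp (D k)"])
      have "arr (a k)" "tgt (a k) = src (D k)" "a k ;; D k = zer (src (a k)) (tgt (D k))"
        using K unfolding kerp_def by blast+
      then show ?thesis using kerp_mono[OF K] D[OF k(2)] by simp
    qed
    then show "arr (a k)" "mono (a k)" "tgt (a k) = E k" "a k ;; D k = zer (src (a k)) (E (Suc k))" by blast+
  qed
  have ak: "\<exists>y. arr y \<and> src y = src x \<and> tgt y = src (a k) \<and> y ;; a k = x"
    if k: "1 < k" "k \<le> n" and x: "arr x" "tgt x = E k" "x ;; D k = zer (src x) (E (Suc k))" for k x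
  proof -
    obtain i where "kerp (D k) i" using ex_kerp[OF D(1)[OF k(2)]] .
    then have K: "kerp (D k) (a k)" using k unfolding a_def by (simp add: someI[of "kerp (D k)"])
    have "tgt x = src (D k)" "x ;; D k = zer (src x) (tgt (D k))" using x D[OF k(2)] by simp_all
    from kerp_factor[OF K x(1) this] show ?thesis by blast
  qed
  have "\<exists>b. arr b \<and> src b = E k \<and> (k < n \<longrightarrow> tgt b = src (a (Suc k)) \<and> b ;; a (Suc k) = D k) \<and> (k = n \<longrightarrow> b = D n)"
    if k: "1 \<le> k" "k \<le> n" for k
  proof (cases "k = n")
    case True then show ?thesis using D[of n] by auto
  next
    case False
    then obtain b where "arr b" "src b = src (D k)" "tgt b = src (a (Suc k))" "b ;; a (Suc k) = D k"
      using ak[of "Suc k" "D k"] ex[of k] D[of k] k by auto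
    then show ?thesis using False D[OF k(2)] by auto
  qed
  then obtain b where b: "\<And>k. 1 \<le> k \<Longrightarrow> k \<le> n \<Longrightarrow> arr (b k) \<and> src (b k) = E k \<and>
      (k < n \<longrightarrow> tgt (b k) = src (a (Suc k)) \<and> b k ;; a (Suc k) = D k) \<and> (k = n \<longrightarrow> b k = D n)"
    using bchoice[of "{1..n}" "\<lambda>k b. arr b \<and> src b = E k \<and>
      (k < n \<longrightarrow> tgt b = src (a (Suc k)) \<and> b ;; a (Suc k) = D k) \<and> (k = n \<longrightarrow> b = D n)"]
    unfolding Ball_def atLeastAtMost_iff by blast
  have im: "\<exists>z. arr z \<and> src z = src y \<and> tgt z = src (a k) \<and> z ;; a k = y ;; D (k - 1)"
    if k: "1 \<le> k" "k \<le> n" and y: "arr y" "tgt y = E (k - 1)" for k y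
  proof (cases "k = 1")
    case True
    then show ?thesis using y D[of 0] by (intro exI[of _ y]) (simp add: a_def)
  next
    case False
    then obtain l where l: "k = Suc l" "1 \<le> l" "l < n" using k by (cases k) auto
    have B: "arr (b l)" "src (b l) = E l" "tgt (b l) = src (a k)" "b l ;; a k = D l" using b[of l] l by auto
    show ?thesis using B y l a(1)[OF k] by (intro exI[of _ "y ;; b l"]) simp
  qed
  have S: "ses (a k) (b k)" if k: "1 \<le> k" "k \<le> n" for k
  proof -
    note A = a[OF k] and Dk = D[OF k(2)]
    have B: "arr (b k)" "src (b k) = E k" "k = n \<Longrightarrow> b k = D n"
      "k < n \<Longrightarrow> tgt (b k) = src (a (Suc k))" "k < n \<Longrightarrow> b k ;; a (Suc k) = D k" using b[OF k] by auto
    have A': "arr (a (Suc k))" "mono (a (Suc k))" if "k < n" using a[of "Suc k"] that by simp_all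
    \<comment> \<open>The arrows \<open>b k\<close> and \<open>D k\<close> differ at most by the
      monomorphism \<open>a (Suc k)\<close>, so they kill the same arrows.\<close>
    have z: "x ;; b k = zer (src x) (tgt (b k)) \<longleftrightarrow> x ;; D k = zer (src x) (E (Suc k))" if x: "arr x" "tgt x = E k" for x
    proof (cases "k = n")
      case True then show ?thesis using B Dk by simp
    next
      case False
      then have kn: "k < n" using k by simp
      have "x ;; D k = (x ;; b k) ;; a (Suc k)" using B x kn A' by simp
      then have e: "x ;; D k = (x ;; b k) ;; a (Suc k)" .
      have ta: "tgt (a (Suc k)) = E (Suc k)" using a[of "Suc k"] kn by simp
      show ?thesis
      proof
        assume w: "x ;; b k = zer (src x) (tgt (b k))"
        show "x ;; D k = zer (src x) (E (Suc k))" unfolding e w using B(4) x kn A' ta by simp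
      next
        assume w: "x ;; D k = zer (src x) (E (Suc k))"
        have "(x ;; b k) ;; a (Suc k) = zer (src x) (tgt (a (Suc k)))" unfolding e[symmetric] w ta ..
        then show "x ;; b k = zer (src x) (tgt (b k))"
          using monoD[OF A'(2)[OF kn], of "x ;; b k"] B(1,2,4) x kn by simp
      qed
    qed
    show ?thesis
    proof (rule ses_elI[OF A(2)])
      show "epi (b k)"
      proof (cases "k = n")
        case True then show ?thesis using B ep by simp
      next
        case False
        then have kn: "k < n" using k by simp
        show ?thesis
        proof (rule epi_elI[OF B(1)])
          fix x assume x: "arr x" "proj (src x)" "tgt x = tgt (b k)"
          note As = a[of "Suc k"]
          have "(x ;; a (Suc k)) ;; D (Suc k) = zer (src x) (E (Suc (Suc k)))"
            using x B kn A' As D[of "Suc k"] ob[of "Suc (Suc k)"] by simp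
          then obtain y where y: "arr y" "src y = src x" "tgt y = E k" "y ;; D k = x ;; a (Suc k)"
            using ex[OF kn, THEN conjunct2, rule_format, of "x ;; a (Suc k)"] x B(4)[OF kn] A'(1)[OF kn] As kn by auto
          have "(y ;; b k) ;; a (Suc k) = x ;; a (Suc k)" using y B kn A' by simp
          then have "y ;; b k = x" using mono_cancel[OF A'(2)[OF kn], of "y ;; b k" x] y B(1,2,4) kn x by simp
          then show "\<exists>y. arr y \<and> src y = src x \<and> tgt y = src (b k) \<and> y ;; b k = x" using y B by auto
        qed
      qed
      show "tgt (a k) = src (b k)" using A B by simp
      show "a k ;; b k = zer (src (a k)) (tgt (b k))" using z[of "a k"] A by simp
      fix x assume x: "arr x" "proj (src x)" "tgt x = src (b k)" "x ;; b k = zer (src x) (tgt (b k))"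
      then have xk: "tgt x = E k" "x ;; D k = zer (src x) (E (Suc k))" using z[of x] B by auto
      obtain l where l: "k = Suc l" "l < n" using k by (cases k) auto
      obtain y where y: "arr y" "src y = src x" "tgt y = E l" "y ;; D l = x"
        using ex[OF l(2)] x xk l by blast
      then show "\<exists>y. arr y \<and> src y = src x \<and> tgt y = src (a k) \<and> y ;; a k = x"
        using im[OF k, of y] l by simp
    qed
  qed
  have "ladder n a b" unfolding ladder_def using S b by auto
  moreover have "splice n a b k = D k" if kn: "k \<le> n" for k
  proof -
    consider "k = 0" | "0 < k" "k < n" | "0 < k" "k = n" using n kn by linarith
    then show ?thesis
    proof cases
      case 1 then show ?thesis using n by (simp add: splice_def a_def)
    next
      case 2 then show ?thesis using b[of k] by (simp add: splice_def)
    next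
      case 3 then show ?thesis using b[of k] by (simp add: splice_def)
    qed
  qed
  moreover have "src (a 1) = Y" using D[of 0] e(2) by (simp add: a_def)
  moreover have "tgt (b n) = X" using b[of n] n D[of n] e(3) by simp
  ultimately have "ext_lad n X Y x a b" unfolding ext_lad_def using x by (simp add: D_def E_def d_def)
  then show ?thesis using that by blast
qed

lemma ext_ladD:
  assumes "ext_lad n X Y x a b" "1 \<le> n"
  shows "ladder n a b" "src (a 1) = Y" "tgt (b n) = X" "fst x 0 = Y" "fst x (Suc n) = X"
    "\<And>k. 1 \<le> k \<Longrightarrow> k \<le> n \<Longrightarrow> fst x k = tgt (a k)"
    "\<And>k. k \<le> n \<Longrightarrow> Arrow (fst x k) (snd x k) (fst x (Suc k)) = splice n a b k"
    "\<And>k. k \<le> n \<Longrightarrow> arr (splice n a b k)" "X \<in> Ob C" "Y \<in> Ob C" "x \<in> extensions C n X Y"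
proof -
  show L: "ladder n a b" "src (a 1) = Y" "tgt (b n) = X" "x \<in> extensions C n X Y"
    and E: "\<And>k. k \<le> n \<Longrightarrow> Arrow (fst x k) (snd x k) (fst x (Suc k)) = splice n a b k"
    using assms unfolding ext_lad_def by auto
  show "\<And>k. k \<le> n \<Longrightarrow> arr (splice n a b k)" using splice_arr[OF L(1) assms(2)] by simp
  have s: "src (splice n a b k) = fst x k" "tgt (splice n a b k) = fst x (Suc k)" if "k \<le> n" for k
    using arg_cong[OF E[OF that], of src] arg_cong[OF E[OF that], of tgt] by simp_all
  show "fst x 0 = Y" using s(1)[of 0] splice_arr(2)[OF L(1) assms(2), of 0] L by simp
  show "fst x (Suc n) = X" using s(2)[of n] splice_arr(5)[OF L(1) assms(2), of n] L by simp
  show "fst x k = tgt (a k)" if "1 \<le> k" "k \<le> n" for k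
    using s(1)[OF that(2)] splice_arr(3)[OF L(1) assms(2) that(2)] that by simp
  show "X \<in> Ob C" "Y \<in> Ob C" using ladderD[OF L(1), of n] ladderD[OF L(1), of 1] assms(2) L by auto
qed

lemma extension_morphismI:
  assumes x: "ext_lad n X Y x a b" and y: "ext_lad n X Y y a' b'" and n: "1 \<le> n"
    and f: "lad_map n a b a' b' u f" "u 1 = idt Y" "u (Suc n) = idt X"
  shows "(x, y) \<in> extension_morphism C n X Y"
proof -
  note A = ext_ladD[OF x n] and A' = ext_ladD[OF y n]
  define h where "h k = (if k = 0 then idt Y else if k \<le> n then f k else idt X)" for k
  have h: "arr (h k)" "src (h k) = fst x k" "tgt (h k) = fst y k" if kn: "k \<le> Suc n" for k
  proof -
    consider "k = 0" | "1 \<le> k" "k \<le> n" | "k = Suc n" using kn by linarith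
    then have "arr (h k) \<and> src (h k) = fst x k \<and> tgt (h k) = fst y k"
      by cases (use A A' lad_mapD[OF f(1), of k] n in \<open>simp_all add: h_def\<close>)
    then show "arr (h k)" "src (h k) = fst x k" "tgt (h k) = fst y k" by blast+
  qed
  have sq: "splice n a b k ;; h (Suc k) = h k ;; splice n a' b' k" if k: "k \<le> n" for k
  proof -
    consider "k = 0" | "1 \<le> k" "k < n" | "1 \<le> k" "k = n" using n k by linarith
    then show ?thesis
    proof cases
      case 1
      then show ?thesis using lad_mapD[OF f(1), of 1] n f(2) ladderD(2)[OF A'(1), of 1] A'(2)
        by (simp add: splice_def h_def)
    next
      case 2
      note M = lad_mapD[OF f(1), of k] and M' = lad_mapD[OF f(1), of "Suc k"]
        and L = ladderD[OF A(1), of k] and L' = ladderD[OF A'(1), of k]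
        and K = ladderD(2)[OF A(1), of "Suc k"] and K' = ladderD(2)[OF A'(1), of "Suc k"]
      have "(b k ;; a (Suc k)) ;; f (Suc k) = b k ;; a (Suc k) ;; f (Suc k)" using 2 L K M' by simp
      also have "\<dots> = b k ;; u (Suc k) ;; a' (Suc k)" using 2 M'(10) by simp
      also have "\<dots> = (f k ;; b' k) ;; a' (Suc k)"
        by (rule cmp_reduce) (use 2 M M' L K' in simp_all)
      also have "\<dots> = f k ;; b' k ;; a' (Suc k)" using 2 M(1-3) L' K' by simp
      finally show ?thesis using 2 by (simp add: splice_def h_def)
    next
      case 3
      then show ?thesis using lad_mapD[OF f(1), of n] n f(3) ladderD(3)[OF A(1), of n] A(3)
        by (simp add: splice_def h_def)
    qed
  qed
  have hk: "val (h k) \<in> mor C (fst x k) (fst y k)" if "k \<le> n + 1" for k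
    using h[of k] that unfolding arr_def by simp
  have v: "Comp C (fst x k) (fst x (k + 1)) (fst y (k + 1)) (snd x k) (val (h (k + 1)))
      = Comp C (fst x k) (fst y k) (fst y (k + 1)) (val (h k)) (snd y k)" if "k \<le> n" for k
    using sq[OF that] h[of k] h[of "Suc k"] that unfolding A(7)[OF that, symmetric] A'(7)[OF that, symmetric]
    by (simp add: cmp_def)
  show ?thesis unfolding extension_morphism_def
  proof (intro CollectI, unfold case_prod_unfold, intro conjI exI[of _ "\<lambda>k. val (h k)"] allI impI)
    show "(fst (fst (x, y)), snd (fst (x, y))) \<in> extensions C n X Y"
      "(fst (snd (x, y)), snd (snd (x, y))) \<in> extensions C n X Y" using A A' by simp_all
    show "val (h 0) = Ident C Y" "val (h (n + 1)) = Ident C X" by (simp_all add: h_def idt_def)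
  qed (use hk v in simp_all)
qed

text \<open>A chain map restricts to the kernels: \<open>a k ;; h k\<close> is killed by
  \<open>b' k\<close>, which is tested after composing with the monomorphism
  \<open>a' (Suc k)\<close>, and so it factors through \<open>a' k\<close>.\<close>

lemma extension_morphismE:
  assumes xy: "(x, y) \<in> extension_morphism C n X Y" and n: "1 \<le> n"
    and x: "ext_lad n X Y x a b" and y: "ext_lad n X Y y a' b'"
  obtains u f where "lad_map n a b a' b' u f" "u 1 = idt Y" "u (Suc n) = idt X"
proof -
  note A = ext_ladD[OF x n] and A' = ext_ladD[OF y n]
  obtain g where g: "\<And>k. k \<le> n + 1 \<Longrightarrow> g k \<in> mor C (fst x k) (fst y k)" "g 0 = Ident C Y" "g (n + 1) = Ident C X"
    "\<And>k. k \<le> n \<Longrightarrow> Comp C (fst x k) (fst x (k + 1)) (fst y (k + 1)) (snd x k) (g (k + 1))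
        = Comp C (fst x k) (fst y k) (fst y (k + 1)) (g k) (snd y k)"
    using xy unfolding extension_morphism_def by (auto simp: case_prod_unfold)
  define h where "h k = Arrow (fst x k) (g k) (fst y k)" for k
  have obx: "fst x k \<in> Ob C" "fst y k \<in> Ob C" if "k \<le> Suc n" for k
    using A(11) A'(11) that unfolding extensions_def chain_def by (auto simp: case_prod_unfold)
  have h: "arr (h k)" "src (h k) = fst x k" "tgt (h k) = fst y k" if "k \<le> Suc n" for k
    using obx[OF that] g(1)[of k] that by (simp_all add: h_def arrI)
  have h0: "h 0 = idt Y" "h (Suc n) = idt X" using g A A' by (simp_all add: h_def idt_def)
  have sq: "splice n a b k ;; h (Suc k) = h k ;; splice n a' b' k" if k: "k \<le> n" for k
    unfolding A(7)[OF that, symmetric] A'(7)[OF that, symmetric] using g(4)[OF that] by (simp add: cmp_def h_def)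
  have ht: "src (h k) = tgt (a k)" "tgt (h k) = tgt (a' k)" if "1 \<le> k" "k \<le> n" for k
    using h[of k] A(6) A'(6) that by simp_all
  have hb: "splice n a b k ;; h (Suc k) = h k ;; b' k ;; a' (Suc k)" "splice n a b k = b k ;; a (Suc k)" if "1 \<le> k" "k < n" for k
    using sq[of k] that by (simp_all add: splice_def)
  have hn: "b n = h n ;; b' n" using sq[of n] n h0 ladderD(3)[OF A(1), of n] A(3) by (simp add: splice_def)
  have ex: "\<exists>u. arr u \<and> src u = src (a k) \<and> tgt u = src (a' k) \<and> u ;; a' k = a k ;; h k" if k: "1 \<le> k" "k \<le> n" for k
  proof -
    note L = ladderD[OF A(1) k] and L' = ladderD[OF A'(1) k] and H = h[of k] ht[OF k]
    have z: "(a k ;; h k) ;; b' k = zer (src (a k)) (tgt (b' k))"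
    proof (cases "k = n")
      case True
      have "(a k ;; h k) ;; b' k = a k ;; b k" using True hn L(2) H L' k by simp
      then show ?thesis using L True A A' by simp
    next
      case False
      then have kn: "k < n" using k by simp
      note K = ladderD[OF A(1), of "Suc k"] and K' = ladderD[OF A'(1), of "Suc k"]
      have "((a k ;; h k) ;; b' k) ;; a' (Suc k) = a k ;; h k ;; b' k ;; a' (Suc k)" using L(2) L' H K' kn k by simp
      also have "\<dots> = a k ;; (b k ;; a (Suc k)) ;; h (Suc k)" using hb[OF k(1) kn] by simp
      also have "\<dots> = a k ;; b k ;; a (Suc k) ;; h (Suc k)" using L K h[of "Suc k"] ht[of "Suc k"] kn by simp
      also have "\<dots> = zer (src (a k)) (tgt (a' (Suc k)))"
        using L(1-4,6-8) K(2) h[of "Suc k"] ht[of "Suc k"] kn by (simp add: cmp_reduce[OF L(5)])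
      finally show ?thesis using monoD[OF K'(6), of "(a k ;; h k) ;; b' k"] kn L(2) L' H k by simp
    qed
    have "arr (a k ;; h k)" "tgt (a k ;; h k) = src (b' k)" "(a k ;; h k) ;; b' k = zer (src (a k ;; h k)) (tgt (b' k))"
      using L(2) L' H k z by simp_all
    then obtain w where "arr w" "src w = src (a k ;; h k)" "tgt w = src (a' k)" "w ;; a' k = a k ;; h k"
      using ses_lift[OF L'(1)] by blast
    then show ?thesis by auto
  qed
  obtain u where u: "\<And>k. 1 \<le> k \<Longrightarrow> k \<le> n \<Longrightarrow> arr (u k) \<and> src (u k) = src (a k) \<and> tgt (u k) = src (a' k) \<and> u k ;; a' k = a k ;; h k"
    using bchoice[of "{1..n}" "\<lambda>k u. arr u \<and> src u = src (a k) \<and> tgt u = src (a' k) \<and> u ;; a' k = a k ;; h k"] ex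
    unfolding Ball_def atLeastAtMost_iff by blast
  \<comment> \<open>The choice \<open>u\<close> stops at index \<open>n\<close>; at
    \<open>Suc n\<close> the arrow is the identity of the right end.\<close>
  define v where "v k = (if k \<le> n then u k else idt X)" for k
  have "lad_map n a b a' b' v h" unfolding lad_map_def
  proof (intro allI impI, elim conjE)
    fix k :: nat assume k: "1 \<le> k" "k \<le> n"
    note L = ladderD[OF A(1) k] and L' = ladderD[OF A'(1) k] and H = h[of k] ht[OF k] and U = u[OF k]
    have vs: "arr (v (Suc k)) \<and> src (v (Suc k)) = tgt (b k) \<and> tgt (v (Suc k)) = tgt (b' k) \<and> b k ;; v (Suc k) = h k ;; b' k"
    proof (cases "k = n")
      case True
      then show ?thesis using A A' hn L by (simp add: v_def)
    next
      case False
      then have kn: "k < n" using k by simp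
      note K = ladderD[OF A(1), of "Suc k"] and K' = ladderD[OF A'(1), of "Suc k"] and U' = u[of "Suc k"]
      have "(b k ;; u (Suc k)) ;; a' (Suc k) = b k ;; a (Suc k) ;; h (Suc k)" using U' kn L K' by simp
      also have "\<dots> = (b k ;; a (Suc k)) ;; h (Suc k)" using L K h[of "Suc k"] ht[of "Suc k"] kn by simp
      also have "\<dots> = h k ;; b' k ;; a' (Suc k)" using hb[OF k(1) kn] by simp
      also have "\<dots> = (h k ;; b' k) ;; a' (Suc k)" using L' K' H kn k by simp
      finally have "b k ;; u (Suc k) = h k ;; b' k"
        using mono_cancel[OF K'(6), of "b k ;; u (Suc k)" "h k ;; b' k"] U' kn L L' H k by simp
      then show ?thesis using U' kn L L' by (simp add: v_def)
    qed
    show "arr (h k) \<and> src (h k) = tgt (a k) \<and> tgt (h k) = tgt (a' k) \<and>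
         arr (v k) \<and> src (v k) = src (a k) \<and> tgt (v k) = src (a' k) \<and>
         arr (v (Suc k)) \<and> src (v (Suc k)) = tgt (b k) \<and> tgt (v (Suc k)) = tgt (b' k) \<and>
         a k ;; h k = v k ;; a' k \<and> b k ;; v (Suc k) = h k ;; b' k"
      using vs U H k by (simp add: v_def)
  qed
  moreover have "v 1 = idt Y"
  proof -
    have U: "arr (u 1)" "src (u 1) = src (a 1)" "tgt (u 1) = src (a' 1)" "u 1 ;; a' 1 = a 1 ;; h 1"
      using u[of 1] n by blast+
    have m: "mono (a' 1)" using ladderD(6)[OF A'(1), of 1] n by blast
    have "a 1 ;; h 1 = idt Y ;; a' 1" using sq[of 0, OF le0] by (simp add: splice_def h0(1))
    then have e: "u 1 ;; a' 1 = idt Y ;; a' 1" using U(4) by (rule trans[rotated])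
    have "par (u 1) (idt Y)" "tgt (u 1) = src (a' 1)" using U(1-3) A(2) A'(2,10) by simp_all
    then have "u 1 = idt Y" by (rule mono_cancel[OF m _ _ e])
    then show ?thesis using n unfolding v_def by simp
  qed
  moreover have "v (Suc n) = idt X" by (simp add: v_def)
  ultimately show ?thesis by (rule that)
qed

end

section \<open>Projective resolutions and the classification of extensions\<close>

context abelian_enough_projectives
begin

text \<open>A truncated projective resolution of \<open>tgt (q n)\<close>; for positive
  \<open>n\<close> the object \<open>src (p 1)\<close> is its n-th syzygy.\<close>

definition plad :: "nat \<Rightarrow> (nat \<Rightarrow> ('o, 'a) arrow) \<Rightarrow> (nat \<Rightarrow> ('o, 'a) arrow) \<Rightarrow> bool"
  where "plad n p q \<longleftrightarrow> ladder n p q \<and> (\<forall>k. 1 \<le> k \<and> k \<le> n \<longrightarrow> proj (tgt (p k)))"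

lemma ladder_mono: "ladder (Suc n) a b \<Longrightarrow> ladder n a b"
  unfolding ladder_def by auto

lemma plad_mono: "plad (Suc n) a b \<Longrightarrow> plad n a b"
  unfolding plad_def using ladder_mono by auto

lemma ladder_snoc:
  assumes "ladder n a b" "ses f g" "1 \<le> n \<Longrightarrow> tgt (b n) = src f"
  shows "ladder (Suc n) (a(Suc n := f)) (b(Suc n := g))"
  using assms unfolding ladder_def by (auto simp: le_Suc_eq)

lemma plad_snoc:
  assumes "plad n a b" "ses f g" "proj (src g)" "1 \<le> n \<Longrightarrow> tgt (b n) = src f"
  shows "plad (Suc n) (a(Suc n := f)) (b(Suc n := g))"
  using assms ladder_snoc[of n a b f g] sesD(3)[OF assms(2)] unfolding plad_def by (auto simp: le_Suc_eq)

lemma ex_plad: assumes "X \<in> Ob C" obtains p q where "plad (Suc n) p q" "tgt (q (Suc n)) = X"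
proof -
  have "\<exists>p q. plad (Suc n) p q \<and> tgt (q (Suc n)) = X" using assms
  proof (induction n arbitrary: X)
    case 0
    obtain f g where S: "ses f g" "tgt g = X" "proj (src g)" using cover_ses[OF 0] .
    have "plad 0 (\<lambda>_. f) (\<lambda>_. g)" by (simp add: plad_def ladder_def)
    from plad_snoc[OF this S(1,3)] S(2) show ?case by force
  next
    case (Suc n)
    obtain f g where S: "ses f g" "tgt g = X" "proj (src g)" using cover_ses[OF Suc.prems] .
    obtain p q where p: "plad (Suc n) p q" "tgt (q (Suc n)) = src f" using Suc.IH[of "src f"] sesD(1)[OF S(1)] by auto
    have "plad (Suc (Suc n)) (p(Suc (Suc n) := f)) (q(Suc (Suc n) := g))" using plad_snoc[OF p(1) S(1,3)] p(2) by simp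
    then show ?case using S(2) by force
  qed
  then show ?thesis using that by blast
qed

text \<open>The comparison theorem, from the right end to the left: projectivity lifts the arrow to
  the middle terms, and its restriction to the kernels is the input of the next step.\<close>

lemma lad_map_ex:
  assumes "plad n p q" "ladder n a b" "arr c" "1 \<le> n \<Longrightarrow> src c = tgt (q n)" "1 \<le> n \<Longrightarrow> tgt c = tgt (b n)"
  shows "\<exists>u f. lad_map n p q a b u f \<and> u (Suc n) = c"
  using assms
proof (induction n arbitrary: c)
  case 0
  then show ?case by (intro exI[of _ "\<lambda>_. c"]) (simp add: lad_map_def)
next
  case (Suc n)
  note P = ladderD[of "Suc n" p q "Suc n"] and A = ladderD[OF Suc.prems(2), of "Suc n"]
  have L: "ladder (Suc n) p q" and Q: "proj (tgt (p (Suc n)))" using Suc.prems(1) by (auto simp: plad_def)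
  have S: "ses (p (Suc n)) (q (Suc n))" "ses (a (Suc n)) (b (Suc n))" using P(1)[OF L] A(1) by auto
  have Q': "proj (src (q (Suc n)))" using Q sesD(3)[OF S(1)] by simp
  have c: "src c = tgt (q (Suc n))" "tgt c = tgt (b (Suc n))" using Suc.prems by auto
  obtain t s where t: "arr t" "src t = src (q (Suc n))" "tgt t = src (b (Suc n))" "t ;; b (Suc n) = q (Suc n) ;; c"
    and s: "arr s" "src s = src (p (Suc n))" "tgt s = src (a (Suc n))" "p (Suc n) ;; t = s ;; a (Suc n)"
    using ses_cmp[OF S Q' Suc.prems(3) c] .
  have "1 \<le> n \<Longrightarrow> src s = tgt (q n)" "1 \<le> n \<Longrightarrow> tgt s = tgt (b n)"
    using ladderD(8)[OF L, of n] ladderD(8)[OF Suc.prems(2), of n] s by simp_all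
  from Suc.IH[OF plad_mono[OF Suc.prems(1)] ladder_mono[OF Suc.prems(2)] s(1) this]
  obtain u f where u: "lad_map n p q a b u f" "u (Suc n) = s" by blast
  have "lad_map (Suc n) p q a b (u(Suc (Suc n) := c)) (f(Suc n := t))" unfolding lad_map_def
  proof (intro allI impI, elim conjE)
    fix k :: nat assume k: "1 \<le> k" "k \<le> Suc n"
    let ?u = "u(Suc (Suc n) := c)" and ?f = "f(Suc n := t)"
    show "arr (?f k) \<and> src (?f k) = tgt (p k) \<and> tgt (?f k) = tgt (a k) \<and>
       arr (?u k) \<and> src (?u k) = src (p k) \<and> tgt (?u k) = src (a k) \<and>
       arr (?u (Suc k)) \<and> src (?u (Suc k)) = tgt (q k) \<and> tgt (?u (Suc k)) = tgt (b k) \<and>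
       p k ;; ?f k = ?u k ;; a k \<and> q k ;; ?u (Suc k) = ?f k ;; b k"
    proof (cases "k = Suc n")
      case True
      then show ?thesis using t s u(2) c Suc.prems(3) sesD(3)[OF S(1)] sesD(3)[OF S(2)] by simp
    next
      case False
      then show ?thesis using lad_mapD[OF u(1), of k] k by simp
    qed
  qed
  moreover have "(u(Suc (Suc n) := c)) (Suc (Suc n)) = c" by simp
  ultimately show ?case by blast
qed

text \<open>One step of a chain homotopy. The arrow \<open>f\<close> minus \<open>g\<close> minus
  \<open>q ;; r\<close> is killed by \<open>b\<close>; its factor through \<open>a\<close> is the
  next homotopy \<open>s\<close>, and \<open>q ;; r\<close> disappears after composing with
  \<open>p\<close>.\<close>

lemma htpy_step:
  assumes S: "ses p q" "ses a b"
    and f: "arr f" "src f = tgt p" "tgt f = tgt a" and g: "arr g" "src g = tgt p" "tgt g = tgt a"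
    and u: "arr u" "src u = src p" "tgt u = src a" and v: "arr v" "src v = src p" "tgt v = src a"
    and u': "arr u'" "src u' = tgt q" "tgt u' = tgt b" and v': "arr v'" "src v' = tgt q" "tgt v' = tgt b"
    and e: "p ;; f = u ;; a" "p ;; g = v ;; a" "q ;; u' = f ;; b" "q ;; v' = g ;; b"
    and r: "arr r" "src r = tgt q" "tgt r = tgt a" "r ;; b = u' \<boxplus> neg v'"
  shows "\<exists>s. arr s \<and> src s = tgt p \<and> tgt s = src a \<and> p ;; s = u \<boxplus> neg v"
proof -
  note d = sesD[OF S(1)] and d' = sesD[OF S(2)]
  define w where "w = (f \<boxplus> neg g) \<boxplus> neg (q ;; r)"
  have w: "arr w" "src w = tgt p" "tgt w = tgt a" unfolding w_def using f g r d by simp_all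
  have "w ;; b = (f ;; b \<boxplus> neg (g ;; b)) \<boxplus> neg (q ;; r ;; b)" unfolding w_def using f g r(1-3) d d' by simp
  also have "q ;; r ;; b = f ;; b \<boxplus> neg (g ;; b)" unfolding r(4) using e(3,4) u' v' d by simp
  also have "f ;; b \<boxplus> neg (g ;; b) \<boxplus> neg (f ;; b \<boxplus> neg (g ;; b)) = zer (src w) (tgt b)"
    by (subst add_neg) (use f g d' w in simp_all)
  finally have "w ;; b = zer (src w) (tgt b)" .
  then obtain s where s: "arr s" "src s = src w" "tgt s = src a" "s ;; a = w"
    using ses_lift[OF S(2), of w] w d' by auto
  have "p ;; w = (p ;; f \<boxplus> neg (p ;; g)) \<boxplus> neg (p ;; q ;; r)" unfolding w_def using f g r(1-3) d by simp
  also have "p ;; q ;; r = zer (src p) (tgt a)" using r(1-3) d(1-3) by (simp add: cmp_reduce[OF d(4)])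
  also have "(p ;; f \<boxplus> neg (p ;; g)) \<boxplus> neg (zer (src p) (tgt a)) = (u \<boxplus> neg v) ;; a"
    unfolding e(1,2) using u v d d' by simp
  finally have "(p ;; s) ;; a = (u \<boxplus> neg v) ;; a" using s w d d' by simp
  then have "p ;; s = u \<boxplus> neg v"
    using mono_cancel[OF d'(5), of "p ;; s" "u \<boxplus> neg v"] s w d u v by simp
  then show ?thesis using s w by auto
qed

text \<open>Two comparison maps with the same right end are homotopic, so on each syzygy their
  difference extends over the projective object above it. The downward induction starts with the
  zero homotopy at the right end.\<close>

lemma lad_map_htpy:
  assumes P: "plad n p q" and A: "ladder n a b" and U: "lad_map n p q a b u f" and V: "lad_map n p q a b v g"
    and top: "u (Suc n) = v (Suc n)" and k: "1 \<le> k" "k \<le> n"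
  shows "\<exists>s. arr s \<and> src s = tgt (p k) \<and> tgt s = src (a k) \<and> p k ;; s = u k \<boxplus> neg (v k)"
  using k(2)
proof (induction k rule: inc_induct)
  have L: "ladder n p q" using P by (simp add: plad_def)
  have step: "\<exists>s. arr s \<and> src s = tgt (p m) \<and> tgt s = src (a m) \<and> p m ;; s = u m \<boxplus> neg (v m)"
    if m: "1 \<le> m" "m \<le> n" and r: "arr r" "src r = tgt (q m)" "tgt r = tgt (a m)" "r ;; b m = u (Suc m) \<boxplus> neg (v (Suc m))" for m r
  proof -
    note U' = lad_mapD[OF U m] and V' = lad_mapD[OF V m]
    show ?thesis
      by (rule htpy_step[OF ladderD(1)[OF L m] ladderD(1)[OF A m] U'(1-3) V'(1-3) U'(4-6) V'(4-6) U'(7-9) V'(7-9)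
          U'(10) V'(10) U'(11) V'(11) r])
  qed
  {
    case base
    have n: "1 \<le> n" "n \<le> n" using k by simp_all
    note d = ladderD[OF A n] and d' = ladderD[OF L n] and V' = lad_mapD[OF V n]
    show ?case
      by (rule step[OF n, of "zer (tgt (q n)) (tgt (a n))"]) (use d d' V' top in simp_all)
  next
    case (step m)
    have m: "1 \<le> m" "m \<le> n" "1 \<le> Suc m" "Suc m \<le> n" using step k by simp_all
    note d = ladderD[OF A m(1,2)] and d' = ladderD[OF L m(1,2)] and V' = lad_mapD[OF V m(3,4)] and U' = lad_mapD[OF U m(3,4)]
      and D = ladderD[OF A m(3,4)] and D' = ladderD[OF L m(3,4)]
    obtain s where s: "arr s" "src s = tgt (p (Suc m))" "tgt s = src (a (Suc m))" "p (Suc m) ;; s = u (Suc m) \<boxplus> neg (v (Suc m))"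
      using step.IH by blast
    have Q: "proj (src s)" using P m s by (simp add: plad_def)
    have ts: "tgt s = tgt (b m)" using s d(8) m by simp
    obtain t where t: "arr t" "src t = src s" "tgt t = src (b m)" "t ;; b m = s"
      using ses_el[OF d(1) s(1) ts Q] .
    have t': "(p (Suc m) ;; t) ;; b m = u (Suc m) \<boxplus> neg (v (Suc m))" using t s D'(2) d(3) by simp
    show ?case
      by (rule \<open>\<And>m r. 1 \<le> m \<Longrightarrow> m \<le> n \<Longrightarrow> arr r \<Longrightarrow> src r = tgt (q m) \<Longrightarrow> tgt r = tgt (a m) \<Longrightarrow>
          r ;; b m = u (Suc m) \<boxplus> neg (v (Suc m)) \<Longrightarrow> _ m\<close>[OF m(1,2) _ _ _ t'])
        (use t(1-3) s(1-3) D'(2) d(4) d'(8) m in simp_all)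
  }
qed

text \<open>Unfolding \<open>evan\<close> along the resolution shifts the degree down to the first
  step, where vanishing means that arrows from the syzygy \<open>src (p 1)\<close> into Y extend
  over \<open>p 1\<close>. The converse is \<open>evan_ladderI\<close>.\<close>

lemma evan_ladder:
  assumes "plad (Suc m) p q" "evan m (tgt (q (Suc m))) Y" "arr a" "src a = src (p 1)" "tgt a = Y"
  shows "\<exists>c. arr c \<and> src c = tgt (p 1) \<and> tgt c = Y \<and> p 1 ;; c = a"
  using assms(1,2)
proof (induction m)
  case 0
  then have "ses (p 1) (q 1)" unfolding plad_def ladder_def by simp
  from evan_0D[OF _ this assms(3-5)] 0 show ?case by auto
next
  case (Suc m)
  have L: "ladder (Suc (Suc m)) p q" "proj (tgt (p (Suc (Suc m))))" using Suc.prems(1) unfolding plad_def by auto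
  have S: "ses (p (Suc (Suc m))) (q (Suc (Suc m)))" "tgt (q (Suc m)) = src (p (Suc (Suc m)))"
    using L(1) unfolding ladder_def by auto
  have "evan m (src (p (Suc (Suc m)))) Y" using evan_SucD[OF Suc.prems(2) S(1)] L(2) sesD(3)[OF S(1)] by simp
  then show ?case using Suc.IH[OF plad_mono[OF Suc.prems(1)]] S(2) by simp
qed

lemma evan_ladderI:
  assumes "X \<in> Ob C" and "\<And>p q a. plad (Suc m) p q \<Longrightarrow> tgt (q (Suc m)) = X \<Longrightarrow> arr a \<Longrightarrow> src a = src (p 1) \<Longrightarrow> tgt a = Y \<Longrightarrow>
    \<exists>c. arr c \<and> src c = tgt (p 1) \<and> tgt c = Y \<and> p 1 ;; c = a"
  shows "evan m X Y"
  using assms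
proof (induction m arbitrary: X)
  case 0
  obtain f g where S: "ses f g" "tgt g = X" "proj (src g)" using cover_ses[OF 0(1)] .
  have "plad 0 (\<lambda>_. f) (\<lambda>_. g)" by (simp add: plad_def ladder_def)
  from plad_snoc[OF this S(1,3)] have P: "plad (Suc 0) ((\<lambda>_. f)(Suc 0 := f)) ((\<lambda>_. g)(Suc 0 := g))" by simp
  have "evan 0 (tgt g) Y"
  proof (rule evan_0I[OF S(1,3)])
    fix a assume "arr a" "src a = src f" "tgt a = Y"
    then show "\<exists>b. arr b \<and> src b = tgt f \<and> tgt b = Y \<and> f ;; b = a" using 0(2)[OF P] S(2) by simp
  qed
  then show ?case using S by simp
next
  case (Suc m)
  show ?case unfolding evan.simps(2)
  proof (intro allI impI, elim conjE)
    fix f g assume S: "ses f g" "tgt g = X" "proj (src g)"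
    show "evan m (src f) Y"
    proof (rule Suc.IH)
      show "src f \<in> Ob C" using sesD(1)[OF S(1)] by simp
      fix p q a assume p: "plad (Suc m) p q" "tgt (q (Suc m)) = src f" and a: "arr a" "src a = src (p 1)" "tgt a = Y"
      have "plad (Suc (Suc m)) (p(Suc (Suc m) := f)) (q(Suc (Suc m) := g))" using plad_snoc[OF p(1) S(1,3)] p(2) by simp
      from Suc.prems(2)[OF this, of a] show "\<exists>c. arr c \<and> src c = tgt (p 1) \<and> tgt c = Y \<and> p 1 ;; c = a" using a S(2) by simp
    qed
  qed
qed

text \<open>Only the first step changes: it is replaced by its pushout along \<open>h\<close>. The
  last clause is the universal property: a comparison map that induces \<open>h\<close> factors
  through the pushout by a map that is the identity at both ends.\<close>

lemma pushout_ladder: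
  assumes P: "ladder n p q" "1 \<le> n" and h: "arr h" "src h = src (p 1)"
  obtains a b u f where "ladder n a b" "src (a 1) = tgt h" "tgt (b n) = tgt (q n)"
    "lad_map n p q a b u f" "u 1 = h" "u (Suc n) = idt (tgt (q n))"
    "\<forall>a' b' v g. ladder n a' b' \<and> lad_map n p q a' b' v g \<and> v 1 = h \<and> src (a' 1) = tgt h \<and> v (Suc n) = idt (tgt (q n)) \<longrightarrow>
       (\<exists>w k. lad_map n a b a' b' w k \<and> w 1 = idt (tgt h) \<and> w (Suc n) = idt (tgt (q n)))"
proof -
  have o: "(1::nat) \<le> 1" by simp
  note D1 = ladderD[OF P(1) o P(2)]
  obtain f1 g1 t where F: "ses f1 g1" "src f1 = tgt h" "tgt g1 = tgt (q 1)"
    and t: "arr t" "src t = src (q 1)" "tgt t = src g1" "t ;; g1 = q 1" "p 1 ;; t = h ;; f1"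
    using ex_pushout[OF D1(1) h] .
  note d = sesD[OF F(1)]
  define a b where "a = p(1 := f1)" and "b = q(1 := g1)"
  have ab: "a 1 = f1" "b 1 = g1" "\<And>k. k \<noteq> 1 \<Longrightarrow> a k = p k" "\<And>k. k \<noteq> 1 \<Longrightarrow> b k = q k"
    by (simp_all add: a_def b_def)
  have tb: "tgt (b k) = tgt (q k)" for k using F by (simp add: b_def)
  have L: "ladder n a b" unfolding ladder_def
  proof (intro allI impI conjI)
    fix k :: nat assume k: "1 \<le> k \<and> k \<le> n"
    show "ses (a k) (b k)" using ladderD(1)[OF P(1), of k] F(1) k by (cases "k = 1") (simp_all add: ab ab(1,2)[unfolded One_nat_def])
    assume "k < n"
    then show "tgt (b k) = src (a (Suc k))" using ladderD(8)[OF P(1), of k] k by (simp add: tb ab)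
  qed
  define u where "u k = (if k = 1 then h else if k \<le> n then idt (src (p k)) else idt (tgt (q n)))" for k
  define f where "f k = (if k = 1 then t else idt (tgt (p k)))" for k
  have uS: "u (Suc k) = idt (tgt (q k))" if "1 \<le> k" "k \<le> n" for k
    using that ladderD(8)[OF P(1), of k] by (cases "k = n") (simp_all add: u_def)
  have M: "lad_map n p q a b u f" unfolding lad_map_def
  proof (intro allI impI, elim conjE)
    fix k :: nat assume k: "1 \<le> k" "k \<le> n"
    note D = ladderD[OF P(1) k]
    show "arr (f k) \<and> src (f k) = tgt (p k) \<and> tgt (f k) = tgt (a k) \<and>
       arr (u k) \<and> src (u k) = src (p k) \<and> tgt (u k) = src (a k) \<and>
       arr (u (Suc k)) \<and> src (u (Suc k)) = tgt (q k) \<and> tgt (u (Suc k)) = tgt (b k) \<and>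
       p k ;; f k = u k ;; a k \<and> q k ;; u (Suc k) = f k ;; b k"
    proof (cases "k = 1")
      case True
      have "u (Suc 0) = h" "f (Suc 0) = t" "a (Suc 0) = f1" "b (Suc 0) = g1" using ab by (simp_all add: u_def f_def)
      then show ?thesis using uS[OF k] True t h F D d by simp
    next
      case False
      then show ?thesis using uS[OF k] k D ab(3,4)[OF False] by (simp add: u_def f_def)
    qed
  qed
  have uni: "\<exists>w k. lad_map n a b a' b' w k \<and> w 1 = idt (tgt h) \<and> w (Suc n) = idt (tgt (q n))"
    if A': "ladder n a' b'" "lad_map n p q a' b' v g" "v 1 = h" "src (a' 1) = tgt h" "v (Suc n) = idt (tgt (q n))" for a' b' v g
  proof -
    note V = lad_mapD[OF A'(2) o P(2)] and D' = ladderD[OF A'(1) o P(2)]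
    have 1: "p 1 ;; g 1 = h ;; a' 1" using V(10) A'(3) by simp
    have 2: "src (a' 1) = src f1" "src (g 1) = src (q 1)" "tgt (g 1) = tgt (a' 1)" using A'(4) F V D1 by simp_all
    obtain x where x: "arr x" "src x = src g1" "tgt x = tgt (a' 1)" "f1 ;; x = a' 1" "t ;; x = g 1"
      by (rule pushout_glue[OF D1(1) F(1) t(1-4) h F(2)[symmetric] t(5) D'(2) 2(1) V(1) 2(2,3) 1])
    \<comment> \<open>The difference \<open>y\<close> of the two sides vanishes after
      \<open>f1\<close> and after \<open>t\<close>. The former lets it factor through
      \<open>g1\<close>, and by the latter the factor is killed by the epimorphism
      \<open>q 1\<close>.\<close>
    have xb: "x ;; b' 1 = g1 ;; v (Suc 1)"
    proof -
      have "f1 ;; x ;; b' 1 = a' 1 ;; b' 1" by (rule cmp_reduce[OF x(4)]) (use x(1-3) d D' in simp_all)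
      also have "\<dots> = zer (src f1) (tgt (b' 1))" using D' 2 by simp
      finally have e1: "f1 ;; x ;; b' 1 = zer (src f1) (tgt (b' 1))" .
      have "t ;; x ;; b' 1 = g 1 ;; b' 1" by (rule cmp_reduce[OF x(5)]) (use x(1-3) t D' in simp_all)
      also have "\<dots> = (t ;; g1) ;; v (Suc 1)" using V(11) t(4) by simp
      also have "\<dots> = t ;; g1 ;; v (Suc 1)" using t(1-3) d V(7,8) F(3) by simp
      finally have e2: "t ;; x ;; b' 1 = t ;; g1 ;; v (Suc 1)" .
      define y where "y = x ;; b' 1 \<boxplus> neg (g1 ;; v (Suc 1))"
      have y: "arr y" "src y = src g1" "tgt y = tgt (b' 1)" unfolding y_def using x(1-3) D' d V(7-9) F(3) by simp_all
      have "f1 ;; g1 ;; v (Suc 1) = zer (src f1) (tgt (b' 1))" using d(1-3) V(7-9) F(3) by (simp add: cmp_reduce[OF d(4)])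
      then have fy: "f1 ;; y = zer (src f1) (tgt y)" unfolding y_def using e1 x(1-3) D' d V(7-9) F(3) by simp
      have ty: "t ;; y = zer (src t) (tgt y)" unfolding y_def using e2 x(1-3) D' d V(7-9) F(3) t(1-3) by simp
      have "src y = tgt f1" using y d by simp
      then obtain z where z: "arr z" "src z = tgt g1" "tgt z = tgt y" "g1 ;; z = y"
        using ses_extend[OF F(1) y(1) _ fy] by blast
      have "q 1 ;; z = t ;; g1 ;; z" by (rule cmp_reduce[OF t(4), symmetric]) (use t(1-3) d z in simp_all)
      also have "\<dots> = zer (src (q 1)) (tgt z)" unfolding z(4) ty using t(2) z(3) by simp
      finally have "z = zer (tgt g1) (tgt z)" using epiD[OF D1(7) z(1)] z F(3) by simp
      then have "y = zer (src g1) (tgt y)" using z d by (metis arr_ob(2) cmp_zer)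
      then show ?thesis unfolding y_def using add_neg_eq_zer[of "x ;; b' 1" "g1 ;; v (Suc 1)"] x(1-3) D' d V(7-9) F(3) by simp
    qed
    define w k where "w = v(1 := idt (tgt h))" and "k = g(1 := x)"
    have "lad_map n a b a' b' w k" unfolding lad_map_def
    proof (intro allI impI, elim conjE)
      fix l :: nat assume l: "1 \<le> l" "l \<le> n"
      note V = lad_mapD[OF A'(2) l]
      have wS: "w (Suc l) = v (Suc l)" using l by (simp add: w_def)
      show "arr (k l) \<and> src (k l) = tgt (a l) \<and> tgt (k l) = tgt (a' l) \<and>
       arr (w l) \<and> src (w l) = src (a l) \<and> tgt (w l) = src (a' l) \<and>
       arr (w (Suc l)) \<and> src (w (Suc l)) = tgt (b l) \<and> tgt (w (Suc l)) = tgt (b' l) \<and>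
       a l ;; k l = w l ;; a' l \<and> b l ;; w (Suc l) = k l ;; b' l"
      proof (cases "l = 1")
        case True
        have "w (Suc 0) = idt (tgt h)" "k (Suc 0) = x" "a (Suc 0) = f1" "b (Suc 0) = g1" using ab by (simp_all add: w_def k_def)
        then show ?thesis using True x xb h F d wS V(7-9) D' A'(4) by simp
      next
        case False
        then show ?thesis using V ab(3,4)[OF False] wS by (simp add: w_def k_def)
      qed
    qed
    moreover have "w 1 = idt (tgt h)" "w (Suc n) = idt (tgt (q n))" using A'(5) P(2) by (simp_all add: w_def)
    ultimately show ?thesis by blast
  qed
  show ?thesis
  proof (rule that[OF L _ _ M])
    show "src (a 1) = tgt h" using F ab by simp
    show "tgt (b n) = tgt (q n)" by (rule tb)
    show "u 1 = h" by (simp add: u_def)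
    show "u (Suc n) = idt (tgt (q n))" using P(2) by (simp add: u_def)
  qed (use uni in blast)
qed

lemma ext_lad_refl: assumes "ext_lad n X Y x a b" "1 \<le> n" shows "(x, x) \<in> extension_morphism C n X Y"
proof -
  note A = ext_ladD[OF assms]
  define u where "u k = (if k \<le> n then idt (src (a k)) else idt X)" for k
  have uS: "u (Suc k) = idt (tgt (b k))" if "1 \<le> k" "k \<le> n" for k
    using that ladderD(8)[OF A(1), of k] A(3) by (cases "k = n") (simp_all add: u_def)
  have "lad_map n a b a b u (\<lambda>k. idt (tgt (a k)))" unfolding lad_map_def
  proof (intro allI impI, elim conjE)
    fix k :: nat assume k: "1 \<le> k" "k \<le> n"
    note D = ladderD[OF A(1) k]
    show "arr (idt (tgt (a k))) \<and> src (idt (tgt (a k))) = tgt (a k) \<and> tgt (idt (tgt (a k))) = tgt (a k) \<and>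
         arr (u k) \<and> src (u k) = src (a k) \<and> tgt (u k) = src (a k) \<and>
         arr (u (Suc k)) \<and> src (u (Suc k)) = tgt (b k) \<and> tgt (u (Suc k)) = tgt (b k) \<and>
         a k ;; idt (tgt (a k)) = u k ;; a k \<and> b k ;; u (Suc k) = idt (tgt (a k)) ;; b k"
      using uS[OF k] k D by (simp add: u_def)
  qed
  then show ?thesis by (rule extension_morphismI[OF assms(1) assms(1,2)]) (use assms A in \<open>simp_all add: u_def\<close>)
qed

text \<open>For a fixed projective resolution, an extension is recorded by the arrow that a
  comparison map induces from the n-th syzygy to Y, taken up to arrows that extend over
  \<open>p 1\<close>. If all arrows extend, every comparison map can be corrected to induce zero, so
  the pushout along zero maps to every extension. Conversely, the property that the induced arrow
  extends is invariant under the equivalence and holds for the pushout along zero; if there is a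
  single class, it holds for the pushout along any \<open>h\<close>.\<close>

theorem Ext_zero_iff:
  assumes ob: "X \<in> Ob C" "Y \<in> Ob C"
  shows "Ext_zero C (Suc m) X Y \<longleftrightarrow> evan m X Y"
proof -
  define n where "n = Suc m"
  have n: "1 \<le> n" by (simp add: n_def)
  define R where "R = (extension_morphism C n X Y \<union> (extension_morphism C n X Y)\<inverse>)\<^sup>+"
  have Ext: "Ext C n X Y = extensions C n X Y // R" by (simp add: Ext_def R_def)
  have Msub: "extension_morphism C n X Y \<subseteq> extensions C n X Y \<times> extensions C n X Y"
    unfolding extension_morphism_def by auto
  have "R \<subseteq> extensions C n X Y \<times> extensions C n X Y"
    unfolding R_def by (rule trancl_subset_Sigma) (use Msub in auto)
  note Rsub = this
  \<comment> \<open>The pushout of the resolution along \<open>h\<close> induces \<open>h\<close>,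
    and it has a morphism to every other extension that induces \<open>h\<close>.\<close>
  have po: "\<exists>x a b u f. ext_lad n X Y x a b \<and> lad_map n p q a b u f \<and> u 1 = h \<and> u (Suc n) = idt X \<and>
     (\<forall>y a' b' v g. ext_lad n X Y y a' b' \<and> lad_map n p q a' b' v g \<and> v 1 = h \<and> v (Suc n) = idt X \<longrightarrow>
       (x, y) \<in> extension_morphism C n X Y)"
    if P: "plad n p q" "tgt (q n) = X" and h: "arr h" "src h = src (p 1)" "tgt h = Y" for p q h
  proof -
    have L: "ladder n p q" using P by (simp add: plad_def)
    obtain a b u f where F: "ladder n a b" "src (a 1) = tgt h" "tgt (b n) = tgt (q n)"
      "lad_map n p q a b u f" "u 1 = h" "u (Suc n) = idt (tgt (q n))"
      "\<forall>a' b' v g. ladder n a' b' \<and> lad_map n p q a' b' v g \<and> v 1 = h \<and> src (a' 1) = tgt h \<and> v (Suc n) = idt (tgt (q n)) \<longrightarrow>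
       (\<exists>w k. lad_map n a b a' b' w k \<and> w 1 = idt (tgt h) \<and> w (Suc n) = idt (tgt (q n)))"
      by (rule pushout_ladder[OF L n h(1,2)])
    obtain x where "ext_lad n (tgt (b n)) (src (a 1)) x a b" using ladder_extension[OF F(1) n] .
    then have x: "ext_lad n X Y x a b" using F(2,3) P h by simp
    have "(x, y) \<in> extension_morphism C n X Y"
      if y: "ext_lad n X Y y a' b'" "lad_map n p q a' b' v g" "v 1 = h" "v (Suc n) = idt X" for y a' b' v g
    proof -
      note A = ext_ladD[OF y(1) n]
      obtain w k where "lad_map n a b a' b' w k" "w 1 = idt Y" "w (Suc n) = idt X"
        using F(7)[rule_format, of a' b' v g] A(1,2) y(2-4) P h by auto
      then show ?thesis by (rule extension_morphismI[OF x y(1) n])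
    qed
    then show ?thesis using x F(4-6) P(2) by blast
  qed
  have lift: "\<exists>v g. lad_map n p q a b v g \<and> v (Suc n) = idt X"
    if "plad n p q" "tgt (q n) = X" "ext_lad n X Y x a b" for p q x a b
    using lad_map_ex[OF that(1) ext_ladD(1)[OF that(3) n], of "idt X"] that(2) ext_ladD(3)[OF that(3) n] ob by simp
  show ?thesis
  proof
    assume ev: "evan m X Y"
    obtain p q where P: "plad n p q" "tgt (q n) = X" using ex_plad[OF ob(1), of m] unfolding n_def by blast
    have L: "ladder n p q" using P by (simp add: plad_def)
    note D1 = ladderD[OF L le_refl n]
    have z: "arr (zer (src (p 1)) Y)" "src (zer (src (p 1)) Y) = src (p 1)" "tgt (zer (src (p 1)) Y) = Y"
      using D1 ob by simp_all
    obtain x0 a0 b0 where x0: "ext_lad n X Y x0 a0 b0"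
      "\<forall>y a' b' v g. ext_lad n X Y y a' b' \<and> lad_map n p q a' b' v g \<and> v 1 = zer (src (p 1)) Y \<and> v (Suc n) = idt X \<longrightarrow>
       (x0, y) \<in> extension_morphism C n X Y"
      using po[OF P z] by blast
    have M: "(x0, y) \<in> extension_morphism C n X Y" if y: "y \<in> extensions C n X Y" for y
    proof -
      obtain a b where A: "ext_lad n X Y y a b" using extension_ladder[OF y n] .
      note A' = ext_ladD[OF A n] and Da = ladderD[OF ext_ladD(1)[OF A n] le_refl n]
      obtain v g where v: "lad_map n p q a b v g" "v (Suc n) = idt X" using lift[OF P A] by blast
      note V = lad_mapD[OF v(1) le_refl n]
      obtain c where c: "arr c" "src c = tgt (p 1)" "tgt c = Y" "p 1 ;; c = v 1"
        using evan_ladder[of m p q Y "v 1"] P ev V A'(2) unfolding n_def by auto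
      \<comment> \<open>Subtracting \<open>c ;; a 1\<close> from the first middle arrow makes the
        induced arrow zero; since \<open>a 1 ;; b 1\<close> is zero, the square to the right stays
        commutative.\<close>
      define v' g' where "v' = v(1 := zer (src (p 1)) Y)" and "g' = g(1 := g 1 \<boxplus> neg (c ;; a 1))"
      have "lad_map n p q a b v' g'" unfolding lad_map_def
      proof (intro allI impI, elim conjE)
        fix k :: nat assume k: "1 \<le> k" "k \<le> n"
        note Vk = lad_mapD[OF v(1) k]
        have S: "v' (Suc k) = v (Suc k)" using k by (simp add: v'_def)
        show "arr (g' k) \<and> src (g' k) = tgt (p k) \<and> tgt (g' k) = tgt (a k) \<and>
         arr (v' k) \<and> src (v' k) = src (p k) \<and> tgt (v' k) = src (a k) \<and>
         arr (v' (Suc k)) \<and> src (v' (Suc k)) = tgt (q k) \<and> tgt (v' (Suc k)) = tgt (b k) \<and>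
         p k ;; g' k = v' k ;; a k \<and> q k ;; v' (Suc k) = g' k ;; b k"
        proof (cases "k = 1")
          case True
          have t: "v' 1 = zer (src (p 1)) Y" "g' 1 = g 1 \<boxplus> neg (c ;; a 1)" by (simp_all add: v'_def g'_def)
          have ca: "arr (c ;; a 1)" using c Da A'(2) by simp
          have "p 1 ;; c ;; a 1 = v 1 ;; a 1" by (rule cmp_reduce[OF c(4)]) (use c(1-3) D1 Da A'(2) in simp_all)
          then have "p 1 ;; (g 1 \<boxplus> neg (c ;; a 1)) = v 1 ;; a 1 \<boxplus> neg (v 1 ;; a 1)"
            using V(1-3,10) c(1-3) D1(2) Da(2) A'(2) by simp
          then have e1: "p 1 ;; (g 1 \<boxplus> neg (c ;; a 1)) = zer (src (p 1)) Y ;; a 1" using V(4-6) Da(2) D1(2) A'(2) by simp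
          have "(g 1 \<boxplus> neg (c ;; a 1)) ;; b 1 = g 1 ;; b 1 \<boxplus> neg (c ;; a 1 ;; b 1)"
            using V(1-3) c(1-3) Da(2-4) A'(2) by simp
          also have "\<dots> = g 1 ;; b 1" using V(1-3) c(1-3) Da(2-5) A'(2) arr_ob(2)[OF D1(2)] by simp
          finally have e2: "(g 1 \<boxplus> neg (c ;; a 1)) ;; b 1 = q 1 ;; v (Suc 1)" using V(11) by simp
          show ?thesis unfolding True t S[unfolded True]
            using e1 e2 V ca c(1-3) Da(2) A'(2) D1(2) ob by simp
        next
          case False
          then show ?thesis using Vk S by (simp add: v'_def g'_def)
        qed
      qed
      moreover have "v' 1 = zer (src (p 1)) Y" "v' (Suc n) = idt X" using v(2) n by (simp_all add: v'_def)
      ultimately show ?thesis using x0(2) A by blast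
    qed
    have R: "(x, y) \<in> R" if xy: "x \<in> extensions C n X Y" "y \<in> extensions C n X Y" for x y
    proof -
      have "(x, x0) \<in> (extension_morphism C n X Y)\<inverse>" "(x0, y) \<in> extension_morphism C n X Y" using M xy by auto
      then show ?thesis unfolding R_def by (meson UnI1 UnI2 trancl.simps)
    qed
    have "x0 \<in> extensions C n X Y" using x0(1) by (simp add: ext_lad_def)
    then have "extensions C n X Y // R = {extensions C n X Y}"
      using R Rsub unfolding quotient_def by blast
    then show "Ext_zero C (Suc m) X Y" using Ext unfolding Ext_zero_def is_singleton_def n_def by auto
  next
    assume "Ext_zero C (Suc m) X Y"
    then obtain Z where Z: "extensions C n X Y // R = {Z}" using Ext unfolding Ext_zero_def is_singleton_def n_def by auto
    have R: "(x, y) \<in> R" if xy: "x \<in> extensions C n X Y" "y \<in> extensions C n X Y" for x y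
    proof -
      have "R `` {x} \<in> {Z}" "R `` {y} \<in> {Z}" unfolding Z[symmetric] using xy by (auto intro: quotientI)
      then have e: "R `` {x} = R `` {y}" by simp
      \<comment> \<open>A transitive closure is not reflexive by definition; reflexivity comes from
        the identity morphism of the extension.\<close>
      obtain a b where "ext_lad n X Y y a b" using extension_ladder[OF xy(2) n] .
      then have "(y, y) \<in> extension_morphism C n X Y" using ext_lad_refl n by blast
      then have "(y, y) \<in> R" unfolding R_def by blast
      then show ?thesis using e by blast
    qed
    show "evan m X Y"
    proof (rule evan_ladderI[OF ob(1)])
      fix p q h assume P: "plad (Suc m) p q" "tgt (q (Suc m)) = X" and h: "arr h" "src h = src (p 1)" "tgt h = Y"
      have P': "plad n p q" "tgt (q n) = X" using P by (simp_all add: n_def)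
      have L: "ladder n p q" using P' by (simp add: plad_def)
      note D1 = ladderD[OF L le_refl n]
      define ext where "ext w \<longleftrightarrow> (\<exists>c. arr c \<and> src c = tgt (p 1) \<and> tgt c = Y \<and> p 1 ;; c = w)" for w
      \<comment> \<open>The invariant: some comparison map to \<open>x\<close> induces an arrow that
        extends over \<open>p 1\<close>. By \<open>indep\<close> some can be replaced by every,
        which makes it transferable backwards along morphisms of extensions.\<close>
      define I where "I x \<longleftrightarrow> (\<exists>a b v g. ext_lad n X Y x a b \<and> lad_map n p q a b v g \<and> v (Suc n) = idt X \<and> ext (v 1))" for x
      have indep: "ext (v 1)" if x: "ext_lad n X Y x a b" and u: "lad_map n p q a b u f" "u (Suc n) = idt X" "ext (u 1)"
         and v: "lad_map n p q a b v g" "v (Suc n) = idt X" for x a b u f v g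
      proof -
        note A = ext_ladD[OF x n] and U = lad_mapD[OF u(1) le_refl n] and V = lad_mapD[OF v(1) le_refl n]
        have top: "v (Suc n) = u (Suc n)" using u v by simp
        obtain s where s: "arr s" "src s = tgt (p 1)" "tgt s = Y" "p 1 ;; s = v 1 \<boxplus> neg (u 1)"
          using lad_map_htpy[OF P'(1) A(1) v(1) u(1) top le_refl n] A(2) by blast
        obtain c where c: "arr c" "src c = tgt (p 1)" "tgt c = Y" "p 1 ;; c = u 1" using u(3) unfolding ext_def by blast
        have "p 1 ;; (s \<boxplus> c) = (v 1 \<boxplus> neg (u 1)) \<boxplus> u 1" using s c D1(2) by simp
        also have "\<dots> = v 1" using U(4-6) V(4-6) by simp
        finally show ?thesis unfolding ext_def using s(1-3) c(1-3) by (intro exI[of _ "s \<boxplus> c"]) simp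
      qed
      have trans: "\<exists>w k. lad_map n p q a' b' w k \<and> w 1 = v 1 \<and> w (Suc n) = idt X"
        if xy: "(x, y) \<in> extension_morphism C n X Y" and x: "ext_lad n X Y x a b" and y: "ext_lad n X Y y a' b'"
          and v: "lad_map n p q a b v g" "v (Suc n) = idt X" for x y a b a' b' v g
      proof -
        note A = ext_ladD[OF x n] and A' = ext_ladD[OF y n] and V = lad_mapD[OF v(1) le_refl n]
        obtain w k where w: "lad_map n a b a' b' w k" "w 1 = idt Y" "w (Suc n) = idt X"
          using extension_morphismE[OF xy n x y] .
        have "lad_map n p q a' b' (\<lambda>k. v k ;; w k) (\<lambda>l. g l ;; k l)"
          by (rule lad_map_cmp[OF L A(1) A'(1) v(1) w(1)])
        moreover have "v 1 ;; w 1 = v 1" using w(2) V A(2) by simp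
        moreover have "v (Suc n) ;; w (Suc n) = idt X" using v(2) w(3) ob by simp
        ultimately show ?thesis by (intro exI[of _ "\<lambda>k. v k ;; w k"] exI[of _ "\<lambda>l. g l ;; k l"]) simp
      qed
      have I_M: "I x \<longleftrightarrow> I y" if xy: "(x, y) \<in> extension_morphism C n X Y" for x y
      proof -
        have "x \<in> extensions C n X Y" "y \<in> extensions C n X Y" using xy Msub by auto
        then obtain a b a' b' where A: "ext_lad n X Y x a b" "ext_lad n X Y y a' b'"
          using extension_ladder[OF _ n] by metis
        show ?thesis
        proof
          assume "I x"
          then obtain a b v g where v: "ext_lad n X Y x a b" "lad_map n p q a b v g" "v (Suc n) = idt X" "ext (v 1)"
            unfolding I_def by blast
          obtain w k where "lad_map n p q a' b' w k" "w 1 = v 1" "w (Suc n) = idt X"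
            using trans[OF xy v(1) A(2) v(2,3)] by blast
          then show "I y" unfolding I_def using A(2) v(4) by (intro exI[of _ a'] exI[of _ b'] exI[of _ w] exI[of _ k]) simp
        next
          assume "I y"
          then obtain a' b' v g where v: "ext_lad n X Y y a' b'" "lad_map n p q a' b' v g" "v (Suc n) = idt X" "ext (v 1)"
            unfolding I_def by blast
          obtain u f where u: "lad_map n p q a b u f" "u (Suc n) = idt X" using lift[OF P' A(1)] by blast
          obtain w k where w: "lad_map n p q a' b' w k" "w 1 = u 1" "w (Suc n) = idt X"
            using trans[OF xy A(1) v(1) u] by blast
          have "ext (w 1)" by (rule indep[OF v w(1,3)])
          then have "ext (u 1)" using w(2) by simp
          then show "I x" unfolding I_def using A(1) u by blast
        qed
      qed
      have I_R: "I x \<longleftrightarrow> I y" if "(x, y) \<in> R" for x y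
        using that unfolding R_def by (induction rule: trancl_induct) (use I_M in blast)+
      obtain x a b u f where x: "ext_lad n X Y x a b" "lad_map n p q a b u f" "u 1 = h" "u (Suc n) = idt X"
        using po[OF P' h] by blast
      obtain x0 a0 b0 u0 f0 where x0: "ext_lad n X Y x0 a0 b0" "lad_map n p q a0 b0 u0 f0" "u0 1 = zer (src (p 1)) Y" "u0 (Suc n) = idt X"
        using po[OF P', of "zer (src (p 1)) Y"] arr_zer[OF arr_ob(1)[OF D1(2)] ob(2)] src_tgt_ops(7,8) by blast
      have "ext (u0 1)" unfolding ext_def x0(3) using D1 ob by (intro exI[of _ "zer (tgt (p 1)) Y"]) simp
      then have "I x0" unfolding I_def using x0 by blast
      moreover have "(x0, x) \<in> R" using R x(1) x0(1) by (simp add: ext_lad_def)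
      ultimately have "I x" using I_R by blast
      then obtain a' b' v g where v: "ext_lad n X Y x a' b'" "lad_map n p q a' b' v g" "v (Suc n) = idt X" "ext (v 1)"
        unfolding I_def by blast
      obtain w k where w: "lad_map n p q a' b' w k" "w 1 = u 1" "w (Suc n) = idt X"
        using trans[OF ext_lad_refl[OF x(1) n] x(1) v(1) x(2,4)] by blast
      have "ext (w 1)" by (rule indep[OF v w(1,3)])
      then show "\<exists>c. arr c \<and> src c = tgt (p 1) \<and> tgt c = Y \<and> p 1 ;; c = h" using w(2) x(3) unfolding ext_def by simp
    qed
  qed
qed

end

section \<open>A criterion for cluster tilting\<close>

context abelian_enough_projectives
begin

definition left_approx :: "'o set \<Rightarrow> ('o, 'a) arrow \<Rightarrow> bool"
  where "left_approx N a \<longleftrightarrow> (\<forall>f. arr f \<and> src f = src a \<and> tgt f \<in> N \<longrightarrow>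
    (\<exists>g. arr g \<and> src g = tgt a \<and> tgt g = tgt f \<and> a ;; g = f))"

text \<open>Iterated left approximations and cokernels, as an n-cokernel provides them. The
  approximations need not be mono; the chain ends in an object without nonzero arrows into
  N.\<close>

primrec hchain :: "'o set \<Rightarrow> nat \<Rightarrow> 'o \<Rightarrow> bool" where
  "hchain N 0 G \<longleftrightarrow> (\<forall>f. arr f \<and> src f = G \<and> tgt f \<in> N \<longrightarrow> f = zer G (tgt f))"
| "hchain N (Suc m) G \<longleftrightarrow> (\<exists>a c. arr a \<and> src a = G \<and> tgt a \<in> N \<and> left_approx N a \<and> cokerp a c \<and> hchain N m (tgt c))"

text \<open>A partial resolution of \<open>m\<close> steps on which Hom into N is exact: each arrow
  from a syzygy into N extends over the middle term.\<close>

primrec xres :: "'o set \<Rightarrow> nat \<Rightarrow> 'o \<Rightarrow> bool" where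
  "xres N 0 G \<longleftrightarrow> True"
| "xres N (Suc m) G \<longleftrightarrow> (\<exists>f g. ses f g \<and> tgt g = G \<and> src g \<in> N \<and> left_approx N f \<and> xres N m (src f))"

primrec res :: "'o set \<Rightarrow> nat \<Rightarrow> 'o \<Rightarrow> bool" where
  "res N 0 G \<longleftrightarrow> zob G"
| "res N (Suc m) G \<longleftrightarrow> (\<exists>f g. ses f g \<and> tgt g = G \<and> src g \<in> N \<and> res N m (src f))"

primrec cores :: "'o set \<Rightarrow> nat \<Rightarrow> 'o \<Rightarrow> bool" where
  "cores N 0 G \<longleftrightarrow> zob G"
| "cores N (Suc m) G \<longleftrightarrow> (\<exists>f g. ses f g \<and> src f = G \<and> tgt f \<in> N \<and> cores N m (tgt g))"

definition cogen :: "'o set \<Rightarrow> 'o \<Rightarrow> bool"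
  where "cogen N G \<longleftrightarrow> (\<exists>m. mono m \<and> src m = G \<and> tgt m \<in> N)"

lemma left_approxD: assumes "left_approx N a" "arr f" "src f = src a" "tgt f \<in> N"
  obtains g where "arr g" "src g = tgt a" "tgt g = tgt f" "a ;; g = f"
  using assms unfolding left_approx_def by blast

lemma xres_mono: "xres N m G \<Longrightarrow> m' \<le> m \<Longrightarrow> xres N m' G"
proof (induction m arbitrary: m' G)
  case (Suc m)
  show ?case
  proof (cases m')
    case (Suc l)
    obtain f g where "ses f g" "tgt g = G" "src g \<in> N" "left_approx N f" "xres N m (src f)"
      using Suc.prems by auto
    then show ?thesis using Suc Suc.IH[of "src f" l] Suc.prems by auto
  qed simp
qed simp

lemma mono_coker_ses: assumes i: "mono i" and c: "cokerp i c" shows "ses i c"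
proof -
  obtain g where g: "ses i g" using mono_ses[OF i] .
  note d = sesD[OF g]
  have C: "arr c" "src c = tgt i" "i ;; c = zer (src i) (tgt c)" using c unfolding cokerp_def by blast+
  obtain w where w: "arr w" "src w = tgt c" "tgt w = tgt g" "c ;; w = g"
    using cokerp_factor[OF c d(2) d(3)[symmetric] d(4)] .
  show ?thesis
  proof (rule ses_elI[OF i cokerp_epi[OF c] C(2)[symmetric] C(3)])
    fix x assume x: "arr x" "tgt x = src c" "x ;; c = zer (src x) (tgt c)"
    have "x ;; g = x ;; c ;; w" by (simp add: w(4))
    also have "\<dots> = zer (src x) (tgt g)" using x(1,2) C(1) w(1-3) by (simp add: cmp_reduce[OF x(3)])
    finally have xg: "x ;; g = zer (src x) (tgt g)" .
    have "tgt x = src g" using x C d by simp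
    from ses_lift[OF g x(1) this xg] show "\<exists>y. arr y \<and> src y = src x \<and> tgt y = src i \<and> y ;; i = x" by blast
  qed
qed

lemma ses_split_right:
  assumes S: "ses f g" and w: "arr w" "src w = tgt f" "tgt w = src f" "f ;; w = idt (src f)"
  obtains r where "arr r" "src r = tgt g" "tgt r = src g" "r ;; g = idt (tgt g)"
proof -
  note d = sesD[OF S]
  define u where "u = idt (src g) \<boxplus> neg (w ;; f)"
  have u: "arr u" "src u = src g" "tgt u = src g" unfolding u_def using d w by simp_all
  have "f ;; u = f \<boxplus> neg (f ;; w ;; f)" unfolding u_def using d w(1-3) by simp
  also have "f ;; w ;; f = f" using d(1-3) w(1-3) by (simp add: cmp_reduce[OF w(4)])
  finally have "f ;; u = zer (src f) (tgt u)" using d u by simp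
  then obtain r where r: "arr r" "src r = tgt g" "tgt r = src g" "g ;; r = u"
    using ses_extend[OF S, of u thesis] u d by simp
  have "g ;; r ;; g = u ;; g" by (rule cmp_reduce[OF r(4)]) (use r(1-3) d in simp_all)
  also have "\<dots> = g \<boxplus> neg (w ;; f ;; g)" unfolding u_def using d(1-3) w(1-3) by simp
  also have "\<dots> = g ;; idt (tgt g)" using d w(1-3) by simp
  finally have "r ;; g = idt (tgt g)" using epi_cancel[OF d(6), of "r ;; g" "idt (tgt g)"] r(1-3) d by simp
  then show ?thesis using that r by blast
qed

lemma zob_mono: assumes "zob (src f)" "arr f" shows "mono f"
  by (rule monoI[OF assms(2)]) (use zob_to[OF assms(1)] in simp)

lemma mono_cmp: assumes "mono f" "mono g" "tgt f = src g" shows "mono (f ;; g)"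
proof -
  have a: "arr f" "arr g" using assms by (simp_all add: mono_def)
  show ?thesis
  proof (rule monoI)
    show "arr (f ;; g)" using a assms by simp
    fix x assume x: "arr x" "tgt x = src (f ;; g)" "x ;; f ;; g = zer (src x) (tgt (f ;; g))"
    then have "x ;; f = zer (src x) (tgt f)" using monoD[OF assms(2), of "x ;; f"] a assms by simp
    then show "x = zer (src x) (src (f ;; g))" using monoD[OF assms(1) x(1)] x by simp
  qed
qed

end

text \<open>What the argument uses about the essential image: \<open>N_hchain\<close> reflects
  n-cokernels, \<open>N_ker\<close> n-kernels, \<open>N_mono\<close> axiom (A2) and
  \<open>N_epi\<close> its dual. \<open>N_faithful\<close> says that an object without nonzero
  arrows into N is zero. In \<open>N_epi\<close> the sequence gives one approximation for the kernel
  itself and \<open>n - 2\<close> further ones.\<close>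

locale cluster_tilting_criterion = abelian_enough_projectives C for C :: "('o, 'a) pcat" +
  fixes N :: "'o set" and n :: nat
  assumes N_ob: "N \<subseteq> Ob C"
    and N_retract: "\<lbrakk>arr i; arr r; tgt i \<in> N; src r = tgt i; tgt r = src i; i ;; r = idt (src i)\<rbrakk> \<Longrightarrow> src i \<in> N"
    and N_bip: "\<lbrakk>bip i j p q; src i \<in> N; src j \<in> N\<rbrakk> \<Longrightarrow> tgt i \<in> N"
    and N_zero: "\<exists>Z\<in>N. zob Z"
    and N_proj: "proj P \<Longrightarrow> P \<in> N"
    and n_pos: "1 \<le> n"
    and N_faithful: "\<lbrakk>G \<in> Ob C; hchain N 0 G\<rbrakk> \<Longrightarrow> zob G"
    and N_hchain: "G \<in> Ob C \<Longrightarrow> hchain N n G"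
    and N_mono: "\<lbrakk>ses f g; src f \<in> N; tgt f \<in> N\<rbrakk> \<Longrightarrow> cogen N (tgt g)"
    and N_epi: "\<lbrakk>ses f g; src g \<in> N; tgt g \<in> N; 2 \<le> n\<rbrakk> \<Longrightarrow> left_approx N f \<and> xres N (n - 2) (src f)"
    and N_ker: "\<lbrakk>kerp f k; src f \<in> N; tgt f \<in> N\<rbrakk> \<Longrightarrow> res N n (src k) \<and>
      (\<exists>a. arr a \<and> src a \<in> N \<and> tgt a = src k \<and> (\<forall>g. arr g \<and> src g \<in> N \<and> tgt g = src k \<longrightarrow>
        (\<exists>h. arr h \<and> src h = src g \<and> tgt h = src a \<and> h ;; a = g)))"
begin

text \<open>Dimension shifting along the resolution; the last step, in the lowest degree, uses that
  the syzygy inclusion is a left approximation in place of a vanishing Ext group.\<close>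

lemma xres_evan:
  "xres N (Suc j) G \<Longrightarrow> Z \<in> Ob C \<Longrightarrow> Z \<in> N \<Longrightarrow> (\<And>i X. i \<le> j \<Longrightarrow> X \<in> N \<Longrightarrow> evan i X Z) \<Longrightarrow> evan j G Z"
proof (induction j arbitrary: G)
  case 0
  obtain f g where S: "ses f g" "tgt g = G" "src g \<in> N" "left_approx N f" using 0(1) by auto
  have "evan 0 (tgt f) Z" using 0(4)[of 0 "src g"] S sesD(3)[OF S(1)] by simp
  then have "evan 0 (tgt g) Z"
  proof (rule evan_0_right[OF S(1)])
    fix a assume "arr a" "src a = src f" "tgt a = Z"
    then show "\<exists>b. arr b \<and> src b = tgt f \<and> tgt b = Z \<and> f ;; b = a" using S(4) 0(3) unfolding left_approx_def by auto
  qed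
  then show ?case using S by simp
next
  case (Suc j)
  obtain f g where S: "ses f g" "tgt g = G" "src g \<in> N" "xres N (Suc j) (src f)"
    using Suc.prems(1) by auto
  have "evan j (src f) Z" using Suc.IH[OF S(4) Suc.prems(2,3)] Suc.prems(4) by simp
  moreover have "evan (Suc j) (tgt f) Z" using Suc.prems(4)[of "Suc j" "src g"] S sesD(3)[OF S(1)] by simp
  ultimately show ?case using evan_right[OF S(1) _ _ Suc.prems(2)] S(2) by simp
qed

text \<open>Projective objects lie in N, so the syzygy of \<open>X\<close> is the kernel of an
  epimorphism between objects of N. By \<open>N_epi\<close> it has a resolution that stays exact
  under Hom into N, and \<open>xres_evan\<close> shifts along it with the vanishing already known in
  lower degrees.\<close>

lemma evan_N: "X \<in> N \<Longrightarrow> Z \<in> N \<Longrightarrow> Suc k < n \<Longrightarrow> evan k X Z"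
proof (induction k arbitrary: X rule: less_induct)
  case (less k)
  have Z: "Z \<in> Ob C" and X: "X \<in> Ob C" using less.prems N_ob by auto
  show ?case
  proof (cases k)
    case 0
    obtain f g where S: "ses f g" "tgt g = X" "proj (src g)" using cover_ses[OF X] .
    have "left_approx N f" using N_epi[OF S(1)] S less.prems N_proj by simp
    then have "evan 0 (tgt g) Z"
      using less.prems(2) unfolding left_approx_def by (intro evan_0I[OF S(1,3)]) auto
    then show ?thesis using S 0 by simp
  next
    case (Suc j)
    show ?thesis unfolding Suc evan.simps(2)
    proof (intro allI impI, elim conjE)
      fix f g assume S: "ses f g" "tgt g = X" "proj (src g)"
      have "xres N (n - 2) (src f)" using N_epi[OF S(1)] S less.prems N_proj by simp
      then have x: "xres N (Suc j) (src f)" by (rule xres_mono) (use less.prems Suc in linarith)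
      show "evan j (src f) Z"
        by (rule xres_evan[OF x Z less.prems(2)]) (use less.IH less.prems(2,3) Suc in auto)
    qed
  qed
qed

text \<open>Each step of the coresolution raises the degree by one until the zero object is reached;
  \<open>k + m < n\<close> keeps all degrees inside the range of \<open>evan_N\<close>.\<close>

lemma cores_evan: "cores N m G \<Longrightarrow> Z \<in> N \<Longrightarrow> k + m < n \<Longrightarrow> evan k G Z"
proof (induction m arbitrary: G k)
  case 0
  then show ?case using zob_evan N_ob by auto
next
  case (Suc m)
  obtain f g where S: "ses f g" "src f = G" "tgt f \<in> N" "cores N m (tgt g)" using Suc.prems by auto
  have "evan (Suc k) (tgt g) Z" using Suc.IH[OF S(4) Suc.prems(2), of "Suc k"] Suc.prems(3) by simp
  moreover have "evan k (tgt f) Z" using evan_N[OF S(3) Suc.prems(2)] Suc.prems(3) by simp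
  ultimately show ?case using evan_left[OF S(1)] S(2) Suc.prems(2) N_ob by auto
qed

text \<open>The approximation \<open>a\<close> is mono below the top of the chain. Let
  \<open>e\<close> be the epimorphism onto its image. The cokernel has a coresolution by N of length
  \<open>m\<close>, so its Ext^2 into N vanishes and hence so does Ext^1 of the image. Thus an arrow
  into N from the kernel of \<open>e\<close> extends to G, factors through \<open>a\<close>, and so
  is zero on the kernel; \<open>N_faithful\<close> then makes the kernel zero.\<close>

lemma hchain_cores: "hchain N m G \<Longrightarrow> G \<in> Ob C \<Longrightarrow> m < n \<Longrightarrow> cores N m G"
proof (induction m arbitrary: G)
  case 0
  then show ?case using N_faithful[OF 0(2,1)] by simp
next
  case (Suc m)
  obtain a c where a: "arr a" "src a = G" "tgt a \<in> N" "left_approx N a" "cokerp a c" "hchain N m (tgt c)"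
    using Suc.prems by auto
  have c: "arr c" "src c = tgt a" using a(5) unfolding cokerp_def by blast+
  have co: "cores N m (tgt c)" using Suc.IH[OF a(6)] c Suc.prems by simp
  obtain e i where e: "epi e" "mono i" "arr e" "arr i" "tgt e = src i" "e ;; i = a" using image_factor[OF a(1)] .
  have t: "tgt i = tgt a" "src e = G" using e(6) a(2) by auto
  \<comment> \<open>The image of \<open>a\<close> has the same cokernel as \<open>a\<close>.\<close>
  have ic: "cokerp i c"
  proof (rule cokerpI[OF cokerp_epi[OF a(5)] e(4)])
    show "src c = tgt i" using c t by simp
    have "e ;; i ;; c = a ;; c" by (rule cmp_reduce[OF e(6)]) (use e c t in simp_all)
    also have "\<dots> = zer (src e) (tgt c)" using a(5) t a(2) unfolding cokerp_def by simp
    finally show "i ;; c = zer (src i) (tgt c)" using epiD[OF e(1), of "i ;; c"] e c t by simp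
    fix x assume x: "arr x" "src x = tgt i" "i ;; x = zer (src i) (tgt x)"
    have "a ;; x = e ;; i ;; x" by (rule cmp_reduce[OF e(6), symmetric]) (use e x in simp_all)
    also have "\<dots> = zer (src a) (tgt x)" using x e t a(2) by simp
    finally have ax: "a ;; x = zer (src a) (tgt x)" .
    have "src x = tgt a" using x t by simp
    from cokerp_factor[OF a(5) x(1) this ax] show "\<exists>y. arr y \<and> src y = tgt c \<and> tgt y = tgt x \<and> c ;; y = x" by blast
  qed
  have S: "ses i c" by (rule mono_coker_ses[OF e(2) ic])
  \<comment> \<open>Here Ext^2 of the cokernel must vanish; this is where the chain has to be
    shorter than \<open>n\<close>.\<close>
  have ev: "evan 0 (tgt e) Z" if Z: "Z \<in> N" for Z
  proof -
    have "evan (Suc 0) (tgt c) Z" using cores_evan[OF co Z, of "Suc 0"] Suc.prems(3) by simp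
    moreover have "evan 0 (tgt i) Z" using evan_N[of "tgt i" Z 0] Z a(3) t Suc.prems(3) by simp
    ultimately show ?thesis using evan_left[OF S] Z N_ob e(5) by auto
  qed
  obtain k where k: "ses k e" using epi_ses[OF e(1)] .
  note d = sesD[OF k]
  have "hchain N 0 (src k)" unfolding hchain.simps
  proof (intro allI impI, elim conjE)
    fix f assume f: "arr f" "src f = src k" "tgt f \<in> N"
    obtain h where h: "arr h" "src h = tgt k" "tgt h = tgt f" "k ;; h = f"
      using evan_0D[OF ev[OF f(3)] k f(1,2) refl] .
    have "src h = src a" "tgt h \<in> N" using h f d t a(2) by simp_all
    then obtain w where w: "arr w" "src w = tgt a" "tgt w = tgt h" "a ;; w = h"
      using left_approxD[OF a(4) h(1)] by blast
    have "h = e ;; i ;; w" unfolding w(4)[symmetric] by (rule cmp_reduce[OF e(6), symmetric]) (use e t w in simp_all)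
    then have "f = k ;; e ;; i ;; w" using h by simp
    also have "\<dots> = zer (src k) (tgt f)" using d(1-3) e(3-5) t w(1-3) h(3) by (simp add: cmp_reduce[OF d(4)])
    finally show "f = zer (src k) (tgt f)" .
  qed
  then have z: "zob (src k)" using N_faithful d by simp
  have "mono e"
  proof (rule monoI[OF e(3)])
    fix x assume x: "arr x" "tgt x = src e" "x ;; e = zer (src x) (tgt e)"
    obtain y where y: "arr y" "src y = src x" "tgt y = src k" "y ;; k = x" using ses_lift[OF k x] .
    have "x = zer (src x) (src k) ;; k" using y zob_to[OF z y(1,3)] by simp
    then show "x = zer (src x) (src e)" using d x(1) by simp
  qed
  then have "mono a" using mono_cmp[OF _ e(2,5)] e(6) by simp
  then have "ses a c" using mono_coker_ses a(5) by blast
  then show ?case using a(2,3) co by auto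
qed

lemma zob_cogen: assumes "zob G" shows "cogen N G"
proof -
  obtain Z where Z: "Z \<in> N" "zob Z" using N_zero by blast
  have ob: "G \<in> Ob C" "Z \<in> Ob C" using assms Z by (simp_all add: zob_def)
  have "mono (zer G Z)" by (rule zob_mono) (use assms ob in simp_all)
  then show ?thesis unfolding cogen_def using Z(1) by (intro exI[of _ "zer G Z"]) simp
qed

lemma cores_cogen: assumes "cores N m G" shows "cogen N G"
proof (cases m)
  case 0
  then show ?thesis using assms zob_cogen by simp
next
  case (Suc l)
  then obtain f g where "ses f g" "src f = G" "tgt f \<in> N" using assms by auto
  then show ?thesis unfolding cogen_def using sesD(5) by blast
qed

text \<open>An embedding of G into N factors through the left approximation, which is therefore
  mono. The rest of the chain has length \<open>n - 1\<close>, so \<open>hchain_cores\<close>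
  applies to it.\<close>

lemma approx_ses:
  assumes G: "G \<in> Ob C" "cogen N G" and m: "n = Suc m"
  obtains a c where "ses a c" "src a = G" "tgt a \<in> N" "left_approx N a" "cores N m (tgt c)"
proof -
  obtain a c where a: "arr a" "src a = G" "tgt a \<in> N" "left_approx N a" "cokerp a c" "hchain N m (tgt c)"
    using N_hchain[OF G(1)] m by auto
  have c: "arr c" "src c = tgt a" using a(5) unfolding cokerp_def by blast+
  obtain i where i: "mono i" "src i = G" "tgt i \<in> N" using G(2) unfolding cogen_def by blast
  have "arr i" "src i = src a" using i a by (simp_all add: mono_def)
  then obtain w where w: "arr w" "src w = tgt a" "tgt w = tgt i" "a ;; w = i"
    using left_approxD[OF a(4) _ _ i(3)] by blast
  have "mono a" using mono_cmpD[of a w] i(1) w a(1) by simp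
  then have "ses a c" using mono_coker_ses a(5) by blast
  moreover have "cores N m (tgt c)" using hchain_cores[OF a(6)] c m by simp
  ultimately show ?thesis using that a by blast
qed

text \<open>Let \<open>a\<close> be a monic approximation of \<open>src f\<close> with cokernel
  \<open>c\<close>, let \<open>b\<close> embed \<open>tgt c\<close> into N, and let
  \<open>f = a ;; w\<close>. The arrow \<open>u\<close> with components \<open>w\<close> and
  \<open>c ;; b\<close> is a monomorphism between objects of N, so its cokernel \<open>v\<close> is
  cogenerated by \<open>N_mono\<close>. The inclusion of \<open>tgt f\<close> into the sum induces
  an arrow \<open>r\<close> from \<open>tgt g\<close> to \<open>tgt v\<close>, which is
  mono.\<close>

lemma cogen_quotient:
  assumes S: "ses f g" "src g \<in> N" and c: "cogen N (src f)"
  shows "cogen N (tgt g)"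
proof -
  note d = sesD[OF S(1)]
  obtain m where m: "n = Suc m" using n_pos by (cases n) auto
  have ob: "src f \<in> Ob C" using d by simp
  obtain a c where a: "ses a c" "src a = src f" "tgt a \<in> N" "left_approx N a" "cores N m (tgt c)"
    using approx_ses[OF ob c m] .
  note D = sesD[OF a(1)]
  obtain b where b: "mono b" "src b = tgt c" "tgt b \<in> N" using cores_cogen[OF a(5)] unfolding cogen_def by blast
  have b': "arr b" using b by (simp add: mono_def)
  have fN: "src f = src a" "tgt f \<in> N" using a S d by simp_all
  obtain w where w: "arr w" "src w = tgt a" "tgt w = tgt f" "a ;; w = f" using left_approxD[OF a(4) d(1) fN] .
  have ob: "tgt f \<in> Ob C" "tgt b \<in> Ob C" using d b' by simp_all
  obtain i j p q where B0: "bip i j p q" "src i = tgt f" "src j = tgt b" using ex_bip[OF ob] .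
  note B = bipD[OF B0(1)]
  \<comment> \<open>The second component kills exactly what factors through \<open>a\<close>, and
    there the first one acts as the monomorphism \<open>f\<close>; so the two together are
    mono.\<close>
  define u where "u = w ;; i \<boxplus> (c ;; b) ;; j"
  have cb: "arr (c ;; b)" "src (c ;; b) = tgt a" "tgt (c ;; b) = tgt b" using D b b' by simp_all
  have u: "arr u" "src u = tgt a" "tgt u = tgt i" unfolding u_def using w cb B B0 by simp_all
  have up: "u ;; p = w" unfolding u_def using w(1-3) D(1-3) b b' B(1-13) B0 ob by simp
  have uq: "u ;; q = c ;; b" unfolding u_def using w(1-3) D(1-3) b b' B(1-13) B0 ob by simp
  have ker: "\<exists>y. arr y \<and> src y = src x \<and> tgt y = src a \<and> y ;; a = x"
    if x: "arr x" "tgt x = tgt a" "x ;; c ;; b = zer (src x) (tgt b)" for x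
  proof -
    have "(x ;; c) ;; b = zer (src x) (tgt b)" using x D b b' by simp
    then have xc: "x ;; c = zer (src x) (tgt c)" using monoD[OF b(1), of "x ;; c"] x D b by simp
    have "tgt x = src c" using x D by simp
    from ses_lift[OF a(1) x(1) this xc] show ?thesis by blast
  qed
  have "mono u"
  proof (rule monoI[OF u(1)])
    fix x assume x: "arr x" "tgt x = src u" "x ;; u = zer (src x) (tgt u)"
    have "x ;; w = x ;; u ;; p" by (simp add: up)
    also have "\<dots> = zer (src x) (tgt w)" using x(1,2) u B B0 w(3) by (simp add: cmp_reduce[OF x(3)])
    finally have xw: "x ;; w = zer (src x) (tgt w)" .
    have "x ;; c ;; b = x ;; u ;; q" by (simp add: uq)
    also have "\<dots> = zer (src x) (tgt b)" using x(1,2) u B B0 by (simp add: cmp_reduce[OF x(3)])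
    finally obtain y where y: "arr y" "src y = src x" "tgt y = src a" "y ;; a = x" using ker[of x] x u by auto
    have "y ;; f = y ;; a ;; w" by (simp add: w(4))
    also have "\<dots> = x ;; w" by (rule cmp_reduce[OF y(4)]) (use y(1-3) D w in simp_all)
    finally have "y = zer (src y) (src f)" using monoD[OF d(5), of y] y xw a(2) w(3) by simp
    then have "x = zer (src x) (src a) ;; a" using y a(2) by simp
    then show "x = zer (src x) (src u)" using D x(1) u by simp
  qed
  then obtain v where v: "ses u v" using mono_ses by blast
  note V = sesD[OF v]
  have "tgt u \<in> N" using N_bip[OF B0(1)] B0 fN b u by simp
  then obtain t where t: "mono t" "src t = tgt v" "tgt t \<in> N" using N_mono[OF v] u a unfolding cogen_def by auto
  have au: "a ;; u = f ;; i"
  proof -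
    have "a ;; u = a ;; w ;; i \<boxplus> a ;; c ;; b ;; j" unfolding u_def using w(1-3) D B B0 b b' by simp
    also have "a ;; w ;; i = f ;; i" by (rule cmp_reduce[OF w(4)]) (use w D B B0 in simp_all)
    also have "a ;; c ;; b ;; j = zer (src a) (tgt i)" using D(1-3) b b' B B0 by (simp add: cmp_reduce[OF D(4)])
    finally show ?thesis using d B B0 a(2) by simp
  qed
  have "f ;; i ;; v = a ;; u ;; v"
    using cmp_assoc[of f i v] cmp_assoc[of a u v] au d B B0 V u D by simp
  also have "\<dots> = zer (src f) (tgt v)" using V u D a(2) by simp
  finally obtain r where r: "arr r" "src r = tgt g" "tgt r = tgt v" "g ;; r = i ;; v"
    using ses_extend[OF S(1), of "i ;; v"] B B0 V u by auto
  \<comment> \<open>If \<open>x\<close> represents an element killed by \<open>r\<close>, then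
    \<open>x ;; i\<close> factors through \<open>u\<close> by some \<open>y\<close>. The second
    component of \<open>x ;; i\<close> is zero, so \<open>y\<close> comes from \<open>src f\<close>
    along \<open>a\<close>, and comparing first components shows that \<open>x\<close> factors
    through \<open>f\<close>.\<close>
  have "mono r"
  proof (rule mono_elI[OF r(1)])
    fix k assume k: "arr k" "proj (src k)" "tgt k = src r" "k ;; r = zer (src k) (tgt r)"
    obtain x where x: "arr x" "src x = src k" "tgt x = src g" "x ;; g = k"
      using ses_el[OF S(1) k(1)] k r by auto
    have "(x ;; i) ;; v = x ;; g ;; r" using x(1-3) r B B0 V u d by simp
    also have "\<dots> = k ;; r" by (rule cmp_reduce[OF x(4)]) (use x(1-3) d r in simp_all)
    finally obtain y where y: "arr y" "src y = src x" "tgt y = src u" "y ;; u = x ;; i"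
      using ses_lift[OF v, of "x ;; i"] x(1-3) B B0 V u d k(4) r(3) by auto
    have "y ;; c ;; b = y ;; u ;; q" by (simp add: uq)
    also have "\<dots> = (x ;; i) ;; q" by (rule cmp_reduce[OF y(4)]) (use y(1-3) u B in simp_all)
    also have "\<dots> = zer (src y) (tgt b)" using x(1-3) B B0 y(2) d ob by simp
    finally obtain z where z: "arr z" "src z = src y" "tgt z = src a" "z ;; a = y" using ker[of y] y u by auto
    have "z ;; f = z ;; a ;; w" by (simp add: w(4))
    also have "\<dots> = y ;; w" by (rule cmp_reduce[OF z(4)]) (use z(1-3) D w in simp_all)
    also have "\<dots> = y ;; u ;; p" by (simp add: up)
    also have "\<dots> = (x ;; i) ;; p" by (rule cmp_reduce[OF y(4)]) (use y(1-3) u B in simp_all)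
    also have "\<dots> = x" using x(1-3) B B0 d by simp
    finally have zf: "z ;; f = x" .
    have "k = z ;; f ;; g" unfolding x(4)[symmetric] by (rule cmp_reduce[OF zf, symmetric]) (use z a(2) d in simp_all)
    then show "k = zer (src k) (src r)" using z(1-3) y x a(2) d r by simp
  qed
  then have "mono (r ;; t)" using mono_cmp[OF _ t(1)] r t by simp
  then show ?thesis unfolding cogen_def using r t by (intro exI[of _ "r ;; t"]) simp
qed

lemma res_cogen: "res N m G \<Longrightarrow> cogen N G"
proof (induction m arbitrary: G)
  case 0
  then show ?case using zob_cogen by simp
next
  case (Suc m)
  then obtain f g where "ses f g" "tgt g = G" "src g \<in> N" "res N m (src f)" by auto
  then show ?case using cogen_quotient[of f g] Suc.IH by blast
qed

text \<open>Two covers present G by projective objects. The second syzygy is the kernel of an arrow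
  between them, so it has an N-resolution of length \<open>n\<close> by \<open>N_ker\<close>; with
  the two covers G has one of length \<open>n + 2\<close>, and \<open>res_cogen\<close> climbs along
  it.\<close>

lemma cogen_all: assumes "G \<in> Ob C" shows "cogen N G"
proof -
  obtain f g where S: "ses f g" "tgt g = G" "proj (src g)" using cover_ses[OF assms] .
  note d = sesD[OF S(1)]
  have ob: "src f \<in> Ob C" using d by simp
  obtain f' g' where S': "ses f' g'" "tgt g' = src f" "proj (src g')" using cover_ses[OF ob] .
  have "kerp (g' ;; f) f'" using kerp_cmp_mono[of g' f' f] S' d by (simp add: ses_def)
  then have "res N n (src f')" using N_ker[of "g' ;; f" f'] S S' N_proj d by simp
  then have "res N (Suc n) (src f)" using S' N_proj by auto
  then have "res N (Suc (Suc n)) G" using S N_proj by auto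
  then show ?thesis by (rule res_cogen)
qed

lemma cores_all: assumes "G \<in> Ob C" shows "cores N n G"
proof -
  obtain m where m: "n = Suc m" using n_pos by (cases n) auto
  obtain a c where "ses a c" "src a = G" "tgt a \<in> N" "left_approx N a" "cores N m (tgt c)"
    using approx_ses[OF assms cogen_all[OF assms] m] .
  then show ?thesis unfolding m by auto
qed

text \<open>G embeds into N with some cokernel, and that cokernel embeds into N in turn; G is the
  kernel of the composite.\<close>

lemma ker_all: assumes "G \<in> Ob C"
  obtains f k where "kerp f k" "src f \<in> N" "tgt f \<in> N" "src k = G"
proof -
  obtain a where a: "mono a" "src a = G" "tgt a \<in> N" using cogen_all[OF assms] unfolding cogen_def by blast
  obtain c where c: "ses a c" using mono_ses[OF a(1)] .
  note d = sesD[OF c]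
  have ob: "tgt c \<in> Ob C" using d by simp
  obtain b where b: "mono b" "src b = tgt c" "tgt b \<in> N" using cogen_all[OF ob] unfolding cogen_def by blast
  have b': "arr b" using b by (simp add: mono_def)
  have "kerp (c ;; b) a" using kerp_cmp_mono[of c a b] c b b' by (simp add: ses_def)
  then show ?thesis using that[of "c ;; b" a] a b d by simp
qed

lemma zob_N: assumes "zob G" shows "G \<in> N"
proof -
  obtain Z where Z: "Z \<in> N" "zob Z" using N_zero by blast
  have ob: "G \<in> Ob C" "Z \<in> Ob C" using assms Z by (simp_all add: zob_def)
  show ?thesis
    using N_retract[of "zer G Z" "zer Z G"] ob Z(1) assms by (simp add: zob_def)
qed

text \<open>The vanishing passes to the syzygy with its range shortened by one, so by induction the
  syzygy lies in N. Then Ext^1 of G by its syzygy vanishes, the sequence splits, and G is a retract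
  of the middle term.\<close>

lemma res_N: "res N m G \<Longrightarrow> m \<le> n \<Longrightarrow> (\<And>k Z. Z \<in> N \<Longrightarrow> Suc k < m \<Longrightarrow> evan k G Z) \<Longrightarrow> G \<in> N"
proof (induction m arbitrary: G)
  case 0
  then show ?case using zob_N by simp
next
  case (Suc m)
  obtain f g where S: "ses f g" "tgt g = G" "src g \<in> N" "res N m (src f)" using Suc.prems(1) by auto
  note d = sesD[OF S(1)]
  have "src f \<in> N"
  proof (rule Suc.IH[OF S(4)])
    show "m \<le> n" using Suc.prems by simp
    fix k Z assume k: "Z \<in> N" "Suc k < m"
    have "evan k (tgt f) Z" unfolding d(3) by (rule evan_N[OF S(3) k(1)]) (use k(2) Suc.prems(2) in linarith)
    moreover have "evan (Suc k) (tgt g) Z" using Suc.prems(3)[OF k(1), of "Suc k"] k(2) S(2) by simp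
    ultimately show "evan k (src f) Z" by (rule evan_left[OF S(1)]) (use k(1) N_ob in blast)
  qed
  \<comment> \<open>For a resolution of length one the assumed range is empty, but then the syzygy
    is a zero object.\<close>
  then have v: "evan 0 (tgt g) (src f)"
  proof (cases m)
    case 0
    then show ?thesis using S(4) zob_evan_0 by simp
  next
    case (Suc l)
    then show ?thesis using Suc.prems(3)[of "src f" 0] S(2) \<open>src f \<in> N\<close> by simp
  qed
  obtain w where w: "arr w" "src w = tgt f" "tgt w = src f" "f ;; w = idt (src f)"
    by (rule evan_0D[OF v S(1), of "idt (src f)"]) (use d in simp_all)
  obtain r where r: "arr r" "src r = tgt g" "tgt r = src g" "r ;; g = idt (tgt g)" using ses_split_right[OF S(1) w] .
  have "src r \<in> N" by (rule N_retract[OF r(1) d(2)]) (use r S(3) in simp_all)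
  then show ?case using r(2) S(2) by simp
qed

text \<open>As for \<open>res_N\<close>, with cosyzygies: \<open>evan_target\<close> passes the
  vanishing to the cokernel, which then lies in N, and the sequence splits.\<close>

lemma cores_N: "cores N m G \<Longrightarrow> m \<le> n \<Longrightarrow> (\<And>k Z. Z \<in> N \<Longrightarrow> Suc k < m \<Longrightarrow> evan k Z G) \<Longrightarrow> G \<in> N"
proof (induction m arbitrary: G)
  case 0
  then show ?case using zob_N by simp
next
  case (Suc m)
  obtain f g where S: "ses f g" "src f = G" "tgt f \<in> N" "cores N m (tgt g)" using Suc.prems(1) by auto
  note d = sesD[OF S(1)]
  have "tgt g \<in> N"
  proof (rule Suc.IH[OF S(4)])
    show "m \<le> n" using Suc.prems by simp
    fix k Z assume k: "Z \<in> N" "Suc k < m"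
    have "evan k Z (tgt f)" by (rule evan_N[OF k(1) S(3)]) (use k(2) Suc.prems(2) in linarith)
    moreover have "evan (Suc k) Z (src f)" using Suc.prems(3)[OF k(1), of "Suc k"] k(2) S(2) by simp
    ultimately show "evan k Z (tgt g)" by (rule evan_target[OF S(1)]) (use k(1) N_ob in blast)
  qed
  then have v: "evan 0 (tgt g) (src f)"
  proof (cases m)
    case 0
    then show ?thesis using S(4) zob_evan d by simp
  next
    case (Suc l)
    then show ?thesis using Suc.prems(3)[of "tgt g" 0] S(2) \<open>tgt g \<in> N\<close> by simp
  qed
  obtain w where "arr w" "src w = tgt f" "tgt w = src f" "f ;; w = idt (src f)"
    by (rule evan_0D[OF v S(1), of "idt (src f)"]) (use d in simp_all)
  note w = this
  have "src f \<in> N" by (rule N_retract[OF d(1) w(1)]) (use w S(3) in simp_all)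
  then show ?case using S(2) by simp
qed

lemma mono_is_mono: "mono m \<Longrightarrow> is_mono C (src m) (tgt m) (val m)"
  by (simp add: is_mono_iff mono_def)

theorem cluster_tilting: "n_cluster_tilting n C N"
  unfolding n_cluster_tilting_def
proof (intro conjI)
  show "abelian_category C" by (rule abelian_category_axioms)
  show "N \<subseteq> Ob C" by (rule N_ob)
  show "generating C N" unfolding generating_def
  proof
    fix X assume X: "X \<in> Ob C"
    obtain q where q: "proj (src q)" "epi q" "arr q" "tgt q = X" using cover[OF X] .
    then have "is_epi C (src q) X (val q)" using is_epi_iff[of "src q" "tgt q" "val q"] X by simp
    then show "\<exists>Y\<in>N. \<exists>f. is_epi C Y X f" using N_proj q(1) by blast
  qed
  show "cogenerating C N" unfolding cogenerating_def
  proof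
    fix X assume X: "X \<in> Ob C"
    obtain m where m: "mono m" "src m = X" "tgt m \<in> N" using cogen_all[OF X] unfolding cogen_def by blast
    then show "\<exists>Y\<in>N. \<exists>f. is_mono C X Y f" using mono_is_mono[OF m(1)] by blast
  qed
  have arr_of: "arr g \<and> src g = X \<and> tgt g = Y \<and> val g \<in> mor C X Y" if "arr g" "src g = X" "tgt g = Y" for g X Y
    using that unfolding arr_def by simp
  show "functorially_finite C N" unfolding functorially_finite_def
  proof
    show "covariantly_finite C N" unfolding covariantly_finite_def
    proof
      fix X assume X: "X \<in> Ob C"
      obtain m where m: "n = Suc m" using n_pos by (cases n) auto
      obtain a where a: "arr a" "src a = X" "tgt a \<in> N" "left_approx N a"
        using N_hchain[OF X] m by auto
      show "\<exists>Y\<in>N. \<exists>f\<in>mor C X Y. \<forall>Z\<in>N. \<forall>g\<in>mor C X Z. \<exists>h\<in>mor C Y Z. Comp C X Y Z f h = g"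
      proof (rule bexI[of _ "tgt a"], rule bexI[of _ "val a"], intro ballI)
        show "tgt a \<in> N" by fact
        show "val a \<in> mor C X (tgt a)" using a unfolding arr_def by simp
        fix Z g assume g: "Z \<in> N" "g \<in> mor C X Z"
        have "arr (Arrow X g Z)" "src (Arrow X g Z) = src a" "tgt (Arrow X g Z) \<in> N" using g X N_ob a by (auto intro: arrI)
        then obtain h where h: "arr h" "src h = tgt a" "tgt h = Z" "a ;; h = Arrow X g Z"
          using left_approxD[OF a(4), of "Arrow X g Z" thesis] by simp
        have "val h \<in> mor C (tgt a) Z" using h unfolding arr_def by simp
        moreover have "Comp C X (tgt a) Z (val a) (val h) = g" using h a by (simp add: cmp_def)
        ultimately show "\<exists>h\<in>mor C (tgt a) Z. Comp C X (tgt a) Z (val a) h = g" by blast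
      qed
    qed
    show "contravariantly_finite C N" unfolding contravariantly_finite_def
    proof
      fix X assume X: "X \<in> Ob C"
      obtain f k where k: "kerp f k" "src f \<in> N" "tgt f \<in> N" "src k = X" using ker_all[OF X] .
      obtain a where a: "arr a" "src a \<in> N" "tgt a = X" "\<forall>g. arr g \<and> src g \<in> N \<and> tgt g = X \<longrightarrow>
        (\<exists>h. arr h \<and> src h = src g \<and> tgt h = src a \<and> h ;; a = g)" using N_ker[OF k(1-3)] k(4) by auto
      show "\<exists>Y\<in>N. \<exists>f\<in>mor C Y X. \<forall>Z\<in>N. \<forall>g\<in>mor C Z X. \<exists>h\<in>mor C Z Y. Comp C Z Y X h f = g"
      proof (rule bexI[of _ "src a"], rule bexI[of _ "val a"], intro ballI)
        show "src a \<in> N" by fact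
        show "val a \<in> mor C (src a) X" using a unfolding arr_def by simp
        fix Z g assume g: "Z \<in> N" "g \<in> mor C Z X"
        have "arr (Arrow Z g X) \<and> src (Arrow Z g X) \<in> N \<and> tgt (Arrow Z g X) = X" using g X N_ob by (auto intro: arrI)
        then obtain h where h: "arr h" "src h = Z" "tgt h = src a" "h ;; a = Arrow Z g X"
          using a(4)[rule_format, of "Arrow Z g X"] by auto
        have "val h \<in> mor C Z (src a)" using h unfolding arr_def by simp
        moreover have "Comp C Z (src a) X (val h) (val a) = g" using h a by (simp add: cmp_def)
        ultimately show "\<exists>h\<in>mor C Z (src a). Comp C Z (src a) X h (val a) = g" by blast
      qed
    qed
  qed
  have ez: "Ext_zero C i X Y" if XY: "X \<in> N" "Y \<in> N" "1 \<le> i" "i \<le> n - 1" for i X Y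
  proof -
    obtain k where "i = Suc k" "Suc k < n" using XY(3,4) by (cases i) auto
    then show ?thesis using Ext_zero_iff[of X Y k] evan_N[of X Y k] XY N_ob by auto
  qed
  have ev: "evan k X Y" if "Ext_zero C (Suc k) X Y" "X \<in> Ob C" "Y \<in> Ob C" for k X Y
    using Ext_zero_iff[OF that(2,3)] that(1) by blast
  show "N = {X \<in> Ob C. \<forall>i. 1 \<le> i \<and> i \<le> n - 1 \<longrightarrow> (\<forall>Y\<in>N. Ext_zero C i X Y)}"
  proof (intro equalityI subsetI CollectI)
    fix X assume "X \<in> {X \<in> Ob C. \<forall>i. 1 \<le> i \<and> i \<le> n - 1 \<longrightarrow> (\<forall>Y\<in>N. Ext_zero C i X Y)}"
    then have X: "X \<in> Ob C" "\<And>i Y. 1 \<le> i \<Longrightarrow> i \<le> n - 1 \<Longrightarrow> Y \<in> N \<Longrightarrow> Ext_zero C i X Y" by auto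
    obtain f k where k: "kerp f k" "src f \<in> N" "tgt f \<in> N" "src k = X" using ker_all[OF X(1)] .
    have "res N n X" using N_ker[OF k(1-3)] k(4) by simp
    then show "X \<in> N"
    proof (rule res_N[OF _ le_refl])
      fix l Z assume "Z \<in> N" "Suc l < n"
      then show "evan l X Z" using ev[OF X(2)] X(1) N_ob by auto
    qed
  qed (use ez N_ob in auto)
  show "N = {X \<in> Ob C. \<forall>i. 1 \<le> i \<and> i \<le> n - 1 \<longrightarrow> (\<forall>Y\<in>N. Ext_zero C i Y X)}"
  proof (intro equalityI subsetI CollectI)
    fix X assume "X \<in> {X \<in> Ob C. \<forall>i. 1 \<le> i \<and> i \<le> n - 1 \<longrightarrow> (\<forall>Y\<in>N. Ext_zero C i Y X)}"
    then have X: "X \<in> Ob C" "\<And>i Y. 1 \<le> i \<Longrightarrow> i \<le> n - 1 \<Longrightarrow> Y \<in> N \<Longrightarrow> Ext_zero C i Y X" by auto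
    show "X \<in> N"
    proof (rule cores_N[OF cores_all[OF X(1)] le_refl])
      fix l Z assume "Z \<in> N" "Suc l < n"
      then show "evan l Z X" using ev[OF X(2)] X(1) N_ob by auto
    qed
  qed (use ez N_ob in auto)
qed

end

section \<open>Coherent modules\<close>

lemma full_subcat_simps [simp]:
  "Ob (full_subcat C S) = S" "Hom (full_subcat C S) = Hom C" "Comp (full_subcat C S) = Comp C" "Ident (full_subcat C S) = Ident C"
  by (simp_all add: full_subcat_def)

lemma full_subcat_preadditive:
  assumes "preadditive_category C" "S \<subseteq> Ob C"
  shows "preadditive_category (full_subcat C S)"
proof -
  interpret preadditive_category C by fact
  have s: "X \<in> S \<Longrightarrow> X \<in> Ob C" for X using assms(2) by blast
  show ?thesis
    by (rule preadditive_category.intro)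
      (simp_all add: s hom_group comp_closed ident_closed ident_left ident_right comp_assoc comp_add_left comp_add_right)
qed

lemma module_cat_simps [simp]:
  "Ob (module_cat C) = {G. is_module C G}"
  "Hom (module_cat C) G H = \<lparr>carrier = mod_hom C G H,
      monoid.mult = (\<lambda>\<sigma> \<tau>. \<lambda>X\<in>Ob C. \<lambda>x\<in>carrier (mob G X). \<sigma> X x \<otimes>\<^bsub>mob H X\<^esub> \<tau> X x),
      one = (\<lambda>X\<in>Ob C. \<lambda>x\<in>carrier (mob G X). \<one>\<^bsub>mob H X\<^esub>)\<rparr>"
  "Comp (module_cat C) G H K \<sigma> \<tau> = (\<lambda>X\<in>Ob C. \<lambda>x\<in>carrier (mob G X). \<tau> X (\<sigma> X x))"
  "Ident (module_cat C) G = (\<lambda>X\<in>Ob C. \<lambda>x\<in>carrier (mob G X). x)"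
  by (simp_all add: module_cat_def)

lemma is_module_group: "is_module C G \<Longrightarrow> X \<in> Ob C \<Longrightarrow> comm_group (mob G X)"
  by (simp add: is_module_def)

lemma is_module_grp: "is_module C G \<Longrightarrow> X \<in> Ob C \<Longrightarrow> group (mob G X)"
  by (simp add: is_module_def comm_group.axioms(2))

lemma is_module_mon: "is_module C G \<Longrightarrow> X \<in> Ob C \<Longrightarrow> Group.monoid (mob G X)"
  by (simp add: is_module_grp group.is_monoid)

lemma mod_homD:
  assumes "\<tau> \<in> mod_hom C G H"
  shows "X \<in> Ob C \<Longrightarrow> \<tau> X \<in> hom (mob G X) (mob H X)"
    "X \<in> Ob C \<Longrightarrow> x \<in> carrier (mob G X) \<Longrightarrow> \<tau> X x \<in> carrier (mob H X)"
    "X \<in> Ob C \<Longrightarrow> x \<in> carrier (mob G X) \<Longrightarrow> y \<in> carrier (mob G X) \<Longrightarrow> \<tau> X (x \<otimes>\<^bsub>mob G X\<^esub> y) = \<tau> X x \<otimes>\<^bsub>mob H X\<^esub> \<tau> X y"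
    "X \<in> Ob C \<Longrightarrow> Y \<in> Ob C \<Longrightarrow> f \<in> mor C X Y \<Longrightarrow> x \<in> carrier (mob G Y) \<Longrightarrow> \<tau> X (mar G X Y f x) = mar H X Y f (\<tau> Y x)"
  using assms unfolding mod_hom_def by (auto simp: hom_def Pi_def)

lemma mod_homI:
  assumes "\<And>X x. X \<in> Ob C \<Longrightarrow> x \<in> carrier (mob G X) \<Longrightarrow> \<tau> X x \<in> carrier (mob H X)"
    "\<And>X x y. X \<in> Ob C \<Longrightarrow> x \<in> carrier (mob G X) \<Longrightarrow> y \<in> carrier (mob G X) \<Longrightarrow> \<tau> X (x \<otimes>\<^bsub>mob G X\<^esub> y) = \<tau> X x \<otimes>\<^bsub>mob H X\<^esub> \<tau> X y"
    "\<And>X Y f x. X \<in> Ob C \<Longrightarrow> Y \<in> Ob C \<Longrightarrow> f \<in> mor C X Y \<Longrightarrow> x \<in> carrier (mob G Y) \<Longrightarrow> \<tau> X (mar G X Y f x) = mar H X Y f (\<tau> Y x)"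
    and G: "is_module C G"
  shows "(\<lambda>X\<in>Ob C. \<lambda>x\<in>carrier (mob G X). \<tau> X x) \<in> mod_hom C G H"
proof -
  have 1: "mar G X Y f x \<in> carrier (mob G X)" if "X \<in> Ob C" "Y \<in> Ob C" "f \<in> mor C X Y" "x \<in> carrier (mob G Y)" for X Y f x
    using G that unfolding is_module_def by (auto simp: hom_def Pi_def)
  have 2: "x \<otimes>\<^bsub>mob G X\<^esub> y \<in> carrier (mob G X)" if "X \<in> Ob C" "x \<in> carrier (mob G X)" "y \<in> carrier (mob G X)" for X x y
    using is_module_mon[OF G that(1)] that by (simp add: monoid.m_closed)
  show ?thesis unfolding mod_hom_def using assms(1-3) 1 2 by (auto simp: hom_def)
qed

lemma mod_hom_eqI:
  assumes "\<sigma> \<in> mod_hom C G H" "\<tau> \<in> mod_hom C G H"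
    "\<And>X x. X \<in> Ob C \<Longrightarrow> x \<in> carrier (mob G X) \<Longrightarrow> \<sigma> X x = \<tau> X x"
  shows "\<sigma> = \<tau>"
proof
  fix X
  show "\<sigma> X = \<tau> X"
  proof (cases "X \<in> Ob C")
    case True
    then have "\<sigma> X \<in> extensional (carrier (mob G X))" "\<tau> X \<in> extensional (carrier (mob G X))"
      using assms(1,2) unfolding mod_hom_def by auto
    then show ?thesis using assms(3)[OF True] by (intro extensionalityI) auto
  next
    case False
    then show ?thesis using assms(1,2) unfolding mod_hom_def extensional_def by auto
  qed
qed

lemma mod_hom_one:
  assumes "is_module C G" "is_module C H" "\<tau> \<in> mod_hom C G H" "X \<in> Ob C"
  shows "\<tau> X \<one>\<^bsub>mob G X\<^esub> = \<one>\<^bsub>mob H X\<^esub>"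
  using mod_homD(1)[OF assms(3,4)] is_module_grp[OF assms(1,4)] is_module_grp[OF assms(2,4)] by (simp add: hom_one)

lemma mod_hom_inv:
  assumes "is_module C G" "is_module C H" "\<tau> \<in> mod_hom C G H" "X \<in> Ob C" "x \<in> carrier (mob G X)"
  shows "\<tau> X (inv\<^bsub>mob G X\<^esub> x) = inv\<^bsub>mob H X\<^esub> (\<tau> X x)"
proof -
  have "group_hom (mob G X) (mob H X) (\<tau> X)"
    using mod_homD(1)[OF assms(3,4)] is_module_grp[OF assms(1,4)] is_module_grp[OF assms(2,4)]
    by (simp add: group_hom_def group_hom_axioms_def)
  then show ?thesis using assms(5) by (rule group_hom.hom_inv)
qed

section \<open>Modules acted on by arrows, and presentations by a generator and relations\<close>

context preadditive_category
begin

definition act :: "('o, 'a, 'v) cmodule \<Rightarrow> ('o, 'a) arrow \<Rightarrow> 'v \<Rightarrow> 'v"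
  where "act G a y = mar G (src a) (tgt a) (val a) y"

lemma act_closed: "is_module C G \<Longrightarrow> arr a \<Longrightarrow> y \<in> carrier (mob G (tgt a)) \<Longrightarrow> act G a y \<in> carrier (mob G (src a))"
  unfolding act_def is_module_def arr_def by (auto simp: hom_def Pi_def)

lemma act_mult: "is_module C G \<Longrightarrow> arr a \<Longrightarrow> x \<in> carrier (mob G (tgt a)) \<Longrightarrow> y \<in> carrier (mob G (tgt a)) \<Longrightarrow>
    act G a (x \<otimes>\<^bsub>mob G (tgt a)\<^esub> y) = act G a x \<otimes>\<^bsub>mob G (src a)\<^esub> act G a y"
  unfolding act_def is_module_def arr_def by (auto simp: hom_def Pi_def)

lemma act_hom: "is_module C G \<Longrightarrow> arr a \<Longrightarrow> group_hom (mob G (tgt a)) (mob G (src a)) (act G a)"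
  using act_closed[of G a] act_mult[of G a] is_module_grp[of C G]
  by (auto simp: group_hom_def group_hom_axioms_def hom_def Pi_def)

lemma act_one: "is_module C G \<Longrightarrow> arr a \<Longrightarrow> act G a \<one>\<^bsub>mob G (tgt a)\<^esub> = \<one>\<^bsub>mob G (src a)\<^esub>"
  using act_hom by (rule group_hom.hom_one)

lemma act_idt: "is_module C G \<Longrightarrow> X \<in> Ob C \<Longrightarrow> x \<in> carrier (mob G X) \<Longrightarrow> act G (idt X) x = x"
  unfolding act_def is_module_def idt_def by simp

lemma act_cmp: "is_module C G \<Longrightarrow> arr a \<Longrightarrow> arr b \<Longrightarrow> tgt a = src b \<Longrightarrow> x \<in> carrier (mob G (tgt b)) \<Longrightarrow>
    act G (a ;; b) x = act G a (act G b x)"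
  unfolding act_def is_module_def arr_def cmp_def by auto

lemma act_add: "is_module C G \<Longrightarrow> par a b \<Longrightarrow> x \<in> carrier (mob G (tgt b)) \<Longrightarrow>
    act G (a \<boxplus> b) x = act G a x \<otimes>\<^bsub>mob G (src b)\<^esub> act G b x"
  unfolding act_def is_module_def arr_def add_def by auto

lemma act_zer: assumes "is_module C G" "X \<in> Ob C" "Y \<in> Ob C" "x \<in> carrier (mob G Y)" shows "act G (zer X Y) x = \<one>\<^bsub>mob G X\<^esub>"
proof -
  interpret group "mob G X" by (rule is_module_grp[OF assms(1,2)])
  have c: "act G (zer X Y) x \<in> carrier (mob G X)" using act_closed[of G "zer X Y" x] assms by simp
  have "zer X Y \<boxplus> zer X Y = zer X Y" using assms by simp
  then have "act G (zer X Y) x \<otimes>\<^bsub>mob G X\<^esub> act G (zer X Y) x = act G (zer X Y) x"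
    using act_add[of G "zer X Y" "zer X Y" x] assms by simp
  then show ?thesis using c by (simp add: l_cancel_one)
qed

lemma act_neg: assumes "is_module C G" "arr a" "x \<in> carrier (mob G (tgt a))" shows "act G (neg a) x = inv\<^bsub>mob G (src a)\<^esub> (act G a x)"
proof -
  interpret group "mob G (src a)" by (rule is_module_grp[OF assms(1) arr_ob(1)[OF assms(2)]])
  have "act G (neg a) x \<otimes>\<^bsub>mob G (src a)\<^esub> act G a x = act G (neg a \<boxplus> a) x"
    using act_add[of G "neg a" a x] assms by simp
  also have "\<dots> = act G (zer (src a) (tgt a)) x" using assms by simp
  also have "\<dots> = \<one>\<^bsub>mob G (src a)\<^esub>" by (rule act_zer[OF assms(1) _ _ assms(3)]) (use assms(2) in simp_all)
  finally have e: "act G (neg a) x \<otimes>\<^bsub>mob G (src a)\<^esub> act G a x = \<one>\<^bsub>mob G (src a)\<^esub>" .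
  have "act G (neg a) x \<in> carrier (mob G (src a))" using act_closed[of G "neg a" x] assms by simp
  then show ?thesis using inv_equality[OF e act_closed[OF assms]] by simp
qed

lemma mod_hom_act: "\<tau> \<in> mod_hom C G H \<Longrightarrow> arr a \<Longrightarrow> x \<in> carrier (mob G (tgt a)) \<Longrightarrow>
    \<tau> (src a) (act G a x) = act H a (\<tau> (tgt a) x)"
  using mod_homD(4)[of \<tau> C G H "src a" "tgt a" "val a" x] unfolding act_def arr_def by simp

text \<open>Every element of K is the image of one of H under \<open>r\<close>, and the operations
  of K are determined by those of H; so all module axioms carry over. This serves both quotients and
  changes of value type.\<close>

lemma image_module:
  fixes H :: "('o, 'a, 'w) cmodule" and K :: "('o, 'a, 'v) cmodule"
  assumes H: "is_module C H"
    and car: "\<And>X. X \<in> Ob C \<Longrightarrow> carrier (mob K X) = r X ` carrier (mob H X)"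
    and mult: "\<And>X x y. X \<in> Ob C \<Longrightarrow> x \<in> carrier (mob H X) \<Longrightarrow> y \<in> carrier (mob H X) \<Longrightarrow>
      r X x \<otimes>\<^bsub>mob K X\<^esub> r X y = r X (x \<otimes>\<^bsub>mob H X\<^esub> y)"
    and one: "\<And>X. X \<in> Ob C \<Longrightarrow> \<one>\<^bsub>mob K X\<^esub> = r X \<one>\<^bsub>mob H X\<^esub>"
    and mar: "\<And>X Y f y. X \<in> Ob C \<Longrightarrow> Y \<in> Ob C \<Longrightarrow> f \<in> mor C X Y \<Longrightarrow> y \<in> carrier (mob H Y) \<Longrightarrow>
      mar K X Y f (r Y y) = r X (mar H X Y f y)"
  shows "is_module C K" "(\<lambda>X\<in>Ob C. \<lambda>x\<in>carrier (mob H X). r X x) \<in> mod_hom C H K"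
proof -
  have c: "mar H X Y f y \<in> carrier (mob H X)" if "X \<in> Ob C" "Y \<in> Ob C" "f \<in> mor C X Y" "y \<in> carrier (mob H Y)" for X Y f y
    using act_closed[OF H, of "Arrow X f Y" y] that by (simp add: act_def arrI)
  show "is_module C K" unfolding is_module_def
  proof (intro conjI ballI)
    fix X assume X: "X \<in> Ob C"
    interpret comm_group "mob H X" by (rule is_module_group[OF H X])
    show "comm_group (mob K X)"
    proof (rule comm_groupI)
      fix x y assume "x \<in> carrier (mob K X)" "y \<in> carrier (mob K X)"
      then show "x \<otimes>\<^bsub>mob K X\<^esub> y \<in> carrier (mob K X)" "x \<otimes>\<^bsub>mob K X\<^esub> y = y \<otimes>\<^bsub>mob K X\<^esub> x"
        using X by (auto simp: car mult m_comm)
    next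
      fix x y z assume "x \<in> carrier (mob K X)" "y \<in> carrier (mob K X)" "z \<in> carrier (mob K X)"
      then show "x \<otimes>\<^bsub>mob K X\<^esub> y \<otimes>\<^bsub>mob K X\<^esub> z = x \<otimes>\<^bsub>mob K X\<^esub> (y \<otimes>\<^bsub>mob K X\<^esub> z)"
        using X by (auto simp: car mult m_assoc)
    next
      fix x assume "x \<in> carrier (mob K X)"
      then obtain u where u: "u \<in> carrier (mob H X)" "x = r X u" using X car by auto
      then show "\<one>\<^bsub>mob K X\<^esub> \<otimes>\<^bsub>mob K X\<^esub> x = x" using X by (simp add: one mult)
      show "\<exists>y\<in>carrier (mob K X). y \<otimes>\<^bsub>mob K X\<^esub> x = \<one>\<^bsub>mob K X\<^esub>"
        using X u by (intro bexI[of _ "r X (inv\<^bsub>mob H X\<^esub> u)"]) (simp_all add: car one mult)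
    qed (use X in \<open>simp add: car one\<close>)
  next
    fix X Y f assume X: "X \<in> Ob C" "Y \<in> Ob C" "f \<in> mor C X Y"
    have "mar K X Y f (x \<otimes>\<^bsub>mob K Y\<^esub> y) = mar K X Y f x \<otimes>\<^bsub>mob K X\<^esub> mar K X Y f y"
      if xy: "x \<in> carrier (mob K Y)" "y \<in> carrier (mob K Y)" for x y
    proof -
      obtain u v where u: "u \<in> carrier (mob H Y)" "x = r Y u" "v \<in> carrier (mob H Y)" "y = r Y v" using xy X car by auto
      then show ?thesis using X c act_mult[OF H, of "Arrow X f Y" u v] is_module_mon[OF H X(2)]
        by (simp add: mult mar act_def arrI monoid.m_closed)
    qed
    then show "mar K X Y f \<in> hom (mob K Y) (mob K X)" using X c by (auto simp: hom_def car mar)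
  next
    fix X x assume X: "X \<in> Ob C" "x \<in> carrier (mob K X)"
    then show "mar K X X (Ident C X) x = x"
      using H ident_closed[OF X(1)] unfolding is_module_def by (auto simp: car mar)
  next
    fix X Y Z f g x assume X: "X \<in> Ob C" "Y \<in> Ob C" "Z \<in> Ob C" "f \<in> mor C X Y" "g \<in> mor C Y Z" "x \<in> carrier (mob K Z)"
    then obtain u where u: "u \<in> carrier (mob H Z)" "x = r Z u" using car by auto
    have "mar H X Z (Comp C X Y Z f g) u = mar H X Y f (mar H Y Z g u)" using H X u unfolding is_module_def by simp
    then show "mar K X Z (Comp C X Y Z f g) x = mar K X Y f (mar K Y Z g x)" using X u c by (simp add: mar comp_closed)
  next
    fix X Y f g x assume X: "X \<in> Ob C" "Y \<in> Ob C" "f \<in> mor C X Y" "g \<in> mor C X Y" "x \<in> carrier (mob K Y)"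
    then obtain u where u: "u \<in> carrier (mob H Y)" "x = r Y u" using car by auto
    have "mar H X Y (f \<otimes>\<^bsub>Hom C X Y\<^esub> g) u = mar H X Y f u \<otimes>\<^bsub>mob H X\<^esub> mar H X Y g u" using H X u unfolding is_module_def by simp
    moreover have "f \<otimes>\<^bsub>Hom C X Y\<^esub> g \<in> mor C X Y" using X hom_mon' by (simp add: monoid.m_closed)
    ultimately show "mar K X Y (f \<otimes>\<^bsub>Hom C X Y\<^esub> g) x = mar K X Y f x \<otimes>\<^bsub>mob K X\<^esub> mar K X Y g x" using X u c by (simp add: mar mult)
  qed
  show "(\<lambda>X\<in>Ob C. \<lambda>x\<in>carrier (mob H X). r X x) \<in> mod_hom C H K"
    by (rule mod_homI[OF _ _ _ H]) (simp_all add: car mult mar)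
qed

text \<open>The structure of \<open>H\<close> carried along pointwise maps \<open>r\<close>.
  Representatives are chosen by \<open>inv_into\<close>, so the result is a module only if
  \<open>r\<close> is compatible with the operations, as \<open>push_module\<close>
  requires.\<close>

definition push :: "('o \<Rightarrow> 'w \<Rightarrow> 'v) \<Rightarrow> ('o, 'a, 'w) cmodule \<Rightarrow> ('o, 'a, 'v) cmodule"
  where "push r H = \<lparr>mob = (\<lambda>X. \<lparr>carrier = r X ` carrier (mob H X),
      monoid.mult = (\<lambda>u v. r X (inv_into (carrier (mob H X)) (r X) u \<otimes>\<^bsub>mob H X\<^esub> inv_into (carrier (mob H X)) (r X) v)),
      one = r X \<one>\<^bsub>mob H X\<^esub>\<rparr>),
    mar = (\<lambda>X Y f u. r X (mar H X Y f (inv_into (carrier (mob H Y)) (r Y) u)))\<rparr>"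

lemma push_module:
  fixes r :: "'o \<Rightarrow> 'w \<Rightarrow> 'v"
  assumes H: "is_module C H"
    and c1: "\<And>X x y x' y'. X \<in> Ob C \<Longrightarrow> x \<in> carrier (mob H X) \<Longrightarrow> y \<in> carrier (mob H X) \<Longrightarrow>
      x' \<in> carrier (mob H X) \<Longrightarrow> y' \<in> carrier (mob H X) \<Longrightarrow> r X x = r X x' \<Longrightarrow> r X y = r X y' \<Longrightarrow>
      r X (x \<otimes>\<^bsub>mob H X\<^esub> y) = r X (x' \<otimes>\<^bsub>mob H X\<^esub> y')"
    and c2: "\<And>X Y f y y'. X \<in> Ob C \<Longrightarrow> Y \<in> Ob C \<Longrightarrow> f \<in> mor C X Y \<Longrightarrow> y \<in> carrier (mob H Y) \<Longrightarrow>
      y' \<in> carrier (mob H Y) \<Longrightarrow> r Y y = r Y y' \<Longrightarrow> r X (mar H X Y f y) = r X (mar H X Y f y')"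
  shows "is_module C (push r H)" "(\<lambda>X\<in>Ob C. \<lambda>x\<in>carrier (mob H X). r X x) \<in> mod_hom C H (push r H)"
    "carrier (mob (push r H) X) = r X ` carrier (mob H X)" "\<one>\<^bsub>mob (push r H) X\<^esub> = r X \<one>\<^bsub>mob H X\<^esub>"
proof -
  have s: "inv_into (carrier (mob H X)) (r X) (r X x) \<in> carrier (mob H X)"
    "r X (inv_into (carrier (mob H X)) (r X) (r X x)) = r X x" if "x \<in> carrier (mob H X)" for X x
    using that by (auto intro: inv_into_into f_inv_into_f)
  have "mar (push r H) X Y f (r Y y) = r X (mar H X Y f y)"
    if "X \<in> Ob C" "Y \<in> Ob C" "f \<in> mor C X Y" "y \<in> carrier (mob H Y)" for X Y f y
    unfolding push_def using c2[OF that(1-3) s(1)[OF that(4)] that(4) s(2)[OF that(4)]] by simp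
  moreover have "r X x \<otimes>\<^bsub>mob (push r H) X\<^esub> r X y = r X (x \<otimes>\<^bsub>mob H X\<^esub> y)"
    if "X \<in> Ob C" "x \<in> carrier (mob H X)" "y \<in> carrier (mob H X)" for X x y
    unfolding push_def using c1[OF that(1) s(1)[OF that(2)] s(1)[OF that(3)] that(2,3) s(2)[OF that(2)] s(2)[OF that(3)]] by simp
  ultimately show "is_module C (push r H)" "(\<lambda>X\<in>Ob C. \<lambda>x\<in>carrier (mob H X). r X x) \<in> mod_hom C H (push r H)"
    using image_module[OF H, of "push r H" r] by (simp_all add: push_def)
qed (simp_all add: push_def)

text \<open>Coherence without natural transformations: by Yoneda, an epimorphism from a
  representable module is a generator \<open>y\<close>, and the arrows that annihilate
  \<open>y\<close> are exactly those that factor through \<open>f\<close>.\<close>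

definition presents :: "('o, 'a, 'v) cmodule \<Rightarrow> 'v \<Rightarrow> ('o, 'a) arrow \<Rightarrow> bool"
  where "presents G y f \<longleftrightarrow> arr f \<and> y \<in> carrier (mob G (tgt f)) \<and>
    (\<forall>W\<in>Ob C. \<forall>x\<in>carrier (mob G W). \<exists>g. arr g \<and> src g = W \<and> tgt g = tgt f \<and> act G g y = x) \<and>
    (\<forall>g. arr g \<and> tgt g = tgt f \<longrightarrow> (act G g y = \<one>\<^bsub>mob G (src g)\<^esub> \<longleftrightarrow>
      (\<exists>h. arr h \<and> src h = src g \<and> tgt h = src f \<and> h ;; f = g)))"

lemma coherent_iff: "coherent C G \<longleftrightarrow> is_module C G \<and> (\<exists>y f. presents G y f)"
proof
  assume "coherent C G"
  then obtain X Y f p where G: "is_module C G" and X: "X \<in> Ob C" "Y \<in> Ob C" "f \<in> mor C X Y"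
    and p: "p \<in> mod_hom C (representable C Y) G"
    and e': "\<forall>W\<in>Ob C. p W ` mor C W Y = carrier (mob G W) \<and>
        kernel (Hom C W Y) (mob G W) (p W) = (\<lambda>g. Comp C W X Y g f) ` mor C W X"
    unfolding coherent_def by (elim conjE bexE)
  note e = bspec[OF e']
  define y where "y = p Y (Ident C Y)"
  have y: "y \<in> carrier (mob G Y)" using mod_homD(2)[OF p X(2)] ident_closed[OF X(2)] by (simp add: y_def representable_def)
  have py: "p W g = act G (Arrow W g Y) y" if "W \<in> Ob C" "g \<in> mor C W Y" for W g
    using mod_homD(4)[OF p that(1) X(2) that(2), of "Ident C Y"] ident_closed[OF X(2)] that X
    by (simp add: y_def act_def representable_def ident_right)
  have "presents G y (Arrow X f Y)" unfolding presents_def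
  proof (intro conjI ballI allI impI)
    show "arr (Arrow X f Y)" using X by (simp add: arrI)
    show "y \<in> carrier (mob G (tgt (Arrow X f Y)))" using y by simp
  next
    fix W x assume W: "W \<in> Ob C" "x \<in> carrier (mob G W)"
    then obtain g where "g \<in> mor C W Y" "p W g = x" using e[OF W(1)] by (metis imageE)
    then show "\<exists>g. arr g \<and> src g = W \<and> tgt g = tgt (Arrow X f Y) \<and> act G g y = x"
      using W X py by (intro exI[of _ "Arrow W g Y"]) (simp add: arrI)
  next
    fix g assume g: "arr g \<and> tgt g = tgt (Arrow X f Y)"
    then have g': "src g \<in> Ob C" "val g \<in> mor C (src g) Y" "Arrow (src g) (val g) Y = g" by (auto simp: arr_def simp del: arr_ob)
    have "act G g y = \<one>\<^bsub>mob G (src g)\<^esub> \<longleftrightarrow> val g \<in> kernel (Hom C (src g) Y) (mob G (src g)) (p (src g))"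
      using py[OF g'(1,2)] g' by (simp add: kernel_def)
    also have "\<dots> \<longleftrightarrow> (\<exists>h\<in>mor C (src g) X. val g = Comp C (src g) X Y h f)" using e[OF g'(1)] by auto
    also have "\<dots> \<longleftrightarrow> (\<exists>h. arr h \<and> src h = src g \<and> tgt h = src (Arrow X f Y) \<and> h ;; Arrow X f Y = g)"
    proof
      assume "\<exists>h\<in>mor C (src g) X. val g = Comp C (src g) X Y h f"
      then obtain h where "h \<in> mor C (src g) X" "val g = Comp C (src g) X Y h f" by blast
      then show "\<exists>h. arr h \<and> src h = src g \<and> tgt h = src (Arrow X f Y) \<and> h ;; Arrow X f Y = g"
        using g g' X by (intro exI[of _ "Arrow (src g) h X"]) (auto simp: arrI cmp_def intro!: Arrow_eqI)
    next
      assume "\<exists>h. arr h \<and> src h = src g \<and> tgt h = src (Arrow X f Y) \<and> h ;; Arrow X f Y = g"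
      then obtain h where h: "arr h" "src h = src g" "tgt h = X" "h ;; Arrow X f Y = g" by auto
      have "val g = Comp C (src g) X Y (val h) f" using arg_cong[OF h(4), of val] h by (simp add: cmp_def)
      moreover have "val h \<in> mor C (src g) X" using h unfolding arr_def by simp
      ultimately show "\<exists>h\<in>mor C (src g) X. val g = Comp C (src g) X Y h f" by blast
    qed
    finally show "act G g y = \<one>\<^bsub>mob G (src g)\<^esub> \<longleftrightarrow>
      (\<exists>h. arr h \<and> src h = src g \<and> tgt h = src (Arrow X f Y) \<and> h ;; Arrow X f Y = g)" .
  qed
  then show "is_module C G \<and> (\<exists>y f. presents G y f)" using G by blast
next
  assume "is_module C G \<and> (\<exists>y f. presents G y f)"
  then obtain y f where G: "is_module C G" and p: "presents G y f" by blast
  have f: "arr f" "y \<in> carrier (mob G (tgt f))"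
    and gen: "\<And>W x. W \<in> Ob C \<Longrightarrow> x \<in> carrier (mob G W) \<Longrightarrow> \<exists>g. arr g \<and> src g = W \<and> tgt g = tgt f \<and> act G g y = x"
    and rel: "\<And>g. arr g \<Longrightarrow> tgt g = tgt f \<Longrightarrow> act G g y = \<one>\<^bsub>mob G (src g)\<^esub> \<longleftrightarrow>
      (\<exists>h. arr h \<and> src h = src g \<and> tgt h = src f \<and> h ;; f = g)" using p unfolding presents_def by blast+
  have fm: "val f \<in> mor C (src f) (tgt f)" "src f \<in> Ob C" "tgt f \<in> Ob C" using f unfolding arr_def by auto
  define q where "q = (\<lambda>W\<in>Ob C. \<lambda>g\<in>carrier (mob (representable C (tgt f)) W). mar G W (tgt f) g y)"
  have R: "is_module C (representable C (tgt f))" unfolding is_module_def representable_def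
    using fm(3) by (auto simp: hom_def hom_group comp_closed ident_left comp_assoc comp_add_left comp_add_right)
  have q: "q \<in> mod_hom C (representable C (tgt f)) G" unfolding q_def
  proof (rule mod_homI[OF _ _ _ R])
    fix X g assume X: "X \<in> Ob C" "g \<in> carrier (mob (representable C (tgt f)) X)"
    then show "mar G X (tgt f) g y \<in> carrier (mob G X)"
      using act_closed[OF G, of "Arrow X g (tgt f)" y] f fm by (simp add: act_def representable_def arrI)
    fix h assume "h \<in> carrier (mob (representable C (tgt f)) X)"
    then show "mar G X (tgt f) (g \<otimes>\<^bsub>mob (representable C (tgt f)) X\<^esub> h) y = mar G X (tgt f) g y \<otimes>\<^bsub>mob G X\<^esub> mar G X (tgt f) h y"
      using act_add[OF G, of "Arrow X g (tgt f)" "Arrow X h (tgt f)" y] f fm X by (simp add: act_def representable_def arrI add_def)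
  next
    fix X Y g h assume X: "X \<in> Ob C" "Y \<in> Ob C" "g \<in> mor C X Y" "h \<in> carrier (mob (representable C (tgt f)) Y)"
    then show "mar G X (tgt f) (mar (representable C (tgt f)) X Y g h) y = mar G X Y g (mar G Y (tgt f) h y)"
      using act_cmp[OF G, of "Arrow X g Y" "Arrow Y h (tgt f)" y] f fm by (simp add: act_def representable_def arrI cmp_def)
  qed
  have qv: "q W g = act G (Arrow W g (tgt f)) y" if "W \<in> Ob C" "g \<in> mor C W (tgt f)" for W g
    using that by (simp add: q_def act_def representable_def)
  have "q W ` mor C W (tgt f) = carrier (mob G W) \<and>
        kernel (Hom C W (tgt f)) (mob G W) (q W) = (\<lambda>g. Comp C W (src f) (tgt f) g (val f)) ` mor C W (src f)" if W: "W \<in> Ob C" for W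
  proof
    show "q W ` mor C W (tgt f) = carrier (mob G W)"
    proof (intro equalityI subsetI)
      fix x assume "x \<in> q W ` mor C W (tgt f)"
      then show "x \<in> carrier (mob G W)" using mod_homD(2)[OF q W] by (auto simp: representable_def)
    next
      fix x assume x: "x \<in> carrier (mob G W)"
      obtain g where g: "arr g" "src g = W" "tgt g = tgt f" "act G g y = x" using gen[OF W x] by blast
      have gm: "val g \<in> mor C W (tgt f)" using g unfolding arr_def by simp
      have "q W (val g) = x" using qv[OF W gm] g by simp
      then show "x \<in> q W ` mor C W (tgt f)" using gm by blast
    qed
    show "kernel (Hom C W (tgt f)) (mob G W) (q W) = (\<lambda>g. Comp C W (src f) (tgt f) g (val f)) ` mor C W (src f)"
    proof (intro equalityI subsetI)
      fix g assume "g \<in> kernel (Hom C W (tgt f)) (mob G W) (q W)"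
      then have g: "g \<in> mor C W (tgt f)" "act G (Arrow W g (tgt f)) y = \<one>\<^bsub>mob G W\<^esub>" using qv[OF W] by (auto simp: kernel_def)
      then obtain h where h: "arr h" "src h = W" "tgt h = src f" "h ;; f = Arrow W g (tgt f)"
        using rel[of "Arrow W g (tgt f)"] W fm by (auto simp: arrI)
      have "val h \<in> mor C W (src f)" using h unfolding arr_def by simp
      moreover have "g = Comp C W (src f) (tgt f) (val h) (val f)" using h by (simp add: cmp_def)
      ultimately show "g \<in> (\<lambda>g. Comp C W (src f) (tgt f) g (val f)) ` mor C W (src f)" by blast
    next
      fix g assume "g \<in> (\<lambda>g. Comp C W (src f) (tgt f) g (val f)) ` mor C W (src f)"
      then obtain h where h: "h \<in> mor C W (src f)" "g = Comp C W (src f) (tgt f) h (val f)" by blast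
      then have gm: "g \<in> mor C W (tgt f)" using W fm comp_closed by simp
      have "Arrow W h (src f) ;; f = Arrow W g (tgt f)" using h by (simp add: cmp_def)
      then have "act G (Arrow W g (tgt f)) y = \<one>\<^bsub>mob G W\<^esub>"
        using rel[of "Arrow W g (tgt f)"] W fm gm h by (auto simp: arrI intro!: exI[of _ "Arrow W h (src f)"])
      then show "g \<in> kernel (Hom C W (tgt f)) (mob G W) (q W)" using qv[OF W gm] gm by (simp add: kernel_def)
    qed
  qed
  then show "coherent C G" unfolding coherent_def using G q fm by blast
qed

end

section \<open>The category of coherent modules, with pointwise kernels and cokernels\<close>

context preadditive_category
begin

lemma mod_hom_cmp:
  assumes "is_module C G" "\<sigma> \<in> mod_hom C G H" "\<tau> \<in> mod_hom C H K"
  shows "(\<lambda>X\<in>Ob C. \<lambda>x\<in>carrier (mob G X). \<tau> X (\<sigma> X x)) \<in> mod_hom C G K"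
  by (rule mod_homI[OF _ _ _ assms(1)]) (simp_all add: mod_homD[OF assms(2)] mod_homD[OF assms(3)])

lemma mod_hom_zer:
  assumes G: "is_module C G" "is_module C H"
  shows "(\<lambda>X\<in>Ob C. \<lambda>x\<in>carrier (mob G X). \<one>\<^bsub>mob H X\<^esub>) \<in> mod_hom C G H"
proof (rule mod_homI[OF _ _ _ G(1)])
  fix X assume X: "X \<in> Ob C"
  interpret comm_group "mob H X" by (rule is_module_group[OF G(2) X])
  show "\<one>\<^bsub>mob H X\<^esub> \<in> carrier (mob H X)" "\<one>\<^bsub>mob H X\<^esub> = \<one>\<^bsub>mob H X\<^esub> \<otimes>\<^bsub>mob H X\<^esub> \<one>\<^bsub>mob H X\<^esub>" by simp_all
next
  fix X Y f assume "X \<in> Ob C" "Y \<in> Ob C" "f \<in> mor C X Y"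
  then show "\<one>\<^bsub>mob H X\<^esub> = mar H X Y f \<one>\<^bsub>mob H Y\<^esub>"
    using act_one[OF G(2), of "Arrow X f Y"] by (simp add: act_def arrI)
qed

lemma module_cat_preadditive:
  "preadditive_category (module_cat C :: (('o, 'a, 'v) cmodule, 'o \<Rightarrow> 'v \<Rightarrow> 'v) pcat)"
proof (rule preadditive_category.intro)
  let ?M = "module_cat C :: (('o, 'a, 'v) cmodule, 'o \<Rightarrow> 'v \<Rightarrow> 'v) pcat"
  have mult: "(\<lambda>X\<in>Ob C. \<lambda>x\<in>carrier (mob G X). \<sigma> X x \<otimes>\<^bsub>mob H X\<^esub> \<tau> X x) \<in> mod_hom C G H"
    if G: "is_module C G" "is_module C H" and s: "\<sigma> \<in> mod_hom C G H" "\<tau> \<in> mod_hom C G H"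
    for G H :: "('o, 'a, 'v) cmodule" and \<sigma> \<tau>
  proof (rule mod_homI[OF _ _ _ G(1)])
    fix X x assume X: "X \<in> Ob C" "x \<in> carrier (mob G X)"
    interpret comm_group "mob H X" by (rule is_module_group[OF G(2) X(1)])
    show "\<sigma> X x \<otimes>\<^bsub>mob H X\<^esub> \<tau> X x \<in> carrier (mob H X)" using X s mod_homD(2) by (metis m_closed)
    fix y assume y: "y \<in> carrier (mob G X)"
    have c: "\<sigma> X x \<in> carrier (mob H X)" "\<tau> X x \<in> carrier (mob H X)" "\<sigma> X y \<in> carrier (mob H X)" "\<tau> X y \<in> carrier (mob H X)"
      using mod_homD(2)[OF s(1) X(1)] mod_homD(2)[OF s(2) X(1)] X y by simp_all
    show "\<sigma> X (x \<otimes>\<^bsub>mob G X\<^esub> y) \<otimes>\<^bsub>mob H X\<^esub> \<tau> X (x \<otimes>\<^bsub>mob G X\<^esub> y) =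
       \<sigma> X x \<otimes>\<^bsub>mob H X\<^esub> \<tau> X x \<otimes>\<^bsub>mob H X\<^esub> (\<sigma> X y \<otimes>\<^bsub>mob H X\<^esub> \<tau> X y)"
      using mod_homD(3)[OF s(1) X y] mod_homD(3)[OF s(2) X y] c by (simp add: m_ac)
  next
    fix X Y f x assume X: "X \<in> Ob C" "Y \<in> Ob C" "f \<in> mor C X Y" "x \<in> carrier (mob G Y)"
    have c: "\<sigma> Y x \<in> carrier (mob H Y)" "\<tau> Y x \<in> carrier (mob H Y)"
      using mod_homD(2)[OF s(1) X(2)] mod_homD(2)[OF s(2) X(2)] X by simp_all
    show "\<sigma> X (mar G X Y f x) \<otimes>\<^bsub>mob H X\<^esub> \<tau> X (mar G X Y f x) = mar H X Y f (\<sigma> Y x \<otimes>\<^bsub>mob H Y\<^esub> \<tau> Y x)"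
      using mod_homD(4)[OF s(1) X] mod_homD(4)[OF s(2) X] act_mult[OF G(2), of "Arrow X f Y" "\<sigma> Y x" "\<tau> Y x"] c X
      by (simp add: act_def arrI)
  qed
  have inv: "(\<lambda>X\<in>Ob C. \<lambda>x\<in>carrier (mob G X). inv\<^bsub>mob H X\<^esub> (\<tau> X x)) \<in> mod_hom C G H"
    if G: "is_module C G" "is_module C H" and s: "\<tau> \<in> mod_hom C G H" for G H :: "('o, 'a, 'v) cmodule" and \<tau>
  proof (rule mod_homI[OF _ _ _ G(1)])
    fix X x assume X: "X \<in> Ob C" "x \<in> carrier (mob G X)"
    interpret comm_group "mob H X" by (rule is_module_group[OF G(2) X(1)])
    have c: "\<tau> X z \<in> carrier (mob H X)" if "z \<in> carrier (mob G X)" for z using mod_homD(2)[OF s X(1) that] .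
    show "inv\<^bsub>mob H X\<^esub> (\<tau> X x) \<in> carrier (mob H X)" using c X by simp
    fix y assume y: "y \<in> carrier (mob G X)"
    show "inv\<^bsub>mob H X\<^esub> (\<tau> X (x \<otimes>\<^bsub>mob G X\<^esub> y)) = inv\<^bsub>mob H X\<^esub> (\<tau> X x) \<otimes>\<^bsub>mob H X\<^esub> inv\<^bsub>mob H X\<^esub> (\<tau> X y)"
      using mod_homD(3)[OF s X y] c X(2) y by (simp add: inv_mult)
  next
    fix X Y f x assume X: "X \<in> Ob C" "Y \<in> Ob C" "f \<in> mor C X Y" "x \<in> carrier (mob G Y)"
    have a: "arr (Arrow X f Y)" using X by (simp add: arrI)
    have c: "\<tau> Y x \<in> carrier (mob H Y)" using mod_homD(2)[OF s X(2,4)] .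
    show "inv\<^bsub>mob H X\<^esub> (\<tau> X (mar G X Y f x)) = mar H X Y f (inv\<^bsub>mob H Y\<^esub> (\<tau> Y x))"
      using mod_homD(4)[OF s X] group_hom.hom_inv[OF act_hom[OF G(2) a], of "\<tau> Y x"] c by (simp add: act_def)
  qed
  show "comm_group (Hom ?M G H)" if "G \<in> Ob ?M" "H \<in> Ob ?M" for G H
  proof -
    have G: "is_module C G" "is_module C H" using that by simp_all
    have c: "\<tau> X x \<in> carrier (mob H X)" if "\<tau> \<in> mod_hom C G H" "X \<in> Ob C" "x \<in> carrier (mob G X)" for \<tau> X x
      using mod_homD(2)[OF that] .
    have g: "comm_group (mob H X)" if "X \<in> Ob C" for X by (rule is_module_group[OF G(2) that])
    note m = comm_group.axioms(1)[OF g] and gr = comm_group.axioms(2)[OF g]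
    note mo = group.is_monoid[OF gr]
    show ?thesis
    proof (rule comm_groupI)
      fix \<sigma> \<tau> assume s: "\<sigma> \<in> carrier (Hom ?M G H)" "\<tau> \<in> carrier (Hom ?M G H)"
      then show "\<sigma> \<otimes>\<^bsub>Hom ?M G H\<^esub> \<tau> \<in> carrier (Hom ?M G H)" using mult[OF G] by simp
      show "\<sigma> \<otimes>\<^bsub>Hom ?M G H\<^esub> \<tau> = \<tau> \<otimes>\<^bsub>Hom ?M G H\<^esub> \<sigma>"
        using s c comm_monoid.m_comm[OF m] by (auto intro!: restrict_ext)
    next
      show "\<one>\<^bsub>Hom ?M G H\<^esub> \<in> carrier (Hom ?M G H)" using mod_hom_zer[OF G] by simp
    next
      fix \<rho> \<sigma> \<tau> assume s: "\<rho> \<in> carrier (Hom ?M G H)" "\<sigma> \<in> carrier (Hom ?M G H)" "\<tau> \<in> carrier (Hom ?M G H)"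
      then show "\<rho> \<otimes>\<^bsub>Hom ?M G H\<^esub> \<sigma> \<otimes>\<^bsub>Hom ?M G H\<^esub> \<tau> = \<rho> \<otimes>\<^bsub>Hom ?M G H\<^esub> (\<sigma> \<otimes>\<^bsub>Hom ?M G H\<^esub> \<tau>)"
        using c monoid.m_assoc[OF mo] by (auto intro!: restrict_ext)
    next
      fix \<tau> assume s: "\<tau> \<in> carrier (Hom ?M G H)"
      then have t: "\<tau> \<in> mod_hom C G H" by simp
      show "\<one>\<^bsub>Hom ?M G H\<^esub> \<otimes>\<^bsub>Hom ?M G H\<^esub> \<tau> = \<tau>"
        using mult[OF G mod_hom_zer[OF G] t] t c monoid.l_one[OF mo] by (auto intro!: mod_hom_eqI[of _ C G H])
      show "\<exists>\<sigma>\<in>carrier (Hom ?M G H). \<sigma> \<otimes>\<^bsub>Hom ?M G H\<^esub> \<tau> = \<one>\<^bsub>Hom ?M G H\<^esub>"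
        using inv[OF G t] t c group.l_inv[OF gr]
        by (intro bexI[of _ "\<lambda>X\<in>Ob C. \<lambda>x\<in>carrier (mob G X). inv\<^bsub>mob H X\<^esub> (\<tau> X x)"]) (auto intro!: restrict_ext)
    qed
  qed
  show "Comp ?M X Y Z f g \<in> mor ?M X Z"
    if "X \<in> Ob ?M" "Y \<in> Ob ?M" "Z \<in> Ob ?M" "f \<in> mor ?M X Y" "g \<in> mor ?M Y Z" for X Y Z f g
    using mod_hom_cmp[of X f Y g Z] that by simp
  have ident: "(\<lambda>X\<in>Ob C. \<lambda>x\<in>carrier (mob G X). x) \<in> mod_hom C G G" if "is_module C G" for G :: "('o, 'a, 'v) cmodule"
    by (rule mod_homI[OF _ _ _ that]) simp_all
  show "Ident ?M X \<in> mor ?M X X" if "X \<in> Ob ?M" for X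
    using ident[of X] that by simp
  show "Comp ?M X X Y (Ident ?M X) f = f" if "X \<in> Ob ?M" "Y \<in> Ob ?M" "f \<in> mor ?M X Y" for X Y f
    using mod_hom_cmp[of X "Ident ?M X" X f Y] ident[of X] that by (auto intro!: mod_hom_eqI[of _ C X Y])
  show "Comp ?M X Y Y f (Ident ?M Y) = f" if "X \<in> Ob ?M" "Y \<in> Ob ?M" "f \<in> mor ?M X Y" for X Y f
    using mod_hom_cmp[of X f Y "Ident ?M Y" Y] ident[of Y] mod_homD(2)[of f C X Y] that by (auto intro!: mod_hom_eqI[of _ C X Y])
  show "Comp ?M W Y Z (Comp ?M W X Y f g) h = Comp ?M W X Z f (Comp ?M X Y Z g h)"
    if "W \<in> Ob ?M" "X \<in> Ob ?M" "Y \<in> Ob ?M" "Z \<in> Ob ?M" "f \<in> mor ?M W X" "g \<in> mor ?M X Y" "h \<in> mor ?M Y Z" for W X Y Z f g h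
    using that mod_homD(2)[of f C W X] by (auto intro!: restrict_ext)
  show "Comp ?M X Y Z (f \<otimes>\<^bsub>Hom ?M X Y\<^esub> f') g = Comp ?M X Y Z f g \<otimes>\<^bsub>Hom ?M X Z\<^esub> Comp ?M X Y Z f' g"
    if "X \<in> Ob ?M" "Y \<in> Ob ?M" "Z \<in> Ob ?M" "f \<in> mor ?M X Y" "f' \<in> mor ?M X Y" "g \<in> mor ?M Y Z" for X Y Z f f' g
    using that mod_homD(2)[of f C X Y] mod_homD(2)[of f' C X Y] mod_homD(3)[of g C Y Z] by (auto intro!: restrict_ext)
  show "Comp ?M X Y Z f (g \<otimes>\<^bsub>Hom ?M Y Z\<^esub> g') = Comp ?M X Y Z f g \<otimes>\<^bsub>Hom ?M X Z\<^esub> Comp ?M X Y Z f g'"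
    if "X \<in> Ob ?M" "Y \<in> Ob ?M" "Z \<in> Ob ?M" "f \<in> mor ?M X Y" "g \<in> mor ?M Y Z" "g' \<in> mor ?M Y Z" for X Y Z f g g'
    using that mod_homD(2)[of f C X Y] by (auto intro!: restrict_ext)
qed

lemma coh_cat_simps [simp]:
  "Ob (coh_cat C) = {G. coherent C G}" "Hom (coh_cat C) = Hom (module_cat C)"
  "Comp (coh_cat C) = Comp (module_cat C)" "Ident (coh_cat C) = Ident (module_cat C)"
  by (simp_all add: coh_cat_def)

lemma coherent_module: "coherent C G \<Longrightarrow> is_module C G"
  by (simp add: coherent_def)

lemma coh_cat_preadditive: "preadditive_category (coh_cat C)"
  unfolding coh_cat_def by (rule full_subcat_preadditive[OF module_cat_preadditive]) (auto simp: coherent_module)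

text \<open>The values of a transformation killed by \<tau> lie in the image of \<kappa>, where
  injectivity allows pointwise division by \<kappa>; injectivity also makes the quotient additive
  and natural.\<close>

lemma pointwise_ker:
  assumes G: "coherent C G" "coherent C H" "coherent C K" and t: "\<tau> \<in> mod_hom C G H" "\<kappa> \<in> mod_hom C K G"
    and inj: "\<And>X. X \<in> Ob C \<Longrightarrow> inj_on (\<kappa> X) (carrier (mob K X))"
    and im: "\<And>X. X \<in> Ob C \<Longrightarrow> \<kappa> X ` carrier (mob K X) = {x \<in> carrier (mob G X). \<tau> X x = \<one>\<^bsub>mob H X\<^esub>}"
  shows "is_ker (coh_cat C) G H \<tau> K \<kappa>"
  unfolding is_ker_def
proof (intro conjI ballI impI)
  note m = coherent_module[OF G(1)] coherent_module[OF G(2)] coherent_module[OF G(3)]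
  show "K \<in> Ob (coh_cat C)" "\<kappa> \<in> mor (coh_cat C) K G" using G t by simp_all
  have k: "\<kappa> X x \<in> carrier (mob G X) \<and> \<tau> X (\<kappa> X x) = \<one>\<^bsub>mob H X\<^esub>" if "X \<in> Ob C" "x \<in> carrier (mob K X)" for X x
    using im[OF that(1)] that(2) by auto
  then show "Comp (coh_cat C) K G H \<kappa> \<tau> = zero_mor (coh_cat C) K H" by (auto intro!: restrict_ext)
  fix W g assume W: "W \<in> Ob (coh_cat C)" "g \<in> mor (coh_cat C) W G" "Comp (coh_cat C) W G H g \<tau> = zero_mor (coh_cat C) W H"
  then have w: "is_module C W" "g \<in> mod_hom C W G" by (simp_all add: coherent_module)
  have z: "g X x \<in> \<kappa> X ` carrier (mob K X)" if "X \<in> Ob C" "x \<in> carrier (mob W X)" for X x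
    unfolding im[OF that(1)] using mod_homD(2)[OF w(2) that] fun_cong[OF fun_cong[OF W(3), of X], of x] that by simp
  define h where "h X x = inv_into (carrier (mob K X)) (\<kappa> X) (g X x)" for X x
  have h: "h X x \<in> carrier (mob K X)" "\<kappa> X (h X x) = g X x" if "X \<in> Ob C" "x \<in> carrier (mob W X)" for X x
    using z[OF that] by (auto simp: h_def inv_into_into f_inv_into_f)
  have eq: "a = b" if "X \<in> Ob C" "a \<in> carrier (mob K X)" "b \<in> carrier (mob K X)" "\<kappa> X a = \<kappa> X b" for X a b
    using inj[OF that(1)] that by (auto dest: inj_onD)
  have cl: "x \<otimes>\<^bsub>mob K X\<^esub> y \<in> carrier (mob K X)" if "X \<in> Ob C" "x \<in> carrier (mob K X)" "y \<in> carrier (mob K X)" for X x y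
    using is_module_mon[OF m(3) that(1)] that by (simp add: monoid.m_closed)
  have clW: "x \<otimes>\<^bsub>mob W X\<^esub> y \<in> carrier (mob W X)" if "X \<in> Ob C" "x \<in> carrier (mob W X)" "y \<in> carrier (mob W X)" for X x y
    using is_module_mon[OF w(1) that(1)] that by (simp add: monoid.m_closed)
  have maW: "mar W X Y f y \<in> carrier (mob W X)" if "X \<in> Ob C" "Y \<in> Ob C" "f \<in> mor C X Y" "y \<in> carrier (mob W Y)" for X Y f y
    using act_closed[OF w(1), of "Arrow X f Y" y] that by (simp add: act_def arrI)
  have maK: "mar K X Y f y \<in> carrier (mob K X)" if "X \<in> Ob C" "Y \<in> Ob C" "f \<in> mor C X Y" "y \<in> carrier (mob K Y)" for X Y f y
    using act_closed[OF m(3), of "Arrow X f Y" y] that by (simp add: act_def arrI)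
  let ?h = "\<lambda>X\<in>Ob C. \<lambda>x\<in>carrier (mob W X). h X x"
  have hm: "?h \<in> mod_hom C W K"
  proof (rule mod_homI[OF _ _ _ w(1)])
    fix X x y assume X: "X \<in> Ob C" "x \<in> carrier (mob W X)" "y \<in> carrier (mob W X)"
    show "h X (x \<otimes>\<^bsub>mob W X\<^esub> y) = h X x \<otimes>\<^bsub>mob K X\<^esub> h X y"
      by (rule eq[OF X(1)]) (simp_all add: X h cl clW mod_homD(3)[OF t(2)] mod_homD(3)[OF w(2)])
  next
    fix X Y f x assume X: "X \<in> Ob C" "Y \<in> Ob C" "f \<in> mor C X Y" "x \<in> carrier (mob W Y)"
    show "h X (mar W X Y f x) = mar K X Y f (h Y x)"
      by (rule eq[OF X(1)]) (simp_all add: X h maW maK mod_homD(4)[OF t(2)] mod_homD(4)[OF w(2)])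
  qed (simp add: h)
  show "\<exists>!h. h \<in> mor (coh_cat C) W K \<and> Comp (coh_cat C) W K G h \<kappa> = g"
  proof (rule ex1I[of _ ?h])
    show "?h \<in> mor (coh_cat C) W K \<and> Comp (coh_cat C) W K G ?h \<kappa> = g"
    proof
      show "?h \<in> mor (coh_cat C) W K" using hm by simp
      have "Comp (coh_cat C) W K G ?h \<kappa> \<in> mor (coh_cat C) W G"
        using preadditive_category.comp_closed[OF coh_cat_preadditive, of W K G ?h \<kappa>] W G t hm by simp
      then show "Comp (coh_cat C) W K G ?h \<kappa> = g"
        by (intro mod_hom_eqI[of _ C W G]) (use w(2) h in simp_all)
    qed
    fix h' assume h': "h' \<in> mor (coh_cat C) W K \<and> Comp (coh_cat C) W K G h' \<kappa> = g"
    show "h' = ?h"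
    proof (rule mod_hom_eqI[OF _ hm])
      show "h' \<in> mod_hom C W K" using h' by simp
      fix X x assume X: "X \<in> Ob C" "x \<in> carrier (mob W X)"
      have "\<kappa> X (h' X x) = g X x" using fun_cong[OF fun_cong[OF h'[THEN conjunct2], of X], of x] X by simp
      moreover have "h' X x \<in> carrier (mob K X)" using h' mod_homD(2)[of h' C W K X x] X by simp
      ultimately show "h' X x = ?h X x" using eq[OF X(1)] h[OF X] X by simp
    qed
  qed
qed

text \<open>A transformation that kills \<tau> takes equal values on elements with the same image
  under \<pi> (\<open>wd\<close>), so any choice of preimages \<open>s\<close> defines the induced
  one.\<close>

lemma pointwise_coker:
  assumes G: "coherent C G" "coherent C H" "coherent C Q" and t: "\<tau> \<in> mod_hom C G H" "\<pi> \<in> mod_hom C H Q"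
    and sur: "\<And>X. X \<in> Ob C \<Longrightarrow> \<pi> X ` carrier (mob H X) = carrier (mob Q X)"
    and ker: "\<And>X y. X \<in> Ob C \<Longrightarrow> y \<in> carrier (mob H X) \<Longrightarrow> \<pi> X y = \<one>\<^bsub>mob Q X\<^esub> \<longleftrightarrow> y \<in> \<tau> X ` carrier (mob G X)"
  shows "is_coker (coh_cat C) G H \<tau> Q \<pi>"
  unfolding is_coker_def
proof (intro conjI ballI impI)
  note m = coherent_module[OF G(1)] coherent_module[OF G(2)] coherent_module[OF G(3)]
  show "Q \<in> Ob (coh_cat C)" "\<pi> \<in> mor (coh_cat C) H Q" using G t by simp_all
  show "Comp (coh_cat C) G H Q \<tau> \<pi> = zero_mor (coh_cat C) G Q"
    using ker mod_homD(2)[OF t(1)] by (auto intro!: restrict_ext)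
  fix Z g assume Z: "Z \<in> Ob (coh_cat C)" "g \<in> mor (coh_cat C) H Z" "Comp (coh_cat C) G H Z \<tau> g = zero_mor (coh_cat C) G Z"
  then have w: "is_module C Z" "g \<in> mod_hom C H Z" by (simp_all add: coherent_module)
  have z: "g X (\<tau> X x) = \<one>\<^bsub>mob Z X\<^esub>" if "X \<in> Ob C" "x \<in> carrier (mob G X)" for X x
    using fun_cong[OF fun_cong[OF Z(3), of X], of x] that by simp
  have wd: "g X a = g X b" if X: "X \<in> Ob C" "a \<in> carrier (mob H X)" "b \<in> carrier (mob H X)" "\<pi> X a = \<pi> X b" for X a b
  proof -
    interpret H: comm_group "mob H X" by (rule is_module_group[OF m(2) X(1)])
    interpret Q: comm_group "mob Q X" by (rule is_module_group[OF m(3) X(1)])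
    interpret Z: comm_group "mob Z X" by (rule is_module_group[OF w(1) X(1)])
    have c: "\<pi> X b \<in> carrier (mob Q X)" "g X a \<in> carrier (mob Z X)" "g X b \<in> carrier (mob Z X)"
      using mod_homD(2)[OF t(2) X(1,3)] mod_homD(2)[OF w(2) X(1)] X by simp_all
    have ib: "inv\<^bsub>mob H X\<^esub> b \<in> carrier (mob H X)" using X(3) by simp
    have "\<pi> X (a \<otimes>\<^bsub>mob H X\<^esub> inv\<^bsub>mob H X\<^esub> b) = \<one>\<^bsub>mob Q X\<^esub>"
      using mod_homD(3)[OF t(2) X(1,2) ib] mod_hom_inv[OF m(2,3) t(2) X(1,3)] X(4) c by simp
    then obtain x where x: "x \<in> carrier (mob G X)" "a \<otimes>\<^bsub>mob H X\<^esub> inv\<^bsub>mob H X\<^esub> b = \<tau> X x"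
      using ker[OF X(1), of "a \<otimes>\<^bsub>mob H X\<^esub> inv\<^bsub>mob H X\<^esub> b"] X ib by auto
    have "g X a \<otimes>\<^bsub>mob Z X\<^esub> inv\<^bsub>mob Z X\<^esub> (g X b) = \<one>\<^bsub>mob Z X\<^esub>"
      using mod_homD(3)[OF w(2) X(1,2) ib] mod_hom_inv[OF m(2) w(1) w(2) X(1,3)] z[OF X(1) x(1)] x(2) by simp
    then have "g X a \<otimes>\<^bsub>mob Z X\<^esub> inv\<^bsub>mob Z X\<^esub> (g X b) \<otimes>\<^bsub>mob Z X\<^esub> g X b = \<one>\<^bsub>mob Z X\<^esub> \<otimes>\<^bsub>mob Z X\<^esub> g X b" by simp
    then show ?thesis using c by (simp add: Z.m_assoc)
  qed
  define s where "s X u = inv_into (carrier (mob H X)) (\<pi> X) u" for X u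
  have s: "s X u \<in> carrier (mob H X)" "\<pi> X (s X u) = u" if "X \<in> Ob C" "u \<in> carrier (mob Q X)" for X u
    using sur[OF that(1)] that by (auto simp: s_def inv_into_into f_inv_into_f)
  have gs: "g X (s X (\<pi> X y)) = g X y" if "X \<in> Ob C" "y \<in> carrier (mob H X)" for X y
    using wd[OF that(1) s(1) that(2) s(2)] mod_homD(2)[OF t(2) that] that(1) by simp
  have cl: "x \<otimes>\<^bsub>mob H X\<^esub> y \<in> carrier (mob H X)" if "X \<in> Ob C" "x \<in> carrier (mob H X)" "y \<in> carrier (mob H X)" for X x y
    using is_module_mon[OF m(2) that(1)] that by (simp add: monoid.m_closed)
  have ma: "mar H X Y f y \<in> carrier (mob H X)" if "X \<in> Ob C" "Y \<in> Ob C" "f \<in> mor C X Y" "y \<in> carrier (mob H Y)" for X Y f y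
    using act_closed[OF m(2), of "Arrow X f Y" y] that by (simp add: act_def arrI)
  let ?h = "\<lambda>X\<in>Ob C. \<lambda>u\<in>carrier (mob Q X). g X (s X u)"
  have hm: "?h \<in> mod_hom C Q Z"
  proof (rule mod_homI[OF _ _ _ m(3)])
    fix X u assume X: "X \<in> Ob C" "u \<in> carrier (mob Q X)"
    then show "g X (s X u) \<in> carrier (mob Z X)" using mod_homD(2)[OF w(2)] s by simp
    fix v assume v: "v \<in> carrier (mob Q X)"
    have "u \<otimes>\<^bsub>mob Q X\<^esub> v = \<pi> X (s X u \<otimes>\<^bsub>mob H X\<^esub> s X v)" using mod_homD(3)[OF t(2) X(1)] s X v by simp
    then show "g X (s X (u \<otimes>\<^bsub>mob Q X\<^esub> v)) = g X (s X u) \<otimes>\<^bsub>mob Z X\<^esub> g X (s X v)"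
      using gs cl s X v mod_homD(3)[OF w(2) X(1)] by simp
  next
    fix X Y f u assume X: "X \<in> Ob C" "Y \<in> Ob C" "f \<in> mor C X Y" "u \<in> carrier (mob Q Y)"
    have "mar Q X Y f u = \<pi> X (mar H X Y f (s Y u))" using mod_homD(4)[OF t(2) X(1-3)] s X by simp
    then show "g X (s X (mar Q X Y f u)) = mar Z X Y f (g Y (s Y u))"
      using gs ma s X mod_homD(4)[OF w(2) X(1-3)] by simp
  qed
  show "\<exists>!h. h \<in> mor (coh_cat C) Q Z \<and> Comp (coh_cat C) H Q Z \<pi> h = g"
  proof (rule ex1I[of _ ?h])
    show "?h \<in> mor (coh_cat C) Q Z \<and> Comp (coh_cat C) H Q Z \<pi> ?h = g"
    proof
      show "?h \<in> mor (coh_cat C) Q Z" using hm by simp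
      have "Comp (coh_cat C) H Q Z \<pi> ?h \<in> mor (coh_cat C) H Z"
        using preadditive_category.comp_closed[OF coh_cat_preadditive, of H Q Z \<pi> ?h] Z G t hm by simp
      then show "Comp (coh_cat C) H Q Z \<pi> ?h = g"
        by (intro mod_hom_eqI[of _ C H Z]) (use w(2) gs mod_homD(2)[OF t(2)] in simp_all)
    qed
    fix h' assume h': "h' \<in> mor (coh_cat C) Q Z \<and> Comp (coh_cat C) H Q Z \<pi> h' = g"
    show "h' = ?h"
    proof (rule mod_hom_eqI[OF _ hm])
      show "h' \<in> mod_hom C Q Z" using h' by simp
      fix X u assume X: "X \<in> Ob C" "u \<in> carrier (mob Q X)"
      have "h' X (\<pi> X (s X u)) = g X (s X u)"
        using fun_cong[OF fun_cong[OF h'[THEN conjunct2], of X], of "s X u"] s[OF X] X by simp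
      then show "h' X u = ?h X u" using s[OF X] X by simp
    qed
  qed
qed

end

section \<open>Coherent modules over a category with weak kernels\<close>

locale weak_kernel_category = additive_category C for C :: "('o, 'a) pcat" +
  assumes weak_kernel: "arr f \<Longrightarrow> \<exists>k. arr k \<and> tgt k = src f \<and> k ;; f = zer (src k) (tgt f) \<and>
    (\<forall>x. arr x \<and> tgt x = src f \<and> x ;; f = zer (src x) (tgt f) \<longrightarrow> (\<exists>w. arr w \<and> src w = src x \<and> tgt w = src k \<and> w ;; k = x))"

context preadditive_category
begin

lemma presentsD:
  assumes "presents G y f"
  shows "arr f" "y \<in> carrier (mob G (tgt f))"
    "\<And>W x. W \<in> Ob C \<Longrightarrow> x \<in> carrier (mob G W) \<Longrightarrow> \<exists>g. arr g \<and> src g = W \<and> tgt g = tgt f \<and> act G g y = x"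
    "\<And>g. arr g \<Longrightarrow> tgt g = tgt f \<Longrightarrow> act G g y = \<one>\<^bsub>mob G (src g)\<^esub> \<longleftrightarrow> (\<exists>h. arr h \<and> src h = src g \<and> tgt h = src f \<and> h ;; f = g)"
  using assms unfolding presents_def by blast+

lemma coherentI: "is_module C G \<Longrightarrow> presents G y f \<Longrightarrow> coherent C G"
  using coherent_iff by blast

lemma coherentE: assumes "coherent C G" obtains y f where "is_module C G" "presents G y f"
  using assms coherent_iff by blast

lemma act_eq_iff:
  assumes G: "is_module C G" and a: "par a b" "y \<in> carrier (mob G (tgt a))"
  shows "act G a y = act G b y \<longleftrightarrow> act G (a \<boxplus> neg b) y = \<one>\<^bsub>mob G (src a)\<^esub>"
proof -
  interpret group "mob G (src a)" using is_module_grp[OF G] a by simp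
  have c: "act G a y \<in> carrier (mob G (src a))" "act G b y \<in> carrier (mob G (src a))"
    using act_closed[OF G, of a y] act_closed[OF G, of b y] a by simp_all
  have "act G (a \<boxplus> neg b) y = act G a y \<otimes>\<^bsub>mob G (src a)\<^esub> inv\<^bsub>mob G (src a)\<^esub> (act G b y)"
    using act_add[OF G, of a "neg b" y] act_neg[OF G, of b y] a by simp
  moreover have "act G a y = act G b y" if "act G a y \<otimes>\<^bsub>mob G (src a)\<^esub> inv\<^bsub>mob G (src a)\<^esub> (act G b y) = \<one>\<^bsub>mob G (src a)\<^esub>"
    using inv_equality[OF that] c by simp
  ultimately show ?thesis using c by auto
qed

lemma pointwise_module:
  fixes K :: "('o, 'a, 'v) cmodule"
  assumes "is_module C G" "is_module C H" "\<tau> \<in> mod_hom C G H"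
    and K: "K = \<lparr>mob = (\<lambda>X. (mob G X)\<lparr>carrier := {x \<in> carrier (mob G X). \<tau> X x = \<one>\<^bsub>mob H X\<^esub>}\<rparr>), mar = mar G\<rparr>"
  shows "is_module C K" "(\<lambda>X\<in>Ob C. \<lambda>x\<in>carrier (mob K X). x) \<in> mod_hom C K G"
proof -
  have sub: "subgroup {x \<in> carrier (mob G X). \<tau> X x = \<one>\<^bsub>mob H X\<^esub>} (mob G X)" if X: "X \<in> Ob C" for X
  proof -
    have "group_hom (mob G X) (mob H X) (\<tau> X)"
      using mod_homD(1)[OF assms(3) X] is_module_grp[OF assms(1) X] is_module_grp[OF assms(2) X]
      by (simp add: group_hom_def group_hom_axioms_def)
    from group_hom.subgroup_kernel[OF this] show ?thesis by (simp add: kernel_def)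
  qed
  have ma: "mar G X Y f x \<in> carrier (mob G X) \<and> \<tau> X (mar G X Y f x) = \<one>\<^bsub>mob H X\<^esub>"
    if X: "X \<in> Ob C" "Y \<in> Ob C" "f \<in> mor C X Y" and x: "x \<in> carrier (mob G Y)" "\<tau> Y x = \<one>\<^bsub>mob H Y\<^esub>" for X Y f x
    using mod_homD(4)[OF assms(3) X x(1)] act_one[OF assms(2), of "Arrow X f Y"] act_closed[OF assms(1), of "Arrow X f Y" x] X x
    by (simp add: act_def arrI)
  show m: "is_module C K" unfolding is_module_def
  proof (intro conjI ballI)
    fix X assume X: "X \<in> Ob C"
    interpret G: comm_group "mob G X" by (rule is_module_group[OF assms(1) X])
    show "comm_group (mob K X)" unfolding K
      using group.group_comm_groupI[OF G.subgroup_imp_group[OF sub[OF X]]] G.m_comm by simp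
  next
    fix X Y f assume X: "X \<in> Ob C" "Y \<in> Ob C" "f \<in> mor C X Y"
    show "mar K X Y f \<in> hom (mob K Y) (mob K X)"
      using ma[OF X] act_mult[OF assms(1), of "Arrow X f Y"] X unfolding K by (auto simp: hom_def act_def arrI)
  qed (use assms(1) in \<open>auto simp: K is_module_def\<close>)
  show "(\<lambda>X\<in>Ob C. \<lambda>x\<in>carrier (mob K X). x) \<in> mod_hom C K G"
    by (rule mod_homI[OF _ _ _ m]) (simp_all add: K)
qed

end

context weak_kernel_category
begin

text \<open>A weak kernel of the difference of \<open>h\<close> and \<open>f\<close> on a direct
  sum. The final clause records the first component of a factorisation, which is the one that
  presentations need.\<close>

lemma weak_pullback:
  assumes h: "arr h" "arr f" "tgt h = tgt f"
  obtains a b where "arr a" "arr b" "src b = src a" "tgt a = src h" "tgt b = src f" "a ;; h = b ;; f"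
    "\<forall>u v. arr u \<and> arr v \<and> src v = src u \<and> tgt u = src h \<and> tgt v = src f \<and> u ;; h = v ;; f \<longrightarrow>
      (\<exists>w. arr w \<and> src w = src u \<and> tgt w = src a \<and> w ;; a = u)"
proof -
  have ob: "src h \<in> Ob C" "src f \<in> Ob C" using h by simp_all
  obtain i j p q where b: "bip i j p q" "src i = src h" "src j = src f" using ex_bip[OF ob] .
  note B = bipD[OF b(1)] and R = bip_red[OF b(1)]
  define m where "m = p ;; h \<boxplus> neg (q ;; f)"
  have m: "arr m" "src m = tgt i" "tgt m = tgt h" unfolding m_def using B b h by simp_all
  obtain k where k: "arr k" "tgt k = src m" "k ;; m = zer (src k) (tgt m)"
    "\<forall>x. arr x \<and> tgt x = src m \<and> x ;; m = zer (src x) (tgt m) \<longrightarrow> (\<exists>w. arr w \<and> src w = src x \<and> tgt w = src k \<and> w ;; k = x)"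
    using weak_kernel[OF m(1)] by (elim exE conjE)
  have xm: "x ;; m = x ;; p ;; h \<boxplus> neg (x ;; q ;; f)" if "arr x" "tgt x = tgt i" for x
    unfolding m_def using that B(1-9) b h by simp
  have e: "(k ;; p) ;; h = (k ;; q) ;; f"
  proof -
    have ti: "tgt k = tgt i" using k(2) m(2) by simp
    have z: "k ;; p ;; h \<boxplus> neg (k ;; q ;; f) = zer (src k) (tgt h)" using xm[OF k(1) ti] k(3) m(3) by simp
    have "par (k ;; p ;; h) (k ;; q ;; f)" using k(1) ti B(1-9) b h by simp
    from iffD1[OF add_neg_eq_zer[OF this]] z have "k ;; p ;; h = k ;; q ;; f" by simp
    then show ?thesis using k(1) ti B(1-9) b h by simp
  qed
  show ?thesis
  proof (rule that[of "k ;; p" "k ;; q"], goal_cases)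
    case 7
    show ?case
    proof (intro allI impI, elim conjE)
    fix u v assume u: "arr u" "arr v" "src v = src u" "tgt u = src h" "tgt v = src f" "u ;; h = v ;; f"
    define x where "x = u ;; i \<boxplus> v ;; j"
    have x: "arr x" "src x = src u" "tgt x = tgt i" unfolding x_def using u B b by simp_all
    have xp: "x ;; p = u" "x ;; q = v" unfolding x_def using u(1-5) B(1-13) b ob by simp_all
    have "x ;; m = (x ;; p) ;; h \<boxplus> neg ((x ;; q) ;; f)" using xm[of x] x B b h by simp
    also have "\<dots> = zer (src x) (tgt m)" unfolding xp u(6) using u(1-5) h x(2) m(3) by simp
    finally have "x ;; m = zer (src x) (tgt m)" .
    moreover have "tgt x = src m" using x m by simp
    ultimately obtain w where w: "arr w" "src w = src x" "tgt w = src k" "w ;; k = x" using k(4) x(1) by blast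
    have "w ;; k ;; p = u" using cmp_reduce[OF w(4), of p] w(1-3) k(1,2) m B xp by simp
    then show "\<exists>w. arr w \<and> src w = src u \<and> tgt w = src (k ;; p) \<and> w ;; k ;; p = u" using w x by auto
    qed
  qed (use e k(1,2) m B(1-9) b h in simp_all)
qed

text \<open>The generator is the image of the generator \<open>y'\<close> of H. Its relations are
  those of H together with \<open>k\<close>, where \<open>k\<close> expresses \<tau> of the
  generator of G as a multiple of \<open>y'\<close>; both are collected on a direct sum.\<close>

lemma coherent_coker:
  assumes G: "coherent C G" "coherent C H" and t: "\<tau> \<in> mod_hom C G H" and Q: "is_module C Q" "\<pi> \<in> mod_hom C H Q"
    and sur: "\<And>X. X \<in> Ob C \<Longrightarrow> \<pi> X ` carrier (mob H X) = carrier (mob Q X)"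
    and ker: "\<And>X y. X \<in> Ob C \<Longrightarrow> y \<in> carrier (mob H X) \<Longrightarrow> \<pi> X y = \<one>\<^bsub>mob Q X\<^esub> \<longleftrightarrow> y \<in> \<tau> X ` carrier (mob G X)"
  shows "coherent C Q"
proof -
  obtain y f where g: "is_module C G" "presents G y f" using coherentE[OF G(1)] .
  obtain y' f' where h: "is_module C H" "presents H y' f'" using coherentE[OF G(2)] .
  note P = presentsD[OF g(2)] and P' = presentsD[OF h(2)]
  have ty: "\<tau> (tgt f) y \<in> carrier (mob H (tgt f))" using mod_homD(2)[OF t _ P(2)] P(1) by simp
  obtain k where k: "arr k" "src k = tgt f" "tgt k = tgt f'" "act H k y' = \<tau> (tgt f) y"
    using P'(3)[OF _ ty] P(1) by auto
  have ob: "src f' \<in> Ob C" "tgt f \<in> Ob C" using P P' by simp_all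
  obtain i j p q where b: "bip i j p q" "src i = src f'" "src j = tgt f" using ex_bip[OF ob] .
  note B = bipD[OF b(1)] and R = bip_red[OF b(1)]
  define m where "m = p ;; f' \<boxplus> q ;; k"
  have m: "arr m" "src m = tgt i" "tgt m = tgt f'" unfolding m_def using B b k P' by simp_all
  have xm: "x ;; m = x ;; p ;; f' \<boxplus> x ;; q ;; k" if "arr x" "tgt x = tgt i" for x
    unfolding m_def using that B(1-9) b k P' by simp
  have tk: "\<tau> (src u) (act G u y) = act H (u ;; k) y'" if u: "arr u" "tgt u = tgt f" for u
  proof -
    have "\<tau> (src u) (act G u y) = act H u (act H k y')" using mod_hom_act[OF t u(1), of y] u P(2) k(4) by simp
    also have "\<dots> = act H (u ;; k) y'" using act_cmp[OF h(1) u(1) k(1), of y'] u k P'(2) by simp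
    finally show ?thesis .
  qed
  have pa: "\<pi> (src g) (act H g y') = act Q g (\<pi> (tgt f') y')" if "arr g" "tgt g = tgt f'" for g
    using mod_hom_act[OF Q(2) that(1), of y'] that P'(2) by simp
  have "presents Q (\<pi> (tgt f') y') m" unfolding presents_def
  proof (intro conjI ballI allI impI)
    show "arr m" by fact
    show "\<pi> (tgt f') y' \<in> carrier (mob Q (tgt m))" using mod_homD(2)[OF Q(2) _ P'(2)] P'(1) m by simp
  next
    fix W x assume W: "W \<in> Ob C" "x \<in> carrier (mob Q W)"
    then have "x \<in> \<pi> W ` carrier (mob H W)" using sur by simp
    then obtain z where z: "z \<in> carrier (mob H W)" "\<pi> W z = x" by blast
    obtain g where "arr g" "src g = W" "tgt g = tgt f'" "act H g y' = z" using P'(3)[OF W(1) z(1)] by blast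
    then show "\<exists>g. arr g \<and> src g = W \<and> tgt g = tgt m \<and> act Q g (\<pi> (tgt f') y') = x"
      using pa[of g] z m by auto
  next
    fix g assume "arr g \<and> tgt g = tgt m"
    then have g1: "arr g" "tgt g = tgt f'" using m by simp_all
    have c: "act H g y' \<in> carrier (mob H (src g))" using act_closed[OF h(1) g1(1), of y'] g1 P' by simp
    have "act Q g (\<pi> (tgt f') y') = \<one>\<^bsub>mob Q (src g)\<^esub> \<longleftrightarrow> act H g y' \<in> \<tau> (src g) ` carrier (mob G (src g))"
      using pa[OF g1] ker[OF _ c] g1 by simp
    also have "\<dots> \<longleftrightarrow> (\<exists>h. arr h \<and> src h = src g \<and> tgt h = src m \<and> h ;; m = g)"
    proof
      assume "act H g y' \<in> \<tau> (src g) ` carrier (mob G (src g))"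
      then obtain x where x: "x \<in> carrier (mob G (src g))" "act H g y' = \<tau> (src g) x" by auto
      have "src g \<in> Ob C" using g1 by simp
      then obtain u where u: "arr u" "src u = src g" "tgt u = tgt f" "act G u y = x" using P(3)[OF _ x(1)] by blast
      have e1: "act H g y' = act H (u ;; k) y'" using tk[OF u(1,3)] u x by simp
      have e2: "par g (u ;; k)" "y' \<in> carrier (mob H (tgt g))" using g1 u k P'(2) by simp_all
      have "act H (g \<boxplus> neg (u ;; k)) y' = \<one>\<^bsub>mob H (src g)\<^esub>" using act_eq_iff[OF h(1) e2] e1 by simp
      then obtain v where v: "arr v" "src v = src g" "tgt v = src f'" "v ;; f' = g \<boxplus> neg (u ;; k)"
        using P'(4)[of "g \<boxplus> neg (u ;; k)"] g1 u(1-3) k(1-3) by auto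
      have "(v ;; i \<boxplus> u ;; j) ;; m = v ;; f' \<boxplus> u ;; k"
        unfolding m_def using v(1-3) u(1-3) B(1-13) b k P' R by simp
      also have "\<dots> = g" unfolding v(4) using g1 u(1-3) k(1-3) by simp
      finally show "\<exists>h. arr h \<and> src h = src g \<and> tgt h = src m \<and> h ;; m = g"
        using v(1-3) u(1-3) B b m by (intro exI[of _ "v ;; i \<boxplus> u ;; j"]) simp
    next
      assume "\<exists>h. arr h \<and> src h = src g \<and> tgt h = src m \<and> h ;; m = g"
      then obtain w where w: "arr w" "src w = src g" "tgt w = tgt i" "w ;; m = g" using m by auto
      have g2: "g = (w ;; p) ;; f' \<boxplus> (w ;; q) ;; k" using xm[OF w(1,3)] w B b P' k by simp
      have a1: "act H ((w ;; p) ;; f') y' = \<one>\<^bsub>mob H (src g)\<^esub>"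
        using P'(4)[of "(w ;; p) ;; f'"] P'(1) w B b by (auto intro!: exI[of _ "w ;; p"])
      have wq: "arr (w ;; q)" "tgt (w ;; q) = tgt f" "src (w ;; q) = src g" using w B b by simp_all
      interpret Hg: group "mob H (src g)" using is_module_grp[OF h(1)] g1 by simp
      have c2: "act H ((w ;; q) ;; k) y' \<in> carrier (mob H (src g))"
        using act_closed[OF h(1), of "(w ;; q) ;; k" y'] wq k P'(2) by simp
      have "act H g y' = act H ((w ;; p) ;; f') y' \<otimes>\<^bsub>mob H (src g)\<^esub> act H ((w ;; q) ;; k) y'"
        by (subst g2, subst act_add[OF h(1)]) (use w B b P' k wq in simp_all)
      also have "\<dots> = act H ((w ;; q) ;; k) y'" using a1 c2 by simp
      also have "\<dots> = \<tau> (src g) (act G (w ;; q) y)" using tk[OF wq(1,2)] wq by simp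
      finally show "act H g y' \<in> \<tau> (src g) ` carrier (mob G (src g))"
        using act_closed[OF g(1) wq(1), of y] wq P(2) by simp
    qed
    finally show "act Q g (\<pi> (tgt f') y') = \<one>\<^bsub>mob Q (src g)\<^esub> \<longleftrightarrow> (\<exists>h. arr h \<and> src h = src g \<and> tgt h = src m \<and> h ;; m = g)" .
  qed
  then show ?thesis by (rule coherentI[OF Q(1)])
qed

text \<open>A multiple of \<open>y\<close> by \<open>u\<close> is killed by \<tau> iff
  \<open>u ;; k\<close> factors through \<open>f'\<close>, so a weak pullback of \<open>k\<close>
  along \<open>f'\<close> gives the generator. A weak pullback of the resulting \<open>a\<close>
  along the relations \<open>f\<close> of G gives its relations.\<close>

lemma coherent_ker:
  assumes G: "coherent C G" "coherent C H" and t: "\<tau> \<in> mod_hom C G H" and K: "is_module C K" "\<kappa> \<in> mod_hom C K G"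
    and inj: "\<And>X. X \<in> Ob C \<Longrightarrow> inj_on (\<kappa> X) (carrier (mob K X))"
    and im: "\<And>X. X \<in> Ob C \<Longrightarrow> \<kappa> X ` carrier (mob K X) = {x \<in> carrier (mob G X). \<tau> X x = \<one>\<^bsub>mob H X\<^esub>}"
  shows "coherent C K"
proof -
  obtain y f where g: "is_module C G" "presents G y f" using coherentE[OF G(1)] .
  obtain y' f' where h: "is_module C H" "presents H y' f'" using coherentE[OF G(2)] .
  note P = presentsD[OF g(2)] and P' = presentsD[OF h(2)]
  have ty: "\<tau> (tgt f) y \<in> carrier (mob H (tgt f))" using mod_homD(2)[OF t _ P(2)] P(1) by simp
  obtain k where k: "arr k" "src k = tgt f" "tgt k = tgt f'" "act H k y' = \<tau> (tgt f) y"
    using P'(3)[OF _ ty] P(1) by auto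
  have tk: "\<tau> (src u) (act G u y) = act H (u ;; k) y'" if u: "arr u" "tgt u = tgt f" for u
  proof -
    have "\<tau> (src u) (act G u y) = act H u (act H k y')" using mod_hom_act[OF t u(1), of y] u P(2) k(4) by simp
    also have "\<dots> = act H (u ;; k) y'" using act_cmp[OF h(1) u(1) k(1), of y'] u k P'(2) by simp
    finally show ?thesis .
  qed
  obtain a b where ab: "arr a" "arr b" "src b = src a" "tgt a = src k" "tgt b = src f'" "a ;; k = b ;; f'"
    and abu: "\<forall>u v. arr u \<and> arr v \<and> src v = src u \<and> tgt u = src k \<and> tgt v = src f' \<and> u ;; k = v ;; f' \<longrightarrow>
      (\<exists>w. arr w \<and> src w = src u \<and> tgt w = src a \<and> w ;; a = u)"
    using weak_pullback[OF k(1) P'(1) k(3)] .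
  have ta: "tgt a = tgt f" using ab k by simp
  obtain c d where cd: "arr c" "arr d" "src d = src c" "tgt c = src a" "tgt d = src f" "c ;; a = d ;; f"
    and cdu: "\<forall>u v. arr u \<and> arr v \<and> src v = src u \<and> tgt u = src a \<and> tgt v = src f \<and> u ;; a = v ;; f \<longrightarrow>
      (\<exists>w. arr w \<and> src w = src u \<and> tgt w = src c \<and> w ;; c = u)"
    using weak_pullback[OF ab(1) P(1) ta] .
  have ya: "act G a y \<in> carrier (mob G (src a))" using act_closed[OF g(1) ab(1), of y] ta P(2) by simp
  have "\<tau> (src a) (act G a y) = act H (b ;; f') y'" using tk[OF ab(1) ta] ab(6) by simp
  also have "\<dots> = \<one>\<^bsub>mob H (src a)\<^esub>" using P'(4)[of "b ;; f'"] ab P'(1) by auto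
  finally have "act G a y \<in> \<kappa> (src a) ` carrier (mob K (src a))" using im[of "src a"] ya ab by simp
  then obtain z where z: "z \<in> carrier (mob K (src a))" "\<kappa> (src a) z = act G a y" by auto
  have kz: "\<kappa> (src g) (act K g z) = act G (g ;; a) y" if "arr g" "tgt g = src a" for g
  proof -
    have "\<kappa> (src g) (act K g z) = act G g (act G a y)" using mod_hom_act[OF K(2) that(1), of z] that z by simp
    also have "\<dots> = act G (g ;; a) y" using act_cmp[OF g(1) that(1) ab(1), of y] that ta P(2) by simp
    finally show ?thesis .
  qed
  have "presents K z c" unfolding presents_def
  proof (intro conjI ballI allI impI)
    show "arr c" by fact
    show "z \<in> carrier (mob K (tgt c))" using z cd by simp
  next
    fix W x assume W: "W \<in> Ob C" "x \<in> carrier (mob K W)"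
    then have kx: "\<kappa> W x \<in> carrier (mob G W)" "\<tau> W (\<kappa> W x) = \<one>\<^bsub>mob H W\<^esub>" using im[OF W(1)] by auto
    obtain u where u: "arr u" "src u = W" "tgt u = tgt f" "act G u y = \<kappa> W x" using P(3)[OF W(1) kx(1)] by blast
    have "act H (u ;; k) y' = \<one>\<^bsub>mob H (src (u ;; k))\<^esub>" using tk[OF u(1,3)] u kx by simp
    then obtain v where v: "arr v" "src v = src u" "tgt v = src f'" "v ;; f' = u ;; k"
      using P'(4)[of "u ;; k"] u k by auto
    obtain w where w: "arr w" "src w = src u" "tgt w = src a" "w ;; a = u"
      using abu[rule_format, of u v] u k v by auto
    have "\<kappa> W (act K w z) = \<kappa> W x" using kz[OF w(1,3)] w u by simp
    moreover have "act K w z \<in> carrier (mob K W)" using act_closed[OF K(1) w(1), of z] w z u by simp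
    ultimately have "act K w z = x" using inj_onD[OF inj[OF W(1)]] W(2) by blast
    then show "\<exists>g. arr g \<and> src g = W \<and> tgt g = tgt c \<and> act K g z = x" using w u cd by auto
  next
    fix g assume "arr g \<and> tgt g = tgt c"
    then have g1: "arr g" "tgt g = src a" using cd by simp_all
    have ob: "src g \<in> Ob C" using g1 by simp
    have kc: "act K g z \<in> carrier (mob K (src g))" using act_closed[OF K(1) g1(1), of z] g1 z by simp
    have one: "\<one>\<^bsub>mob K (src g)\<^esub> \<in> carrier (mob K (src g))" using is_module_mon[OF K(1) ob] by (rule monoid.one_closed)
    have "act K g z = \<one>\<^bsub>mob K (src g)\<^esub> \<longleftrightarrow> \<kappa> (src g) (act K g z) = \<kappa> (src g) \<one>\<^bsub>mob K (src g)\<^esub>"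
      using inj_on_eq_iff[OF inj[OF ob] kc one] by simp
    also have "\<dots> \<longleftrightarrow> act G (g ;; a) y = \<one>\<^bsub>mob G (src (g ;; a))\<^esub>"
      using kz[OF g1] mod_hom_one[OF K(1) g(1) K(2) ob] by simp
    also have "\<dots> \<longleftrightarrow> (\<exists>h. arr h \<and> src h = src (g ;; a) \<and> tgt h = src f \<and> h ;; f = g ;; a)"
      using P(4)[of "g ;; a"] g1 ab ta by simp
    also have "\<dots> \<longleftrightarrow> (\<exists>h. arr h \<and> src h = src g \<and> tgt h = src c \<and> h ;; c = g)"
    proof
      assume "\<exists>h. arr h \<and> src h = src (g ;; a) \<and> tgt h = src f \<and> h ;; f = g ;; a"
      then obtain v where v: "arr v" "src v = src g" "tgt v = src f" "v ;; f = g ;; a" by auto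
      show "\<exists>h. arr h \<and> src h = src g \<and> tgt h = src c \<and> h ;; c = g"
        using cdu[rule_format, of g v] g1 v by simp
    next
      assume "\<exists>h. arr h \<and> src h = src g \<and> tgt h = src c \<and> h ;; c = g"
      then obtain w where w: "arr w" "src w = src g" "tgt w = src c" "w ;; c = g" by blast
      have "w ;; d ;; f = w ;; c ;; a" using cd(6) by simp
      also have "\<dots> = g ;; a" by (rule cmp_reduce[OF w(4)]) (use w cd ab in simp_all)
      finally show "\<exists>h. arr h \<and> src h = src (g ;; a) \<and> tgt h = src f \<and> h ;; f = g ;; a"
        using w cd P(1) by (intro exI[of _ "w ;; d"]) simp
    qed
    finally show "act K g z = \<one>\<^bsub>mob K (src g)\<^esub> \<longleftrightarrow> (\<exists>h. arr h \<and> src h = src g \<and> tgt h = src c \<and> h ;; c = g)" .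
  qed
  then show ?thesis by (rule coherentI[OF K(1)])
qed

text \<open>The direct sum on pairs of values. It leaves the value type, and
  \<open>coherent_relabel\<close> brings it back.\<close>

definition pair_module :: "('o, 'a, 'v) cmodule \<Rightarrow> ('o, 'a, 'v) cmodule \<Rightarrow> ('o, 'a, 'v \<times> 'v) cmodule"
  where "pair_module G H = \<lparr>mob = (\<lambda>X. \<lparr>carrier = carrier (mob G X) \<times> carrier (mob H X),
      monoid.mult = (\<lambda>u v. (fst u \<otimes>\<^bsub>mob G X\<^esub> fst v, snd u \<otimes>\<^bsub>mob H X\<^esub> snd v)), one = (\<one>\<^bsub>mob G X\<^esub>, \<one>\<^bsub>mob H X\<^esub>)\<rparr>),
    mar = (\<lambda>X Y f u. (mar G X Y f (fst u), mar H X Y f (snd u)))\<rparr>"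

text \<open>The direct sum of the two presentations: the generator lives on the sum of the
  generating objects, and the relation is the diagonal arrow between the two sums.\<close>

lemma pair_module_coherent:
  assumes G: "coherent C G" "coherent C H"
  shows "coherent C (pair_module G H)"
proof -
  obtain y f where g: "is_module C G" "presents G y f" using coherentE[OF G(1)] .
  obtain y' f' where h: "is_module C H" "presents H y' f'" using coherentE[OF G(2)] .
  note P = presentsD[OF g(2)] and P' = presentsD[OF h(2)]
  let ?S = "pair_module G H"
  have S: "is_module C ?S" unfolding is_module_def
  proof (intro conjI ballI)
    fix X assume X: "X \<in> Ob C"
    interpret G: comm_group "mob G X" by (rule is_module_group[OF g(1) X])
    interpret H: comm_group "mob H X" by (rule is_module_group[OF h(1) X])
    show "comm_group (mob ?S X)"
    proof (rule comm_groupI)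
      fix x assume "x \<in> carrier (mob ?S X)"
      then show "\<exists>y\<in>carrier (mob ?S X). y \<otimes>\<^bsub>mob ?S X\<^esub> x = \<one>\<^bsub>mob ?S X\<^esub>"
        by (intro bexI[of _ "(inv\<^bsub>mob G X\<^esub> (fst x), inv\<^bsub>mob H X\<^esub> (snd x))"]) (auto simp: pair_module_def)
    qed (auto simp: pair_module_def G.m_ac H.m_ac)
  next
    fix X Y f assume X: "X \<in> Ob C" "Y \<in> Ob C" "f \<in> mor C X Y"
    have "mar G X Y f \<in> hom (mob G Y) (mob G X)" "mar H X Y f \<in> hom (mob H Y) (mob H X)"
      using g(1) h(1) X unfolding is_module_def by auto
    then show "mar ?S X Y f \<in> hom (mob ?S Y) (mob ?S X)" by (auto simp: hom_def pair_module_def Pi_def)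
  qed (use g(1) h(1) in \<open>auto simp: is_module_def pair_module_def\<close>)
  have act: "act ?S a (x, x') = (act G a x, act H a x')" for a x x' by (simp add: act_def pair_module_def)
  have ob: "tgt f \<in> Ob C" "tgt f' \<in> Ob C" "src f \<in> Ob C" "src f' \<in> Ob C" using P P' by simp_all
  obtain i j p q where b: "bip i j p q" "src i = tgt f" "src j = tgt f'" using ex_bip[OF ob(1,2)] .
  obtain i' j' p' q' where b': "bip i' j' p' q'" "src i' = src f" "src j' = src f'" using ex_bip[OF ob(3,4)] .
  note B = bipD[OF b(1)] and R = bip_red[OF b(1)] and B' = bipD[OF b'(1)] and R' = bip_red[OF b'(1)]
  define m where "m = p' ;; f ;; i \<boxplus> q' ;; f' ;; j"
  have m: "arr m" "src m = tgt i'" "tgt m = tgt i" unfolding m_def using B b B' b' P(1) P'(1) by simp_all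
  define y2 where "y2 = (act G p y, act H q y')"
  have a2: "act ?S x y2 = (act G (x ;; p) y, act H (x ;; q) y')" if "arr x" "tgt x = tgt i" for x
    unfolding y2_def act using act_cmp[OF g(1) that(1) B(3), of y] act_cmp[OF h(1) that(1) B(4), of y'] that B b P(2) P'(2) by simp
  have "presents ?S y2 m" unfolding presents_def
  proof (intro conjI ballI allI impI)
    show "arr m" by fact
    show "y2 \<in> carrier (mob ?S (tgt m))"
      using act_closed[OF g(1) B(3), of y] act_closed[OF h(1) B(4), of y'] B b P(2) P'(2) m
      by (simp add: y2_def pair_module_def)
  next
    fix W x assume W: "W \<in> Ob C" "x \<in> carrier (mob ?S W)"
    then have x: "fst x \<in> carrier (mob G W)" "snd x \<in> carrier (mob H W)" by (auto simp: pair_module_def)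
    obtain u where u: "arr u" "src u = W" "tgt u = tgt f" "act G u y = fst x" using P(3)[OF W(1) x(1)] by blast
    obtain v where v: "arr v" "src v = W" "tgt v = tgt f'" "act H v y' = snd x" using P'(3)[OF W(1) x(2)] by blast
    have w: "arr (u ;; i \<boxplus> v ;; j)" "tgt (u ;; i \<boxplus> v ;; j) = tgt i" using u(1-3) v(1-3) B b by simp_all
    have "(u ;; i \<boxplus> v ;; j) ;; p = u" "(u ;; i \<boxplus> v ;; j) ;; q = v" using u(1-3) v(1-3) B(1-13) b ob by simp_all
    then have "act ?S (u ;; i \<boxplus> v ;; j) y2 = x" using a2[OF w] u v by simp
    then show "\<exists>g. arr g \<and> src g = W \<and> tgt g = tgt m \<and> act ?S g y2 = x"
      using w u m by (intro exI[of _ "u ;; i \<boxplus> v ;; j"]) simp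
  next
    fix x assume "arr x \<and> tgt x = tgt m"
    then have x: "arr x" "tgt x = tgt i" using m by simp_all
    have "act ?S x y2 = \<one>\<^bsub>mob ?S (src x)\<^esub> \<longleftrightarrow> act G (x ;; p) y = \<one>\<^bsub>mob G (src (x ;; p))\<^esub> \<and> act H (x ;; q) y' = \<one>\<^bsub>mob H (src (x ;; q))\<^esub>"
      using a2[OF x] by (simp add: pair_module_def)
    also have "\<dots> \<longleftrightarrow> (\<exists>h. arr h \<and> src h = src (x ;; p) \<and> tgt h = src f \<and> h ;; f = x ;; p) \<and>
       (\<exists>h. arr h \<and> src h = src (x ;; q) \<and> tgt h = src f' \<and> h ;; f' = x ;; q)"
      using P(4)[of "x ;; p"] P'(4)[of "x ;; q"] x B b by simp
    also have "\<dots> \<longleftrightarrow> (\<exists>h. arr h \<and> src h = src x \<and> tgt h = src m \<and> h ;; m = x)"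
    proof
      assume "(\<exists>h. arr h \<and> src h = src (x ;; p) \<and> tgt h = src f \<and> h ;; f = x ;; p) \<and>
       (\<exists>h. arr h \<and> src h = src (x ;; q) \<and> tgt h = src f' \<and> h ;; f' = x ;; q)"
      then obtain u v where u: "arr u" "src u = src x" "tgt u = src f" "u ;; f = x ;; p"
        and v: "arr v" "src v = src x" "tgt v = src f'" "v ;; f' = x ;; q" by auto
      have "(u ;; i' \<boxplus> v ;; j') ;; m = (u ;; f) ;; i \<boxplus> (v ;; f') ;; j"
        unfolding m_def using u(1-3) v(1-3) B'(1-13) b' B b P(1) P'(1) R' by simp
      also have "\<dots> = x" unfolding u(4) v(4) using bip_decomp[OF b(1) x] x B b by simp
      finally show "\<exists>h. arr h \<and> src h = src x \<and> tgt h = src m \<and> h ;; m = x"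
        using u v B' b' m by (intro exI[of _ "u ;; i' \<boxplus> v ;; j'"]) simp
    next
      assume "\<exists>h. arr h \<and> src h = src x \<and> tgt h = src m \<and> h ;; m = x"
      then obtain w where w: "arr w" "src w = src x" "tgt w = tgt i'" "w ;; m = x" using m by auto
      have "m ;; p = p' ;; f" "m ;; q = q' ;; f'" unfolding m_def using B(1-13) b B'(1-9) b' P(1) P'(1) ob by simp_all
      then have "(w ;; p') ;; f = x ;; p" "(w ;; q') ;; f' = x ;; q"
        using cmp_reduce[OF w(4), of p] cmp_reduce[OF w(4), of q] w(1-3) m B B' b' P(1) P'(1) by simp_all
      then show "(\<exists>h. arr h \<and> src h = src (x ;; p) \<and> tgt h = src f \<and> h ;; f = x ;; p) \<and>
       (\<exists>h. arr h \<and> src h = src (x ;; q) \<and> tgt h = src f' \<and> h ;; f' = x ;; q)"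
        using w(1-3) B' b' by (intro conjI exI[of _ "w ;; p'"] exI[of _ "w ;; q'"]) simp_all
    qed
    finally show "act ?S x y2 = \<one>\<^bsub>mob ?S (src x)\<^esub> \<longleftrightarrow> (\<exists>h. arr h \<and> src h = src x \<and> tgt h = src m \<and> h ;; m = x)" .
  qed
  then show ?thesis by (rule coherentI[OF S])
qed

end

context preadditive_category
begin

lemma module_closed:
  assumes "is_module C G" "X \<in> Ob C"
  shows "x \<in> carrier (mob G X) \<Longrightarrow> y \<in> carrier (mob G X) \<Longrightarrow> x \<otimes>\<^bsub>mob G X\<^esub> y \<in> carrier (mob G X)"
    "\<one>\<^bsub>mob G X\<^esub> \<in> carrier (mob G X)"
    "Y \<in> Ob C \<Longrightarrow> f \<in> mor C X Y \<Longrightarrow> z \<in> carrier (mob G Y) \<Longrightarrow> mar G X Y f z \<in> carrier (mob G X)"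
  using is_module_mon[OF assms] act_closed[OF assms(1), of "Arrow X f Y" z] assms(2)
  by (simp_all add: monoid.m_closed monoid.one_closed act_def arrI)

lemma mod_hom_inverse:
  assumes G: "is_module C G" "is_module C H" and r: "\<rho> \<in> mod_hom C G H"
    and bij: "\<And>X. X \<in> Ob C \<Longrightarrow> bij_betw (\<rho> X) (carrier (mob G X)) (carrier (mob H X))"
  shows "(\<lambda>X\<in>Ob C. \<lambda>u\<in>carrier (mob H X). inv_into (carrier (mob G X)) (\<rho> X) u) \<in> mod_hom C H G"
proof (rule mod_homI[OF _ _ _ G(2)])
  let ?s = "\<lambda>X u. inv_into (carrier (mob G X)) (\<rho> X) u"
  have s: "?s X u \<in> carrier (mob G X)" "\<rho> X (?s X u) = u" if "X \<in> Ob C" "u \<in> carrier (mob H X)" for X u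
    using bij_betw_imp_surj_on[OF bij[OF that(1)]] that(2) by (auto simp: inv_into_into f_inv_into_f)
  have eq: "a = b" if "X \<in> Ob C" "a \<in> carrier (mob G X)" "b \<in> carrier (mob G X)" "\<rho> X a = \<rho> X b" for X a b
    using bij_betw_imp_inj_on[OF bij[OF that(1)]] that by (auto dest: inj_onD)
  show "?s X u \<in> carrier (mob G X)" if "X \<in> Ob C" "u \<in> carrier (mob H X)" for X u using s that by blast
  show "?s X (u \<otimes>\<^bsub>mob H X\<^esub> v) = ?s X u \<otimes>\<^bsub>mob G X\<^esub> ?s X v" if X: "X \<in> Ob C" "u \<in> carrier (mob H X)" "v \<in> carrier (mob H X)" for X u v
    by (rule eq[OF X(1)]) (simp_all add: s X module_closed[OF G(1) X(1)] module_closed[OF G(2) X(1)] mod_homD(3)[OF r X(1)])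
  show "?s X (mar H X Y f u) = mar G X Y f (?s Y u)"
    if X: "X \<in> Ob C" "Y \<in> Ob C" "f \<in> mor C X Y" "u \<in> carrier (mob H Y)" for X Y f u
    by (rule eq[OF X(1)]) (simp_all add: s X module_closed(3)[OF G(1) X(1)] module_closed(3)[OF G(2) X(1)] mod_homD(4)[OF r X(1-3)])
qed

lemma mod_hom_inj_iff:
  assumes G: "is_module C G" "is_module C H" and t: "\<tau> \<in> mod_hom C G H" and X: "X \<in> Ob C"
  shows "inj_on (\<tau> X) (carrier (mob G X)) \<longleftrightarrow> (\<forall>x\<in>carrier (mob G X). \<tau> X x = \<one>\<^bsub>mob H X\<^esub> \<longrightarrow> x = \<one>\<^bsub>mob G X\<^esub>)"
proof -
  have "group_hom (mob G X) (mob H X) (\<tau> X)"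
    using mod_homD(1)[OF t X] is_module_grp[OF G(1) X] is_module_grp[OF G(2) X]
    by (simp add: group_hom_def group_hom_axioms_def)
  then show ?thesis using group_hom.inj_on_one_iff by blast
qed

end

section \<open>Kernels, cokernels and direct sums inside one value type\<close>

context weak_kernel_category
begin

lemma ex_pointwise_ker:
  fixes G H :: "('o, 'a, 'v) cmodule"
  assumes G: "coherent C G" "coherent C H" and t: "\<tau> \<in> mod_hom C G H"
  obtains K :: "('o, 'a, 'v) cmodule" and \<kappa> where "coherent C K" "\<kappa> \<in> mod_hom C K G"
    "\<forall>X\<in>Ob C. inj_on (\<kappa> X) (carrier (mob K X))"
    "\<forall>X\<in>Ob C. \<kappa> X ` carrier (mob K X) = {x \<in> carrier (mob G X). \<tau> X x = \<one>\<^bsub>mob H X\<^esub>}"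
proof -
  define K where "K = \<lparr>mob = (\<lambda>X. (mob G X)\<lparr>carrier := {x \<in> carrier (mob G X). \<tau> X x = \<one>\<^bsub>mob H X\<^esub>}\<rparr>), mar = mar G\<rparr>"
  define \<kappa> where "\<kappa> = (\<lambda>X\<in>Ob C. \<lambda>x\<in>carrier (mob K X). x)"
  note m = coherent_module[OF G(1)] coherent_module[OF G(2)]
  have K: "is_module C K" "\<kappa> \<in> mod_hom C K G" using pointwise_module[OF m t K_def] by (simp_all add: \<kappa>_def)
  have 1: "\<forall>X\<in>Ob C. inj_on (\<kappa> X) (carrier (mob K X))" by (auto simp: \<kappa>_def inj_on_def)
  have 2: "\<forall>X\<in>Ob C. \<kappa> X ` carrier (mob K X) = {x \<in> carrier (mob G X). \<tau> X x = \<one>\<^bsub>mob H X\<^esub>}"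
    by (auto simp: \<kappa>_def K_def image_def)
  show ?thesis
    by (rule that[OF coherent_ker[OF G t K] K(2) 1 2]) (use 1 2 in auto)
qed

text \<open>A quotient group would consist of cosets, which have another type. Instead
  \<open>r\<close> sends each element to a chosen representative of its coset, and the structure is
  pushed along \<open>r\<close>.\<close>

lemma ex_pointwise_coker:
  fixes G H :: "('o, 'a, 'v) cmodule"
  assumes G: "coherent C G" "coherent C H" and t: "\<tau> \<in> mod_hom C G H"
  obtains Q :: "('o, 'a, 'v) cmodule" and \<pi> where "coherent C Q" "\<pi> \<in> mod_hom C H Q"
    "\<forall>X\<in>Ob C. \<pi> X ` carrier (mob H X) = carrier (mob Q X)"
    "\<forall>X\<in>Ob C. \<forall>y\<in>carrier (mob H X). \<pi> X y = \<one>\<^bsub>mob Q X\<^esub> \<longleftrightarrow> y \<in> \<tau> X ` carrier (mob G X)"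
proof -
  note m = coherent_module[OF G(1)] coherent_module[OF G(2)]
  define I where "I X = \<tau> X ` carrier (mob G X)" for X
  define r where "r X y = (SOME z. z \<in> I X #>\<^bsub>mob H X\<^esub> y)" for X y
  have sub: "subgroup (I X) (mob H X)" if X: "X \<in> Ob C" for X
  proof -
    have "group_hom (mob G X) (mob H X) (\<tau> X)"
      using mod_homD(1)[OF t X] is_module_grp[OF m(1) X] is_module_grp[OF m(2) X]
      by (simp add: group_hom_def group_hom_axioms_def)
    then show ?thesis unfolding I_def by (rule group_hom.img_is_subgroup)
  qed
  have rI: "r X x = r X y \<longleftrightarrow> I X #>\<^bsub>mob H X\<^esub> x = I X #>\<^bsub>mob H X\<^esub> y"
    if X: "X \<in> Ob C" "x \<in> carrier (mob H X)" "y \<in> carrier (mob H X)" for X x y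
  proof
    interpret H: group "mob H X" by (rule is_module_grp[OF m(2) X(1)])
    have a: "r X z \<in> I X #>\<^bsub>mob H X\<^esub> z" if "z \<in> carrier (mob H X)" for z
      unfolding r_def by (rule someI) (rule H.rcos_self[OF that sub[OF X(1)]])
    assume "r X x = r X y"
    then have "r X x \<in> I X #>\<^bsub>mob H X\<^esub> x" "r X x \<in> I X #>\<^bsub>mob H X\<^esub> y" using a[OF X(2)] a[OF X(3)] by simp_all
    then show "I X #>\<^bsub>mob H X\<^esub> x = I X #>\<^bsub>mob H X\<^esub> y"
      using H.repr_independence[OF _ X(2) sub[OF X(1)], of "r X x"] H.repr_independence[OF _ X(3) sub[OF X(1)], of "r X x"] by simp
  qed (simp add: r_def)
  have c1: "r X (x \<otimes>\<^bsub>mob H X\<^esub> y) = r X (x' \<otimes>\<^bsub>mob H X\<^esub> y')"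
    if X: "X \<in> Ob C" "x \<in> carrier (mob H X)" "y \<in> carrier (mob H X)" "x' \<in> carrier (mob H X)" "y' \<in> carrier (mob H X)"
      "r X x = r X x'" "r X y = r X y'" for X x y x' y'
  proof -
    interpret H: comm_group "mob H X" by (rule is_module_group[OF m(2) X(1)])
    interpret N: normal "I X" "mob H X" by (rule H.subgroup_imp_normal[OF sub[OF X(1)]])
    have "I X #>\<^bsub>mob H X\<^esub> (x \<otimes>\<^bsub>mob H X\<^esub> y) = I X #>\<^bsub>mob H X\<^esub> (x' \<otimes>\<^bsub>mob H X\<^esub> y')"
      using N.rcos_sum[OF X(2,3)] N.rcos_sum[OF X(4,5)] rI[OF X(1,2,4)] rI[OF X(1,3,5)] X(6,7) by simp
    then show ?thesis using rI[OF X(1)] X by simp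
  qed
  have c2: "r X (mar H X Y f y) = r X (mar H X Y f y')"
    if X: "X \<in> Ob C" "Y \<in> Ob C" "f \<in> mor C X Y" "y \<in> carrier (mob H Y)" "y' \<in> carrier (mob H Y)" "r Y y = r Y y'" for X Y f y y'
  proof -
    interpret H: group "mob H X" by (rule is_module_grp[OF m(2) X(1)])
    interpret HY: group "mob H Y" by (rule is_module_grp[OF m(2) X(2)])
    have "y' \<in> I Y #>\<^bsub>mob H Y\<^esub> y" using rI[OF X(2,4,5)] X(6) HY.rcos_self[OF X(5) sub[OF X(2)]] by simp
    then obtain x where x: "x \<in> carrier (mob G Y)" "y' = \<tau> Y x \<otimes>\<^bsub>mob H Y\<^esub> y" unfolding I_def r_coset_def by auto
    have t': "\<tau> Y x \<in> carrier (mob H Y)" using mod_homD(2)[OF t X(2) x(1)] .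
    have "mar H X Y f y' = \<tau> X (mar G X Y f x) \<otimes>\<^bsub>mob H X\<^esub> mar H X Y f y"
      unfolding x(2) using act_mult[OF m(2), of "Arrow X f Y" "\<tau> Y x" y] t' X mod_homD(4)[OF t X(1-3) x(1)]
      by (simp add: act_def arrI)
    moreover have "mar G X Y f x \<in> carrier (mob G X)" using module_closed(3)[OF m(1) X(1-3) x(1)] .
    ultimately have "mar H X Y f y' \<in> I X #>\<^bsub>mob H X\<^esub> mar H X Y f y" unfolding I_def r_coset_def by auto
    moreover have c: "mar H X Y f y \<in> carrier (mob H X)" "mar H X Y f y' \<in> carrier (mob H X)"
      using module_closed(3)[OF m(2) X(1-3)] X by simp_all
    ultimately show ?thesis using rI[OF X(1) c] H.repr_independence[OF _ c(1) sub[OF X(1)]] by simp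
  qed
  define \<pi> where "\<pi> = (\<lambda>X\<in>Ob C. \<lambda>x\<in>carrier (mob H X). r X x)"
  have P: "is_module C (push r H)" "(\<lambda>X\<in>Ob C. \<lambda>x\<in>carrier (mob H X). r X x) \<in> mod_hom C H (push r H)"
    "carrier (mob (push r H) X) = r X ` carrier (mob H X)" "\<one>\<^bsub>mob (push r H) X\<^esub> = r X \<one>\<^bsub>mob H X\<^esub>" for X
    by (rule push_module[OF m(2)], (rule c1; assumption), (rule c2; assumption))+
  have Q: "is_module C (push r H)" "\<pi> \<in> mod_hom C H (push r H)" using P(1,2) by (simp_all add: \<pi>_def)
  have 1: "\<forall>X\<in>Ob C. \<pi> X ` carrier (mob H X) = carrier (mob (push r H) X)" using P(3) by (simp add: \<pi>_def)
  have 2: "\<forall>X\<in>Ob C. \<forall>y\<in>carrier (mob H X). \<pi> X y = \<one>\<^bsub>mob (push r H) X\<^esub> \<longleftrightarrow> y \<in> \<tau> X ` carrier (mob G X)"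
  proof (intro ballI)
    fix X y assume X: "X \<in> Ob C" "y \<in> carrier (mob H X)"
    interpret H: group "mob H X" by (rule is_module_grp[OF m(2) X(1)])
    have "\<pi> X y = \<one>\<^bsub>mob (push r H) X\<^esub> \<longleftrightarrow> I X #>\<^bsub>mob H X\<^esub> y = I X #>\<^bsub>mob H X\<^esub> \<one>\<^bsub>mob H X\<^esub>"
    proof -
      have "\<pi> X y = r X y" using X by (simp add: \<pi>_def)
      moreover have "\<one>\<^bsub>mob (push r H) X\<^esub> = r X \<one>\<^bsub>mob H X\<^esub>" by (rule P(4))
      ultimately show ?thesis using rI[OF X H.one_closed] by simp
    qed
    also have "I X #>\<^bsub>mob H X\<^esub> \<one>\<^bsub>mob H X\<^esub> = I X" by (rule H.coset_mult_one[OF subgroup.subset[OF sub[OF X(1)]]])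
    also have "I X #>\<^bsub>mob H X\<^esub> y = I X \<longleftrightarrow> y \<in> I X"
      by (rule iffI[OF H.coset_join1[OF _ X(2) sub[OF X(1)]] H.coset_join2[OF X(2) sub[OF X(1)]]])
    finally show "\<pi> X y = \<one>\<^bsub>mob (push r H) X\<^esub> \<longleftrightarrow> y \<in> \<tau> X ` carrier (mob G X)" by (simp add: I_def)
  qed
  show ?thesis
    by (rule that[OF coherent_coker[OF G t Q] Q(2) 1 2]) (simp_all add: bspec[OF 1] bspec[OF bspec[OF 2]])
qed

text \<open>An element is a multiple of the generator by some arrow. With source and target known,
  the morphism of a chosen such arrow determines the element; so the module embeds pointwise into
  the type of morphisms, and \<iota> takes it to the value type, whatever the original one
  was.\<close>

lemma coherent_relabel:
  fixes G :: "('o, 'a, 'w) cmodule" and \<iota> :: "'a \<Rightarrow> 'v"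
  assumes i: "inj \<iota>" and G: "coherent C G"
  obtains H :: "('o, 'a, 'v) cmodule" and \<rho> where "coherent C H" "\<rho> \<in> mod_hom C G H"
    "\<forall>X\<in>Ob C. bij_betw (\<rho> X) (carrier (mob G X)) (carrier (mob H X))"
proof -
  obtain y f where g: "is_module C G" "presents G y f" using coherentE[OF G] .
  define s where "s X x = (SOME g. arr g \<and> src g = X \<and> tgt g = tgt f \<and> act G g y = x)" for X x
  have s: "arr (s X x) \<and> src (s X x) = X \<and> tgt (s X x) = tgt f \<and> act G (s X x) y = x" if "X \<in> Ob C" "x \<in> carrier (mob G X)" for X x
    unfolding s_def by (rule someI_ex[OF presentsD(3)[OF g(2) that]])
  define r where "r X x = \<iota> (val (s X x))" for X x
  have r: "x = x'" if X: "X \<in> Ob C" "x \<in> carrier (mob G X)" "x' \<in> carrier (mob G X)" "r X x = r X x'" for X x x'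
  proof -
    have "val (s X x) = val (s X x')" using X(4) i by (simp add: r_def inj_eq)
    then have "s X x = s X x'" using s[OF X(1,2)] s[OF X(1,3)] by (intro Arrow_eqI) simp_all
    then show ?thesis using s[OF X(1,2)] s[OF X(1,3)] by metis
  qed
  have c1: "r X (x \<otimes>\<^bsub>mob G X\<^esub> y) = r X (x' \<otimes>\<^bsub>mob G X\<^esub> y')"
    if "X \<in> Ob C" "x \<in> carrier (mob G X)" "y \<in> carrier (mob G X)" "x' \<in> carrier (mob G X)" "y' \<in> carrier (mob G X)"
      "r X x = r X x'" "r X y = r X y'" for X x y x' y'
    using r[of X x x'] r[of X y y'] that by simp
  have c2: "r X (mar G X Y f y) = r X (mar G X Y f y')"
    if "X \<in> Ob C" "Y \<in> Ob C" "f \<in> mor C X Y" "y \<in> carrier (mob G Y)" "y' \<in> carrier (mob G Y)" "r Y y = r Y y'" for X Y f y y'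
    using r[of Y y y'] that by simp
  define \<rho> where "\<rho> = (\<lambda>X\<in>Ob C. \<lambda>x\<in>carrier (mob G X). r X x)"
  have P: "is_module C (push r G)" "(\<lambda>X\<in>Ob C. \<lambda>x\<in>carrier (mob G X). r X x) \<in> mod_hom C G (push r G)"
    "carrier (mob (push r G) X) = r X ` carrier (mob G X)" "\<one>\<^bsub>mob (push r G) X\<^esub> = r X \<one>\<^bsub>mob G X\<^esub>" for X
    by (rule push_module[OF g(1)], (rule c1; assumption), (rule c2; assumption))+
  have Q: "is_module C (push r G)" "\<rho> \<in> mod_hom C G (push r G)" using P(1,2) by (simp_all add: \<rho>_def)
  have sur: "\<rho> X ` carrier (mob G X) = carrier (mob (push r G) X)" if "X \<in> Ob C" for X using P(3) that by (simp add: \<rho>_def)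
  have bij: "\<forall>X\<in>Ob C. bij_betw (\<rho> X) (carrier (mob G X)) (carrier (mob (push r G) X))"
    using sur r by (auto simp: bij_betw_def inj_on_def \<rho>_def)
  \<comment> \<open>The relabelled module is a cokernel of the zero transformation of G, so
    \<open>coherent_coker\<close> applies.\<close>
  have "coherent C (push r G)"
  proof (rule coherent_coker[OF G G mod_hom_zer[OF g(1) g(1)] Q sur])
    fix X y assume X: "X \<in> Ob C" "y \<in> carrier (mob G X)"
    have o: "\<one>\<^bsub>mob G X\<^esub> \<in> carrier (mob G X)" using module_closed(2)[OF g(1) X(1)] .
    have "\<rho> X y = \<one>\<^bsub>mob (push r G) X\<^esub> \<longleftrightarrow> y = \<one>\<^bsub>mob G X\<^esub>" using P(4)[of X] r[OF X o] X by (auto simp: \<rho>_def)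
    then show "\<rho> X y = \<one>\<^bsub>mob (push r G) X\<^esub> \<longleftrightarrow> y \<in> (\<lambda>X\<in>Ob C. \<lambda>x\<in>carrier (mob G X). \<one>\<^bsub>mob G X\<^esub>) X ` carrier (mob G X)"
      using X o by auto
  qed
  then show ?thesis using that Q(2) bij by blast
qed

lemma coh_cat_biproduct:
  fixes G H :: "('o, 'a, 'v) cmodule" and \<iota> :: "'a \<Rightarrow> 'v"
  assumes i: "inj \<iota>" and G: "coherent C G" "coherent C H"
  shows "\<exists>S i j p q. biproduct (coh_cat C) G H S i j p q"
proof -
  let ?P = "pair_module G H"
  note m = coherent_module[OF G(1)] coherent_module[OF G(2)]
  have cP: "coherent C ?P" by (rule pair_module_coherent[OF G])
  obtain S \<rho> where S: "coherent C (S :: ('o, 'a, 'v) cmodule)" and r: "\<rho> \<in> mod_hom C ?P S"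
    and b: "\<forall>X\<in>Ob C. bij_betw (\<rho> X) (carrier (mob ?P X)) (carrier (mob S X))"
    using coherent_relabel[OF i cP] .
  note mS = coherent_module[OF S] and mP = coherent_module[OF cP]
  have carP: "carrier (mob ?P X) = carrier (mob G X) \<times> carrier (mob H X)"
    "x \<otimes>\<^bsub>mob ?P X\<^esub> y = (fst x \<otimes>\<^bsub>mob G X\<^esub> fst y, snd x \<otimes>\<^bsub>mob H X\<^esub> snd y)"
    "mar ?P X Y f x = (mar G X Y f (fst x), mar H X Y f (snd x))" for X Y f x y
    by (simp_all add: pair_module_def)
  define s where "s X u = inv_into (carrier (mob ?P X)) (\<rho> X) u" for X u
  have sh: "(\<lambda>X\<in>Ob C. \<lambda>u\<in>carrier (mob S X). s X u) \<in> mod_hom C S ?P"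
    unfolding s_def by (rule mod_hom_inverse[OF mP mS r]) (use b in simp)
  have sr: "s X (\<rho> X x) = x" if "X \<in> Ob C" "x \<in> carrier (mob ?P X)" for X x
    using bij_betw_imp_inj_on[OF bspec[OF b that(1)]] that(2) by (simp add: s_def inv_into_f_f)
  have rs: "s X u \<in> carrier (mob ?P X)" "\<rho> X (s X u) = u" if "X \<in> Ob C" "u \<in> carrier (mob S X)" for X u
    using bij_betw_imp_surj_on[OF bspec[OF b that(1)]] that(2) by (auto simp: s_def inv_into_into f_inv_into_f)
  have one: "\<one>\<^bsub>mob G X\<^esub> \<in> carrier (mob G X)" "\<one>\<^bsub>mob H X\<^esub> \<in> carrier (mob H X)"
    "\<one>\<^bsub>mob G X\<^esub> \<otimes>\<^bsub>mob G X\<^esub> \<one>\<^bsub>mob G X\<^esub> = \<one>\<^bsub>mob G X\<^esub>" "\<one>\<^bsub>mob H X\<^esub> \<otimes>\<^bsub>mob H X\<^esub> \<one>\<^bsub>mob H X\<^esub> = \<one>\<^bsub>mob H X\<^esub>" if "X \<in> Ob C" for X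
    using is_module_mon[OF m(1) that] is_module_mon[OF m(2) that] by (simp_all add: monoid.one_closed monoid.l_one)
  have unit: "x \<otimes>\<^bsub>mob G X\<^esub> \<one>\<^bsub>mob G X\<^esub> = x" "z \<otimes>\<^bsub>mob H X\<^esub> \<one>\<^bsub>mob H X\<^esub> = z" "\<one>\<^bsub>mob G X\<^esub> \<otimes>\<^bsub>mob G X\<^esub> x = x" "\<one>\<^bsub>mob H X\<^esub> \<otimes>\<^bsub>mob H X\<^esub> z = z"
    if "X \<in> Ob C" "x \<in> carrier (mob G X)" "z \<in> carrier (mob H X)" for X x z
    using is_module_mon[OF m(1) that(1)] is_module_mon[OF m(2) that(1)] that by (simp_all add: monoid.l_one monoid.r_one)
  have mo: "mar G X Y f \<one>\<^bsub>mob G Y\<^esub> = \<one>\<^bsub>mob G X\<^esub>" "mar H X Y f \<one>\<^bsub>mob H Y\<^esub> = \<one>\<^bsub>mob H X\<^esub>"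
    if "X \<in> Ob C" "Y \<in> Ob C" "f \<in> mor C X Y" for X Y f
    using act_one[OF m(1), of "Arrow X f Y"] act_one[OF m(2), of "Arrow X f Y"] that by (simp_all add: act_def arrI)
  have i0: "(\<lambda>X\<in>Ob C. \<lambda>x\<in>carrier (mob G X). (x, \<one>\<^bsub>mob H X\<^esub>)) \<in> mod_hom C G ?P"
    by (rule mod_homI[OF _ _ _ m(1)]) (simp_all add: carP one mo)
  have j0: "(\<lambda>X\<in>Ob C. \<lambda>x\<in>carrier (mob H X). (\<one>\<^bsub>mob G X\<^esub>, x)) \<in> mod_hom C H ?P"
    by (rule mod_homI[OF _ _ _ m(2)]) (simp_all add: carP one mo)
  have p0: "(\<lambda>X\<in>Ob C. \<lambda>x\<in>carrier (mob ?P X). fst x) \<in> mod_hom C ?P G"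
    by (rule mod_homI[OF _ _ _ mP]) (auto simp: carP)
  have q0: "(\<lambda>X\<in>Ob C. \<lambda>x\<in>carrier (mob ?P X). snd x) \<in> mod_hom C ?P H"
    by (rule mod_homI[OF _ _ _ mP]) (auto simp: carP)
  define i where "i = (\<lambda>X\<in>Ob C. \<lambda>x\<in>carrier (mob G X). \<rho> X (x, \<one>\<^bsub>mob H X\<^esub>))"
  define j where "j = (\<lambda>X\<in>Ob C. \<lambda>x\<in>carrier (mob H X). \<rho> X (\<one>\<^bsub>mob G X\<^esub>, x))"
  define p where "p = (\<lambda>X\<in>Ob C. \<lambda>u\<in>carrier (mob S X). fst (s X u))"
  define q where "q = (\<lambda>X\<in>Ob C. \<lambda>u\<in>carrier (mob S X). snd (s X u))"
  have ih: "i \<in> mod_hom C G S" "j \<in> mod_hom C H S"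
    using mod_hom_cmp[OF m(1) i0 r] mod_hom_cmp[OF m(2) j0 r] by (simp_all add: i_def j_def restrict_def cong: if_cong)
  have pq: "p \<in> mod_hom C S G" "q \<in> mod_hom C S H"
  proof -
    have "(\<lambda>X\<in>Ob C. \<lambda>x\<in>carrier (mob S X). (\<lambda>X\<in>Ob C. \<lambda>x\<in>carrier (mob ?P X). fst x) X ((\<lambda>X\<in>Ob C. \<lambda>u\<in>carrier (mob S X). s X u) X x)) = p"
      "(\<lambda>X\<in>Ob C. \<lambda>x\<in>carrier (mob S X). (\<lambda>X\<in>Ob C. \<lambda>x\<in>carrier (mob ?P X). snd x) X ((\<lambda>X\<in>Ob C. \<lambda>u\<in>carrier (mob S X). s X u) X x)) = q"
      using rs(1) by (auto simp: p_def q_def intro!: restrict_ext)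
    then show "p \<in> mod_hom C S G" "q \<in> mod_hom C S H"
      using mod_hom_cmp[OF mS sh p0] mod_hom_cmp[OF mS sh q0] by simp_all
  qed
  have rc: "\<rho> X (x, z) \<in> carrier (mob S X)" if "X \<in> Ob C" "x \<in> carrier (mob G X)" "z \<in> carrier (mob H X)" for X x z
    using mod_homD(2)[OF r that(1)] that by (simp add: carP)
  have sr': "s X (\<rho> X (x, z)) = (x, z)" if "X \<in> Ob C" "x \<in> carrier (mob G X)" "z \<in> carrier (mob H X)" for X x z
    using sr[OF that(1), of "(x, z)"] that by (simp add: carP)
  have dec: "\<rho> X (fst (s X u), \<one>\<^bsub>mob H X\<^esub>) \<otimes>\<^bsub>mob S X\<^esub> \<rho> X (\<one>\<^bsub>mob G X\<^esub>, snd (s X u)) = u"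
    if X: "X \<in> Ob C" "u \<in> carrier (mob S X)" for X u
  proof -
    have c: "fst (s X u) \<in> carrier (mob G X)" "snd (s X u) \<in> carrier (mob H X)" using rs(1)[OF X] by (auto simp: carP)
    show ?thesis
      using mod_homD(3)[OF r X(1), of "(fst (s X u), \<one>\<^bsub>mob H X\<^esub>)" "(\<one>\<^bsub>mob G X\<^esub>, snd (s X u))"] c one[OF X(1)] unit[OF X(1) c] rs(2)[OF X]
      by (simp add: carP)
  qed
  have fs: "fst (s X u) \<in> carrier (mob G X)" "snd (s X u) \<in> carrier (mob H X)" if "X \<in> Ob C" "u \<in> carrier (mob S X)" for X u
    using rs(1)[OF that] by (auto simp: carP)
  have "biproduct (coh_cat C) G H S i j p q" unfolding biproduct_def
  proof (intro conjI)
    show "S \<in> Ob (coh_cat C)" "i \<in> mor (coh_cat C) G S" "j \<in> mor (coh_cat C) H S" "p \<in> mor (coh_cat C) S G" "q \<in> mor (coh_cat C) S H"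
      using S ih pq by simp_all
    show "Comp (coh_cat C) G S G i p = Ident (coh_cat C) G" "Comp (coh_cat C) H S H j q = Ident (coh_cat C) H"
      "Comp (coh_cat C) G S H i q = zero_mor (coh_cat C) G H" "Comp (coh_cat C) H S G j p = zero_mor (coh_cat C) H G"
      by (auto simp: i_def j_def p_def q_def rc sr' one intro!: restrict_ext)
    show "Comp (coh_cat C) S G S p i \<otimes>\<^bsub>Hom (coh_cat C) S S\<^esub> Comp (coh_cat C) S H S q j = Ident (coh_cat C) S"
      by (auto simp: i_def j_def p_def q_def fs dec intro!: restrict_ext)
  qed
  then show ?thesis by blast
qed

lemma coh_cat_zero_object: "\<exists>Z. zero_object (coh_cat C :: (('o, 'a, 'v) cmodule, 'o \<Rightarrow> 'v \<Rightarrow> 'v) pcat) Z"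
proof -
  define Z :: "('o, 'a, 'v) cmodule" where
    "Z = \<lparr>mob = (\<lambda>X. \<lparr>carrier = {undefined}, monoid.mult = (\<lambda>u v. undefined), one = undefined\<rparr>), mar = (\<lambda>X Y f u. undefined)\<rparr>"
  have m: "is_module C Z" unfolding is_module_def
    by (auto simp: Z_def hom_def intro!: comm_groupI)
  obtain Y where "zero_object C Y" using ex_zero_object by blast
  then have Y: "Y \<in> Ob C" by (simp add: zero_object_def)
  have "presents Z undefined (idt Y)" unfolding presents_def
  proof (intro conjI ballI allI impI)
    fix W x assume "W \<in> Ob C" "x \<in> carrier (mob Z W)"
    then show "\<exists>g. arr g \<and> src g = W \<and> tgt g = tgt (idt Y) \<and> act Z g undefined = x"
      using Y by (intro exI[of _ "zer W Y"]) (simp add: Z_def act_def)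
  next
    fix g assume "arr g \<and> tgt g = tgt (idt Y)"
    then show "act Z g undefined = \<one>\<^bsub>mob Z (src g)\<^esub> \<longleftrightarrow> (\<exists>h. arr h \<and> src h = src g \<and> tgt h = src (idt Y) \<and> h ;; idt Y = g)"
      using Y by (auto simp: Z_def act_def intro!: exI[of _ g])
  qed (use Y in \<open>simp_all add: Z_def\<close>)
  then have c: "coherent C Z" by (rule coherentI[OF m])
  have h: "\<tau> = \<sigma>" if "\<tau> \<in> mod_hom C G Z" "\<sigma> \<in> mod_hom C G Z" for \<tau> \<sigma> and G :: "('o, 'a, 'v) cmodule"
    by (rule mod_hom_eqI[OF that]) (use mod_homD(2)[OF that(1)] mod_homD(2)[OF that(2)] in \<open>simp add: Z_def\<close>)
  have h': "\<tau> = \<sigma>" if G: "is_module C G" and t: "\<tau> \<in> mod_hom C Z G" "\<sigma> \<in> mod_hom C Z G" for \<tau> \<sigma> and G :: "('o, 'a, 'v) cmodule"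
    by (rule mod_hom_eqI[OF t]) (use mod_hom_one[OF m G t(1)] mod_hom_one[OF m G t(2)] in \<open>simp add: Z_def\<close>)
  have z: "zero_mor (coh_cat C) G H \<in> mod_hom C G H" if "coherent C G" "coherent C H" for G H :: "('o, 'a, 'v) cmodule"
    using mod_hom_zer[OF coherent_module[OF that(1)] coherent_module[OF that(2)]] by simp
  have "zero_object (coh_cat C) Z" unfolding zero_object_def
  proof (intro conjI ballI)
    show "Z \<in> Ob (coh_cat C)" using c by simp
    fix G :: "('o, 'a, 'v) cmodule" assume "G \<in> Ob (coh_cat C)"
    then have G: "coherent C G" by simp
    have e: "B = {b}" if "b \<in> B" "\<And>c. c \<in> B \<Longrightarrow> c = b" for B :: "('o \<Rightarrow> 'v \<Rightarrow> 'v) set" and b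
      using that by blast
    have c1: "mor (coh_cat C) G H = mod_hom C G H" for G H :: "('o, 'a, 'v) cmodule" by simp
    show "mor (coh_cat C) G Z = {zero_mor (coh_cat C) G Z}"
      by (rule e) (simp_all only: c1 z[OF G c] h[OF _ z[OF G c]])
    show "mor (coh_cat C) Z G = {zero_mor (coh_cat C) Z G}"
      by (rule e) (simp_all only: c1 z[OF c G] h'[OF coherent_module[OF G] _ z[OF c G]])
  qed
  then show ?thesis by blast
qed

text \<open>The pointwise kernel is coherent, so it can be tested against: \<tau> kills its
  inclusion, which is therefore zero.\<close>

lemma coh_mono_inj:
  fixes G H :: "('o, 'a, 'v) cmodule"
  assumes G: "coherent C G" "coherent C H" and m: "is_mono (coh_cat C) G H \<tau>" and X: "X \<in> Ob C"
  shows "inj_on (\<tau> X) (carrier (mob G X))"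
proof -
  have t: "\<tau> \<in> mod_hom C G H" using m by (simp add: is_mono_def)
  obtain K :: "('o, 'a, 'v) cmodule" and \<kappa> where K: "coherent C K" "\<kappa> \<in> mod_hom C K G" "\<forall>X\<in>Ob C. inj_on (\<kappa> X) (carrier (mob K X))"
    "\<forall>X\<in>Ob C. \<kappa> X ` carrier (mob K X) = {x \<in> carrier (mob G X). \<tau> X x = \<one>\<^bsub>mob H X\<^esub>}"
    using ex_pointwise_ker[OF G t] .
  let ?z = "zero_mor (coh_cat C) K G"
  have z: "?z \<in> mod_hom C K G" using mod_hom_zer[OF coherent_module[OF K(1)] coherent_module[OF G(1)]] by simp
  have kx: "\<tau> X (\<kappa> X x) = \<one>\<^bsub>mob H X\<^esub>" if "X \<in> Ob C" "x \<in> carrier (mob K X)" for X x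
    using bspec[OF K(4) that(1)] that(2) by auto
  have "Comp (coh_cat C) K G H \<kappa> \<tau> = Comp (coh_cat C) K G H ?z \<tau>"
    using kx mod_hom_one[OF coherent_module[OF G(1)] coherent_module[OF G(2)] t] by (auto intro!: restrict_ext)
  then have "\<kappa> = ?z" using m K(1,2) z unfolding is_mono_def by simp
  then have "\<kappa> X x = \<one>\<^bsub>mob G X\<^esub>" if "x \<in> carrier (mob K X)" for x using that X by simp
  then have "x = \<one>\<^bsub>mob G X\<^esub>" if "x \<in> carrier (mob G X)" "\<tau> X x = \<one>\<^bsub>mob H X\<^esub>" for x
    using bspec[OF K(4) X] that by auto
  then show ?thesis using mod_hom_inj_iff[OF coherent_module[OF G(1)] coherent_module[OF G(2)] t X] by blast
qed

lemma coh_epi_surj: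
  fixes G H :: "('o, 'a, 'v) cmodule"
  assumes G: "coherent C G" "coherent C H" and m: "is_epi (coh_cat C) G H \<tau>" and X: "X \<in> Ob C"
  shows "\<tau> X ` carrier (mob G X) = carrier (mob H X)"
proof -
  have t: "\<tau> \<in> mod_hom C G H" using m by (simp add: is_epi_def)
  obtain Q :: "('o, 'a, 'v) cmodule" and \<pi> where Q: "coherent C Q" "\<pi> \<in> mod_hom C H Q"
    "\<forall>X\<in>Ob C. \<pi> X ` carrier (mob H X) = carrier (mob Q X)"
    "\<forall>X\<in>Ob C. \<forall>y\<in>carrier (mob H X). \<pi> X y = \<one>\<^bsub>mob Q X\<^esub> \<longleftrightarrow> y \<in> \<tau> X ` carrier (mob G X)"
    using ex_pointwise_coker[OF G t] .
  let ?z = "zero_mor (coh_cat C) H Q"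
  have z: "?z \<in> mod_hom C H Q" using mod_hom_zer[OF coherent_module[OF G(2)] coherent_module[OF Q(1)]] by simp
  have "\<pi> X (\<tau> X x) = \<one>\<^bsub>mob Q X\<^esub>" if "X \<in> Ob C" "x \<in> carrier (mob G X)" for X x
    using bspec[OF bspec[OF Q(4) that(1)] mod_homD(2)[OF t that]] that(2) by auto
  then have "Comp (coh_cat C) G H Q \<tau> \<pi> = Comp (coh_cat C) G H Q \<tau> ?z"
    using mod_homD(2)[OF t] by (auto intro!: restrict_ext)
  then have p: "\<pi> = ?z" using m Q(1,2) z unfolding is_epi_def by simp
  have "y \<in> \<tau> X ` carrier (mob G X)" if "y \<in> carrier (mob H X)" for y
    using bspec[OF bspec[OF Q(4) X] that] that X unfolding p by simp
  then show ?thesis using mod_homD(2)[OF t X] by auto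
qed

text \<open>Monomorphisms are pointwise injective and epimorphisms pointwise onto. Hence a
  monomorphism is the kernel of its pointwise cokernel, and an epimorphism the cokernel of its
  pointwise kernel.\<close>

theorem coh_cat_abelian:
  fixes \<iota> :: "'a \<Rightarrow> 'v"
  assumes i: "inj \<iota>"
  shows "abelian_category (coh_cat C :: (('o, 'a, 'v) cmodule, 'o \<Rightarrow> 'v \<Rightarrow> 'v) pcat)"
proof -
  let ?A = "coh_cat C :: (('o, 'a, 'v) cmodule, 'o \<Rightarrow> 'v \<Rightarrow> 'v) pcat"
  interpret A: preadditive_category ?A by (rule coh_cat_preadditive)
  show ?thesis
  proof unfold_locales
    show "\<exists>Z. zero_object ?A Z" by (rule coh_cat_zero_object)
    show "\<exists>S i j p q. biproduct ?A X Y S i j p q" if "X \<in> Ob ?A" "Y \<in> Ob ?A" for X Y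
      using coh_cat_biproduct[OF i, of X Y] that by simp
    show "\<exists>K k. is_ker ?A X Y f K k" if "X \<in> Ob ?A" "Y \<in> Ob ?A" "f \<in> mor ?A X Y" for X Y f
    proof -
      have c: "coherent C X" "coherent C Y" "f \<in> mod_hom C X Y" using that by simp_all
      obtain K :: "('o, 'a, 'v) cmodule" and \<kappa> where K: "coherent C K" "\<kappa> \<in> mod_hom C K X" "\<forall>W\<in>Ob C. inj_on (\<kappa> W) (carrier (mob K W))"
        "\<forall>W\<in>Ob C. \<kappa> W ` carrier (mob K W) = {x \<in> carrier (mob X W). f W x = \<one>\<^bsub>mob Y W\<^esub>}"
        using ex_pointwise_ker[OF c] .
      have "is_ker ?A X Y f K \<kappa>" by (rule pointwise_ker[OF c(1,2) K(1) c(3) K(2)]) (use K(3,4) in auto)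
      then show ?thesis by blast
    qed
    show "\<exists>Q q. is_coker ?A X Y f Q q" if "X \<in> Ob ?A" "Y \<in> Ob ?A" "f \<in> mor ?A X Y" for X Y f
    proof -
      have c: "coherent C X" "coherent C Y" "f \<in> mod_hom C X Y" using that by simp_all
      obtain Q :: "('o, 'a, 'v) cmodule" and \<pi> where Q: "coherent C Q" "\<pi> \<in> mod_hom C Y Q" "\<forall>W\<in>Ob C. \<pi> W ` carrier (mob Y W) = carrier (mob Q W)"
        "\<forall>W\<in>Ob C. \<forall>y\<in>carrier (mob Y W). \<pi> W y = \<one>\<^bsub>mob Q W\<^esub> \<longleftrightarrow> y \<in> f W ` carrier (mob X W)"
        using ex_pointwise_coker[OF c] .
      have "is_coker ?A X Y f Q \<pi>" by (rule pointwise_coker[OF c(1,2) Q(1) c(3) Q(2)]) (use Q(3,4) in auto)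
      then show ?thesis by blast
    qed
    show "\<exists>Z\<in>Ob ?A. \<exists>g\<in>mor ?A Y Z. is_ker ?A Y Z g X f" if "X \<in> Ob ?A" "Y \<in> Ob ?A" "is_mono ?A X Y f" for X Y f
    proof -
      have c: "coherent C X" "coherent C Y" "f \<in> mod_hom C X Y" using that by (simp_all add: is_mono_def)
      obtain Q :: "('o, 'a, 'v) cmodule" and \<pi> where Q: "coherent C Q" "\<pi> \<in> mod_hom C Y Q" "\<forall>W\<in>Ob C. \<pi> W ` carrier (mob Y W) = carrier (mob Q W)"
        "\<forall>W\<in>Ob C. \<forall>y\<in>carrier (mob Y W). \<pi> W y = \<one>\<^bsub>mob Q W\<^esub> \<longleftrightarrow> y \<in> f W ` carrier (mob X W)"
        using ex_pointwise_coker[OF c] .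
      have "is_ker ?A Y Q \<pi> X f"
        by (rule pointwise_ker[OF c(2) Q(1) c(1) Q(2) c(3)])
          (use coh_mono_inj[OF c(1,2) that(3)] Q(4) mod_homD(2)[OF c(3)] in auto)
      then show ?thesis using Q(1,2) by (intro bexI[of _ Q] bexI[of _ \<pi>]) simp_all
    qed
    show "\<exists>W\<in>Ob ?A. \<exists>g\<in>mor ?A W X. is_coker ?A W X g Y f" if "X \<in> Ob ?A" "Y \<in> Ob ?A" "is_epi ?A X Y f" for X Y f
    proof -
      have c: "coherent C X" "coherent C Y" "f \<in> mod_hom C X Y" using that by (simp_all add: is_epi_def)
      obtain K :: "('o, 'a, 'v) cmodule" and \<kappa> where K: "coherent C K" "\<kappa> \<in> mod_hom C K X" "\<forall>W\<in>Ob C. inj_on (\<kappa> W) (carrier (mob K W))"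
        "\<forall>W\<in>Ob C. \<kappa> W ` carrier (mob K W) = {x \<in> carrier (mob X W). f W x = \<one>\<^bsub>mob Y W\<^esub>}"
        using ex_pointwise_ker[OF c] .
      have "is_coker ?A K X \<kappa> Y f"
        by (rule pointwise_coker[OF K(1) c(1,2) K(2) c(3)]) (use coh_epi_surj[OF c(1,2) that(3)] K(4) in auto)
      then show ?thesis using K(1,2) by (intro bexI[of _ K] bexI[of _ \<kappa>]) simp_all
    qed
  qed
qed

end

section \<open>Weak kernels and \<open>n\<close>-kernels as arrows\<close>

context preadditive_category
begin

text \<open>A weak kernel: factorisations exist but need not be unique. The equivalence, read at
  \<open>f\<close> itself, contains that the composite is zero.\<close>

definition wk :: "('o, 'a) arrow \<Rightarrow> ('o, 'a) arrow \<Rightarrow> bool"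
  where "wk f g \<longleftrightarrow> arr f \<and> arr g \<and> tgt f = src g \<and> (\<forall>x. arr x \<and> tgt x = src g \<longrightarrow>
    (x ;; g = zer (src x) (tgt g) \<longleftrightarrow> (\<exists>w. arr w \<and> src w = src x \<and> tgt w = src f \<and> w ;; f = x)))"

definition wc :: "('o, 'a) arrow \<Rightarrow> ('o, 'a) arrow \<Rightarrow> bool"
  where "wc f g \<longleftrightarrow> arr f \<and> arr g \<and> tgt f = src g \<and> (\<forall>x. arr x \<and> src x = src g \<longrightarrow>
    (f ;; x = zer (src f) (tgt x) \<longleftrightarrow> (\<exists>w. arr w \<and> src w = tgt g \<and> tgt w = tgt x \<and> g ;; w = x)))"

text \<open>The exact Hom sequences of an n-kernel, cut into pairs: injectivity at the left end, and
  a weak kernel at each further place.\<close>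

definition nker :: "nat \<Rightarrow> (nat \<Rightarrow> ('o, 'a) arrow) \<Rightarrow> bool"
  where "nker n d \<longleftrightarrow> mono (d 0) \<and> (\<forall>k<n. wk (d k) (d (Suc k)))"

definition ncoker :: "nat \<Rightarrow> (nat \<Rightarrow> ('o, 'a) arrow) \<Rightarrow> bool"
  where "ncoker n d \<longleftrightarrow> epi (d n) \<and> (\<forall>k<n. wc (d k) (d (Suc k)))"

lemma wkD: assumes "wk f g"
  shows "arr f" "arr g" "tgt f = src g" "f ;; g = zer (src f) (tgt g)"
proof -
  show *: "arr f" "arr g" "tgt f = src g" using assms unfolding wk_def by blast+
  have "\<exists>w. arr w \<and> src w = src f \<and> tgt w = src f \<and> w ;; f = f"
    using * by (intro exI[of _ "idt (src f)"]) simp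
  then show "f ;; g = zer (src f) (tgt g)" using assms * unfolding wk_def by blast
qed

lemma wk_factor: assumes "wk f g" "arr x" "tgt x = src g" "x ;; g = zer (src x) (tgt g)"
  obtains w where "arr w" "src w = src x" "tgt w = src f" "w ;; f = x"
  using assms unfolding wk_def by blast

lemma wcD: assumes "wc f g"
  shows "arr f" "arr g" "tgt f = src g" "f ;; g = zer (src f) (tgt g)"
proof -
  show *: "arr f" "arr g" "tgt f = src g" using assms unfolding wc_def by blast+
  have "\<exists>w. arr w \<and> src w = tgt g \<and> tgt w = tgt g \<and> g ;; w = g"
    using * by (intro exI[of _ "idt (tgt g)"]) simp
  then show "f ;; g = zer (src f) (tgt g)" using assms * unfolding wc_def by blast
qed

lemma wc_factor: assumes "wc f g" "arr x" "src x = src g" "f ;; x = zer (src f) (tgt x)"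
  obtains w where "arr w" "src w = tgt g" "tgt w = tgt x" "g ;; w = x"
  using assms unfolding wc_def by blast

lemma all_arr_tgt: "Y \<in> Ob C \<Longrightarrow> (\<forall>x. arr x \<and> tgt x = Y \<longrightarrow> Q x) \<longleftrightarrow> (\<forall>W\<in>Ob C. \<forall>h\<in>mor C W Y. Q (Arrow W h Y))"
  by (auto simp del: arr_ob simp: arr_def all_arrow)

lemma all_arr_src: "Y \<in> Ob C \<Longrightarrow> (\<forall>x. arr x \<and> src x = Y \<longrightarrow> Q x) \<longleftrightarrow> (\<forall>W\<in>Ob C. \<forall>h\<in>mor C Y W. Q (Arrow Y h W))"
  by (auto simp del: arr_ob simp: arr_def all_arrow)

lemma ex_arr: "X \<in> Ob C \<Longrightarrow> Y \<in> Ob C \<Longrightarrow> (\<exists>w. arr w \<and> src w = X \<and> tgt w = Y \<and> Q w) \<longleftrightarrow> (\<exists>h\<in>mor C X Y. Q (Arrow X h Y))"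
proof
  assume "X \<in> Ob C" "Y \<in> Ob C" "\<exists>w. arr w \<and> src w = X \<and> tgt w = Y \<and> Q w"
  then obtain w where "arr w" "src w = X" "tgt w = Y" "Q w" by blast
  then show "\<exists>h\<in>mor C X Y. Q (Arrow X h Y)"
    by (intro bexI[of _ "val w"]) (auto simp del: arr_ob simp: arr_def)
next
  assume "X \<in> Ob C" "Y \<in> Ob C" "\<exists>h\<in>mor C X Y. Q (Arrow X h Y)"
  then show "\<exists>w. arr w \<and> src w = X \<and> tgt w = Y \<and> Q w" using arrI by force
qed

lemma Collect_eq_image_iff:
  assumes "\<And>w. w \<in> T \<Longrightarrow> h w \<in> S"
  shows "{x \<in> S. Q x} = h ` T \<longleftrightarrow> (\<forall>x\<in>S. Q x \<longleftrightarrow> (\<exists>w\<in>T. h w = x))"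
proof
  assume e: "{x \<in> S. Q x} = h ` T"
  show "\<forall>x\<in>S. Q x \<longleftrightarrow> (\<exists>w\<in>T. h w = x)"
  proof
    fix x assume "x \<in> S"
    then have "Q x \<longleftrightarrow> x \<in> h ` T" unfolding e[symmetric] by simp
    then show "Q x \<longleftrightarrow> (\<exists>w\<in>T. h w = x)" by blast
  qed
next
  assume e: "\<forall>x\<in>S. Q x \<longleftrightarrow> (\<exists>w\<in>T. h w = x)"
  show "{x \<in> S. Q x} = h ` T"
  proof (intro equalityI subsetI)
    fix x assume "x \<in> h ` T"
    then obtain w where "w \<in> T" "x = h w" by blast
    then show "x \<in> {x \<in> S. Q x}" using e assms by auto
  qed (use e in force)
qed

lemma wk_iff:
  assumes "X \<in> Ob C" "Y \<in> Ob C" "Z \<in> Ob C" "f \<in> mor C X Y" "g \<in> mor C Y Z"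
  shows "wk (Arrow X f Y) (Arrow Y g Z) \<longleftrightarrow> (\<forall>W\<in>Ob C. kernel (Hom C W Y) (Hom C W Z) (\<lambda>h. Comp C W Y Z h g)
    = (\<lambda>h. Comp C W X Y h f) ` mor C W X)"
proof -
  have *: "kernel (Hom C W Y) (Hom C W Z) (\<lambda>h. Comp C W Y Z h g) = (\<lambda>h. Comp C W X Y h f) ` mor C W X \<longleftrightarrow>
    (\<forall>h\<in>mor C W Y. Comp C W Y Z h g = zero_mor C W Z \<longleftrightarrow> (\<exists>w\<in>mor C W X. Comp C W X Y w f = h))" if "W \<in> Ob C" for W
    unfolding kernel_def by (rule Collect_eq_image_iff) (rule comp_closed[OF that assms(1,2) _ assms(4)])
  have "wk (Arrow X f Y) (Arrow Y g Z) \<longleftrightarrow> (\<forall>x. arr x \<and> tgt x = Y \<longrightarrow>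
    (x ;; Arrow Y g Z = zer (src x) Z \<longleftrightarrow> (\<exists>w. arr w \<and> src w = src x \<and> tgt w = X \<and> w ;; Arrow X f Y = x)))"
    unfolding wk_def using assms by (simp add: arrI)
  also have "\<dots> \<longleftrightarrow> (\<forall>W\<in>Ob C. \<forall>h\<in>mor C W Y. Comp C W Y Z h g = zero_mor C W Z \<longleftrightarrow> (\<exists>w\<in>mor C W X. Comp C W X Y w f = h))"
    unfolding all_arr_tgt[OF assms(2)]
    by (intro ball_cong refl) (use assms in \<open>simp add: ex_arr cmp_def zer_def\<close>)
  finally show ?thesis using * by simp
qed

lemma wc_iff:
  assumes "X \<in> Ob C" "Y \<in> Ob C" "Z \<in> Ob C" "f \<in> mor C X Y" "g \<in> mor C Y Z"
  shows "wc (Arrow X f Y) (Arrow Y g Z) \<longleftrightarrow> (\<forall>W\<in>Ob C. kernel (Hom C Y W) (Hom C X W) (\<lambda>h. Comp C X Y W f h)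
    = (\<lambda>h. Comp C Y Z W g h) ` mor C Z W)"
proof -
  have *: "kernel (Hom C Y W) (Hom C X W) (\<lambda>h. Comp C X Y W f h) = (\<lambda>h. Comp C Y Z W g h) ` mor C Z W \<longleftrightarrow>
    (\<forall>h\<in>mor C Y W. Comp C X Y W f h = zero_mor C X W \<longleftrightarrow> (\<exists>w\<in>mor C Z W. Comp C Y Z W g w = h))" if "W \<in> Ob C" for W
    unfolding kernel_def by (rule Collect_eq_image_iff) (rule comp_closed[OF assms(2,3) that assms(5)])
  have "wc (Arrow X f Y) (Arrow Y g Z) \<longleftrightarrow> (\<forall>x. arr x \<and> src x = Y \<longrightarrow>
    (Arrow X f Y ;; x = zer X (tgt x) \<longleftrightarrow> (\<exists>w. arr w \<and> src w = Z \<and> tgt w = tgt x \<and> Arrow Y g Z ;; w = x)))"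
    unfolding wc_def using assms by (simp add: arrI)
  also have "\<dots> \<longleftrightarrow> (\<forall>W\<in>Ob C. \<forall>h\<in>mor C Y W. Comp C X Y W f h = zero_mor C X W \<longleftrightarrow> (\<exists>w\<in>mor C Z W. Comp C Y Z W g w = h))"
    unfolding all_arr_src[OF assms(2)]
    by (intro ball_cong refl) (use assms in \<open>simp add: ex_arr cmp_def zer_def\<close>)
  finally show ?thesis using * by simp
qed

lemma mono_kernel_iff:
  assumes "X \<in> Ob C" "Y \<in> Ob C" "f \<in> mor C X Y"
  shows "mono (Arrow X f Y) \<longleftrightarrow> (\<forall>W\<in>Ob C. kernel (Hom C W X) (Hom C W Y) (\<lambda>h. Comp C W X Y h f) = {zero_mor C W X})"
proof -
  have z: "zero_mor C W X \<in> mor C W X" "Comp C W X Y (zero_mor C W X) f = zero_mor C W Y" if "W \<in> Ob C" for W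
    using zer_cmp[of "Arrow X f Y" X W] that assms hom_mon'[OF that assms(1)] by (simp_all add: arrI cmp_def zer_def monoid.one_closed)
  have *: "kernel (Hom C W X) (Hom C W Y) (\<lambda>h. Comp C W X Y h f) = {zero_mor C W X} \<longleftrightarrow>
    (\<forall>h\<in>mor C W X. Comp C W X Y h f = zero_mor C W Y \<longrightarrow> h = zero_mor C W X)" if "W \<in> Ob C" for W
    using z[OF that] by (auto simp: kernel_def)
  have "mono (Arrow X f Y) \<longleftrightarrow> (\<forall>x. arr x \<and> tgt x = X \<longrightarrow> x ;; Arrow X f Y = zer (src x) Y \<longrightarrow> x = zer (src x) X)"
    unfolding mono_def using assms by (auto simp: arrI)
  also have "\<dots> \<longleftrightarrow> (\<forall>W\<in>Ob C. \<forall>h\<in>mor C W X. Comp C W X Y h f = zero_mor C W Y \<longrightarrow> h = zero_mor C W X)"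
    unfolding all_arr_tgt[OF assms(1)] by (intro ball_cong refl) (simp add: cmp_def zer_def)
  finally show ?thesis using * by simp
qed

lemma epi_kernel_iff:
  assumes "X \<in> Ob C" "Y \<in> Ob C" "f \<in> mor C X Y"
  shows "epi (Arrow X f Y) \<longleftrightarrow> (\<forall>W\<in>Ob C. kernel (Hom C Y W) (Hom C X W) (\<lambda>h. Comp C X Y W f h) = {zero_mor C Y W})"
proof -
  have z: "zero_mor C Y W \<in> mor C Y W" "Comp C X Y W f (zero_mor C Y W) = zero_mor C X W" if "W \<in> Ob C" for W
    using cmp_zer[of "Arrow X f Y" Y W] that assms hom_mon'[OF assms(2) that] by (simp_all add: arrI cmp_def zer_def monoid.one_closed)
  have *: "kernel (Hom C Y W) (Hom C X W) (\<lambda>h. Comp C X Y W f h) = {zero_mor C Y W} \<longleftrightarrow>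
    (\<forall>h\<in>mor C Y W. Comp C X Y W f h = zero_mor C X W \<longrightarrow> h = zero_mor C Y W)" if "W \<in> Ob C" for W
    using z[OF that] by (auto simp: kernel_def)
  have "epi (Arrow X f Y) \<longleftrightarrow> (\<forall>x. arr x \<and> src x = Y \<longrightarrow> Arrow X f Y ;; x = zer X (tgt x) \<longrightarrow> x = zer Y (tgt x))"
    unfolding epi_def using assms by (auto simp: arrI)
  also have "\<dots> \<longleftrightarrow> (\<forall>W\<in>Ob C. \<forall>h\<in>mor C Y W. Comp C X Y W f h = zero_mor C X W \<longrightarrow> h = zero_mor C Y W)"
    unfolding all_arr_src[OF assms(2)] by (intro ball_cong refl) (simp add: cmp_def zer_def)
  finally show ?thesis using * by simp
qed

lemma chain_arr: "chain n C X d \<Longrightarrow> k \<le> n \<Longrightarrow> X k \<in> Ob C \<and> X (Suc k) \<in> Ob C \<and> d k \<in> mor C (X k) (X (Suc k))"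
  unfolding chain_def by simp

lemma n_kernel_iff:
  assumes c: "chain n C X d"
  shows "n_kernel n C X d \<longleftrightarrow> nker n (\<lambda>k. Arrow (X k) (d k) (X (Suc k)))"
proof -
  have m: "mono (Arrow (X 0) (d 0) (X (Suc 0))) \<longleftrightarrow> (\<forall>Y\<in>Ob C. kernel (Hom C Y (X 0)) (Hom C Y (X 1)) (\<lambda>g. Comp C Y (X 0) (X 1) g (d 0))
        = {zero_mor C Y (X 0)})"
    using chain_arr[OF c, of 0] mono_kernel_iff[of "X 0" "X 1" "d 0"] by simp
  have w: "(\<forall>k<n. wk (Arrow (X k) (d k) (X (Suc k))) (Arrow (X (Suc k)) (d (Suc k)) (X (Suc (Suc k))))) \<longleftrightarrow>
    (\<forall>k<n. \<forall>Y\<in>Ob C. kernel (Hom C Y (X (k + 1))) (Hom C Y (X (k + 2)))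
            (\<lambda>g. Comp C Y (X (k + 1)) (X (k + 2)) g (d (k + 1)))
          = (\<lambda>g. Comp C Y (X k) (X (k + 1)) g (d k)) ` mor C Y (X k))"
  proof (intro all_cong)
    fix k assume k: "k < n"
    show "wk (Arrow (X k) (d k) (X (Suc k))) (Arrow (X (Suc k)) (d (Suc k)) (X (Suc (Suc k)))) \<longleftrightarrow>
      (\<forall>Y\<in>Ob C. kernel (Hom C Y (X (k + 1))) (Hom C Y (X (k + 2)))
            (\<lambda>g. Comp C Y (X (k + 1)) (X (k + 2)) g (d (k + 1)))
          = (\<lambda>g. Comp C Y (X k) (X (k + 1)) g (d k)) ` mor C Y (X k))"
      using chain_arr[OF c, of k] chain_arr[OF c, of "Suc k"] k
        wk_iff[of "X k" "X (Suc k)" "X (Suc (Suc k))" "d k" "d (Suc k)"] by simp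
  qed
  show ?thesis unfolding nker_def n_kernel_def m w using c by blast
qed

lemma n_cokernel_iff:
  assumes c: "chain n C X d"
  shows "n_cokernel n C X d \<longleftrightarrow> ncoker n (\<lambda>k. Arrow (X k) (d k) (X (Suc k)))"
proof -
  have m: "epi (Arrow (X n) (d n) (X (Suc n))) \<longleftrightarrow> (\<forall>Y\<in>Ob C.
      kernel (Hom C (X (n + 1)) Y) (Hom C (X n) Y) (\<lambda>g. Comp C (X n) (X (n + 1)) Y (d n) g)
        = {zero_mor C (X (n + 1)) Y})"
    using chain_arr[OF c, of n] epi_kernel_iff[of "X n" "X (Suc n)" "d n"] by simp
  have w: "(\<forall>k<n. wc (Arrow (X k) (d k) (X (Suc k))) (Arrow (X (Suc k)) (d (Suc k)) (X (Suc (Suc k))))) \<longleftrightarrow>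
    (\<forall>k<n. \<forall>Y\<in>Ob C. kernel (Hom C (X (k + 1)) Y) (Hom C (X k) Y) (\<lambda>g. Comp C (X k) (X (k + 1)) Y (d k) g)
          = (\<lambda>g. Comp C (X (k + 1)) (X (k + 2)) Y (d (k + 1)) g) ` mor C (X (k + 2)) Y)"
  proof (intro all_cong)
    fix k assume k: "k < n"
    show "wc (Arrow (X k) (d k) (X (Suc k))) (Arrow (X (Suc k)) (d (Suc k)) (X (Suc (Suc k)))) \<longleftrightarrow>
      (\<forall>Y\<in>Ob C. kernel (Hom C (X (k + 1)) Y) (Hom C (X k) Y) (\<lambda>g. Comp C (X k) (X (k + 1)) Y (d k) g)
          = (\<lambda>g. Comp C (X (k + 1)) (X (k + 2)) Y (d (k + 1)) g) ` mor C (X (k + 2)) Y)"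
      using chain_arr[OF c, of k] chain_arr[OF c, of "Suc k"] k
        wc_iff[of "X k" "X (Suc k)" "X (Suc (Suc k))" "d k" "d (Suc k)"] by simp
  qed
  show ?thesis unfolding ncoker_def n_cokernel_def m w using c by blast
qed

lemma nker_cong: "nker n d \<longleftrightarrow> nker n d'" if "\<And>k. k \<le> n \<Longrightarrow> d k = d' k"
  using that unfolding nker_def by simp

lemma ncoker_cong: "ncoker n d \<longleftrightarrow> ncoker n d'" if "\<And>k. k \<le> n \<Longrightarrow> d k = d' k"
  using that unfolding ncoker_def by simp

lemma arrow_chain:
  assumes a: "\<And>k. k \<le> n \<Longrightarrow> arr (d k)" "\<And>k. k < n \<Longrightarrow> tgt (d k) = src (d (Suc k))"
  defines "X \<equiv> \<lambda>k. if k \<le> n then src (d k) else tgt (d n)"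
  shows "chain n C X (\<lambda>k. val (d k))" "\<And>k. k \<le> n \<Longrightarrow> Arrow (X k) (val (d k)) (X (Suc k)) = d k"
proof -
  have x: "X k = src (d k)" "X (Suc k) = tgt (d k)" if "k \<le> n" for k
    using that a(2)[of k] by (cases "k = n"; simp add: X_def)+
  show "Arrow (X k) (val (d k)) (X (Suc k)) = d k" if "k \<le> n" for k using x[OF that] by simp
  have "X k \<in> Ob C" if "k \<le> n + 1" for k
    using that a(1)[of k] a(1)[of n] by (cases "k \<le> n") (simp_all add: X_def)
  moreover have "val (d k) \<in> mor C (X k) (X (k + 1))" if "k \<le> n" for k
    using x[OF that] a(1)[OF that] by (simp del: arr_ob add: arr_def)
  ultimately show "chain n C X (\<lambda>k. val (d k))" unfolding chain_def by blast
qed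

lemma nker_arr: assumes "nker n d" "k \<le> n" shows "arr (d k)"
  using assms wkD(2)[of "d (k - 1)" "d (Suc (k - 1))"] unfolding nker_def by (cases k) (simp_all add: mono_def)

lemma ncoker_arr: assumes "ncoker n d" "k \<le> n" shows "arr (d k)"
proof (cases "k = n")
  case False
  then have "k < n" using assms by simp
  then show ?thesis using assms wcD(1)[of "d k" "d (Suc k)"] unfolding ncoker_def by blast
qed (use assms in \<open>simp add: ncoker_def epi_def\<close>)

end

section \<open>The axioms of an n-abelian category in terms of arrows\<close>

context n_abelian_category
begin

lemma ex_nker: assumes "arr f" obtains d where "nker n d" "d n = f"
proof -
  obtain X d where d: "X n = src f" "X (n + 1) = tgt f" "d n = val f" "n_kernel n C X d"
    using A1_kernel[of "src f" "tgt f" "val f"] assms by (auto simp del: arr_ob simp: arr_def)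
  have "chain n C X d" using d(4) by (simp add: n_kernel_def)
  from n_kernel_iff[OF this] d show ?thesis by (intro that[of "\<lambda>k. Arrow (X k) (d k) (X (Suc k))"]) auto
qed

lemma ex_ncoker: assumes "arr f" obtains d where "ncoker n d" "d 0 = f"
proof -
  obtain X d where d: "X 0 = src f" "X 1 = tgt f" "d 0 = val f" "n_cokernel n C X d"
    using A1_cokernel[of "src f" "tgt f" "val f"] assms by (auto simp del: arr_ob simp: arr_def)
  have "chain n C X d" using d(4) by (simp add: n_cokernel_def)
  from n_cokernel_iff[OF this] d show ?thesis by (intro that[of "\<lambda>k. Arrow (X k) (d k) (X (Suc k))"]) auto
qed

text \<open>Axiom (A2), after repacking the arrows into families of objects and morphisms;
  \<open>epi_nker_ncoker\<close> is the dual axiom.\<close>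

lemma mono_ncoker_nker: assumes d: "ncoker n d" and m: "mono (d 0)" shows "nker n d"
proof -
  have a: "arr (d k)" if "k \<le> n" for k using ncoker_arr[OF d that] .
  have b: "tgt (d k) = src (d (Suc k))" if "k < n" for k using d that wcD(3) unfolding ncoker_def by blast
  define X where "X = (\<lambda>k. if k \<le> n then src (d k) else tgt (d n))"
  have c: "chain n C X (\<lambda>k. val (d k))" and e: "\<And>k. k \<le> n \<Longrightarrow> Arrow (X k) (val (d k)) (X (Suc k)) = d k"
    unfolding X_def by (rule arrow_chain; use a b in simp)+
  have "n_cokernel n C X (\<lambda>k. val (d k))"
    unfolding n_cokernel_iff[OF c] using d ncoker_cong[of n d, OF e[symmetric]] by simp
  moreover have "is_mono C (X 0) (X 1) (val (d 0))" using m e[of 0] chain_arr[OF c, of 0] by (simp add: is_mono_iff)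
  ultimately have "n_kernel n C X (\<lambda>k. val (d k))" using A2[of X "\<lambda>k. val (d k)"] unfolding n_exact_def by blast
  then show ?thesis unfolding n_kernel_iff[OF c] using nker_cong[of n d, OF e[symmetric]] by simp
qed

lemma epi_nker_ncoker: assumes d: "nker n d" and m: "epi (d n)" shows "ncoker n d"
proof -
  have a: "arr (d k)" if "k \<le> n" for k using nker_arr[OF d that] .
  have b: "tgt (d k) = src (d (Suc k))" if "k < n" for k using d that wkD(3) unfolding nker_def by blast
  define X where "X = (\<lambda>k. if k \<le> n then src (d k) else tgt (d n))"
  have c: "chain n C X (\<lambda>k. val (d k))" and e: "\<And>k. k \<le> n \<Longrightarrow> Arrow (X k) (val (d k)) (X (Suc k)) = d k"
    unfolding X_def by (rule arrow_chain; use a b in simp)+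
  have "n_kernel n C X (\<lambda>k. val (d k))"
    unfolding n_kernel_iff[OF c] using d nker_cong[of n d, OF e[symmetric]] by simp
  moreover have "is_epi C (X n) (X (n + 1)) (val (d n))" using m e[of n] chain_arr[OF c, of n] by (simp add: is_epi_iff)
  ultimately have "n_cokernel n C X (\<lambda>k. val (d k))" using A2_op[of X "\<lambda>k. val (d k)"] unfolding n_exact_def by blast
  then show ?thesis unfolding n_cokernel_iff[OF c] using ncoker_cong[of n d, OF e[symmetric]] by simp
qed

lemma idempotent_split: assumes "arr e" "tgt e = src e" "e ;; e = e"
  obtains r s where "arr r" "src r = src e" "arr s" "src s = tgt r" "tgt s = src e" "r ;; s = e" "s ;; r = idt (tgt r)"
proof -
  have e: "src e \<in> Ob C" "val e \<in> mor C (src e) (src e)" "Comp C (src e) (src e) (src e) (val e) (val e) = val e"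
    using assms(1,2) arg_cong[OF assms(3), of val] unfolding arr_def by (simp_all del: arr_ob add: cmp_def)
  obtain Y r s where "Y \<in> Ob C" "r \<in> mor C (src e) Y" "s \<in> mor C Y (src e)" "Comp C (src e) Y (src e) r s = val e"
    "Comp C Y (src e) Y s r = Ident C Y"
    using A0 e unfolding idempotent_complete_def by blast
  then show ?thesis using assms(1,2) e(1)
    by (intro that[of "Arrow (src e) r Y" "Arrow Y s (src e)"]) (auto simp: arrI cmp_def idt_def)
qed

end

section \<open>Transfer along a fully faithful functor\<close>

text \<open>The properties of the restricted Yoneda functor that the transfer relies on: it is
  additive and fully faithful, keeps projective objects projective, and every object of the abelian
  category is a quotient of the image of a projective one.\<close>

locale generating_embedding = M: n_abelian_category n C + A: abelian_enough_projectives D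
    for n :: nat and C :: "('o, 'a) pcat" and D :: "('p, 'b) pcat" +
  fixes fo :: "'o \<Rightarrow> 'p" and fa :: "('o, 'a) arrow \<Rightarrow> ('p, 'b) arrow"
  assumes n_pos: "1 \<le> n"
    and fo_ob: "X \<in> Ob C \<Longrightarrow> fo X \<in> Ob D"
    and fa_arr: "M.arr f \<Longrightarrow> A.arr (fa f)"
    and fa_src: "M.arr f \<Longrightarrow> src (fa f) = fo (src f)"
    and fa_tgt: "M.arr f \<Longrightarrow> tgt (fa f) = fo (tgt f)"
    and fa_cmp: "\<lbrakk>M.arr f; M.arr g; tgt f = src g\<rbrakk> \<Longrightarrow> fa (M.cmp f g) = A.cmp (fa f) (fa g)"
    and fa_idt: "X \<in> Ob C \<Longrightarrow> fa (M.idt X) = A.idt (fo X)"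
    and fa_add: "M.par f g \<Longrightarrow> fa (M.add f g) = A.add (fa f) (fa g)"
    and fa_full: "\<lbrakk>X \<in> Ob C; Y \<in> Ob C; A.arr t; src t = fo X; tgt t = fo Y\<rbrakk>
      \<Longrightarrow> \<exists>f. M.arr f \<and> src f = X \<and> tgt f = Y \<and> fa f = t"
    and fa_faithful: "M.par f g \<Longrightarrow> fa f = fa g \<Longrightarrow> f = g"
    and fo_proj: "M.proj P \<Longrightarrow> A.proj (fo P)"
    and fo_gen: "G \<in> Ob D \<Longrightarrow> \<exists>P e. M.proj P \<and> A.epi e \<and> src e = fo P \<and> tgt e = G"
begin

no_notation M.cmp (infixr ";;" 75)
no_notation M.add (infixl "\<boxplus>" 65)
notation M.cmp (infixr "\<star>" 75)
notation A.cmp (infixr ";;" 75)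

definition N :: "'p set" where "N = {G \<in> Ob D. \<exists>X\<in>Ob C. A.iso G (fo X)}"

declare fo_ob [simp] fa_arr [simp] fa_src [simp] fa_tgt [simp]

lemma fo_N: "X \<in> Ob C \<Longrightarrow> fo X \<in> N"
  unfolding N_def using A.iso_refl fo_ob by blast

lemma NE: assumes "G \<in> N"
  obtains X u v where "X \<in> Ob C" "A.arr u" "src u = G" "tgt u = fo X" "A.arr v" "src v = fo X" "tgt v = G"
    "u ;; v = A.idt G" "v ;; u = A.idt (fo X)"
proof -
  obtain X where X: "X \<in> Ob C" "A.iso G (fo X)" using assms unfolding N_def by blast
  obtain u v where u: "A.arr u" "src u = G" "tgt u = fo X" "A.arr v" "src v = fo X" "tgt v = G"
    "u ;; v = A.idt G" "v ;; u = A.idt (fo X)" using A.isoE[OF X(2)] .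
  show ?thesis by (rule that[OF X(1) u])
qed

lemma fa_zer: assumes "X \<in> Ob C" "Y \<in> Ob C" shows "fa (M.zer X Y) = A.zer (fo X) (fo Y)"
proof -
  have "fa (M.zer X Y) = A.add (fa (M.zer X Y)) (fa (M.zer X Y))"
    using fa_add[of "M.zer X Y" "M.zer X Y"] assms by simp
  then show ?thesis using A.add_self_zer[of "fa (M.zer X Y)"] assms by simp
qed

lemma fa_zer_iff: assumes "M.arr f" shows "fa f = A.zer (fo (src f)) (fo (tgt f)) \<longleftrightarrow> f = M.zer (src f) (tgt f)"
  using fa_faithful[of f "M.zer (src f) (tgt f)"] fa_zer[of "src f" "tgt f"] assms by auto

lemma fa_cmp_zer_iff: assumes "M.arr f" "M.arr g" "tgt f = src g"
  shows "fa f ;; fa g = A.zer (fo (src f)) (fo (tgt g)) \<longleftrightarrow> f \<star> g = M.zer (src f) (tgt g)"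
  using fa_zer_iff[of "f \<star> g"] fa_cmp[OF assms] assms by simp

lemma fullE: assumes "A.arr t" "src t = fo X" "tgt t = fo Y" "X \<in> Ob C" "Y \<in> Ob C"
  obtains f where "M.arr f" "src f = X" "tgt f = Y" "fa f = t"
  using fa_full assms by blast

lemma gen: assumes "G \<in> Ob D"
  obtains e P where "M.proj P" "P \<in> Ob C" "A.epi e" "A.arr e" "src e = fo P" "tgt e = G"
proof -
  obtain P e where e: "M.proj P" "A.epi e" "src e = fo P" "tgt e = G" using fo_gen[OF assms] by blast
  show ?thesis by (rule that[OF e(1) _ e(2) _ e(3,4)]) (use e in \<open>simp_all add: M.proj_def A.epi_def\<close>)
qed

text \<open>Elements of \<open>fo Y\<close> come from the n-abelian category. The projective source
  of \<open>x\<close> is a retract of some \<open>fo P\<close> by \<open>s\<close> and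
  \<open>e\<close>; fullness provides \<open>y\<close> for \<open>e ;; x\<close>, and precomposing
  with \<open>s\<close> recovers \<open>x\<close>.\<close>

lemma proj_from:
  assumes Q: "A.proj (src x)" and x: "A.arr x" "tgt x = fo Y" and Y: "Y \<in> Ob C"
  obtains y s e where "M.arr y" "M.proj (src y)" "tgt y = Y" "A.arr s" "src s = src x" "tgt s = fo (src y)" "s ;; fa y = x"
    "A.arr e" "src e = fo (src y)" "tgt e = src x" "fa y = e ;; x"
proof -
  have "src x \<in> Ob D" using x by simp
  then obtain e P where e: "M.proj P" "P \<in> Ob C" "A.epi e" "A.arr e" "src e = fo P" "tgt e = src x" using gen by metis
  obtain s where s: "A.arr s" "src s = src x" "tgt s = src e" "s ;; e = A.idt (src x)"
    using A.projE[OF Q e(3), of "A.idt (src x)" thesis] x e by auto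
  obtain y where y: "M.arr y" "src y = P" "tgt y = Y" "fa y = e ;; x"
    using fullE[of "e ;; x" P Y thesis] e x Y by auto
  have "s ;; fa y = x" unfolding y(4) using s(1-3) e x by (simp add: A.cmp_reduce[OF s(4)])
  then show ?thesis using that[of y s e] y s e by simp
qed

text \<open>By \<open>proj_from\<close> the element comes from an arrow \<open>y\<close> of the
  n-abelian category; faithfulness shows that \<open>g\<close> kills \<open>y\<close>, and the weak
  kernel factors it there.\<close>

lemma fa_wk_lift:
  assumes w: "M.wk f g" and Q: "A.proj (src x)" and x: "A.arr x" "tgt x = fo (src g)" "x ;; fa g = A.zer (src x) (fo (tgt g))"
  obtains y where "A.arr y" "src y = src x" "tgt y = fo (src f)" "y ;; fa f = x"
proof -
  note d = M.wkD[OF w]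
  obtain y s e where y: "M.arr y" "M.proj (src y)" "tgt y = src g" "A.arr s" "src s = src x" "tgt s = fo (src y)" "s ;; fa y = x"
    "A.arr e" "src e = fo (src y)" "tgt e = src x" "fa y = e ;; x"
    by (rule proj_from[OF Q x(1,2) M.arr_ob(1)[OF d(2)]])
  have "fa y ;; fa g = A.zer (fo (src y)) (fo (tgt g))" unfolding y(11) using x y(1-10) d by simp
  then have "y \<star> g = M.zer (src y) (tgt g)" using fa_cmp_zer_iff[of y g] y d by simp
  then obtain h where h: "M.arr h" "src h = src y" "tgt h = src f" "h \<star> f = y"
    using M.wk_factor[OF w y(1,3)] by blast
  have "(s ;; fa h) ;; fa f = x" using fa_cmp[of h f] h y(1-10) d by simp
  then show ?thesis using that[of "s ;; fa h"] h y d by simp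
qed

lemma fa_mono: assumes m: "M.mono f" shows "A.mono (fa f)"
proof -
  have f: "M.arr f" using m by (simp add: M.mono_def)
  show ?thesis
  proof (rule A.mono_elI)
    fix x assume x: "A.arr x" "A.proj (src x)" "tgt x = src (fa f)" "x ;; fa f = A.zer (src x) (tgt (fa f))"
    have t: "tgt x = fo (src f)" using x f by simp
    obtain y s e where y: "M.arr y" "M.proj (src y)" "tgt y = src f" "A.arr s" "src s = src x" "tgt s = fo (src y)" "s ;; fa y = x"
      "A.arr e" "src e = fo (src y)" "tgt e = src x" "fa y = e ;; x"
      by (rule proj_from[OF x(2,1) t M.arr_ob(1)[OF f]])
    have "fa y ;; fa f = A.zer (fo (src y)) (fo (tgt f))" unfolding y(11) using x y(1-10) f by simp
    then have "y \<star> f = M.zer (src y) (tgt f)" using fa_cmp_zer_iff[of y f] y f by simp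
    then have "y = M.zer (src y) (src f)" using M.monoD[OF m y(1,3)] by simp
    then have "fa y = A.zer (fo (src y)) (fo (src f))" using fa_zer_iff[OF y(1)] y(3) by simp
    then show "x = A.zer (src x) (src (fa f))" using y(1-6) f unfolding y(7)[symmetric] by simp
  qed (use f in simp)
qed

lemma fa_epi: assumes m: "M.epi f" shows "A.epi (fa f)"
proof -
  have f: "M.arr f" using m by (simp add: M.epi_def)
  show ?thesis
  proof (rule A.epi_elI)
    fix x assume x: "A.arr x" "A.proj (src x)" "tgt x = tgt (fa f)"
    have t: "tgt x = fo (tgt f)" using x f by simp
    obtain y s e where y: "M.arr y" "M.proj (src y)" "tgt y = tgt f" "A.arr s" "src s = src x" "tgt s = fo (src y)" "s ;; fa y = x"
      "A.arr e" "src e = fo (src y)" "tgt e = src x" "fa y = e ;; x"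
      by (rule proj_from[OF x(2,1) t M.arr_ob(2)[OF f]])
    obtain w where w: "M.arr w" "src w = src y" "tgt w = src f" "w \<star> f = y"
      using M.projE[OF y(2) m y(1) refl y(3)] .
    have "(s ;; fa w) ;; fa f = x" using fa_cmp[of w f] w y(1-10) f by simp
    then show "\<exists>y. A.arr y \<and> src y = src x \<and> tgt y = src (fa f) \<and> y ;; fa f = x"
      using w y f by (intro exI[of _ "s ;; fa w"]) simp
  qed (use f in simp)
qed

lemma fa_mono_reflect: assumes m: "A.mono (fa f)" and f: "M.arr f" shows "M.mono f"
proof (rule M.monoI[OF f])
  fix x assume x: "M.arr x" "tgt x = src f" "x \<star> f = M.zer (src x) (tgt f)"
  then have "fa x ;; fa f = A.zer (fo (src x)) (fo (tgt f))" using fa_cmp_zer_iff[of x f] f by simp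
  then have "fa x = A.zer (fo (src x)) (fo (tgt x))" using A.monoD[OF m, of "fa x"] x f by simp
  then show "x = M.zer (src x) (src f)" using fa_zer_iff[OF x(1)] x by simp
qed

lemma fa_epi_reflect: assumes m: "A.epi (fa f)" and f: "M.arr f" shows "M.epi f"
proof (rule M.epiI[OF f])
  fix x assume x: "M.arr x" "src x = tgt f" "f \<star> x = M.zer (src f) (tgt x)"
  then have "fa f ;; fa x = A.zer (fo (src f)) (fo (tgt x))" using fa_cmp_zer_iff[of f x] f by simp
  then have "fa x = A.zer (fo (src x)) (fo (tgt x))" using A.epiD[OF m, of "fa x"] x f by simp
  then show "x = M.zer (tgt f) (tgt x)" using fa_zer_iff[OF x(1)] x by simp
qed

text \<open>An object of \<open>N\<close> may be replaced by the isomorphic \<open>fo X\<close> in the conditions on morphisms into \<open>N\<close>.\<close>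

lemma left_approxI:
  assumes a: "A.arr a" and l: "\<And>t Z. Z \<in> Ob C \<Longrightarrow> A.arr t \<Longrightarrow> src t = src a \<Longrightarrow> tgt t = fo Z \<Longrightarrow>
    \<exists>g. A.arr g \<and> src g = tgt a \<and> tgt g = fo Z \<and> a ;; g = t"
  shows "A.left_approx N a"
  unfolding A.left_approx_def
proof (intro allI impI)
  fix f assume f: "A.arr f \<and> src f = src a \<and> tgt f \<in> N"
  then have "tgt f \<in> N" by simp
  then obtain Z u v where u: "Z \<in> Ob C" "A.arr u" "src u = tgt f" "tgt u = fo Z" "A.arr v" "src v = fo Z" "tgt v = tgt f"
    "u ;; v = A.idt (tgt f)" "v ;; u = A.idt (fo Z)" by (rule NE)
  obtain g where g: "A.arr g" "src g = tgt a" "tgt g = fo Z" "a ;; g = f ;; u" using l[of Z "f ;; u"] f u by auto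
  have "a ;; g ;; v = f ;; u ;; v" using g(1-3) u f a by (simp add: A.cmp_reduce[OF g(4)])
  also have "\<dots> = f" using f u(8) by simp
  finally show "\<exists>g. A.arr g \<and> src g = tgt a \<and> tgt g = tgt f \<and> a ;; g = f"
    using g u by (intro exI[of _ "g ;; v"]) simp
qed

text \<open>A cover of G and a cover of its kernel have the form \<open>fo P\<close> and
  \<open>fo P'\<close>, and fullness makes the composite an arrow of the n-abelian category.\<close>

lemma presentation: assumes "G \<in> Ob D"
  obtains f q where "M.arr f" "A.cokerp (fa f) q" "tgt q = G"
proof -
  obtain e P where e: "M.proj P" "P \<in> Ob C" "A.epi e" "A.arr e" "src e = fo P" "tgt e = G" using gen[OF assms] .
  obtain k where S: "A.ses k e" using A.epi_ses[OF e(3)] .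
  note d = A.sesD[OF S]
  obtain e' P' where e': "M.proj P'" "P' \<in> Ob C" "A.epi e'" "A.arr e'" "src e' = fo P'" "tgt e' = src k"
    using gen[OF A.arr_ob(1)[OF d(1)]] .
  obtain f where f: "M.arr f" "src f = P'" "tgt f = P" "fa f = e' ;; k"
    using fullE[of "e' ;; k" P' P thesis] d e e' by auto
  have "A.cokerp (fa f) e" unfolding f(4) using S by (intro A.cokerp_epi_cmp) (simp_all add: A.ses_def e')
  then show ?thesis using that f e by blast
qed

text \<open>Arrows from the cokernel of \<open>fa f\<close> to \<open>fo Z\<close> are arrows out of
  \<open>tgt f\<close> that \<open>f\<close> kills, by fullness and faithfulness. This reduces Hom
  into N to the n-abelian category.\<close>

lemma hom_from_coker:
  assumes q: "A.cokerp (fa f) q" and f: "M.arr f" and t: "A.arr t" "src t = tgt q" "tgt t = fo Z" "Z \<in> Ob C"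
  obtains s where "M.arr s" "src s = tgt f" "tgt s = Z" "fa s = q ;; t" "f \<star> s = M.zer (src f) Z"
proof -
  have Q: "A.arr q" "src q = tgt (fa f)" "fa f ;; q = A.zer (src (fa f)) (tgt q)" using q unfolding A.cokerp_def by blast+
  obtain s where s: "M.arr s" "src s = tgt f" "tgt s = Z" "fa s = q ;; t"
    using fullE[of "q ;; t" "tgt f" Z thesis] Q t f by auto
  have "fa f ;; fa s = A.zer (fo (src f)) (fo (tgt s))" unfolding s(4) using Q(1,2) t s f by (simp add: A.cmp_reduce[OF Q(3)])
  then have "f \<star> s = M.zer (src f) Z" using fa_cmp_zer_iff[of f s] s f by simp
  then show ?thesis using that s by blast
qed

text \<open>The cokernel of \<open>fa (d k)\<close> has an arrow to the target of
  \<open>fa (d (Suc k))\<close>; it is a left approximation exactly because the n-cokernel makes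
  \<open>d (Suc k)\<close> a weak cokernel of \<open>d k\<close>. At the end \<open>d n\<close> is
  epi, so the last cokernel has no nonzero arrow into N.\<close>

lemma hchain_coker:
  assumes d: "M.ncoker n d"
  shows "k + m = n \<Longrightarrow> A.cokerp (fa (d k)) q \<Longrightarrow> A.hchain N m (tgt q)"
proof (induction m arbitrary: k q)
  case 0
  then have k: "k = n" by simp
  have ep: "M.epi (d n)" using d by (simp add: M.ncoker_def)
  have ar: "M.arr (d n)" using ep by (simp add: M.epi_def)
  have q: "A.cokerp (fa (d n)) q" using 0 k by simp
  have eq: "A.epi q" "A.arr q" using A.cokerp_epi[OF q] by (simp_all add: A.epi_def)
  show ?case unfolding A.hchain.simps
  proof (intro allI impI)
    fix f assume f: "A.arr f \<and> src f = tgt q \<and> tgt f \<in> N"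
    then have fN: "tgt f \<in> N" by simp
    obtain Z u v where u: "Z \<in> Ob C" "A.arr u" "src u = tgt f" "tgt u = fo Z" "A.arr v" "src v = fo Z" "tgt v = tgt f"
      "u ;; v = A.idt (tgt f)" "v ;; u = A.idt (fo Z)" using NE[OF fN] .
    have t: "A.arr (f ;; u)" "src (f ;; u) = tgt q" "tgt (f ;; u) = fo Z" using f u by simp_all
    obtain s where s: "M.arr s" "src s = tgt (d n)" "tgt s = Z" "fa s = q ;; f ;; u" "d n \<star> s = M.zer (src (d n)) Z"
      using hom_from_coker[OF q ar t u(1)] .
    have "s = M.zer (tgt (d n)) Z" using M.epiD[OF ep s(1,2)] s by simp
    then have "q ;; f ;; u = A.zer (src q) (fo Z)" using fa_zer[of "tgt (d n)" Z] s(1-4) ar q u(1) by (simp add: A.cokerp_def)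
    then have "f ;; u = A.zer (tgt q) (fo Z)" using A.epiD[OF eq(1) t(1,2)] t by simp
    then have "f ;; u ;; v = A.zer (tgt q) (tgt f)"
      using A.cmp_reduce[of f u _ v] f u eq by simp
    then show "f = A.zer (tgt q) (tgt f)" using u(8) f by simp
  qed
next
  case (Suc m)
  have k: "Suc k + m = n" "k < n" using Suc.prems(1) by simp_all
  have w: "M.wc (d k) (d (Suc k))" using d k by (simp add: M.ncoker_def)
  note W = M.wcD[OF w]
  note q = Suc.prems(2)
  have Q: "A.arr q" "src q = tgt (fa (d k))" "fa (d k) ;; q = A.zer (src (fa (d k))) (tgt q)" "A.epi q"
    using q A.cokerp_epi[OF q] unfolding A.cokerp_def by blast+
  have "fa (d k) ;; fa (d (Suc k)) = A.zer (fo (src (d k))) (fo (tgt (d (Suc k))))" using fa_cmp_zer_iff W by blast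
  then obtain a where a: "A.arr a" "src a = tgt q" "tgt a = tgt (fa (d (Suc k)))" "q ;; a = fa (d (Suc k))"
    using A.cokerp_factor[OF q, of "fa (d (Suc k))" thesis] W by auto
  have l: "A.left_approx N a"
  proof (rule left_approxI[OF a(1)])
    fix t Z assume t: "Z \<in> Ob C" "A.arr t" "src t = src a" "tgt t = fo Z"
    have st: "src t = tgt q" using t a by simp
    obtain s where s: "M.arr s" "src s = tgt (d k)" "tgt s = Z" "fa s = q ;; t" "d k \<star> s = M.zer (src (d k)) Z"
      using hom_from_coker[OF q W(1) t(2) st t(4,1)] .
    obtain h where h: "M.arr h" "src h = tgt (d (Suc k))" "tgt h = tgt s" "d (Suc k) \<star> h = s"
      using M.wc_factor[OF w s(1)] s W by metis
    have "q ;; a ;; fa h = fa (d (Suc k)) ;; fa h" using a(1-3) Q h W by (simp add: A.cmp_reduce[OF a(4)])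
    also have "\<dots> = q ;; t" using fa_cmp[of "d (Suc k)" h] h s(4) W by simp
    finally have "a ;; fa h = t" using A.epi_cancel[OF Q(4), of "a ;; fa h" t] a h t s W by simp
    then show "\<exists>g. A.arr g \<and> src g = tgt a \<and> tgt g = fo Z \<and> a ;; g = t"
      using h a s W by (intro exI[of _ "fa h"]) simp
  qed
  obtain c where c: "A.cokerp a c" using A.ex_cokerp[OF a(1)] .
  have "A.cokerp (fa (d (Suc k))) c" using A.cokerp_epi_cmp[OF c Q(4,1)] a by simp
  then have "A.hchain N m (tgt c)" using Suc.IH k by blast
  moreover have "tgt a \<in> N" using a W fo_N by simp
  ultimately show ?case unfolding A.hchain.simps using a l c by blast
qed

text \<open>Weak kernels become exact sequences by \<open>fa_wk_lift\<close>: the induced arrow from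
  \<open>fo (src f)\<close> to the kernel of \<open>fa g\<close> is epi, and its kernel is that of
  \<open>fa f\<close>.\<close>

lemma ker_ses:
  assumes w: "M.wk f g" and k: "A.kerp (fa g) \<kappa>"
  obtains \<kappa>' \<rho> where "A.kerp (fa f) \<kappa>'" "A.ses \<kappa>' \<rho>" "src \<rho> = fo (src f)" "tgt \<rho> = src \<kappa>" "\<rho> ;; \<kappa> = fa f"
proof -
  note W = M.wkD[OF w]
  have K: "A.arr \<kappa>" "tgt \<kappa> = fo (src g)" "\<kappa> ;; fa g = A.zer (src \<kappa>) (fo (tgt g))" "A.mono \<kappa>"
    using k A.kerp_mono[OF k] W by (simp_all add: A.kerp_def)
  have "fa f ;; fa g = A.zer (fo (src f)) (fo (tgt g))" using fa_cmp_zer_iff W by blast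
  then obtain \<rho> where r: "A.arr \<rho>" "src \<rho> = src (fa f)" "tgt \<rho> = src \<kappa>" "\<rho> ;; \<kappa> = fa f"
    using A.kerp_factor[OF k, of "fa f" thesis] W by auto
  have e: "A.epi \<rho>"
  proof (rule A.epi_elI[OF r(1)])
    fix x assume x: "A.arr x" "A.proj (src x)" "tgt x = tgt \<rho>"
    have s: "src (x ;; \<kappa>) = src x" "tgt (x ;; \<kappa>) = fo (src g)" "A.arr (x ;; \<kappa>)" "(x ;; \<kappa>) ;; fa g = A.zer (src x) (fo (tgt g))"
      using x r K W by simp_all
    obtain y where y: "A.arr y" "src y = src x" "tgt y = fo (src f)" "y ;; fa f = x ;; \<kappa>"
      using fa_wk_lift[OF w, of "x ;; \<kappa>" thesis] s x(2) by simp
    have "(y ;; \<rho>) ;; \<kappa> = x ;; \<kappa>" using y r K W by simp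
    then have "y ;; \<rho> = x" using A.mono_cancel[OF K(4), of "y ;; \<rho>" x] y r x W by simp
    then show "\<exists>y. A.arr y \<and> src y = src x \<and> tgt y = src \<rho> \<and> y ;; \<rho> = x" using y r W by auto
  qed
  obtain \<kappa>' where S: "A.ses \<kappa>' \<rho>" using A.epi_ses[OF e] .
  then have "A.kerp \<rho> \<kappa>'" by (simp add: A.ses_def)
  then have "A.kerp (fa f) \<kappa>'" using A.kerp_cmp_mono[of \<rho> \<kappa>' \<kappa>] K r by simp
  then show ?thesis using that S r W by simp
qed

text \<open>Iterating \<open>ker_ses\<close> resolves the kernel of \<open>fa (d k)\<close> by
  objects of N until \<open>fa (d 0)\<close> is reached, which is mono and has zero kernel.\<close>

lemma ker_res: assumes d: "M.nker n d" shows "k \<le> n \<Longrightarrow> A.kerp (fa (d k)) \<kappa> \<Longrightarrow> A.res N k (src \<kappa>)"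
proof (induction k arbitrary: \<kappa>)
  case 0
  have m: "A.mono (fa (d 0))" using d fa_mono by (simp add: M.nker_def)
  have K: "A.arr \<kappa>" "tgt \<kappa> = src (fa (d 0))" "\<kappa> ;; fa (d 0) = A.zer (src \<kappa>) (tgt (fa (d 0)))" "A.mono \<kappa>"
    using 0(2) A.kerp_mono[OF 0(2)] by (simp_all add: A.kerp_def)
  have "\<kappa> = A.zer (src \<kappa>) (tgt \<kappa>)" using A.monoD[OF m K(1-3)] K(2) by simp
  then have "A.idt (src \<kappa>) ;; \<kappa> = A.zer (src \<kappa>) (tgt \<kappa>)" using K by simp
  then have "A.idt (src \<kappa>) = A.zer (src \<kappa>) (src \<kappa>)" using A.monoD[OF K(4), of "A.idt (src \<kappa>)"] K by simp
  then show ?case using K by (simp add: A.zob_def)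
next
  case (Suc k)
  have w: "M.wk (d k) (d (Suc k))" using d Suc.prems by (simp add: M.nker_def)
  obtain \<kappa>' \<rho> where S: "A.kerp (fa (d k)) \<kappa>'" "A.ses \<kappa>' \<rho>" "src \<rho> = fo (src (d k))" "tgt \<rho> = src \<kappa>" "\<rho> ;; \<kappa> = fa (d k)"
    using ker_ses[OF w Suc.prems(2)] .
  have "A.res N k (src \<kappa>')" using Suc.IH[OF _ S(1)] Suc.prems by simp
  moreover have "src \<rho> \<in> N" using S(3) fo_N M.wkD[OF w] by simp
  ultimately show ?case unfolding A.res.simps using S(2,4) by blast
qed

text \<open>An arrow from the kernel of \<open>fa h\<close> to \<open>fo Z\<close>, composed with
  the epimorphism from \<open>fo (src g)\<close>, is the image of some \<open>s\<close> killed by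
  \<open>f\<close>. The weak cokernel property factors \<open>s\<close> through \<open>g\<close>,
  and that factor extends the arrow over \<kappa>.\<close>

lemma ker_left_approx:
  assumes w: "M.wk f g" "M.wk g h" and c: "M.wc f g" and k: "A.kerp (fa h) \<kappa>"
  shows "A.left_approx N \<kappa>"
proof -
  note W = M.wkD[OF w(1)] and W' = M.wkD[OF w(2)]
  obtain \<kappa>' \<rho> where S: "A.kerp (fa g) \<kappa>'" "A.ses \<kappa>' \<rho>" "src \<rho> = fo (src g)" "tgt \<rho> = src \<kappa>" "\<rho> ;; \<kappa> = fa g"
    using ker_ses[OF w(2) k] .
  have K: "A.arr \<kappa>" "tgt \<kappa> = fo (src h)" "A.mono \<kappa>" using k A.kerp_mono[OF k] W' by (simp_all add: A.kerp_def)
  note d = A.sesD[OF S(2)]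
  have "fa f ;; fa g = A.zer (fo (src f)) (fo (tgt g))" using fa_cmp_zer_iff W by blast
  then have "(fa f ;; \<rho>) ;; \<kappa> = A.zer (fo (src f)) (fo (tgt g))" using S(3-5) d K W by simp
  then have z: "fa f ;; \<rho> = A.zer (fo (src f)) (src \<kappa>)" using A.monoD[OF K(3), of "fa f ;; \<rho>"] S(3,4) d K W W' by simp
  show ?thesis
  proof (rule left_approxI[OF K(1)])
    fix t Z assume t: "Z \<in> Ob C" "A.arr t" "src t = src \<kappa>" "tgt t = fo Z"
    obtain s where s: "M.arr s" "src s = src g" "tgt s = Z" "fa s = \<rho> ;; t"
      using fullE[of "\<rho> ;; t" "src g" Z thesis] d S(3,4) t W by auto
    have "fa f ;; fa s = A.zer (fo (src f)) (fo (tgt s))" unfolding s(4) using z d S(3,4) t W s(1-3)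
      by (simp add: A.cmp_reduce[OF z])
    then have "f \<star> s = M.zer (src f) (tgt s)" using fa_cmp_zer_iff[of f s] s W by simp
    then obtain u where u: "M.arr u" "src u = tgt g" "tgt u = tgt s" "g \<star> u = s"
      using M.wc_factor[OF c s(1,2)] by blast
    have "\<rho> ;; \<kappa> ;; fa u = fa g ;; fa u" using S(3,4) d K u W W' by (simp add: A.cmp_reduce[OF S(5)])
    also have "\<dots> = \<rho> ;; t" using fa_cmp[of g u] u s(4) W by simp
    finally have "\<kappa> ;; fa u = t" using A.epi_cancel[OF d(6), of "\<kappa> ;; fa u" t] S(4) K u t s W' by simp
    then show "\<exists>g. A.arr g \<and> src g = tgt \<kappa> \<and> tgt g = fo Z \<and> \<kappa> ;; g = t" using u s K W' by (intro exI[of _ "fa u"]) simp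
  qed
qed

text \<open>Each approximation statement involves the next syzygy and three consecutive arrows
  ending at index \<open>k - 1\<close>, so one step needs \<open>k\<close> to be at least 3; hence
  the bound \<open>m + 2 \<le> k\<close>.\<close>

lemma ker_xres:
  assumes d: "M.nker n d" and e: "M.ncoker n d"
  shows "m + 2 \<le> k \<Longrightarrow> k \<le> n \<Longrightarrow> A.kerp (fa (d k)) \<kappa> \<Longrightarrow> A.xres N m (src \<kappa>)"
proof (induction m arbitrary: k \<kappa>)
  case (Suc m)
  obtain l where l: "k = Suc (Suc (Suc l))" using Suc.prems(1) by (cases k; cases "k - 1"; cases "k - 2") auto
  have w: "M.wk (d (Suc (Suc l))) (d k)" "M.wk (d (Suc l)) (d (Suc (Suc l)))" "M.wk (d l) (d (Suc l))" "M.wc (d l) (d (Suc l))"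
    using d e Suc.prems(2) unfolding l by (simp_all add: M.nker_def M.ncoker_def)
  obtain \<kappa>' \<rho> where S: "A.kerp (fa (d (Suc (Suc l)))) \<kappa>'" "A.ses \<kappa>' \<rho>" "src \<rho> = fo (src (d (Suc (Suc l))))" "tgt \<rho> = src \<kappa>" "\<rho> ;; \<kappa> = fa (d (Suc (Suc l)))"
    using ker_ses[OF w(1) Suc.prems(3)] .
  have "A.xres N m (src \<kappa>')" using Suc.IH[OF _ _ S(1)] Suc.prems l by simp
  moreover have "A.left_approx N \<kappa>'" using ker_left_approx[OF w(3,2,4) S(1)] .
  moreover have "src \<rho> \<in> N" using S(3) fo_N M.wkD(1)[OF w(1)] by simp
  ultimately show ?case unfolding A.xres.simps using S(2,4) by blast
qed simp

text \<open>The epimorphism from \<open>fo (src f)\<close> onto the kernel is a right approximation: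
  an arrow from N into the kernel gives an arrow killed by \<open>g\<close>, which factors through
  the weak kernel \<open>f\<close>.\<close>

lemma ker_right_approx:
  assumes w: "M.wk f g" and k: "A.kerp (fa g) \<kappa>"
  shows "\<exists>a. A.arr a \<and> src a \<in> N \<and> tgt a = src \<kappa> \<and> (\<forall>g. A.arr g \<and> src g \<in> N \<and> tgt g = src \<kappa> \<longrightarrow>
    (\<exists>h. A.arr h \<and> src h = src g \<and> tgt h = src a \<and> h ;; a = g))"
proof -
  note W = M.wkD[OF w]
  obtain \<kappa>' \<rho> where S: "A.kerp (fa f) \<kappa>'" "A.ses \<kappa>' \<rho>" "src \<rho> = fo (src f)" "tgt \<rho> = src \<kappa>" "\<rho> ;; \<kappa> = fa f"
    using ker_ses[OF w k] .
  have K: "A.arr \<kappa>" "tgt \<kappa> = fo (src g)" "A.mono \<kappa>" "\<kappa> ;; fa g = A.zer (src \<kappa>) (fo (tgt g))"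
    using k A.kerp_mono[OF k] W by (simp_all add: A.kerp_def)
  note d = A.sesD[OF S(2)]
  have "\<exists>h. A.arr h \<and> src h = src x \<and> tgt h = src \<rho> \<and> h ;; \<rho> = x" if x: "A.arr x" "src x \<in> N" "tgt x = src \<kappa>" for x
  proof -
    obtain Z u v where u: "Z \<in> Ob C" "A.arr u" "src u = src x" "tgt u = fo Z" "A.arr v" "src v = fo Z" "tgt v = src x"
      "u ;; v = A.idt (src x)" "v ;; u = A.idt (fo Z)" using NE[OF x(2)] .
    obtain s where s: "M.arr s" "src s = Z" "tgt s = src g" "fa s = v ;; x ;; \<kappa>"
      using fullE[of "v ;; x ;; \<kappa>" Z "src g" thesis] u x K W by auto
    have "fa s ;; fa g = A.zer (fo (src s)) (fo (tgt g))" unfolding s(4) using u x K W s(2) by simp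
    then have "s \<star> g = M.zer (src s) (tgt g)" using fa_cmp_zer_iff[of s g] s W by simp
    then obtain y where y: "M.arr y" "src y = src s" "tgt y = src f" "y \<star> f = s"
      using M.wk_factor[OF w s(1,3)] by blast
    have "(fa y ;; \<rho>) ;; \<kappa> = (v ;; x) ;; \<kappa>" using S(3-5) d K y u x W s(4) fa_cmp[of y f] by simp
    then have e: "fa y ;; \<rho> = v ;; x" using A.mono_cancel[OF K(3), of "fa y ;; \<rho>" "v ;; x"] y s d S(3,4) u x by simp
    have "(u ;; fa y) ;; \<rho> = u ;; v ;; x" using e y s d S(3) u W by simp
    also have "\<dots> = x" using u(1-7) x by (simp add: A.cmp_reduce[OF u(8)])
    finally show ?thesis using u y s S(3) by (intro exI[of _ "u ;; fa y"]) simp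
  qed
  then show ?thesis using d S(3,4) fo_N W by (intro exI[of _ \<rho>]) simp
qed

lemma N_arrow: assumes f: "A.arr f" "src f \<in> N" "tgt f \<in> N"
  obtains h i i' j j' where "M.arr h" "A.arr i" "src i = src f" "tgt i = fo (src h)" "A.arr i'" "src i' = fo (src h)" "tgt i' = src f"
    "i ;; i' = A.idt (src f)" "i' ;; i = A.idt (fo (src h))"
    "A.arr j" "src j = tgt f" "tgt j = fo (tgt h)" "A.arr j'" "src j' = fo (tgt h)" "tgt j' = tgt f"
    "j ;; j' = A.idt (tgt f)" "j' ;; j = A.idt (fo (tgt h))" "fa h = i' ;; f ;; j"
proof -
  obtain X i i' where i: "X \<in> Ob C" "A.arr i" "src i = src f" "tgt i = fo X" "A.arr i'" "src i' = fo X" "tgt i' = src f"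
    "i ;; i' = A.idt (src f)" "i' ;; i = A.idt (fo X)" using NE[OF f(2)] .
  obtain Y j j' where j: "Y \<in> Ob C" "A.arr j" "src j = tgt f" "tgt j = fo Y" "A.arr j'" "src j' = fo Y" "tgt j' = tgt f"
    "j ;; j' = A.idt (tgt f)" "j' ;; j = A.idt (fo Y)" using NE[OF f(3)] .
  obtain h where h: "M.arr h" "src h = X" "tgt h = Y" "fa h = i' ;; f ;; j"
    using fullE[of "i' ;; f ;; j" X Y thesis] f i j by auto
  show ?thesis by (rule that[of h i i' j j']) (use h i j in simp_all)
qed

lemma kerp_transport:
  assumes k: "A.kerp f k" and i: "A.arr i" "src i = src f" "A.arr i'" "src i' = tgt i" "tgt i' = src f"
    "i ;; i' = A.idt (src f)" "i' ;; i = A.idt (tgt i)"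
    and j: "A.arr j" "src j = tgt f" "A.arr j'" "src j' = tgt j" "tgt j' = tgt f" "j ;; j' = A.idt (tgt f)"
  shows "A.kerp (i' ;; f ;; j) (k ;; i)"
proof -
  have f: "A.arr f" "A.arr k" "tgt k = src f" "k ;; f = A.zer (src k) (tgt f)" "A.mono k"
    using k A.kerp_mono[OF k] by (simp_all add: A.kerp_def)
  show ?thesis
  proof (rule A.kerpI)
    show "A.mono (k ;; i)"
    proof (rule A.monoI)
      fix x assume x: "A.arr x" "tgt x = src (k ;; i)" "x ;; k ;; i = A.zer (src x) (tgt (k ;; i))"
      have "(x ;; k ;; i) ;; i' = x ;; k" using x(1,2) f i(1-5) i(6) by simp
      then have "x ;; k = A.zer (src x) (tgt k)" unfolding x(3) using x(1,2) f i by simp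
      then show "x = A.zer (src x) (src (k ;; i))" using A.monoD[OF f(5) x(1)] x(2) by simp
    qed (use f i in simp)
    have "(k ;; i) ;; i' ;; f ;; j = k ;; f ;; j" using f(1-3) i(1-5) j by (simp add: A.cmp_reduce[OF i(6)])
    also have "\<dots> = A.zer (src k) (tgt j)" using f(1-3) j by (simp add: A.cmp_reduce[OF f(4)])
    finally show "(k ;; i) ;; i' ;; f ;; j = A.zer (src (k ;; i)) (tgt (i' ;; f ;; j))" by simp
    fix x assume x: "A.arr x" "tgt x = src (i' ;; f ;; j)" "x ;; i' ;; f ;; j = A.zer (src x) (tgt (i' ;; f ;; j))"
    have t: "tgt x = tgt i" using x(2) i by simp
    have "(x ;; i' ;; f ;; j) ;; j' = (x ;; i') ;; f" using x(1) t f(1) i(1-5) j by simp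
    then have "(x ;; i') ;; f = A.zer (src x) (tgt f)" unfolding x(3) using x(1) t j f by simp
    then obtain y where y: "A.arr y" "src y = src x" "tgt y = src k" "y ;; k = x ;; i'"
      using A.kerp_factor[OF k, of "x ;; i'" thesis] x(1) t i by auto
    have "y ;; k ;; i = x ;; i' ;; i" using y(1-3) f(1-3) x(1) t i(1-5) by (simp add: A.cmp_reduce[OF y(4)])
    also have "\<dots> = x" using i(7) x(1) t by simp
    finally show "\<exists>y. A.arr y \<and> src y = src x \<and> tgt y = src (k ;; i) \<and> y ;; k ;; i = x" using y by auto
  qed (use f i j in simp_all)
qed

text \<open>The idempotent \<open>r ;; i\<close> comes from an idempotent of the n-abelian category,
  which splits by (A0); the image of the splitting object is isomorphic to the retract.\<close>

lemma retract_N: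
  assumes i: "A.arr i" "A.arr r" "tgt i = fo X" "X \<in> Ob C" "src r = tgt i" "tgt r = src i" "i ;; r = A.idt (src i)"
  shows "src i \<in> N"
proof -
  obtain e where e: "M.arr e" "src e = X" "tgt e = X" "fa e = r ;; i" using fullE[of "r ;; i" X X thesis] i by auto
  have "i ;; r ;; i = i" using i(1-6) by (simp add: A.cmp_reduce[OF i(7)])
  then have "fa (e \<star> e) = fa e" using fa_cmp[of e e] e i(1-6) by simp
  then have "e \<star> e = e" using fa_faithful[of "e \<star> e" e] e by simp
  then obtain p s where p: "M.arr p" "src p = src e" "M.arr s" "src s = tgt p" "tgt s = src e" "p \<star> s = e" "s \<star> p = M.idt (tgt p)"
    using M.idempotent_split[of e thesis] e by auto
  have f: "fa p ;; fa s = r ;; i" "fa s ;; fa p = A.idt (fo (tgt p))"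
    using fa_cmp[of p s] fa_cmp[of s p] fa_idt[of "tgt p"] p e by simp_all
  have "A.iso (src i) (fo (tgt p))"
  proof (rule A.isoI)
    have "(i ;; fa p) ;; fa s ;; r = i ;; (r ;; i) ;; r" using i(1-6) p(1-5) e(2) by (simp add: A.cmp_reduce[OF f(1)])
    also have "\<dots> = A.idt (src i)" using i(1-6) by (simp add: i(7) A.cmp_reduce[OF i(7)])
    finally show "(i ;; fa p) ;; fa s ;; r = A.idt (src i)" .
    have "(fa s ;; r) ;; i ;; fa p = fa s ;; (fa p ;; fa s) ;; fa p" unfolding f(1) using i(1-6) p(1-5) e(2) by simp
    also have "\<dots> = A.idt (fo (tgt p))" using p(1-5) e(2) by (simp add: f(2) A.cmp_reduce[OF f(2)])
    finally show "(fa s ;; r) ;; i ;; fa p = A.idt (fo (tgt p))" .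
  qed (use i p e in simp_all)
  then show ?thesis unfolding N_def using i p by auto
qed

text \<open>The sum is compared with the image of a direct sum in the n-abelian category. One
  composite being the identity is enough, since \<open>retract_N\<close> finishes.\<close>

lemma bip_N: assumes b: "A.bip i j p q" and N: "src i \<in> N" "src j \<in> N" shows "tgt i \<in> N"
proof -
  note B = A.bipD[OF b]
  obtain X u u' where u: "X \<in> Ob C" "A.arr u" "src u = src i" "tgt u = fo X" "A.arr u'" "src u' = fo X" "tgt u' = src i"
    "u ;; u' = A.idt (src i)" "u' ;; u = A.idt (fo X)" using NE[OF N(1)] .
  obtain Y v v' where v: "Y \<in> Ob C" "A.arr v" "src v = src j" "tgt v = fo Y" "A.arr v'" "src v' = fo Y" "tgt v' = src j"
    "v ;; v' = A.idt (src j)" "v' ;; v = A.idt (fo Y)" using NE[OF N(2)] .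
  obtain k l r s where m: "M.bip k l r s" "src k = X" "src l = Y" using M.ex_bip[OF u(1) v(1)] .
  note m' = M.bipD[OF m(1)]
  have F: "fa k ;; fa r = A.idt (fo X)" "fa l ;; fa s = A.idt (fo Y)" "fa k ;; fa s = A.zer (fo X) (fo Y)" "fa l ;; fa r = A.zer (fo Y) (fo X)"
    using fa_cmp[of k r] fa_cmp[of l s] fa_cmp[of k s] fa_cmp[of l r] m m' fa_idt fa_zer u(1) v(1) by simp_all
  define \<phi> where "\<phi> = A.add (p ;; u ;; fa k) (q ;; v ;; fa l)"
  define \<psi> where "\<psi> = A.add (fa r ;; u' ;; i) (fa s ;; v' ;; j)"
  have a: "A.arr \<phi>" "src \<phi> = tgt i" "tgt \<phi> = fo (tgt k)" "A.arr \<psi>" "src \<psi> = fo (tgt k)" "tgt \<psi> = tgt i"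
    unfolding \<phi>_def \<psi>_def using B(1-9) u v m m'(1-9) by simp_all
  have k: "fa k ;; \<psi> = u' ;; i" "fa l ;; \<psi> = v' ;; j" unfolding \<psi>_def
    using B(1-9) u(1-7) v(1-7) m m'(1-9)
    by (simp_all add: A.cmp_reduce[OF F(1)] A.cmp_reduce[OF F(2)] A.cmp_reduce[OF F(3)] A.cmp_reduce[OF F(4)])
  have "\<phi> ;; \<psi> = A.add (p ;; u ;; fa k ;; \<psi>) (q ;; v ;; fa l ;; \<psi>)"
    unfolding \<phi>_def using B(1-9) u(1-7) v(1-7) m m'(1-9) a by simp
  also have "\<dots> = A.add (p ;; i) (q ;; j)" unfolding k using B(1-9) u(1-7) v(1-7)
    by (simp add: A.cmp_reduce[OF u(8)] A.cmp_reduce[OF v(8)])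
  also have "\<dots> = A.idt (tgt i)" by (rule B(14))
  finally have "\<phi> ;; \<psi> = A.idt (src \<phi>)" using a by simp
  then have "src \<phi> \<in> N" using retract_N[of \<phi> \<psi> "tgt k"] a m'(1) by simp
  then show ?thesis using a by simp
qed

text \<open>Up to isomorphism \<open>f\<close> is \<open>fa h\<close>, and \<open>h\<close> is mono
  because \<open>fa\<close> is faithful. By (A2) \<open>h\<close> is a weak kernel of the first
  arrow \<open>c 1\<close> of its n-cokernel, so exactness there makes the arrow from the cokernel
  to \<open>fo (tgt (c 1))\<close> mono.\<close>

lemma coker_mono_cogen: assumes S: "A.ses f g" and N: "src f \<in> N" "tgt f \<in> N" shows "A.cogen N (tgt g)"
proof -
  note d = A.sesD[OF S]
  obtain h i i' j j' where h: "M.arr h" "A.arr i" "src i = src f" "tgt i = fo (src h)" "A.arr i'" "src i' = fo (src h)" "tgt i' = src f"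
    "i ;; i' = A.idt (src f)" "i' ;; i = A.idt (fo (src h))"
    "A.arr j" "src j = tgt f" "tgt j = fo (tgt h)" "A.arr j'" "src j' = fo (tgt h)" "tgt j' = tgt f"
    "j ;; j' = A.idt (tgt f)" "j' ;; j = A.idt (fo (tgt h))" "fa h = i' ;; f ;; j"
    using N_arrow[OF d(1) N] .
  have fj: "f ;; j = i ;; fa h" unfolding h(18) using d h(1-7) h(10-12) by (simp add: A.cmp_reduce[OF h(8)])
  have "A.mono (fa h)"
  proof (rule A.monoI)
    fix x assume x: "A.arr x" "tgt x = src (fa h)" "x ;; fa h = A.zer (src x) (tgt (fa h))"
    have t: "tgt x = fo (src h)" using x h by simp
    have "(x ;; fa h) ;; j' = (x ;; i') ;; f" unfolding h(18) using x(1) t d h(2-7) h(10-16) by simp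
    then have "(x ;; i') ;; f = A.zer (src (x ;; i')) (tgt f)" unfolding x(3) using x(1) h d by simp
    then have xi: "x ;; i' = A.zer (src x) (src f)" using A.monoD[OF d(5), of "x ;; i'"] x(1) t h by simp
    have "x = x ;; i' ;; i" using x(1) t h(9) by simp
    also have "\<dots> = A.zer (src x) (fo (src h))" using x(1) t h(1-7) d by (simp add: A.cmp_reduce[OF xi])
    finally show "x = A.zer (src x) (src (fa h))" using h(1) by simp
  qed (rule fa_arr[OF h(1)])
  then have hm: "M.mono h" using fa_mono_reflect h(1) by blast
  obtain c where c: "M.ncoker n c" "c 0 = h" using M.ex_ncoker[OF h(1)] .
  have "M.nker n c" using M.mono_ncoker_nker[OF c(1)] c(2) hm by simp
  then have w: "M.wk h (c 1)" using c(2) n_pos by (auto simp: M.nker_def)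
  note W = M.wkD[OF w]
  have hz: "fa h ;; fa (c 1) = A.zer (fo (src h)) (fo (tgt (c 1)))" using fa_cmp_zer_iff W by blast
  have "f ;; j ;; fa (c 1) = i ;; fa h ;; fa (c 1)" using fj A.cmp_reduce[OF fj] d h(1-7) h(10-12) W by simp
  also have "\<dots> = A.zer (src f) (fo (tgt (c 1)))" unfolding hz using h(1-7) W by simp
  finally have "f ;; j ;; fa (c 1) = A.zer (src f) (tgt (j ;; fa (c 1)))" using W by simp
  then obtain u where u: "A.arr u" "src u = tgt g" "tgt u = fo (tgt (c 1))" "g ;; u = j ;; fa (c 1)"
    using A.ses_extend[OF S, of "j ;; fa (c 1)" thesis] h W by auto
  have "A.mono u"
  proof (rule A.mono_elI[OF u(1)])
    fix x assume x: "A.arr x" "A.proj (src x)" "tgt x = src u" "x ;; u = A.zer (src x) (tgt u)"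
    obtain y where y: "A.arr y" "src y = src x" "tgt y = src g" "y ;; g = x"
      using A.projE[OF x(2) d(6) x(1) refl] x(3) u(2) by metis
    have "(y ;; j) ;; fa (c 1) = y ;; g ;; u" unfolding u(4) using y d h W by simp
    also have "\<dots> = A.zer (src x) (tgt u)" using x y(1-3) d u(1-3) by (simp add: A.cmp_reduce[OF y(4)])
    finally have z: "(y ;; j) ;; fa (c 1) = A.zer (src x) (fo (tgt (c 1)))" using u(3) by simp
    obtain v where v: "A.arr v" "src v = src x" "tgt v = fo (src h)" "v ;; fa h = y ;; j"
      using fa_wk_lift[OF w, of "y ;; j" thesis] x(2) y d h W z by simp
    have "(v ;; fa h) ;; j' = (v ;; i') ;; f" unfolding h(18) using v d h(2-7) h(10-16) by simp
    also have "(v ;; fa h) ;; j' = y" unfolding v(4) using y d h by simp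
    finally have "x = (v ;; i' ;; f) ;; g" using y v(1-3) h(5-7) d by simp
    also have "\<dots> = v ;; i' ;; f ;; g" using v(1-3) h(5-7) d(1-3) by simp
    also have "\<dots> = A.zer (src x) (src u)" unfolding d(4) using v(1-3) h(5-7) d(1-3) u by simp
    finally show "x = A.zer (src x) (src u)" .
  qed
  then show ?thesis unfolding A.cogen_def using u fo_N W by auto
qed

text \<open>Up to isomorphism \<open>g\<close> is \<open>fa h\<close> with \<open>h\<close> epi, and
  by the dual of (A2) an n-kernel of \<open>h\<close> is also an n-cokernel sequence. So
  \<open>ker_left_approx\<close> and \<open>ker_xres\<close> apply at its last arrow.\<close>

lemma epi_kernel_xres: assumes S: "A.ses f g" and N: "src g \<in> N" "tgt g \<in> N" and n: "2 \<le> n"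
  shows "A.left_approx N f \<and> A.xres N (n - 2) (src f)"
proof -
  note d = A.sesD[OF S]
  obtain h i i' j j' where h: "M.arr h" "A.arr i" "src i = src g" "tgt i = fo (src h)" "A.arr i'" "src i' = fo (src h)" "tgt i' = src g"
    "i ;; i' = A.idt (src g)" "i' ;; i = A.idt (fo (src h))"
    "A.arr j" "src j = tgt g" "tgt j = fo (tgt h)" "A.arr j'" "src j' = fo (tgt h)" "tgt j' = tgt g"
    "j ;; j' = A.idt (tgt g)" "j' ;; j = A.idt (fo (tgt h))" "fa h = i' ;; g ;; j"
    using N_arrow[OF d(2) N] .
  have K: "A.kerp (fa h) (f ;; i)" unfolding h(18)
    by (rule kerp_transport[of g f i i' j j']) (use S h in \<open>simp_all add: A.ses_def\<close>)
  have "A.epi (fa h)"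
  proof (rule A.epiI)
    fix x assume x: "A.arr x" "src x = tgt (fa h)" "fa h ;; x = A.zer (src (fa h)) (tgt x)"
    have t: "src x = fo (tgt h)" using x h by simp
    have "i ;; fa h ;; x = i ;; i' ;; g ;; j ;; x" unfolding h(18) using x(1) t d h(2-7) h(10-16) by simp
    also have "\<dots> = g ;; j ;; x" using x(1) t d h(2-7) h(10-16) by (simp add: A.cmp_reduce[OF h(8)])
    finally have "g ;; j ;; x = A.zer (src g) (tgt (j ;; x))" unfolding x(3) using x(1) h(1-4) d by simp
    then have jx: "j ;; x = A.zer (tgt g) (tgt x)" using A.epiD[OF d(6), of "j ;; x"] x(1) t h by simp
    have "x = j' ;; j ;; x" using x(1) t h(10-15) by (simp add: A.cmp_reduce[OF h(17)])
    also have "\<dots> = A.zer (fo (tgt h)) (tgt x)" unfolding jx using x(1) h(10-15) d by simp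
    finally show "x = A.zer (tgt (fa h)) (tgt x)" using h(1) by simp
  qed (rule fa_arr[OF h(1)])
  then have he: "M.epi h" using fa_epi_reflect h(1) by blast
  obtain c where c: "M.nker n c" "c n = h" using M.ex_nker[OF h(1)] .
  have e: "M.ncoker n c" using M.epi_nker_ncoker[OF c(1)] c(2) he by simp
  \<comment> \<open>The last three arrows of the n-kernel are \<open>c m\<close>,
    \<open>c (Suc m)\<close> and \<open>h\<close>.\<close>
  obtain m where m: "n = Suc (Suc m)" using n by (metis add_2_eq_Suc le_Suc_ex)
  have w: "M.wk (c m) (c (Suc m))" "M.wk (c (Suc m)) h" "M.wc (c m) (c (Suc m))"
    using c e m by (auto simp: M.nker_def M.ncoker_def)
  have l: "A.left_approx N (f ;; i)" by (rule ker_left_approx[OF w K])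
  have "n - 2 + 2 \<le> n" using n by simp
  then have "A.xres N (n - 2) (src (f ;; i))" by (rule ker_xres[OF c(1) e _ order_refl]) (simp only: c(2) K)
  moreover have "A.left_approx N f"
  proof (rule left_approxI[OF d(1)])
    fix t Z assume t: "Z \<in> Ob C" "A.arr t" "src t = src f" "tgt t = fo Z"
    obtain s where s: "A.arr s" "src s = tgt i" "tgt s = fo Z" "(f ;; i) ;; s = t"
      using A.left_approxD[OF l t(2)] t fo_N[OF t(1)] by auto
    then show "\<exists>g. A.arr g \<and> src g = tgt f \<and> tgt g = fo Z \<and> f ;; g = t"
      using d h(2-4) by (intro exI[of _ "i ;; s"]) simp
  qed
  ultimately show ?thesis by simp
qed

lemma kernel_N: assumes K: "A.kerp f k" and N: "src f \<in> N" "tgt f \<in> N"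
  shows "A.res N n (src k) \<and> (\<exists>a. A.arr a \<and> src a \<in> N \<and> tgt a = src k \<and> (\<forall>g. A.arr g \<and> src g \<in> N \<and> tgt g = src k \<longrightarrow>
        (\<exists>h. A.arr h \<and> src h = src g \<and> tgt h = src a \<and> h ;; a = g)))"
proof -
  have f: "A.arr f" using K by (simp add: A.kerp_def)
  obtain h i i' j j' where h: "M.arr h" "A.arr i" "src i = src f" "tgt i = fo (src h)" "A.arr i'" "src i' = fo (src h)" "tgt i' = src f"
    "i ;; i' = A.idt (src f)" "i' ;; i = A.idt (fo (src h))"
    "A.arr j" "src j = tgt f" "tgt j = fo (tgt h)" "A.arr j'" "src j' = fo (tgt h)" "tgt j' = tgt f"
    "j ;; j' = A.idt (tgt f)" "j' ;; j = A.idt (fo (tgt h))" "fa h = i' ;; f ;; j"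
    using N_arrow[OF f N] .
  have K': "A.kerp (fa h) (k ;; i)" unfolding h(18) by (rule kerp_transport[of f k i i' j j']) (use K h in simp_all)
  obtain c where c: "M.nker n c" "c n = h" using M.ex_nker[OF h(1)] .
  have "A.res N n (src (k ;; i))" by (rule ker_res[OF c(1) order_refl]) (simp only: c(2) K')
  moreover obtain m where m: "n = Suc m" using n_pos by (cases n) auto
  have w: "M.wk (c m) h" using c m by (auto simp: M.nker_def)
  note ker_right_approx[OF w K']
  ultimately show ?thesis by simp
qed

text \<open>If the cokernel of \<open>fa f\<close> has no nonzero arrows into N, then
  \<open>f\<close> is epi in the n-abelian category. Since \<open>fa\<close> preserves epimorphisms,
  the cokernel is zero.\<close>

lemma faithful_N: assumes G: "G \<in> Ob D" and h: "A.hchain N 0 G" shows "A.zob G"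
proof -
  obtain f q where f: "M.arr f" "A.cokerp (fa f) q" "tgt q = G" using presentation[OF G] .
  have Q: "A.arr q" "src q = fo (tgt f)" "fa f ;; q = A.zer (fo (src f)) (tgt q)" "A.epi q"
    using f A.cokerp_epi[OF f(2)] by (simp_all add: A.cokerp_def)
  have "M.epi f"
  proof (rule M.epiI[OF f(1)])
    fix s assume s: "M.arr s" "src s = tgt f" "f \<star> s = M.zer (src f) (tgt s)"
    then have "fa f ;; fa s = A.zer (src (fa f)) (tgt (fa s))" using fa_cmp_zer_iff[of f s] f by simp
    then obtain t where t: "A.arr t" "src t = tgt q" "tgt t = tgt (fa s)" "q ;; t = fa s"
      using A.cokerp_factor[OF f(2), of "fa s" thesis] f s by auto
    have "tgt t \<in> N" using t(3) s(1) fo_N by simp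
    then have "t = A.zer G (tgt t)" using h t(1,2) f(3) by simp
    then have "fa s = A.zer (fo (src s)) (fo (tgt s))" using t Q s f(1) A.cmp_zer[of q G "tgt t"] f(3) by (metis A.arr_ob(2) fa_tgt)
    then show "s = M.zer (tgt f) (tgt s)" using fa_zer_iff[OF s(1)] s by simp
  qed
  then have "A.epi (fa f)" by (rule fa_epi)
  then have "q = A.zer (src q) (tgt q)" using A.epiD[of "fa f" q] Q f by simp
  then have "q ;; A.idt G = A.zer (src q) G" using Q f(3) by simp
  then have "A.idt G = A.zer G G" using A.epiD[OF Q(4), of "A.idt G"] G f(3) by simp
  then show ?thesis using G by (simp add: A.zob_def)
qed

theorem N_cluster_tilting: "n_cluster_tilting n D N"
proof -
  interpret cluster_tilting_criterion D N n
  proof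
    show "N \<subseteq> Ob D" unfolding N_def by blast
    show "src i \<in> N" if a: "A.arr i" "A.arr r" "tgt i \<in> N" "src r = tgt i" "tgt r = src i" "i ;; r = A.idt (src i)" for i r
    proof -
      obtain X u v where u: "X \<in> Ob C" "A.arr u" "src u = tgt i" "tgt u = fo X" "A.arr v" "src v = fo X" "tgt v = tgt i"
        "u ;; v = A.idt (tgt i)" "v ;; u = A.idt (fo X)" using NE[OF a(3)] .
      have "(i ;; u) ;; v ;; r = i ;; r" using a(1-5) u(1-7) by (simp add: A.cmp_reduce[OF u(8)])
      then show ?thesis using retract_N[of "i ;; u" "v ;; r" X] a u by simp
    qed
    show "tgt i \<in> N" if "A.bip i j p q" "src i \<in> N" "src j \<in> N" for i j p q using bip_N[OF that] .
    obtain Z where Z: "zero_object C Z" using M.ex_zero_object by blast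
    have "M.idt Z = M.zer Z Z" using Z M.ident_closed[of Z] by (simp add: zero_object_def M.idt_def M.zer_def)
    then have "A.zob (fo Z)" using Z fa_idt[of Z] fa_zer[of Z Z] by (simp add: A.zob_def zero_object_def)
    then show "\<exists>Z\<in>N. A.zob Z" using fo_N Z by (auto simp: zero_object_def)
    \<comment> \<open>A projective object is a retract of the image that covers it.\<close>
    show "P \<in> N" if P: "A.proj P" for P
    proof -
      have ob: "P \<in> Ob D" using P by (simp add: A.proj_def)
      obtain e Q where e: "M.proj Q" "Q \<in> Ob C" "A.epi e" "A.arr e" "src e = fo Q" "tgt e = P" using gen[OF ob] .
      obtain s where s: "A.arr s" "src s = P" "tgt s = src e" "s ;; e = A.idt P"
        using A.projE[OF P e(3), of "A.idt P" thesis] e ob by auto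
      then show ?thesis using retract_N[of s e Q] e by simp
    qed
    show "1 \<le> n" by (rule n_pos)
    show "A.zob G" if "G \<in> Ob D" "A.hchain N 0 G" for G using faithful_N[OF that] .
    show "A.hchain N n G" if G: "G \<in> Ob D" for G
    proof -
      obtain f q where f: "M.arr f" "A.cokerp (fa f) q" "tgt q = G" using presentation[OF G] .
      obtain d where d: "M.ncoker n d" "d 0 = f" using M.ex_ncoker[OF f(1)] .
      show ?thesis using hchain_coker[OF d(1), of 0 n q] d f by simp
    qed
    show "A.cogen N (tgt g)" if "A.ses f g" "src f \<in> N" "tgt f \<in> N" for f g using coker_mono_cogen[OF that] .
    show "A.left_approx N f \<and> A.xres N (n - 2) (src f)" if "A.ses f g" "src g \<in> N" "tgt g \<in> N" "2 \<le> n" for f g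
      using epi_kernel_xres[OF that] .
    show "A.res N n (src k) \<and> (\<exists>a. A.arr a \<and> src a \<in> N \<and> tgt a = src k \<and> (\<forall>g. A.arr g \<and> src g \<in> N \<and> tgt g = src k \<longrightarrow>
        (\<exists>h. A.arr h \<and> src h = src g \<and> tgt h = src a \<and> h ;; a = g)))" if "A.kerp f k" "src f \<in> N" "tgt f \<in> N" for f k
      using kernel_N[OF that] .
  qed
  show ?thesis by (rule cluster_tilting)
qed

end

section \<open>The restricted Yoneda functor\<close>

locale projectively_generated_n_abelian = n_abelian_category n C for n :: nat and C :: "('o, 'a) pcat" +
  fixes \<iota> :: "'a \<Rightarrow> 'v"
  assumes pgen: "projectively_generated C" and n_pos: "1 \<le> n" and inj: "inj \<iota>"
begin

abbreviation P :: "('o, 'a) pcat" where "P \<equiv> proj_subcat C"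

abbreviation fo :: "'o \<Rightarrow> ('o, 'a, 'v) cmodule" where "fo X \<equiv> transport_module \<iota> (representable C X)"

lemma P_simps [simp]: "Ob P = {X. proj X}" "Hom P = Hom C" "Comp P = Comp C" "Ident P = Ident C"
  by (simp_all add: proj_subcat_def projective_iff)

lemma proj_Ob: "proj X \<Longrightarrow> X \<in> Ob C"
  by (simp add: proj_def)

sublocale P: preadditive_category P
  unfolding proj_subcat_def
  by (rule full_subcat_preadditive[OF preadditive_category_axioms]) (auto simp: projective_def)

lemma P_arr: "P.arr f \<longleftrightarrow> arr f \<and> proj (src f) \<and> proj (tgt f)"
  unfolding P.arr_def arr_def by (auto simp: proj_Ob)

lemma P_ops: "P.cmp f g = f ;; g" "P.add f g = add f g" "P.zer X Y = zer X Y" "P.idt X = idt X"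
  by (simp_all add: P.cmp_def cmp_def P.add_def add_def P.zer_def zer_def P.idt_def idt_def)

lemmas proj_cover = projectively_generated_cover[OF pgen]

text \<open>Precompose the last arrow of an n-kernel of \<open>f\<close> with a projective cover:
  factorisations from projective sources lift to the cover. If \<open>f\<close> is epi, the dual of
  (A2) makes \<open>f\<close> a weak cokernel of that last arrow, and an epimorphism in front does
  not change this.\<close>

lemma proj_weak_kernel: assumes f: "arr f"
  obtains k where "arr k" "proj (src k)" "tgt k = src f" "k ;; f = zer (src k) (tgt f)"
    "\<forall>x. arr x \<and> proj (src x) \<and> tgt x = src f \<and> x ;; f = zer (src x) (tgt f) \<longrightarrow>
      (\<exists>w. arr w \<and> src w = src x \<and> tgt w = src k \<and> w ;; k = x)"
    "epi f \<longrightarrow> (\<forall>x. arr x \<and> src x = src f \<and> k ;; x = zer (src k) (tgt x) \<longrightarrow>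
      (\<exists>w. arr w \<and> src w = tgt f \<and> tgt w = tgt x \<and> f ;; w = x))"
proof -
  obtain d where d: "nker n d" "d n = f" using ex_nker[OF f] .
  obtain m where m: "n = Suc m" using n_pos by (cases n) auto
  have w: "wk (d m) f" using d m by (auto simp: nker_def)
  note W = wkD[OF w]
  obtain c where c: "proj (src c)" "epi c" "arr c" "tgt c = src (d m)" using proj_cover[OF arr_ob(1)[OF W(1)]] .
  have z: "(c ;; d m) ;; f = zer (src c) (tgt f)" using c W by simp
  have l: "\<exists>w. arr w \<and> src w = src x \<and> tgt w = src (c ;; d m) \<and> w ;; c ;; d m = x"
    if x: "arr x" "proj (src x)" "tgt x = src f" "x ;; f = zer (src x) (tgt f)" for x
  proof -
    obtain u where u: "arr u" "src u = src x" "tgt u = src (d m)" "u ;; d m = x" using wk_factor[OF w x(1,3,4)] .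
    obtain v where v: "arr v" "src v = src x" "tgt v = src c" "v ;; c = u"
      using projE[OF x(2) c(2) u(1,2), of thesis] u(3) c(4) by simp
    have "v ;; c ;; d m = x" using v(1-3) c W by (simp add: cmp_reduce[OF v(4)] u(4))
    then show ?thesis using v by auto
  qed
  have r: "\<exists>w. arr w \<and> src w = tgt f \<and> tgt w = tgt x \<and> f ;; w = x"
    if e: "epi f" and x: "arr x" "src x = src f" "(c ;; d m) ;; x = zer (src c) (tgt x)" for x
  proof -
    have "ncoker n d" using epi_nker_ncoker[OF d(1)] e d(2) by simp
    then have wc: "wc (d m) f" using d m by (auto simp: ncoker_def)
    have "d m ;; x = zer (src (d m)) (tgt x)" using epiD[OF c(2), of "d m ;; x"] x c W by simp
    then show ?thesis using wc_factor[OF wc x(1,2)] by metis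
  qed
  show ?thesis
  proof (rule that[of "c ;; d m"])
    show "\<forall>x. arr x \<and> proj (src x) \<and> tgt x = src f \<and> x ;; f = zer (src x) (tgt f) \<longrightarrow>
      (\<exists>w. arr w \<and> src w = src x \<and> tgt w = src (c ;; d m) \<and> w ;; c ;; d m = x)"
      using l by blast
    show "epi f \<longrightarrow> (\<forall>x. arr x \<and> src x = src f \<and> (c ;; d m) ;; x = zer (src (c ;; d m)) (tgt x) \<longrightarrow>
      (\<exists>w. arr w \<and> src w = tgt f \<and> tgt w = tgt x \<and> f ;; w = x))"
      using r by simp
  qed (use c W z in simp_all)
qed

sublocale P: weak_kernel_category P
proof
  obtain Z where Z: "zero_object C Z" using ex_zero_object by blast
  have "proj Z" unfolding proj_def
  proof (intro conjI allI impI)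
    show ob: "Z \<in> Ob C" using Z by (simp add: zero_object_def)
    fix f x assume a: "epi f \<and> arr x \<and> src x = Z \<and> tgt x = tgt f"
    then have f: "arr f" by (simp add: epi_def)
    have "val x = zero_mor C Z (tgt f)" using a f Z by (auto simp del: arr_ob simp: arr_def zero_object_def)
    then have "x = zer Z (tgt f)" using a by (intro Arrow_eqI) (simp_all add: zer_def)
    then show "\<exists>y. arr y \<and> src y = Z \<and> tgt y = src f \<and> y ;; f = x"
      using f ob by (intro exI[of _ "zer Z (src f)"]) simp
  qed
  moreover have "mor C X Z = {zero_mor C X Z} \<and> mor C Z X = {zero_mor C Z X}" if "proj X" for X
    using Z proj_Ob[OF that] unfolding zero_object_def by blast
  ultimately have "zero_object P Z" unfolding zero_object_def by simp
  then show "\<exists>Z. zero_object P Z" by blast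
next
  fix X Y assume "X \<in> Ob P" "Y \<in> Ob P"
  then have X: "proj X" "proj Y" by simp_all
  obtain i j p q where b: "bip i j p q" "src i = X" "src j = Y" using ex_bip[OF proj_Ob[OF X(1)] proj_Ob[OF X(2)]] .
  have "proj (tgt i)" using proj_bip[OF b(1)] b X by simp
  then have "P.bip i j p q" using b X unfolding P.bip_def bip_def P_arr P_ops by simp
  then have "biproduct P X Y (tgt i) (val i) (val j) (val p) (val q)"
    using P.biproduct_iff[of X Y "tgt i" "val i" "val j" "val p" "val q"] bipD[OF b(1)] b X by simp
  then show "\<exists>S i j p q. biproduct P X Y S i j p q" by blast
next
  fix f assume "P.arr f"
  then have f: "arr f" "proj (src f)" "proj (tgt f)" by (simp_all add: P_arr)
  obtain k where k: "arr k" "proj (src k)" "tgt k = src f" "k ;; f = zer (src k) (tgt f)"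
    "\<forall>x. arr x \<and> proj (src x) \<and> tgt x = src f \<and> x ;; f = zer (src x) (tgt f) \<longrightarrow>
      (\<exists>w. arr w \<and> src w = src x \<and> tgt w = src k \<and> w ;; k = x)"
    using proj_weak_kernel[OF f(1)] .
  show "\<exists>k. P.arr k \<and> tgt k = src f \<and> P.cmp k f = P.zer (src k) (tgt f) \<and>
    (\<forall>x. P.arr x \<and> tgt x = src f \<and> P.cmp x f = P.zer (src x) (tgt f) \<longrightarrow>
      (\<exists>w. P.arr w \<and> src w = src x \<and> tgt w = src k \<and> P.cmp w k = x))"
    unfolding P_arr P_ops
  proof (rule exI[of _ k], intro conjI allI impI)
    fix x assume "(arr x \<and> proj (src x) \<and> proj (tgt x)) \<and> tgt x = src f \<and> x ;; f = zer (src x) (tgt f)"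
    then obtain w where "arr w" "src w = src x" "tgt w = src k" "w ;; k = x" "proj (src x)" using k(5) by blast
    then show "\<exists>w. (arr w \<and> proj (src w) \<and> proj (tgt w)) \<and> src w = src x \<and> tgt w = src k \<and> w ;; k = x"
      using k(2) by (intro exI[of _ w]) simp
  qed (use k(1-4) f in simp_all)
qed

lemma fo_simps:
  "carrier (mob (fo X) W) = \<iota> ` mor C W X" "\<iota> a \<otimes>\<^bsub>mob (fo X) W\<^esub> \<iota> b = \<iota> (a \<otimes>\<^bsub>Hom C W X\<^esub> b)"
  "\<one>\<^bsub>mob (fo X) W\<^esub> = \<iota> (zero_mor C W X)" "mar (fo X) V W f (\<iota> a) = \<iota> (Comp C V W X f a)"
  using inj by (simp_all add: transport_module_def transport_group_def representable_def)

lemma inv_iota [simp]: "inv_into UNIV \<iota> (\<iota> a) = a"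
  using inj by simp

lemma \<iota>_eq: "\<iota> a = \<iota> b \<longleftrightarrow> a = b"
  using inj by (simp add: inj_eq)

lemma representable_module: assumes X: "X \<in> Ob C" shows "is_module P (representable C X)"
  unfolding is_module_def
proof (intro conjI ballI)
  fix V assume V: "V \<in> Ob P"
  then have v: "V \<in> Ob C" by (simp add: proj_Ob)
  show "comm_group (mob (representable C X) V)" using hom_group[OF v X] by (simp add: representable_def)
  show "mar (representable C X) V V (Ident P V) x = x" if "x \<in> carrier (mob (representable C X) V)" for x
    using ident_left[OF v X] that by (simp add: representable_def)
next
  fix V W f assume a: "V \<in> Ob P" "W \<in> Ob P" "f \<in> mor P V W"
  then have v: "V \<in> Ob C" "W \<in> Ob C" "f \<in> mor C V W" by (simp_all add: proj_Ob)
  show "mar (representable C X) V W f \<in> hom (mob (representable C X) W) (mob (representable C X) V)"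
    using comp_closed[OF v(1,2) X v(3)] comp_add_right[OF v(1,2) X v(3)] by (simp add: representable_def hom_def)
  fix g x assume g: "g \<in> mor P V W" "x \<in> carrier (mob (representable C X) W)"
  show "mar (representable C X) V W (f \<otimes>\<^bsub>Hom P V W\<^esub> g) x =
    mar (representable C X) V W f x \<otimes>\<^bsub>mob (representable C X) V\<^esub> mar (representable C X) V W g x"
    using comp_add_left[OF v(1,2) X v(3)] g by (simp add: representable_def)
next
  fix U V W f g x assume a: "U \<in> Ob P" "V \<in> Ob P" "W \<in> Ob P" "f \<in> mor P U V" "g \<in> mor P V W" "x \<in> carrier (mob (representable C X) W)"
  then have u: "U \<in> Ob C" "V \<in> Ob C" "W \<in> Ob C" by (simp_all add: proj_Ob)
  show "mar (representable C X) U W (Comp P U V W f g) x = mar (representable C X) U V f (mar (representable C X) V W g x)"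
    using comp_assoc[OF u X] a by (simp add: representable_def)
qed

lemma fo_module: assumes X: "X \<in> Ob C" shows "is_module P (fo X)"
  by (rule P.image_module(1)[OF representable_module[OF X], where r = "\<lambda>_. \<iota>"])
    (simp_all add: fo_simps, simp_all add: representable_def)

lemma yoneda:
  assumes X: "proj X" and G: "is_module P G" and y: "y \<in> carrier (mob G X)"
  defines "\<tau> \<equiv> \<lambda>W\<in>Ob P. \<lambda>u\<in>carrier (mob (fo X) W). mar G W X (inv_into UNIV \<iota> u) y"
  shows "\<tau> \<in> mod_hom P (fo X) G" "\<And>W a. proj W \<Longrightarrow> a \<in> mor C W X \<Longrightarrow> \<tau> W (\<iota> a) = mar G W X a y"
proof -
  show t: "\<tau> W (\<iota> a) = mar G W X a y" if "proj W" "a \<in> mor C W X" for W a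
    using that by (simp add: \<tau>_def fo_simps)
  show "\<tau> \<in> mod_hom P (fo X) G" unfolding \<tau>_def
  proof (rule mod_homI[OF _ _ _ fo_module[OF proj_Ob[OF X]]])
    fix W u assume W: "W \<in> Ob P" "u \<in> carrier (mob (fo X) W)"
    then obtain a where a: "a \<in> mor C W X" "u = \<iota> a" by (auto simp: fo_simps)
    show "mar G W X (inv_into UNIV \<iota> u) y \<in> carrier (mob G W)"
      using P.act_closed[OF G, of "Arrow W a X" y] a W X y by (simp add: P.act_def P.arrI)
    fix v assume "v \<in> carrier (mob (fo X) W)"
    then obtain b where b: "b \<in> mor C W X" "v = \<iota> b" by (auto simp: fo_simps)
    show "mar G W X (inv_into UNIV \<iota> (u \<otimes>\<^bsub>mob (fo X) W\<^esub> v)) y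
      = mar G W X (inv_into UNIV \<iota> u) y \<otimes>\<^bsub>mob G W\<^esub> mar G W X (inv_into UNIV \<iota> v) y"
      using P.act_add[OF G, of "Arrow W a X" "Arrow W b X" y] a b W X y by (simp add: P.act_def P.arrI P.add_def fo_simps)
  next
    fix V W f u assume W: "V \<in> Ob P" "W \<in> Ob P" "f \<in> mor P V W" "u \<in> carrier (mob (fo X) W)"
    then obtain a where a: "a \<in> mor C W X" "u = \<iota> a" by (auto simp: fo_simps)
    show "mar G V X (inv_into UNIV \<iota> (mar (fo X) V W f u)) y = mar G V W f (mar G W X (inv_into UNIV \<iota> u) y)"
      using P.act_cmp[OF G, of "Arrow V f W" "Arrow W a X" y] a W X y by (simp add: P.act_def P.arrI P.cmp_def fo_simps)
  qed
qed

text \<open>Arrows from projective objects to \<open>tgt p\<close> factor through the epimorphism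
  \<open>p\<close>, so \<open>p\<close> generates \<open>fo (tgt p)\<close>; the weak kernel of
  \<open>p\<close> gives the relations. The final clause is what fullness will need.\<close>

lemma presentation_fo:
  assumes p: "epi p" "proj (src p)" "arr p"
  obtains k where "P.presents (fo (tgt p)) (\<iota> (val p)) k" "tgt k = src p" "arr k" "proj (src k)" "k ;; p = zer (src k) (tgt p)"
    "\<forall>x. arr x \<and> src x = src p \<and> k ;; x = zer (src k) (tgt x) \<longrightarrow>
      (\<exists>w. arr w \<and> src w = tgt p \<and> tgt w = tgt x \<and> p ;; w = x)"
proof -
  obtain k where k: "arr k" "proj (src k)" "tgt k = src p" "k ;; p = zer (src k) (tgt p)"
    "\<forall>x. arr x \<and> proj (src x) \<and> tgt x = src p \<and> x ;; p = zer (src x) (tgt p) \<longrightarrow>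
      (\<exists>w. arr w \<and> src w = src x \<and> tgt w = src k \<and> w ;; k = x)"
    "epi p \<longrightarrow> (\<forall>x. arr x \<and> src x = src p \<and> k ;; x = zer (src k) (tgt x) \<longrightarrow>
      (\<exists>w. arr w \<and> src w = tgt p \<and> tgt w = tgt x \<and> p ;; w = x))"
    using proj_weak_kernel[OF p(3)] .
  have pm: "val p \<in> mor C (src p) (tgt p)" using p(3) by (simp del: arr_ob add: arr_def)
  have ac: "P.act (fo (tgt p)) g (\<iota> (val p)) = \<iota> (val (g ;; p))" if "tgt g = src p" for g
    using that by (simp add: P.act_def fo_simps cmp_def)
  have "P.presents (fo (tgt p)) (\<iota> (val p)) k" unfolding P.presents_def
  proof (intro conjI ballI allI impI)
    show "P.arr k" "\<iota> (val p) \<in> carrier (mob (fo (tgt p)) (tgt k))" using k(1-3) p pm by (simp_all add: P_arr fo_simps)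
  next
    fix W x assume W: "W \<in> Ob P" "x \<in> carrier (mob (fo (tgt p)) W)"
    then obtain a where a: "a \<in> mor C W (tgt p)" "x = \<iota> a" by (auto simp: fo_simps)
    have a': "arr (Arrow W a (tgt p))" using a W p(3) by (simp add: arrI proj_Ob)
    have W': "proj W" using W by simp
    obtain g where g: "arr g" "src g = W" "tgt g = src p" "g ;; p = Arrow W a (tgt p)"
      using projE[OF W' p(1) a', of thesis] by simp
    show "\<exists>g. P.arr g \<and> src g = W \<and> tgt g = tgt k \<and> P.act (fo (tgt p)) g (\<iota> (val p)) = x"
      by (rule exI[of _ g]) (use g k(3) p W' in \<open>simp add: P_arr ac a(2)\<close>)
  next
    fix g assume "P.arr g \<and> tgt g = tgt k"
    then have g: "arr g" "proj (src g)" "tgt g = src p" using k(3) by (simp_all add: P_arr)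
    have "P.act (fo (tgt p)) g (\<iota> (val p)) = \<one>\<^bsub>mob (fo (tgt p)) (src g)\<^esub> \<longleftrightarrow> val (g ;; p) = val (zer (src g) (tgt p))"
      unfolding ac[OF g(3)] fo_simps(3) \<iota>_eq by (simp add: zer_def)
    also have "\<dots> \<longleftrightarrow> g ;; p = zer (src g) (tgt p)"
    proof
      assume v: "val (g ;; p) = val (zer (src g) (tgt p))"
      show "g ;; p = zer (src g) (tgt p)" by (rule Arrow_eqI) (simp_all add: v)
    qed simp
    also have "\<dots> \<longleftrightarrow> (\<exists>h. P.arr h \<and> src h = src g \<and> tgt h = src k \<and> P.cmp h k = g)"
    proof
      assume z: "g ;; p = zer (src g) (tgt p)"
      obtain h where "arr h" "src h = src g" "tgt h = src k" "h ;; k = g"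
        using mp[OF spec[OF k(5)] conjI[OF g(1) conjI[OF g(2) conjI[OF g(3) z]]]] by blast
      then show "\<exists>h. P.arr h \<and> src h = src g \<and> tgt h = src k \<and> P.cmp h k = g"
        using k(2) g(2) unfolding P_arr P_ops by (intro exI[of _ h]) simp
    next
      assume "\<exists>h. P.arr h \<and> src h = src g \<and> tgt h = src k \<and> P.cmp h k = g"
      then obtain h where h: "arr h" "src h = src g" "tgt h = src k" "h ;; k = g" unfolding P_arr P_ops by blast
      have "(h ;; k) ;; p = zer (src h) (tgt p)" using h(1-3) k(1-4) p by simp
      then show "g ;; p = zer (src g) (tgt p)" unfolding h(4) h(2) .
    qed
    finally show "P.act (fo (tgt p)) g (\<iota> (val p)) = \<one>\<^bsub>mob (fo (tgt p)) (src g)\<^esub> \<longleftrightarrow>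
      (\<exists>h. P.arr h \<and> src h = src g \<and> tgt h = src k \<and> P.cmp h k = g)" .
  qed
  then show ?thesis by (rule that[OF _ k(3,1,2,4) mp[OF k(6) p(1)]])
qed

lemma fo_coherent: assumes X: "X \<in> Ob C" shows "coherent P (fo X)"
proof -
  obtain p where p: "proj (src p)" "epi p" "arr p" "tgt p = X" using proj_cover[OF X] .
  obtain k where "P.presents (fo (tgt p)) (\<iota> (val p)) k" using presentation_fo[OF p(2,1,3)] .
  then show ?thesis using P.coherentI[OF fo_module[OF X]] p by simp
qed

section \<open>The functor on morphisms, and projective coherent modules\<close>

abbreviation F where "F \<equiv> restricted_yoneda \<iota> C"

lemma F_simps: "fob F X = fo X"
  "far F X Y f = (\<lambda>W\<in>Ob P. \<lambda>x\<in>\<iota> ` mor C W X. \<iota> (Comp C W X Y (inv_into UNIV \<iota> x) f))"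
  by (simp_all add: restricted_yoneda_def del: P_simps)

lemma far_app: "proj W \<Longrightarrow> a \<in> mor C W X \<Longrightarrow> far F X Y f W (\<iota> a) = \<iota> (Comp C W X Y a f)"
  by (simp add: F_simps)

lemma far_hom: assumes X: "X \<in> Ob C" "Y \<in> Ob C" and f: "f \<in> mor C X Y" shows "far F X Y f \<in> mod_hom P (fo X) (fo Y)"
proof -
  have "(\<lambda>W\<in>Ob P. \<lambda>x\<in>carrier (mob (fo X) W). \<iota> (Comp C W X Y (inv_into UNIV \<iota> x) f)) \<in> mod_hom P (fo X) (fo Y)"
  proof (rule mod_homI[OF _ _ _ fo_module[OF X(1)]])
    fix W u assume W: "W \<in> Ob P" "u \<in> carrier (mob (fo X) W)"
    then obtain a where a: "a \<in> mor C W X" "u = \<iota> a" by (auto simp: fo_simps)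
    have w: "W \<in> Ob C" using W by (simp add: proj_Ob)
    show "\<iota> (Comp C W X Y (inv_into UNIV \<iota> u) f) \<in> carrier (mob (fo Y) W)"
      using comp_closed[OF w X a(1) f] a by (simp add: fo_simps)
    fix v assume "v \<in> carrier (mob (fo X) W)"
    then obtain b where b: "b \<in> mor C W X" "v = \<iota> b" by (auto simp: fo_simps)
    show "\<iota> (Comp C W X Y (inv_into UNIV \<iota> (u \<otimes>\<^bsub>mob (fo X) W\<^esub> v)) f)
      = \<iota> (Comp C W X Y (inv_into UNIV \<iota> u) f) \<otimes>\<^bsub>mob (fo Y) W\<^esub> \<iota> (Comp C W X Y (inv_into UNIV \<iota> v) f)"
      using comp_add_left[OF w X a(1) b(1) f] a b by (simp add: fo_simps)
  next
    fix V W g u assume W: "V \<in> Ob P" "W \<in> Ob P" "g \<in> mor P V W" "u \<in> carrier (mob (fo X) W)"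
    then obtain a where a: "a \<in> mor C W X" "u = \<iota> a" by (auto simp: fo_simps)
    show "\<iota> (Comp C V X Y (inv_into UNIV \<iota> (mar (fo X) V W g u)) f) = mar (fo Y) V W g (\<iota> (Comp C W X Y (inv_into UNIV \<iota> u) f))"
      using comp_assoc[OF proj_Ob proj_Ob X, of V W g a f] a W f by (simp add: fo_simps)
  qed
  then show ?thesis by (simp only: F_simps fo_simps)
qed

abbreviation A :: "(('o, 'a, 'v) cmodule, 'o \<Rightarrow> 'v \<Rightarrow> 'v) pcat" where "A \<equiv> coh_cat P"

sublocale A: abelian_category A
  by (rule P.coh_cat_abelian[OF inj])

lemma A_arr: "A.arr t \<longleftrightarrow> coherent P (src t) \<and> coherent P (tgt t) \<and> val t \<in> mod_hom P (src t) (tgt t)"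
  unfolding A.arr_def by (simp del: A.arr_ob P_simps)

lemma A_hom: "A.arr t \<Longrightarrow> src t = G \<Longrightarrow> tgt t = H \<Longrightarrow> val t \<in> mod_hom P G H"
  by (auto simp: A_arr)

lemma A_eqI:
  assumes "A.par s t" "\<And>W x. proj W \<Longrightarrow> x \<in> carrier (mob (src s) W) \<Longrightarrow> val s W x = val t W x"
  shows "s = t"
proof -
  have "val s = val t"
    by (rule mod_hom_eqI[OF A_hom A_hom]) (use assms in simp_all)
  then show ?thesis using assms(1) by (intro Arrow_eqI) simp_all
qed

lemma A_cmp_app: "A.arr s \<Longrightarrow> proj W \<Longrightarrow> x \<in> carrier (mob (src s) W) \<Longrightarrow> val (A.cmp s t) W x = val t W (val s W x)"
  by (simp add: A.cmp_def)

lemma iota_ident: "proj X \<Longrightarrow> \<iota> (Ident C X) \<in> carrier (mob (fo X) X)"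
  using ident_closed[OF proj_Ob] by (simp add: fo_simps)

text \<open>The identity of \<open>X\<close> generates \<open>fo X\<close>, so naturality determines
  both transformations by their value there.\<close>

lemma yoneda_eqI:
  assumes a: "A.par s t" "src s = fo X" and X: "proj X" and e: "val s X (\<iota> (Ident C X)) = val t X (\<iota> (Ident C X))"
  shows "s = t"
proof (rule A_eqI[OF a(1)])
  fix W x assume W: "proj W" "x \<in> carrier (mob (src s) W)"
  obtain g where g: "g \<in> mor C W X" "x = \<iota> g" using W(2) unfolding a(2) fo_simps by blast
  have x: "x = mar (fo X) W X g (\<iota> (Ident C X))" using ident_right[OF proj_Ob[OF W(1)] proj_Ob[OF X] g(1)] g by (simp add: fo_simps)
  have "val s \<in> mod_hom P (src s) (tgt s)" "val t \<in> mod_hom P (src s) (tgt s)" using a(1) A_hom by simp_all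
  note h = this[unfolded a(2)]
  have o: "W \<in> Ob P" "X \<in> Ob P" "g \<in> mor P W X" using W X g by simp_all
  show "val s W x = val t W x" unfolding x
    using mod_homD(4)[OF h(1) o iota_ident[OF X]] mod_homD(4)[OF h(2) o iota_ident[OF X]] e by simp
qed

lemma yoneda_arrow:
  assumes X: "proj X" and G: "coherent P G" and y: "y \<in> carrier (mob G X)"
  obtains t where "A.arr t" "src t = fo X" "tgt t = G" "\<forall>W a. proj W \<and> a \<in> mor C W X \<longrightarrow> val t W (\<iota> a) = mar G W X a y"
proof -
  note m = P.coherent_module[OF G]
  define \<tau> where "\<tau> = (\<lambda>W\<in>Ob P. \<lambda>u\<in>carrier (mob (fo X) W). mar G W X (inv_into UNIV \<iota> u) y)"
  have t: "\<tau> \<in> mod_hom P (fo X) G" "\<And>W a. proj W \<Longrightarrow> a \<in> mor C W X \<Longrightarrow> \<tau> W (\<iota> a) = mar G W X a y"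
    unfolding \<tau>_def by (rule yoneda[OF X m y], rule yoneda(2)[OF X m y])
  show ?thesis
    by (rule that[of "Arrow (fo X) \<tau> G"]) (use t G fo_coherent[OF proj_Ob[OF X]] in \<open>simp_all add: A_arr\<close>)
qed

lemma A_epi_iff: assumes "A.arr s"
  shows "A.epi s \<longleftrightarrow> (\<forall>W. proj W \<longrightarrow> val s W ` carrier (mob (src s) W) = carrier (mob (tgt s) W))"
proof
  assume e: "A.epi s"
  have c: "coherent P (src s)" "coherent P (tgt s)" using assms by (simp_all add: A_arr)
  have "is_epi A (src s) (tgt s) (val s)" using A.is_epi_iff[of "src s" "tgt s" "val s"] e c by simp
  from P.coh_epi_surj[OF c this] show "\<forall>W. proj W \<longrightarrow> val s W ` carrier (mob (src s) W) = carrier (mob (tgt s) W)" by simp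
next
  assume e: "\<forall>W. proj W \<longrightarrow> val s W ` carrier (mob (src s) W) = carrier (mob (tgt s) W)"
  show "A.epi s"
  proof (rule A.epiI[OF assms])
    fix x assume x: "A.arr x" "src x = tgt s" "A.cmp s x = A.zer (src s) (tgt x)"
    show "x = A.zer (tgt s) (tgt x)"
    proof (rule A_eqI)
      show "A.par x (A.zer (tgt s) (tgt x))" 
        using A.arr_zer[OF A.arr_ob(2)[OF assms] A.arr_ob(2)[OF x(1)]] x by simp
      fix W y assume W: "proj W" "y \<in> carrier (mob (src x) W)"
      then have "y \<in> val s W ` carrier (mob (src s) W)" using e x(2) by simp
      then obtain z where z: "z \<in> carrier (mob (src s) W)" "y = val s W z" by blast
      have "val x W y = val (A.cmp s x) W z" using A_cmp_app[OF assms W(1) z(1)] z(2) by simp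
      also have "\<dots> = \<one>\<^bsub>mob (tgt x) W\<^esub>" unfolding x(3) using W z by (simp add: A.zer_def)
      also have "\<dots> = val (A.zer (tgt s) (tgt x)) W y" using W x(2) by (simp add: A.zer_def)
      finally show "val x W y = val (A.zer (tgt s) (tgt x)) W y" .
    qed
  qed
qed

text \<open>Epimorphisms are pointwise onto, so the value of \<open>x\<close> at the identity has a
  preimage, and by Yoneda this preimage defines the lift.\<close>

lemma fo_proj: assumes X: "proj X" shows "A.proj (fo X)"
  unfolding A.proj_def
proof (intro conjI allI impI)
  show "fo X \<in> Ob A" using fo_coherent[OF proj_Ob[OF X]] by (simp del: P_simps)
  fix s x assume a: "A.epi s \<and> A.arr x \<and> src x = fo X \<and> tgt x = tgt s"
  then have s: "A.arr s" by (simp add: A.epi_def)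
  have "val x \<in> mod_hom P (fo X) (tgt s)" using a A_hom by blast
  then have "val x X (\<iota> (Ident C X)) \<in> carrier (mob (tgt s) X)" by (rule mod_homD(2)[OF _ _ iota_ident[OF X]]) (simp add: X)
  moreover have "val s X ` carrier (mob (src s) X) = carrier (mob (tgt s) X)" using A_epi_iff[OF s] a X by blast
  ultimately obtain g where g: "g \<in> carrier (mob (src s) X)" "val s X g = val x X (\<iota> (Ident C X))" by force
  have c: "coherent P (src s)" using s by (simp add: A_arr)
  obtain t where t: "A.arr t" "src t = fo X" "tgt t = src s"
    "\<forall>W a. proj W \<and> a \<in> mor C W X \<longrightarrow> val t W (\<iota> a) = mar (src s) W X a g"
    using yoneda_arrow[OF X c g(1)] .
  have i: "val t X (\<iota> (Ident C X)) = g"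
    using t(4) X ident_closed[OF proj_Ob[OF X]] P.act_idt[OF P.coherent_module[OF c], of X g] g(1)
    by (simp add: P.act_def P.idt_def)
  have "A.cmp t s = x"
  proof (rule yoneda_eqI[OF _ _ X])
    show "A.par (A.cmp t s) x" "src (A.cmp t s) = fo X" using t(1-3) s a by simp_all
    show "val (A.cmp t s) X (\<iota> (Ident C X)) = val x X (\<iota> (Ident C X))"
      using A_cmp_app[OF t(1) X, of "\<iota> (Ident C X)" s] iota_ident[OF X] t(2) i g(2) by simp
  qed
  then show "\<exists>y. A.arr y \<and> src y = fo X \<and> tgt y = src s \<and> A.cmp y s = x" using t(1-3) by blast
qed

text \<open>The generator of a presentation corresponds by Yoneda to a transformation from
  \<open>fo (tgt f)\<close>, and generation says that it is pointwise onto.\<close>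

lemma fo_gen: assumes G: "G \<in> Ob A"
  shows "\<exists>X e. proj X \<and> A.epi e \<and> src e = fo X \<and> tgt e = G"
proof -
  have c: "coherent P G" using G by (simp del: P_simps)
  obtain y f where g: "is_module P G" "P.presents G y f" using P.coherentE[OF c] .
  note d = P.presentsD[OF g(2)]
  have X: "proj (tgt f)" using d(1) by (simp add: P_arr)
  obtain t where t: "A.arr t" "src t = fo (tgt f)" "tgt t = G"
    "\<forall>W a. proj W \<and> a \<in> mor C W (tgt f) \<longrightarrow> val t W (\<iota> a) = mar G W (tgt f) a y"
    using yoneda_arrow[OF X c d(2)] .
  have "A.epi t" unfolding A_epi_iff[OF t(1)]
  proof (intro allI impI equalityI subsetI)
    fix W x assume W: "proj W"
    {
      assume "x \<in> val t W ` carrier (mob (src t) W)"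
      then show "x \<in> carrier (mob (tgt t) W)"
        using mod_homD(2)[of "val t" P "src t" "tgt t" W] t(1) W by (auto simp: A_arr)
    next
      assume "x \<in> carrier (mob (tgt t) W)"
      then have x: "x \<in> carrier (mob G W)" using t(3) by simp
      obtain h where h: "P.arr h" "src h = W" "tgt h = tgt f" "P.act G h y = x" using d(3)[OF _ x] W by auto
      have hm: "val h \<in> mor C W (tgt f)" using h(1-3) by (auto simp del: arr_ob simp: P_arr arr_def)
      have "val t W (\<iota> (val h)) = x" using t(4) W hm h(2-4) by (simp add: P.act_def)
      moreover have "\<iota> (val h) \<in> carrier (mob (src t) W)" using hm t(2) by (simp add: fo_simps)
      ultimately show "x \<in> val t W ` carrier (mob (src t) W)" by blast
    }
  qed
  then show ?thesis using X t by blast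
qed

sublocale A: abelian_enough_projectives A
proof
  show "projectively_generated A" unfolding projectively_generated_def
  proof
    fix G assume G: "G \<in> Ob A"
    obtain X e where e: "proj X" "A.epi e" "src e = fo X" "tgt e = G" using fo_gen[OF G] by blast
    have "fo X \<in> Ob A" using fo_coherent[OF proj_Ob[OF e(1)]] by (simp del: P_simps)
    then have "is_epi A (fo X) G (val e)" using A.is_epi_iff[of "fo X" G "val e"] e G by simp
    moreover have "projective A (fo X)" using fo_proj[OF e(1)] A.projective_iff by blast
    ultimately show "\<exists>P f. projective A P \<and> is_epi A P G f" by blast
  qed
qed

section \<open>The functor as a generating embedding\<close>

definition fa :: "('o, 'a) arrow \<Rightarrow> (('o, 'a, 'v) cmodule, 'o \<Rightarrow> 'v \<Rightarrow> 'v) arrow"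
  where "fa f = Arrow (fo (src f)) (far F (src f) (tgt f) (val f)) (fo (tgt f))"

lemma fa_simps [simp]: "src (fa f) = fo (src f)" "tgt (fa f) = fo (tgt f)"
  by (simp_all add: fa_def)

lemma fa_app: "proj W \<Longrightarrow> a \<in> mor C W (src f) \<Longrightarrow> val (fa f) W (\<iota> a) = \<iota> (Comp C W (src f) (tgt f) a (val f))"
  by (simp add: fa_def far_app)

lemma fa_arr: "arr f \<Longrightarrow> A.arr (fa f)"
  unfolding A_arr using far_hom[of "src f" "tgt f" "val f"] fo_coherent by (simp del: arr_ob add: fa_def arr_def)

lemma fa_eqI:
  assumes s: "A.arr s" "src s = fo (src f)" "tgt s = fo (tgt f)" and f: "arr f"
    and e: "\<And>a. arr a \<Longrightarrow> proj (src a) \<Longrightarrow> tgt a = src f \<Longrightarrow> val s (src a) (\<iota> (val a)) = \<iota> (val (a ;; f))"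
  shows "s = fa f"
proof (rule A_eqI)
  show "A.par s (fa f)" using s fa_arr[OF f] by simp
  fix W x assume W: "proj W" "x \<in> carrier (mob (src s) W)"
  then obtain a where a: "a \<in> mor C W (src f)" "x = \<iota> a" using s(2) by (auto simp: fo_simps)
  show "val s W x = val (fa f) W x"
    using e[of "Arrow W a (src f)"] a W(1) f by (simp add: fa_app arrI proj_Ob cmp_def)
qed

lemma fa_cmp: assumes "arr f" "arr g" "tgt f = src g" shows "fa (f ;; g) = A.cmp (fa f) (fa g)"
proof (rule fa_eqI[symmetric])
  fix a assume a: "arr a" "proj (src a)" "tgt a = src (f ;; g)"
  have v: "val a \<in> mor C (src a) (src f)" "val (a ;; f) \<in> mor C (src a) (src g)"
    using a arr_cmp[of a f] assms by (simp_all del: arr_ob arr_cmp add: arr_def)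
  have "val (A.cmp (fa f) (fa g)) (src a) (\<iota> (val a)) = val (fa g) (src a) (\<iota> (val (a ;; f)))"
    using A_cmp_app[OF fa_arr[OF assms(1)] a(2), of "\<iota> (val a)" "fa g"] v a assms by (simp add: fo_simps fa_app cmp_def)
  also have "\<dots> = \<iota> (val ((a ;; f) ;; g))" using fa_app[OF a(2) v(2)] by (simp add: cmp_def assms)
  finally show "val (A.cmp (fa f) (fa g)) (src a) (\<iota> (val a)) = \<iota> (val (a ;; f ;; g))" using a assms by simp
qed (use assms fa_arr in simp_all)

lemma fa_idt: assumes "X \<in> Ob C" shows "fa (idt X) = A.idt (fo X)"
proof (rule fa_eqI[symmetric])
  have o: "fo X \<in> Ob A" using fo_coherent[OF assms] by (simp del: P_simps)
  show "A.arr (A.idt (fo X))" using o by (rule A.arr_idt)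
  fix a assume a: "arr a" "proj (src a)" "tgt a = src (idt X)"
  have "val a \<in> mor C (src a) X" using a by (simp del: arr_ob add: arr_def)
  then show "val (A.idt (fo X)) (src a) (\<iota> (val a)) = \<iota> (val (a ;; idt X))"
    using a by (simp add: A.idt_def fo_simps)
qed (use assms in simp_all)

lemma fa_add: assumes "par f g" shows "fa (add f g) = A.add (fa f) (fa g)"
proof (rule fa_eqI[symmetric])
  fix a assume a: "arr a" "proj (src a)" "tgt a = src (add f g)"
  have v: "val a \<in> mor C (src a) (src f)" "val a \<in> mor C (src a) (src g)" using a assms by (simp_all del: arr_ob add: arr_def)
  have "val (A.add (fa f) (fa g)) (src a) (\<iota> (val a)) = \<iota> (val (add (a ;; f) (a ;; g)))"
    using v a assms by (simp add: A.add_def fo_simps fa_app add_def cmp_def)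
  then show "val (A.add (fa f) (fa g)) (src a) (\<iota> (val a)) = \<iota> (val (a ;; add f g))" using a assms by simp
qed (use assms fa_arr in simp_all)

text \<open>Evaluation at a projective cover \<open>p\<close> of the source gives
  \<open>p ;; f = p ;; g\<close>, and \<open>p\<close> is epi.\<close>

lemma fa_faithful: assumes "par f g" and e: "fa f = fa g" shows "f = g"
proof -
  have ob: "src f \<in> Ob C" using assms by simp
  obtain p where p: "proj (src p)" "epi p" "arr p" "tgt p = src f" using proj_cover[OF ob] .
  have v: "val p \<in> mor C (src p) (src f)" "val p \<in> mor C (src p) (src g)" using p assms by (simp_all del: arr_ob add: arr_def)
  have "\<iota> (val (p ;; f)) = \<iota> (val (p ;; g))" using fa_app[OF p(1) v(1)] fa_app[OF p(1) v(2)] e p assms by (simp add: cmp_def)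
  then have "p ;; f = p ;; g" using assms by (intro Arrow_eqI) (simp_all add: \<iota>_eq)
  then show ?thesis using epi_cancel[OF p(2)] assms p by simp
qed

text \<open>The value of \<open>t\<close> at the generator \<open>p\<close> is an arrow
  \<open>h\<close>. Naturality (\<open>nat\<close>) shows that \<open>h\<close> is killed by the
  relations \<open>k\<close> of \<open>p\<close>, so it factors as \<open>p ;; w\<close>; and since
  every arrow from a projective factors through \<open>p\<close>, the image of \<open>w\<close> is
  \<open>t\<close>.\<close>

lemma fa_full:
  assumes X: "X \<in> Ob C" "Y \<in> Ob C" and t: "A.arr t" "src t = fo X" "tgt t = fo Y"
  shows "\<exists>f. arr f \<and> src f = X \<and> tgt f = Y \<and> fa f = t"
proof -
  obtain p where p: "proj (src p)" "epi p" "arr p" "tgt p = X" using proj_cover[OF X(1)] .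
  obtain k where k: "tgt k = src p" "arr k" "proj (src k)" "k ;; p = zer (src k) (tgt p)"
    "\<forall>x. arr x \<and> src x = src p \<and> k ;; x = zer (src k) (tgt x) \<longrightarrow>
      (\<exists>w. arr w \<and> src w = tgt p \<and> tgt w = tgt x \<and> p ;; w = x)"
    using presentation_fo[OF p(2,1,3)] .
  have v: "\<iota> (val a) \<in> carrier (mob (fo X) (src a))" if "arr a" "tgt a = X" for a
    using that by (simp del: arr_ob add: arr_def fo_simps)
  have th: "val t \<in> mod_hom P (fo X) (fo Y)" using t by (simp add: A_arr)
  have "val t (src p) (\<iota> (val p)) \<in> carrier (mob (fo Y) (src p))" using mod_homD(2)[OF th _ v[OF p(3,4)]] p(1) by simp
  then obtain h' where h': "h' \<in> mor C (src p) Y" "val t (src p) (\<iota> (val p)) = \<iota> h'" by (auto simp: fo_simps)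
  define h where "h = Arrow (src p) h' Y"
  have h: "arr h" "src h = src p" "tgt h = Y" using h'(1) X p(3) by (simp_all add: h_def arrI)
  have nat: "val t (src g) (\<iota> (val (g ;; p))) = \<iota> (val (g ;; h))" if g: "arr g" "proj (src g)" "tgt g = src p" for g
  proof -
    have gm: "val g \<in> mor P (src g) (src p)" using g by (simp del: arr_ob add: arr_def)
    show ?thesis
      using mod_homD(4)[OF th _ _ gm v[OF p(3,4)]] g p h'(2) by (simp add: fo_simps cmp_def h_def)
  qed
  have "\<iota> (val (k ;; h)) = \<iota> (val (zer (src k) Y))"
    using nat[OF k(2,3,1)] mod_hom_one[OF fo_module[OF X(1)] fo_module[OF X(2)] th, of "src k"] k(3,4) p(4)
    by (simp add: fo_simps zer_def)
  then have "k ;; h = zer (src k) (tgt h)" using h by (intro Arrow_eqI) (simp_all add: \<iota>_eq)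
  then obtain w where w: "arr w" "src w = tgt p" "tgt w = tgt h" "p ;; w = h"
    using mp[OF spec[OF k(5)], of h] h by auto
  have "t = fa w"
  proof (rule fa_eqI)
    fix a assume a: "arr a" "proj (src a)" "tgt a = src w"
    obtain g where g: "arr g" "src g = src a" "tgt g = src p" "g ;; p = a"
      using projE[OF a(2) p(2) a(1) refl] a(3) w(2) by metis
    have "val t (src a) (\<iota> (val a)) = \<iota> (val (g ;; h))" using nat[of g] g a(2) by simp
    also have "g ;; h = a ;; w" using cmp_reduce[OF g(4), of w] g(1-3) p(3) w by simp
    finally show "val t (src a) (\<iota> (val a)) = \<iota> (val (a ;; w))" .
  qed (use t w p h in simp_all)
  then show ?thesis using w p(4) h by blast
qed

sublocale generating_embedding n C A fo fa
proof
  show "1 \<le> n" by (rule n_pos)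
  show "fo X \<in> Ob A" if "X \<in> Ob C" for X using fo_coherent[OF that] by (simp del: P_simps)
  show "\<exists>X e. proj X \<and> A.epi e \<and> src e = fo X \<and> tgt e = G" if "G \<in> Ob A" for G using fo_gen[OF that] .
qed (simp_all add: fa_arr fa_cmp fa_idt fa_add fa_full fa_faithful fo_proj)

lemma far_fa: "far F X Y f = val (fa (Arrow X f Y))"
  by (simp add: fa_def)

lemma F_additive: "additive_functor C A F"
  unfolding additive_functor_def is_functor_def F_simps(1)
proof (intro conjI ballI)
  show "fo X \<in> Ob A" if "X \<in> Ob C" for X using fo_ob[OF that] .
  show h: "far F X Y f \<in> mor A (fo X) (fo Y)" if "X \<in> Ob C" "Y \<in> Ob C" "f \<in> mor C X Y" for X Y f
    using far_hom[OF that] by simp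
  show "far F X X (Ident C X) = Ident A (fo X)" if "X \<in> Ob C" for X
    using arg_cong[OF fa_idt[OF that], of val] unfolding far_fa idt_def A.idt_def by (simp only: arrow.sel)
  show "far F X Z (Comp C X Y Z f g) = Comp A (fo X) (fo Y) (fo Z) (far F X Y f) (far F Y Z g)"
    if "X \<in> Ob C" "Y \<in> Ob C" "Z \<in> Ob C" "f \<in> mor C X Y" "g \<in> mor C Y Z" for X Y Z f g
    using arg_cong[OF fa_cmp[OF arrI[OF that(1,2,4)] arrI[OF that(2,3,5)]], of val]
    unfolding far_fa cmp_def A.cmp_def by (simp only: arrow.sel fa_simps simp_thms)
  show "far F X Y \<in> hom (Hom C X Y) (Hom A (fo X) (fo Y))" if X: "X \<in> Ob C" "Y \<in> Ob C" for X Y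
  proof (rule homI)
    show "far F X Y f \<in> mor A (fo X) (fo Y)" if "f \<in> mor C X Y" for f using h[OF X that] .
    show "far F X Y (f \<otimes>\<^bsub>Hom C X Y\<^esub> g) = far F X Y f \<otimes>\<^bsub>Hom A (fo X) (fo Y)\<^esub> far F X Y g"
      if f: "f \<in> mor C X Y" "g \<in> mor C X Y" for f g
    proof -
      have p: "par (Arrow X f Y) (Arrow X g Y)" using f X by (simp add: arrI)
      show ?thesis using arg_cong[OF fa_add[OF p], of val]
        unfolding far_fa add_def A.add_def by (simp only: arrow.sel fa_simps)
    qed
  qed
qed

lemma F_fully_faithful: "fully_faithful C A F"
  unfolding fully_faithful_def F_simps(1)
proof (intro ballI)
  fix X Y assume X: "X \<in> Ob C" "Y \<in> Ob C"
  show "bij_betw (far F X Y) (mor C X Y) (mor A (fo X) (fo Y))"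
  proof (rule bij_betwI')
    fix f g assume f: "f \<in> mor C X Y" "g \<in> mor C X Y"
    have p: "par (Arrow X f Y) (Arrow X g Y)" using f X by (simp add: arrI)
    show "far F X Y f = far F X Y g \<longleftrightarrow> f = g"
    proof
      assume "far F X Y f = far F X Y g"
      then have "fa (Arrow X f Y) = fa (Arrow X g Y)" by (simp add: fa_def)
      then show "f = g" using fa_faithful[OF p] by simp
    qed simp
  next
    show "far F X Y f \<in> mor A (fo X) (fo Y)" if "f \<in> mor C X Y" for f using far_hom[OF X that] by simp
  next
    fix t assume t: "t \<in> mor A (fo X) (fo Y)"
    have a: "A.arr (Arrow (fo X) t (fo Y))" using A.arrI[OF fo_ob[OF X(1)] fo_ob[OF X(2)] t] .
    obtain f where f: "arr f" "src f = X" "tgt f = Y" "fa f = Arrow (fo X) t (fo Y)"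
      using fa_full[OF X a] by auto
    then have "val f \<in> mor C X Y" by (auto simp del: arr_ob simp: arr_def)
    moreover have "t = far F X Y (val f)" using f unfolding far_fa by simp
    ultimately show "\<exists>f\<in>mor C X Y. t = far F X Y f" by blast
  qed
qed

lemma N_essential_image: "N = essential_image C A F"
proof -
  have "A.iso G (fo X) \<longleftrightarrow> isomorphic A G (fo X)" if "G \<in> Ob A" "X \<in> Ob C" for G X
  proof -
    have "isomorphic A G (fo X) \<longleftrightarrow> (\<exists>f. A.isomap (Arrow G f (fo X)))"
      unfolding isomorphic_def A.is_iso_iff[OF that(1) fo_ob[OF that(2)]] ..
    also have "\<dots> \<longleftrightarrow> A.iso G (fo X)"
    proof
      assume "A.iso G (fo X)"
      then obtain f where "A.isomap f" "src f = G" "tgt f = fo X" unfolding A.iso_def by blast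
      then show "\<exists>f. A.isomap (Arrow G f (fo X))" by (intro exI[of _ "val f"]) simp
    qed (auto simp: A.iso_def)
    finally show ?thesis by blast
  qed
  then show ?thesis unfolding N_def essential_image_def F_simps(1) by blast
qed

end

theorem theorem3p20:
  fixes n :: nat
    and M :: "('o, 'a) pcat"
    and \<iota> :: "'a \<Rightarrow> 'v"
  defines "P \<equiv> proj_subcat M"
  defines "modP \<equiv> (coh_cat P :: (('o, 'a, 'v) cmodule, 'o \<Rightarrow> 'v \<Rightarrow> 'v) pcat)"
    and "modPop \<equiv> (coh_cat (op_cat P) :: (('o, 'a, 'v) cmodule, 'o \<Rightarrow> 'v \<Rightarrow> 'v) pcat)"
    and "F \<equiv> restricted_yoneda \<iota> M"
  assumes "inj \<iota>" and "(UNIV :: 'a set set) \<lesssim> (UNIV :: 'v set)"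
    and "n \<ge> 1"
    and "n_abelian_category n M"
    and "projectively_generated M"
    and "\<exists>D. exact_duality modP modPop D"
  shows "additive_functor M modP F \<and> fully_faithful M modP F \<and>
    n_cluster_tilting n modP (essential_image M modP F)"
proof -
  interpret Y: projectively_generated_n_abelian n M \<iota>
    using assms(5,7-9) by (simp add: projectively_generated_n_abelian_def projectively_generated_n_abelian_axioms_def)
  show ?thesis
    unfolding P_def modP_def F_def
    using Y.F_additive Y.F_fully_faithful Y.N_cluster_tilting Y.N_essential_image by simp
qed

end
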